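(* Let $N\ge 3$, let $q\in\mathbb{C}$ be transcendental, let $\mathcal{A}=\mathcal{O}(O_q(N))$, and let $\Gamma$ be one of the two $N^2$-dimensional bicovariant first order differential calculi $\Gamma_+$ or $\Gamma_-$ on $\mathcal{A}$. Let $\Gamma^{\wedge}=\bigoplus_{k\ge 0}\Gamma^{\wedge k}$ be Woronowicz' external algebra over $\Gamma$. Then for each positive integer $k$ there exists a nonzero $k$-form in $\Gamma^\wedge$, i.e. $\Gamma^{\wedge k}\neq\{0\}$. In other words, $\Gamma^\wedge$ is an infinite differential complex.
   Context: **The quantum group.** Put $i'=N+1-i$ and let $\rho=(\tfrac N2-1,\tfrac N2-2,\dots,\tfrac12,0,-\tfrac12,\dots,1-\tfrac N2)$ for $N$ odd, $\rho=(\tfrac N2-1,\dots,1,0,0,-1,\dots,1-\tfrac N2)$ for $N$ even; fix a square root $q^{1/2}$. With matrix units $e_{ij}$ of $M_N(\mathbb{C})$ let $$R=q\sum_{i\ne i'}e_{ii}\otimes e_{ii}+\sum_{i= i'}e_{ii}\otimes e_{ii}+\sum_{i\ne j,j'}e_{ii}\otimes e_{jj}+q^{-1}\sum_{i\neq i'}e_{i'i'}\otimes e_{ii}+(q-q^{-1})\sum_{i>j}\bigl(e_{ij}\otimes e_{ji}-q^{\rho_i-\rho_j}e_{ij}\otimes e_{i'j'}\bigr),$$ $\hat R^{ij}_{kl}=R^{ji}_{kl}$ and $C=(C^{ij})$ with $C^{ij}=\delta_{ij'}q^{-\rho_i}$. The Hopf algebra $\mathcal{A}=\mathcal{O}(O_q(N))$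 (Faddeev–Reshetikhin–Takhtajan) is generated by the entries of $u=(u^i_j)_{i,j=1}^N$ with relations $\hat R(u\otimes u)=(u\otimes u)\hat R$, $uCu^{t}C^{-1}=I=Cu^{t}C^{-1}u$, comultiplication $\Delta(u^i_j)=\sum_k u^i_k\otimes u^k_j$, and antipode $S(u)=Cu^tC^{-1}$. It is coquasitriangular with universal $r$-form $\mathbf r$ determined by $\mathbf r(u^i_j,u^k_l)=R^{ik}_{jl}$, with conventions $\mathbf r(ab,c)=\sum\mathbf r(a,c_{(1)})\mathbf r(b,c_{(2)})$, $\mathbf r(a,bc)=\sum\mathbf r(a_{(1)},c)\mathbf r(a_{(2)},b)$ and $\sum \mathbf r(a_{(1)},b_{(1)})a_{(2)}b_{(2)}=\sum b_{(1)}a_{(1)}\mathbf r(a_{(2)},b_{(2)})$. **The calculi $\Gamma_\pm$.** Let $\chi_\pm:\mathcal{A}\to\mathbb{C}$ be the algebra homomorphism with $\chi_\pm(u^i_j)=\pm\delta_{ij}$. The bicovariant bimodule $\Gamma_\pm$ is the free left $\mathcal{A}$-module with basis $\{\theta_{ij}\mid i,j=1,\dots,N\}$ of left-invariant elements, with right action and right coaction $$\theta_{ij}a=\sum_{k,l} a_{(1)}\,\chi_\pm(a_{(2)})\,\mathbf r(u^k_i,a_{(3)})\,\mathbf r(a_{(4)},u^j_l)\,\theta_{kl},\qquad \Delta_R(\theta_{ij})=\sum_{k,l}\theta_{kl}\otimes u^k_i\,(u^{\rm c})^l_j,$$ where $(u^{\rm c})^l_j=S(u^j_l)$ is the contragredient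 corepresentation. The differential is $da=\omega a-a\omega$ with $\omega=\sum_i\theta_{ii}$ (up to a nonzero scalar); the external algebra below depends only on the bicovariant bimodule. **Woronowicz' external algebra.** Let $\Gamma^{\otimes k}=\Gamma\otimes_{\mathcal{A}}\cdots\otimes_{\mathcal{A}}\Gamma$ ($k$ factors). Let $\sigma$ be the canonical braiding of $\Gamma\otimes_{\mathcal{A}}\Gamma$: the unique bimodule homomorphism with $\sigma(\omega\otimes\eta)=\eta\otimes\omega$ for $\omega$ left-invariant and $\eta$ right-invariant. Let $\sigma_{i}$ be $\sigma$ acting on the $i$-th and $(i+1)$-th factors of $\Gamma^{\otimes k}$, and for $w\in S_k$ with reduced expression $w=s_{i_1}\cdots s_{i_m}$ in nearest neighbour transpositions put $\sigma_w=\sigma_{i_1}\cdots\sigma_{i_m}$. The antisymmetrizer is $A_k=\sum_{w\in S_k}(-1)^{\ell(w)}\sigma_w$, where $\ell$ is the length. Then $\Gamma^{\wedge}=\bigoplus_k\Gamma^{\wedge k}$ with $\Gamma^{\wedge k}=\Gamma^{\otimes k}/\ker A_k$; elements of $\Gamma^{\wedge k}$ are called $k$-forms. *)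

theory Defs
  imports
    Complex_Main
    "HOL-Library.Poly_Mapping"
    "HOL-Library.Product_Plus"
    "HOL-Combinatorics.Permutations"
    "HOL-Computational_Algebra.Polynomial"
    "HOL-Algebra.Free_Abelian_Groups"
    "HOL-Algebra.Generated_Groups"
    "HOL-Algebra.QuotRing"
    "HOL-Algebra.Module"
begin

section \<open>Free associative algebras\<close>

text \<open>Words under concatenation, written additively: then \<open>'a fword \<Rightarrow>\<^sub>0 complex\<close>, with the
  convolution product of \<^theory>\<open>HOL-Library.Poly_Mapping\<close>, is the free complex algebra \<open>F\<close> on the
  letters \<open>'a\<close>, and \<open>('a fword \<times> 'a fword) \<Rightarrow>\<^sub>0 complex\<close> is the algebra \<open>F \<otimes> F\<close>.\<close>

datatype 'a fword = FWord (letters: "'a list")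

instantiation fword :: (type) monoid_add
begin

definition zero_fword :: "'a fword" where "zero_fword = FWord []"

definition plus_fword :: "'a fword \<Rightarrow> 'a fword \<Rightarrow> 'a fword"
  where "plus_fword v w = FWord (letters v @ letters w)"

instance by standard (simp_all add: zero_fword_def plus_fword_def)

end

type_synonym falg = "(nat \<times> nat) fword \<Rightarrow>\<^sub>0 complex"
type_synonym falg2 = "((nat \<times> nat) fword \<times> (nat \<times> nat) fword) \<Rightarrow>\<^sub>0 complex"

abbreviation kconst :: "complex \<Rightarrow> ('m::monoid_add \<Rightarrow>\<^sub>0 complex)"
  where "kconst c \<equiv> Poly_Mapping.single 0 c"

definition ugen :: "nat \<Rightarrow> nat \<Rightarrow> falg"
  where "ugen i j = Poly_Mapping.single (FWord [(i, j)]) 1"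

definition free_alg :: "nat \<Rightarrow> falg ring" where
  "free_alg N =
    \<lparr>carrier = {f. \<forall>w\<in>Poly_Mapping.keys f. set (letters w) \<subseteq> {1..N} \<times> {1..N}},
     monoid.mult = (*), one = 1, zero = 0, add = (+)\<rparr>"

section \<open>The algebra \<open>\<O>(O\<^sub>q(N))\<close>\<close>

text \<open>All data depend on the chosen square root \<open>h = q\<^sup>1\<^sup>/\<^sup>2\<close>, so \<open>q = h\<^sup>2\<close>. We use
  \<open>2\<rho>\<^sub>i\<close>, an integer, so that \<open>q\<close> to the power \<open>\<rho>\<^sub>i\<close> is \<open>h powi (2\<rho>\<^sub>i)\<close>.\<close>

definition opp :: "nat \<Rightarrow> nat \<Rightarrow> nat"
  where "opp N i = N + 1 - i"

definition rho2 :: "nat \<Rightarrow> nat \<Rightarrow> int" where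
  "rho2 N i = (if i < opp N i then int N - 2 * int i
               else if i = opp N i then 0
               else int N + 2 - 2 * int i)"

lemma rho2_values:
  "map (rho2 5) [1..<6] = [3, 1, 0, -1, -3]"
  "map (rho2 6) [1..<7] = [4, 2, 0, 0, -2, -4]"
  by (simp_all add: rho2_def opp_def upt_rec)

text \<open>\<open>munit i j a b\<close> is the \<open>(a,b)\<close> entry of the matrix unit \<open>e\<^sub>i\<^sub>j\<close>, and \<open>munit2 i j k l\<close> is
  \<open>e\<^sub>i\<^sub>j \<otimes> e\<^sub>k\<^sub>l\<close>; the arguments of \<open>Rmat N h a b c d\<close> are those of \<open>R\<close> with upper (row)
  indices \<open>a b\<close> and lower (column) indices \<open>c d\<close>.\<close>

definition munit :: "nat \<Rightarrow> nat \<Rightarrow> nat \<Rightarrow> nat \<Rightarrow> complex"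
  where "munit i j a b = of_bool (a = i \<and> b = j)"

definition munit2 ::
    "nat \<Rightarrow> nat \<Rightarrow> nat \<Rightarrow> nat \<Rightarrow> nat \<Rightarrow> nat \<Rightarrow> nat \<Rightarrow> nat \<Rightarrow> complex"
  where "munit2 i j k l a b c d = munit i j a c * munit k l b d"

definition Rmat :: "nat \<Rightarrow> complex \<Rightarrow> nat \<Rightarrow> nat \<Rightarrow> nat \<Rightarrow> nat \<Rightarrow> complex" where
  "Rmat N h a b c d =
    (let q = h\<^sup>2 in
      q * (\<Sum>i | i \<in> {1..N} \<and> i \<noteq> opp N i. munit2 i i i i a b c d)
      + (\<Sum>i | i \<in> {1..N} \<and> i = opp N i. munit2 i i i i a b c d)
      + (\<Sum>(i, j) | i \<in> {1..N} \<and> j \<in> {1..N} \<and> i \<noteq> j \<and> i \<noteq> opp N j.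
            munit2 i i j j a b c d)
      + inverse q * (\<Sum>i | i \<in> {1..N} \<and> i \<noteq> opp N i.
            munit2 (opp N i) (opp N i) i i a b c d)
      + (q - inverse q) * (\<Sum>(i, j) | i \<in> {1..N} \<and> j \<in> {1..N} \<and> i > j.
            munit2 i j j i a b c d
            - h powi (rho2 N i - rho2 N j) * munit2 i j (opp N i) (opp N j) a b c d))"

definition Rhat :: "nat \<Rightarrow> complex \<Rightarrow> nat \<Rightarrow> nat \<Rightarrow> nat \<Rightarrow> nat \<Rightarrow> complex"
  where "Rhat N h a b c d = Rmat N h b a c d"

definition Cmat :: "nat \<Rightarrow> complex \<Rightarrow> nat \<Rightarrow> nat \<Rightarrow> complex"
  where "Cmat N h i j = (if i = opp N j then h powi (- rho2 N i) else 0)"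

text \<open>\<open>C\<close> is its own inverse; this is used below wherever \<open>C\<^sup>-\<^sup>1\<close> is called for.\<close>

lemma Cmat_involutive:
  assumes "h \<noteq> 0" "i \<in> {1..N}" "k \<in> {1..N}"
  shows "(\<Sum>j\<in>{1..N}. Cmat N h i j * Cmat N h j k) = of_bool (i = k)"
proof -
  have "(\<Sum>j\<in>{1..N}. Cmat N h i j * Cmat N h j k)
      = (\<Sum>j\<in>{1..N}. if j = opp N k
          then (if i = k then h powi (- rho2 N i) * h powi (- rho2 N j) else 0) else 0)"
    using assms by (intro sum.cong) (auto simp: Cmat_def opp_def)
  also have "\<dots> = (if i = k then h powi (- rho2 N i) * h powi (- rho2 N (opp N k)) else 0)"
    using assms by (subst sum.delta) (auto simp: opp_def)
  also have "\<dots> = of_bool (i = k)"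
  proof -
    have "rho2 N (opp N k) = - rho2 N k"
      using assms by (auto simp: rho2_def opp_def)
    then show ?thesis using assms by (simp add: power_int_minus)
  qed
  finally show ?thesis .
qed

text \<open>The entries of \<open>\<hat>R(u \<otimes> u) - (u \<otimes> u)\<hat>R\<close>, of \<open>u C u\<^sup>t C\<^sup>-\<^sup>1 - I\<close> and of
  \<open>C u\<^sup>t C\<^sup>-\<^sup>1 u - I\<close>.\<close>

definition rel_RTT :: "nat \<Rightarrow> complex \<Rightarrow> nat \<Rightarrow> nat \<Rightarrow> nat \<Rightarrow> nat \<Rightarrow> falg" where
  "rel_RTT N h i j k l =
    (\<Sum>a\<in>{1..N}. \<Sum>b\<in>{1..N}. kconst (Rhat N h i j a b) * ugen a k * ugen b l)
    - (\<Sum>a\<in>{1..N}. \<Sum>b\<in>{1..N}. ugen i a * ugen j b * kconst (Rhat N h a b k l))"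

definition rel_C1 :: "nat \<Rightarrow> complex \<Rightarrow> nat \<Rightarrow> nat \<Rightarrow> falg" where
  "rel_C1 N h i j =
    (\<Sum>a\<in>{1..N}. \<Sum>b\<in>{1..N}. \<Sum>c\<in>{1..N}.
        ugen i a * kconst (Cmat N h a b) * ugen c b * kconst (Cmat N h c j))
    - kconst (of_bool (i = j))"

definition rel_C2 :: "nat \<Rightarrow> complex \<Rightarrow> nat \<Rightarrow> nat \<Rightarrow> falg" where
  "rel_C2 N h i j =
    (\<Sum>a\<in>{1..N}. \<Sum>b\<in>{1..N}. \<Sum>c\<in>{1..N}.
        kconst (Cmat N h i a) * ugen b a * kconst (Cmat N h b c) * ugen c j)
    - kconst (of_bool (i = j))"

definition Oq_ideal :: "nat \<Rightarrow> complex \<Rightarrow> falg set" where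
  "Oq_ideal N h = genideal (free_alg N)
    ({rel_RTT N h i j k l | i j k l. {i, j, k, l} \<subseteq> {1..N}}
     \<union> {rel_C1 N h i j | i j. {i, j} \<subseteq> {1..N}}
     \<union> {rel_C2 N h i j | i j. {i, j} \<subseteq> {1..N}})"

type_synonym oq = "falg set"

definition Oq :: "nat \<Rightarrow> complex \<Rightarrow> oq ring"
  where "Oq N h = free_alg N Quot Oq_ideal N h"

definition cls :: "nat \<Rightarrow> complex \<Rightarrow> falg \<Rightarrow> oq"
  where "cls N h f = Oq_ideal N h +>\<^bsub>free_alg N\<^esub> f"

definition scal :: "nat \<Rightarrow> complex \<Rightarrow> complex \<Rightarrow> oq"
  where "scal N h c = cls N h (kconst c)"

definition ucls :: "nat \<Rightarrow> complex \<Rightarrow> nat \<Rightarrow> nat \<Rightarrow> oq"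
  where "ucls N h i j = cls N h (ugen i j)"

text \<open>The entries of the antipode matrix \<open>S(u) = C u\<^sup>t C\<^sup>-\<^sup>1\<close>.\<close>

definition Su :: "nat \<Rightarrow> complex \<Rightarrow> nat \<Rightarrow> nat \<Rightarrow> oq" where
  "Su N h i j = cls N h (\<Sum>a\<in>{1..N}. \<Sum>b\<in>{1..N}.
      kconst (Cmat N h i a) * ugen b a * kconst (Cmat N h b j))"

section \<open>Comultiplication and Sweedler sums\<close>

definition rep :: "'a set \<Rightarrow> 'a"
  where "rep X = (SOME x. x \<in> X)"

text \<open>The algebra homomorphism \<open>\<Delta> : F \<rightarrow> F \<otimes> F\<close> with
  \<open>\<Delta>(u\<^sub>i\<^sub>j) = \<Sum>\<^sub>k u\<^sub>i\<^sub>k \<otimes> u\<^sub>k\<^sub>j\<close>. The ideal of relations is a biideal, so \<open>\<Delta>\<close> descends to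
  the quotient; there \<open>\<Delta>(a)\<close> is represented by \<open>coprod N a\<close>.\<close>

definition coprod_free :: "nat \<Rightarrow> falg \<Rightarrow> falg2" where
  "coprod_free N f =
    (\<Sum>w\<in>Poly_Mapping.keys f. kconst (Poly_Mapping.lookup f w) *
       prod_list (map (\<lambda>(i, j). \<Sum>k\<in>{1..N}.
         Poly_Mapping.single (FWord [(i, k)], FWord [(k, j)]) 1) (letters w)))"

definition coprod :: "nat \<Rightarrow> oq \<Rightarrow> falg2"
  where "coprod N a = coprod_free N (rep a)"

definition wcls :: "nat \<Rightarrow> complex \<Rightarrow> (nat \<times> nat) fword \<Rightarrow> oq"
  where "wcls N h w = cls N h (Poly_Mapping.single w 1)"

text \<open>\<open>\<Sum> \<beta>(a\<^sub>(\<^sub>1\<^sub>), a\<^sub>(\<^sub>2\<^sub>))\<close> for a complex bilinear \<open>\<beta>\<close> with values in the complex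
  numbers, respectively in a commutative group \<open>G\<close> (written multiplicatively).\<close>

definition sweedler_C :: "nat \<Rightarrow> complex \<Rightarrow> oq \<Rightarrow> (oq \<Rightarrow> oq \<Rightarrow> complex) \<Rightarrow> complex" where
  "sweedler_C N h a \<beta> =
    (\<Sum>(v, w)\<in>Poly_Mapping.keys (coprod N a).
       Poly_Mapping.lookup (coprod N a) (v, w) * \<beta> (wcls N h v) (wcls N h w))"

definition sweedler ::
    "('g, 'm) monoid_scheme \<Rightarrow> nat \<Rightarrow> complex \<Rightarrow> oq \<Rightarrow> (oq \<Rightarrow> oq \<Rightarrow> 'g) \<Rightarrow> 'g" where
  "sweedler G N h a \<beta> =
    finprod G (\<lambda>(v, w).
        \<beta> (scal N h (Poly_Mapping.lookup (coprod N a) (v, w)) \<otimes>\<^bsub>Oq N h\<^esub> wcls N h v)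
          (wcls N h w))
      (Poly_Mapping.keys (coprod N a))"

abbreviation sweedler_A :: "nat \<Rightarrow> complex \<Rightarrow> oq \<Rightarrow> (oq \<Rightarrow> oq \<Rightarrow> oq) \<Rightarrow> oq"
  where "sweedler_A N h \<equiv> sweedler (add_monoid (Oq N h)) N h"

text \<open>The character with \<open>u\<^sub>i\<^sub>j \<mapsto> s \<delta>\<^sub>i\<^sub>j\<close>; \<open>s = 1\<close> gives both the counit and \<open>\<chi>\<^sub>+\<close>,
  and \<open>s = -1\<close> gives \<open>\<chi>\<^sub>-\<close>.\<close>

definition chi :: "complex \<Rightarrow> oq \<Rightarrow> complex" where
  "chi s a =
    (\<Sum>w\<in>Poly_Mapping.keys (rep a). Poly_Mapping.lookup (rep a) w *
       prod_list (map (\<lambda>(i, j). s * of_bool (i = j)) (letters w)))"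

abbreviation counit :: "oq \<Rightarrow> complex"
  where "counit \<equiv> chi 1"

section \<open>The universal r-form\<close>

definition bilinear_form :: "nat \<Rightarrow> complex \<Rightarrow> (oq \<Rightarrow> oq \<Rightarrow> complex) \<Rightarrow> bool" where
  "bilinear_form N h r \<longleftrightarrow>
    (\<forall>a\<in>carrier (Oq N h). \<forall>b\<in>carrier (Oq N h). \<forall>c\<in>carrier (Oq N h). \<forall>z.
      r (a \<oplus>\<^bsub>Oq N h\<^esub> b) c = r a c + r b c \<and>
      r a (b \<oplus>\<^bsub>Oq N h\<^esub> c) = r a b + r a c \<and>
      r (scal N h z \<otimes>\<^bsub>Oq N h\<^esub> a) b = z * r a b \<and>
      r a (scal N h z \<otimes>\<^bsub>Oq N h\<^esub> b) = z * r a b)"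

definition universal_r_form :: "nat \<Rightarrow> complex \<Rightarrow> (oq \<Rightarrow> oq \<Rightarrow> complex) \<Rightarrow> bool" where
  "universal_r_form N h r \<longleftrightarrow>
    bilinear_form N h r \<and>
    (\<exists>r'. bilinear_form N h r' \<and>
      (\<forall>a\<in>carrier (Oq N h). \<forall>b\<in>carrier (Oq N h).
        sweedler_C N h a (\<lambda>a1 a2. sweedler_C N h b (\<lambda>b1 b2. r a1 b1 * r' a2 b2))
          = counit a * counit b \<and>
        sweedler_C N h a (\<lambda>a1 a2. sweedler_C N h b (\<lambda>b1 b2. r' a1 b1 * r a2 b2))
          = counit a * counit b)) \<and>
    (\<forall>a\<in>carrier (Oq N h). \<forall>b\<in>carrier (Oq N h). \<forall>c\<in>carrier (Oq N h).
      r (a \<otimes>\<^bsub>Oq N h\<^esub> b) c = sweedler_C N h c (\<lambda>c1 c2. r a c1 * r b c2) \<and>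
      r a (b \<otimes>\<^bsub>Oq N h\<^esub> c) = sweedler_C N h a (\<lambda>a1 a2. r a1 c * r a2 b)) \<and>
    (\<forall>a\<in>carrier (Oq N h). \<forall>b\<in>carrier (Oq N h).
      sweedler_A N h a (\<lambda>a1 a2. sweedler_A N h b (\<lambda>b1 b2.
          scal N h (r a1 b1) \<otimes>\<^bsub>Oq N h\<^esub> (a2 \<otimes>\<^bsub>Oq N h\<^esub> b2)))
      = sweedler_A N h a (\<lambda>a1 a2. sweedler_A N h b (\<lambda>b1 b2.
          scal N h (r a2 b2) \<otimes>\<^bsub>Oq N h\<^esub> (b1 \<otimes>\<^bsub>Oq N h\<^esub> a1))))"

section \<open>Bimodules and tensor powers\<close>

record ('a, 'b) bimodule = "('a, 'b) module" +
  rsmult :: "'b \<Rightarrow> 'a \<Rightarrow> 'b"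

text \<open>Tensor powers over \<open>A\<close> are the usual quotients of the free abelian group on \<open>k\<close>-tuples by
  additivity in each factor and \<open>A\<close>-balancedness, for \<open>k \<ge> 1\<close> (for \<open>k = 0\<close> the definition does not
  give \<open>A\<close>). For the algebra over the complex numbers below, the scalars are central in \<open>A\<close> and
  act equally from both sides, so complex multilinearity is automatic. As in
  \<^theory>\<open>HOL-Algebra.Free_Abelian_Groups\<close>, these abelian groups are records of type
  \<open>monoid\<close>, so that addition appears as \<open>\<otimes>\<close> and zero as \<open>\<one>\<close>.\<close>

definition tuples :: "('a, 'b, 'm) bimodule_scheme \<Rightarrow> nat \<Rightarrow> 'b list set"
  where "tuples M k = {xs. length xs = k \<and> set xs \<subseteq> carrier M}"

definition tensor_rels ::
    "('a, 'r) ring_scheme \<Rightarrow> ('a, 'b, 'm) bimodule_scheme \<Rightarrow> nat \<Rightarrow> ('b list \<Rightarrow>\<^sub>0 int) set" where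
  "tensor_rels A M k =
    {frag_of (xs @ [x \<oplus>\<^bsub>M\<^esub> y] @ ys) - frag_of (xs @ [x] @ ys) - frag_of (xs @ [y] @ ys)
      | xs x y ys. xs @ [x] @ ys \<in> tuples M k \<and> y \<in> carrier M}
    \<union> {frag_of (xs @ [rsmult M x a, y] @ ys) - frag_of (xs @ [x, a \<odot>\<^bsub>M\<^esub> y] @ ys)
      | xs x y ys a. xs @ [x, y] @ ys \<in> tuples M k \<and> a \<in> carrier A}"

definition tensor_ker ::
    "('a, 'r) ring_scheme \<Rightarrow> ('a, 'b, 'm) bimodule_scheme \<Rightarrow> nat \<Rightarrow> ('b list \<Rightarrow>\<^sub>0 int) set" where
  "tensor_ker A M k = generate (free_Abelian_group (tuples M k)) (tensor_rels A M k)"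

definition tensor_power ::
    "('a, 'r) ring_scheme \<Rightarrow> ('a, 'b, 'm) bimodule_scheme \<Rightarrow> nat \<Rightarrow> ('b list \<Rightarrow>\<^sub>0 int) set monoid"
  where "tensor_power A M k = free_Abelian_group (tuples M k) Mod tensor_ker A M k"

definition tensor_cls ::
    "('a, 'r) ring_scheme \<Rightarrow> ('a, 'b, 'm) bimodule_scheme \<Rightarrow> nat
      \<Rightarrow> ('b list \<Rightarrow>\<^sub>0 int) \<Rightarrow> ('b list \<Rightarrow>\<^sub>0 int) set"
  where "tensor_cls A M k f = tensor_ker A M k #>\<^bsub>free_Abelian_group (tuples M k)\<^esub> f"

text \<open>The elementary tensor \<open>x\<^sub>1 \<otimes> \<dots> \<otimes> x\<^sub>k\<close>.\<close>

definition tens ::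
    "('a, 'r) ring_scheme \<Rightarrow> ('a, 'b, 'm) bimodule_scheme \<Rightarrow> 'b list \<Rightarrow> ('b list \<Rightarrow>\<^sub>0 int) set"
  where "tens A M xs = tensor_cls A M (length xs) (frag_of xs)"

definition tensor_lact ::
    "('a, 'r) ring_scheme \<Rightarrow> ('a, 'b, 'm) bimodule_scheme \<Rightarrow> nat
      \<Rightarrow> 'a \<Rightarrow> ('b list \<Rightarrow>\<^sub>0 int) set \<Rightarrow> ('b list \<Rightarrow>\<^sub>0 int) set" where
  "tensor_lact A M k a \<xi> = tensor_cls A M k
    (frag_extend (\<lambda>xs. frag_of ((a \<odot>\<^bsub>M\<^esub> hd xs) # tl xs)) (rep \<xi>))"

definition tensor_ract ::
    "('a, 'r) ring_scheme \<Rightarrow> ('a, 'b, 'm) bimodule_scheme \<Rightarrow> nat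
      \<Rightarrow> ('b list \<Rightarrow>\<^sub>0 int) set \<Rightarrow> 'a \<Rightarrow> ('b list \<Rightarrow>\<^sub>0 int) set" where
  "tensor_ract A M k \<xi> a = tensor_cls A M k
    (frag_extend (\<lambda>xs. frag_of (butlast xs @ [rsmult M (last xs) a])) (rep \<xi>))"

text \<open>The tensor product over the complex numbers of two modules over an algebra with unit map
  \<open>\<kappa>\<close>.\<close>

definition ctensor_ker ::
    "(complex \<Rightarrow> 'a) \<Rightarrow> ('a, 'b, 'm) module_scheme \<Rightarrow> ('a, 'c, 'n) module_scheme
      \<Rightarrow> ('b \<times> 'c \<Rightarrow>\<^sub>0 int) set" where
  "ctensor_ker \<kappa> M M' = generate (free_Abelian_group (carrier M \<times> carrier M'))
    ({frag_of (x \<oplus>\<^bsub>M\<^esub> x', y) - frag_of (x, y) - frag_of (x', y)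
       | x x' y. x \<in> carrier M \<and> x' \<in> carrier M \<and> y \<in> carrier M'}
     \<union> {frag_of (x, y \<oplus>\<^bsub>M'\<^esub> y') - frag_of (x, y) - frag_of (x, y')
       | x y y'. x \<in> carrier M \<and> y \<in> carrier M' \<and> y' \<in> carrier M'}
     \<union> {frag_of (\<kappa> c \<odot>\<^bsub>M\<^esub> x, y) - frag_of (x, \<kappa> c \<odot>\<^bsub>M'\<^esub> y)
       | c x y. x \<in> carrier M \<and> y \<in> carrier M'})"

definition ctensor ::
    "(complex \<Rightarrow> 'a) \<Rightarrow> ('a, 'b, 'm) module_scheme \<Rightarrow> ('a, 'c, 'n) module_scheme
      \<Rightarrow> ('b \<times> 'c \<Rightarrow>\<^sub>0 int) set monoid"
  where "ctensor \<kappa> M M' =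
    free_Abelian_group (carrier M \<times> carrier M') Mod ctensor_ker \<kappa> M M'"

definition ctens ::
    "(complex \<Rightarrow> 'a) \<Rightarrow> ('a, 'b, 'm) module_scheme \<Rightarrow> ('a, 'c, 'n) module_scheme
      \<Rightarrow> 'b \<Rightarrow> 'c \<Rightarrow> ('b \<times> 'c \<Rightarrow>\<^sub>0 int) set"
  where "ctens \<kappa> M M' x y =
    ctensor_ker \<kappa> M M' #>\<^bsub>free_Abelian_group (carrier M \<times> carrier M')\<^esub> frag_of (x, y)"

definition regular_module :: "('a, 'r) ring_scheme \<Rightarrow> ('a, 'a) module" where
  "regular_module A =
    \<lparr>carrier = carrier A, monoid.mult = monoid.mult A, one = one A, zero = zero A, add = add A,
     smult = monoid.mult A\<rparr>"

section \<open>The bicovariant bimodules \<open>\<Gamma>\<^sub>\<plusminus>\<close>\<close>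

text \<open>The element \<open>\<Sum> x\<^sub>i\<^sub>j \<theta>\<^sub>i\<^sub>j\<close> of the free left module is the family \<open>x\<close>.\<close>

type_synonym gam = "nat \<times> nat \<Rightarrow> oq"

text \<open>\<open>\<Sum> a\<^sub>(\<^sub>1\<^sub>) \<chi>(a\<^sub>(\<^sub>2\<^sub>)) r(u\<^sup>k\<^sub>i, a\<^sub>(\<^sub>3\<^sub>)) r(a\<^sub>(\<^sub>4\<^sub>), u\<^sup>j\<^sub>l)\<close>, the coefficient of \<open>\<theta>\<^sub>k\<^sub>l\<close> in
  \<open>\<theta>\<^sub>i\<^sub>j a\<close>.\<close>

definition theta_act ::
    "nat \<Rightarrow> complex \<Rightarrow> complex \<Rightarrow> (oq \<Rightarrow> oq \<Rightarrow> complex) \<Rightarrow> nat \<times> nat \<Rightarrow> nat \<times> nat \<Rightarrow> oq \<Rightarrow> oq"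
  where
  "theta_act N h s r = (\<lambda>(i, j) (k, l) a.
    sweedler_A N h a (\<lambda>a1 a'.
      scal N h (sweedler_C N h a' (\<lambda>a2 a''.
        chi s a2 * sweedler_C N h a'' (\<lambda>a3 a4. r (ucls N h k i) a3 * r a4 (ucls N h j l))))
      \<otimes>\<^bsub>Oq N h\<^esub> a1))"

definition Gamma ::
    "nat \<Rightarrow> complex \<Rightarrow> complex \<Rightarrow> (oq \<Rightarrow> oq \<Rightarrow> complex) \<Rightarrow> (oq, gam) bimodule" where
  "Gamma N h s r =
    \<lparr>carrier = ({1..N} \<times> {1..N}) \<rightarrow>\<^sub>E carrier (Oq N h),
     monoid.mult = undefined, one = undefined,
     zero = (\<lambda>I\<in>{1..N} \<times> {1..N}. \<zero>\<^bsub>Oq N h\<^esub>),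
     add = (\<lambda>x y. \<lambda>I\<in>{1..N} \<times> {1..N}. x I \<oplus>\<^bsub>Oq N h\<^esub> y I),
     smult = (\<lambda>a x. \<lambda>I\<in>{1..N} \<times> {1..N}. a \<otimes>\<^bsub>Oq N h\<^esub> x I),
     rsmult = (\<lambda>x a. \<lambda>J\<in>{1..N} \<times> {1..N}.
        \<Oplus>\<^bsub>Oq N h\<^esub>I\<in>{1..N} \<times> {1..N}. x I \<otimes>\<^bsub>Oq N h\<^esub> theta_act N h s r I J a)\<rparr>"

definition theta :: "nat \<Rightarrow> complex \<Rightarrow> nat \<times> nat \<Rightarrow> gam" where
  "theta N h I = (\<lambda>J\<in>{1..N} \<times> {1..N}. if J = I then \<one>\<^bsub>Oq N h\<^esub> else \<zero>\<^bsub>Oq N h\<^esub>)"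

text \<open>The matrix coefficients \<open>u\<^sup>k\<^sub>i (u\<^sup>c)\<^sup>l\<^sub>j\<close>, where \<open>(u\<^sup>c)\<^sup>l\<^sub>j = S(u\<^sup>j\<^sub>l)\<close>.\<close>

definition vcoef :: "nat \<Rightarrow> complex \<Rightarrow> nat \<times> nat \<Rightarrow> nat \<times> nat \<Rightarrow> oq" where
  "vcoef N h = (\<lambda>(k, l) (i, j). ucls N h k i \<otimes>\<^bsub>Oq N h\<^esub> Su N h j l)"

text \<open>The coactions of a bicovariant bimodule satisfy \<open>\<Delta>\<^sub>L(a x) = \<Delta>(a) \<Delta>\<^sub>L(x)\<close> and
  \<open>\<Delta>\<^sub>R(a x) = \<Delta>(a) \<Delta>\<^sub>R(x)\<close>; so they are determined by their values on the
  \<open>\<theta>\<^sub>i\<^sub>j\<close>, which are \<open>1 \<otimes> \<theta>\<^sub>i\<^sub>j\<close> and \<open>\<Sum> \<theta>\<^sub>k\<^sub>l \<otimes> u\<^sup>k\<^sub>i (u\<^sup>c)\<^sup>l\<^sub>j\<close>.\<close>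

definition left_coaction ::
    "nat \<Rightarrow> complex \<Rightarrow> complex \<Rightarrow> (oq \<Rightarrow> oq \<Rightarrow> complex) \<Rightarrow> gam \<Rightarrow> (oq \<times> gam \<Rightarrow>\<^sub>0 int) set" where
  "left_coaction N h s r x =
    (let A = regular_module (Oq N h); M = Gamma N h s r; T = ctensor (scal N h) A M in
      \<Otimes>\<^bsub>T\<^esub>I\<in>{1..N} \<times> {1..N}. sweedler T N h (x I) (\<lambda>a1 a2.
        ctens (scal N h) A M a1 (a2 \<odot>\<^bsub>M\<^esub> theta N h I)))"

definition right_coaction ::
    "nat \<Rightarrow> complex \<Rightarrow> complex \<Rightarrow> (oq \<Rightarrow> oq \<Rightarrow> complex) \<Rightarrow> gam \<Rightarrow> (gam \<times> oq \<Rightarrow>\<^sub>0 int) set" where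
  "right_coaction N h s r x =
    (let A = regular_module (Oq N h); M = Gamma N h s r; T = ctensor (scal N h) M A in
      \<Otimes>\<^bsub>T\<^esub>I\<in>{1..N} \<times> {1..N}. \<Otimes>\<^bsub>T\<^esub>J\<in>{1..N} \<times> {1..N}. sweedler T N h (x I) (\<lambda>a1 a2.
        ctens (scal N h) M A (a1 \<odot>\<^bsub>M\<^esub> theta N h J) (a2 \<otimes>\<^bsub>Oq N h\<^esub> vcoef N h J I)))"

definition left_invariants ::
    "nat \<Rightarrow> complex \<Rightarrow> complex \<Rightarrow> (oq \<Rightarrow> oq \<Rightarrow> complex) \<Rightarrow> gam set" where
  "left_invariants N h s r = {x \<in> carrier (Gamma N h s r).
    left_coaction N h s r x
      = ctens (scal N h) (regular_module (Oq N h)) (Gamma N h s r) \<one>\<^bsub>Oq N h\<^esub> x}"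

definition right_invariants ::
    "nat \<Rightarrow> complex \<Rightarrow> complex \<Rightarrow> (oq \<Rightarrow> oq \<Rightarrow> complex) \<Rightarrow> gam set" where
  "right_invariants N h s r = {x \<in> carrier (Gamma N h s r).
    right_coaction N h s r x
      = ctens (scal N h) (Gamma N h s r) (regular_module (Oq N h)) x \<one>\<^bsub>Oq N h\<^esub>}"

section \<open>Woronowicz' external algebra\<close>

text \<open>\<open>is_braiding A M L R \<sigma>\<close>: \<open>\<sigma>\<close> is an \<open>A\<close>-bimodule endomorphism of \<open>M \<otimes>\<^sub>A M\<close> flipping
  \<open>\<omega> \<otimes> \<eta>\<close> for \<open>\<omega> \<in> L\<close> and \<open>\<eta> \<in> R\<close>.\<close>

definition is_braiding ::
    "('a, 'r) ring_scheme \<Rightarrow> ('a, 'b, 'm) bimodule_scheme \<Rightarrow> 'b set \<Rightarrow> 'b set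
      \<Rightarrow> (('b list \<Rightarrow>\<^sub>0 int) set \<Rightarrow> ('b list \<Rightarrow>\<^sub>0 int) set) \<Rightarrow> bool" where
  "is_braiding A M L R \<sigma> \<longleftrightarrow>
    \<sigma> \<in> hom (tensor_power A M 2) (tensor_power A M 2) \<and>
    (\<forall>a\<in>carrier A. \<forall>\<xi>\<in>carrier (tensor_power A M 2).
      \<sigma> (tensor_lact A M 2 a \<xi>) = tensor_lact A M 2 a (\<sigma> \<xi>) \<and>
      \<sigma> (tensor_ract A M 2 \<xi> a) = tensor_ract A M 2 (\<sigma> \<xi>) a) \<and>
    (\<forall>\<omega>\<in>L. \<forall>\<eta>\<in>R. \<sigma> (tens A M [\<omega>, \<eta>]) = tens A M [\<eta>, \<omega>])"

definition canonical_braiding ::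
    "('a, 'r) ring_scheme \<Rightarrow> ('a, 'b, 'm) bimodule_scheme \<Rightarrow> 'b set \<Rightarrow> 'b set
      \<Rightarrow> ('b list \<Rightarrow>\<^sub>0 int) set \<Rightarrow> ('b list \<Rightarrow>\<^sub>0 int) set" where
  "canonical_braiding A M L R =
    (THE \<sigma>. \<sigma> \<in> extensional (carrier (tensor_power A M 2)) \<and> is_braiding A M L R \<sigma>)"

text \<open>\<open>\<sigma>\<^sub>i\<close>, acting on the factors \<open>i\<close> and \<open>i + 1\<close> (numbered from 1) of the \<open>k\<close>-th tensor power.\<close>

definition braid_at ::
    "('a, 'r) ring_scheme \<Rightarrow> ('a, 'b, 'm) bimodule_scheme
      \<Rightarrow> (('b list \<Rightarrow>\<^sub>0 int) set \<Rightarrow> ('b list \<Rightarrow>\<^sub>0 int) set) \<Rightarrow> nat \<Rightarrow> nat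
      \<Rightarrow> ('b list \<Rightarrow>\<^sub>0 int) set \<Rightarrow> ('b list \<Rightarrow>\<^sub>0 int) set" where
  "braid_at A M \<sigma> k i \<xi> = tensor_cls A M k
    (frag_extend (\<lambda>xs. frag_extend
        (\<lambda>ys. frag_of (take (i - 1) xs @ ys @ drop (i + 1) xs))
        (rep (\<sigma> (tens A M [xs ! (i - 1), xs ! i]))))
      (rep \<xi>))"

text \<open>\<open>s\<^sub>i\<close> is the transposition of \<open>i\<close> and \<open>i + 1\<close>; \<open>perm_of_word [i\<^sub>1, \<dots>, i\<^sub>m]\<close> is
  \<open>s\<^sub>i\<^sub>1 \<dots> s\<^sub>i\<^sub>m\<close>.\<close>

definition perm_of_word :: "nat list \<Rightarrow> nat \<Rightarrow> nat"
  where "perm_of_word is = foldr (\<lambda>i w. transpose i (Suc i) \<circ> w) is id"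

definition reduced_word :: "nat \<Rightarrow> (nat \<Rightarrow> nat) \<Rightarrow> nat list \<Rightarrow> bool" where
  "reduced_word k w is \<longleftrightarrow>
    set is \<subseteq> {1..<k} \<and> perm_of_word is = w \<and>
    (\<forall>js. set js \<subseteq> {1..<k} \<and> perm_of_word js = w \<longrightarrow> length is \<le> length js)"

definition some_reduced_word :: "nat \<Rightarrow> (nat \<Rightarrow> nat) \<Rightarrow> nat list"
  where "some_reduced_word k w = (SOME is. reduced_word k w is)"

definition perm_length :: "nat \<Rightarrow> (nat \<Rightarrow> nat) \<Rightarrow> nat"
  where "perm_length k w = length (some_reduced_word k w)"

text \<open>The choice of the reduced word is immaterial, since \<open>\<sigma>\<close> satisfies the braid equation.\<close>

definition braid_perm ::
    "('a, 'r) ring_scheme \<Rightarrow> ('a, 'b, 'm) bimodule_scheme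
      \<Rightarrow> (('b list \<Rightarrow>\<^sub>0 int) set \<Rightarrow> ('b list \<Rightarrow>\<^sub>0 int) set) \<Rightarrow> nat \<Rightarrow> (nat \<Rightarrow> nat)
      \<Rightarrow> ('b list \<Rightarrow>\<^sub>0 int) set \<Rightarrow> ('b list \<Rightarrow>\<^sub>0 int) set" where
  "braid_perm A M \<sigma> k w =
    foldr (\<lambda>i f. braid_at A M \<sigma> k i \<circ> f) (some_reduced_word k w) id"

text \<open>In the group \<open>tensor_power A M k\<close>, written multiplicatively, the sum is a product and the
  signs are exponents.\<close>

definition antisymmetrizer ::
    "('a, 'r) ring_scheme \<Rightarrow> ('a, 'b, 'm) bimodule_scheme
      \<Rightarrow> (('b list \<Rightarrow>\<^sub>0 int) set \<Rightarrow> ('b list \<Rightarrow>\<^sub>0 int) set) \<Rightarrow> nat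
      \<Rightarrow> ('b list \<Rightarrow>\<^sub>0 int) set \<Rightarrow> ('b list \<Rightarrow>\<^sub>0 int) set" where
  "antisymmetrizer A M \<sigma> k \<xi> =
    (\<Otimes>\<^bsub>tensor_power A M k\<^esub>w\<in>{w. w permutes {1..k}}.
      braid_perm A M \<sigma> k w \<xi> [^]\<^bsub>tensor_power A M k\<^esub> ((-1) ^ perm_length k w :: int))"

definition external_power ::
    "('a, 'r) ring_scheme \<Rightarrow> ('a, 'b, 'm) bimodule_scheme
      \<Rightarrow> (('b list \<Rightarrow>\<^sub>0 int) set \<Rightarrow> ('b list \<Rightarrow>\<^sub>0 int) set) \<Rightarrow> nat
      \<Rightarrow> ('b list \<Rightarrow>\<^sub>0 int) set set monoid" where
  "external_power A M \<sigma> k =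
    tensor_power A M k Mod
      kernel (tensor_power A M k) (tensor_power A M k) (antisymmetrizer A M \<sigma> k)"

text \<open>The space of \<open>k\<close>-forms over \<open>\<Gamma>\<^sub>\<plusminus>\<close>, for \<open>s = \<plusminus>1\<close> and \<open>k \<ge> 1\<close>.\<close>

definition Gamma_forms ::
    "nat \<Rightarrow> complex \<Rightarrow> complex \<Rightarrow> (oq \<Rightarrow> oq \<Rightarrow> complex) \<Rightarrow> nat
      \<Rightarrow> (gam list \<Rightarrow>\<^sub>0 int) set set monoid" where
  "Gamma_forms N h s r k =
    external_power (Oq N h) (Gamma N h s r)
      (canonical_braiding (Oq N h) (Gamma N h s r)
        (left_invariants N h s r) (right_invariants N h s r)) k"

end

theory Submission
  imports Defs
begin

text \<open>The left module \<open>\<Gamma>\<^sup>\<otimes>\<^sup>k\<close> has the words \<open>\<theta>\<^sub>I\<^sub>1 \<otimes> \<dots> \<otimes> \<theta>\<^sub>I\<^sub>k\<close> as a basis, and the braiding is left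
  linear. Write \<open>\<theta>\<^sub>I a = \<Sum> a\<^sub>(\<^sub>1\<^sub>) F\<^sub>I\<^sub>K(a\<^sub>(\<^sub>2\<^sub>)) \<theta>\<^sub>K\<close> and \<open>\<Delta>\<^sub>R(\<theta>\<^sub>I) = \<Sum> \<theta>\<^sub>P \<otimes> v\<^sub>P\<^sub>I\<close>. Then
  \<open>\<sigma>(\<theta>\<^sub>I \<otimes> \<theta>\<^sub>J) = \<Sum> F\<^sub>I\<^sub>K(v\<^sub>P\<^sub>J) \<theta>\<^sub>P \<otimes> \<theta>\<^sub>K\<close>, so the antisymmetrizer is given by complex matrices on words.
  Two features of these matrices produce a word that the antisymmetrizer does not annihilate.

  The span of \<open>\<theta>\<^sub>1\<^sub>N, \<dots>, \<theta>\<^sub>N\<^sub>N\<close> is a braided subspace, and up to conjugation by a diagonal matrix on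
  words \<open>\<sigma>\<close> acts on it as \<open>q\<^sup>-\<^sup>1 \<hat>R\<close> (\<open>F_invariant_line\<close>, \<open>braid_step\<close>). In the limit of infinite \<open>q\<close>
  this operator degenerates: with \<open>x = h\<^sup>-\<^sup>1\<close> its entries are integer polynomials in \<open>x\<close>
  (\<open>scaled_R_int_poly_values\<close>), and for \<open>m = (N + 1) div 2\<close> and \<open>m' = N + 1 - m\<close> the columns of \<open>(m, m')\<close>
  and \<open>(m', m)\<close> vanish at \<open>x = 0\<close> (\<open>scaled_R_small_values\<close>). Apply the antisymmetrizer to the word
  with first indices \<open>m, m', m, m', \<dots>\<close> and second indices \<open>N\<close>. Any nonempty product of the \<open>\<sigma>\<^sub>i\<close> gives
  coefficients that are polynomials in \<open>x\<close> with integer coefficients and no constant term, because the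
  first factor does and the others keep this property (\<open>word_coeff_Bw\<close>). The identity permutation
  contributes \<open>1\<close>. So the coefficient of the word in its antisymmetrization is \<open>1 + P(x)\<close> with
  \<open>P(0) = 0\<close>, which is not zero as \<open>q\<close> is transcendental (\<open>one_add_small_values_nonzero\<close>).

  Most of the text justifies the formula for \<open>\<sigma>\<close>. All elements of the algebra are represented in the
  free algebra, and functionals given there by Sweedler sums descend because the relations form a
  biideal (\<open>Dl_kernel\<close>). The formula defines a bimodule endomorphism \<open>braid_map\<close>; it flips
  left-invariant and right-invariant elements, and these determine it since their products generate
  \<open>\<Gamma> \<otimes>\<^sub>A \<Gamma>\<close> as a left module (\<open>canonical_braiding_eq\<close>). Nonvanishing is detected by functionals
  \<open>word_coeff\<close> that move all coefficients to the left and apply the counit (\<open>word_coeff_Kg\<close>,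
  \<open>word_coeff_braid\<close>).\<close>

section \<open>Linear extension and the free algebra\<close>

abbreviation lookup where "lookup \<equiv> Poly_Mapping.lookup"
abbreviation keys where "keys \<equiv> Poly_Mapping.keys"
abbreviation single where "single \<equiv> Poly_Mapping.single"

definition lin_ext :: "('w \<Rightarrow> 'c::zero \<Rightarrow> 'g::comm_monoid_add) \<Rightarrow> ('w \<Rightarrow>\<^sub>0 'c) \<Rightarrow> 'g" where
  "lin_ext \<phi> f = (\<Sum>w\<in>keys f. \<phi> w (lookup f w))"

lemma lin_ext_zero [simp]: "lin_ext \<phi> 0 = 0"
  by (simp add: lin_ext_def)

lemma lin_ext_single [simp]: "\<phi> w 0 = 0 \<Longrightarrow> lin_ext \<phi> (single w c) = \<phi> w c"
  by (simp add: lin_ext_def)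

lemma lin_ext_add:
  assumes "\<And>w. \<phi> w 0 = 0" "\<And>w a b. \<phi> w (a + b) = \<phi> w a + \<phi> w b"
  shows "lin_ext \<phi> (f + g) = lin_ext \<phi> f + lin_ext \<phi> g"
  unfolding lin_ext_def by (rule setsum_keys_plus_distrib) (auto simp: assms)

lemma poly_mapping_sum_single: "f = (\<Sum>w\<in>keys f. single w (lookup f w))"
  by (rule poly_mapping_eqI)
    (auto simp: lookup_sum lookup_single when_def sum.delta' in_keys_iff intro!: sym[OF sum.neutral])

lemma poly_mapping_add_induct [case_names single add]:
  assumes s: "\<And>w c. P (single w c)" and a: "\<And>f g. P f \<Longrightarrow> P g \<Longrightarrow> P (f + g)"
  shows "P (f :: 'w \<Rightarrow>\<^sub>0 'c::comm_monoid_add)"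
proof -
  have "P (\<Sum>w\<in>A. single w (lookup f w))" if "finite A" for A
    using that by (induction A) (use s[of _ 0] in \<open>auto intro: s a\<close>)
  from this[of "keys f"] show ?thesis by (simp flip: poly_mapping_sum_single)
qed

lemma additive_sum:
  fixes P :: "'a::comm_monoid_add \<Rightarrow> 'b::comm_monoid_add"
  assumes "P 0 = 0" "\<And>x y. P (x + y) = P x + P y"
  shows "P (sum f A) = (\<Sum>i\<in>A. P (f i))"
  by (induction A rule: infinite_finite_induct) (auto simp: assms)

lemma lin_ext_mult:
  fixes \<phi> :: "'w::monoid_add \<Rightarrow> 'c::semiring_1 \<Rightarrow> 'r::semiring_1"
  assumes z: "\<And>w. \<phi> w 0 = 0" and a: "\<And>w a b. \<phi> w (a + b) = \<phi> w a + \<phi> w b"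
    and m: "\<And>v w a b. \<phi> (v + w) (a * b) = \<phi> v a * \<phi> w b"
  shows "lin_ext \<phi> (f * g) = lin_ext \<phi> f * lin_ext \<phi> g"
proof (induction f rule: poly_mapping_add_induct)
  case (single v c)
  show ?case
    by (induction g rule: poly_mapping_add_induct)
      (simp_all add: z m mult_single distrib_left lin_ext_add[OF z a])
qed (simp add: distrib_right lin_ext_add[OF z a])

lemma kconst_mult_single [simp]: "kconst c * single w d = single w (c * d)"
  by (simp add: mult_single)

lemma kconst_central: "(kconst c :: 'm::monoid_add \<Rightarrow>\<^sub>0 complex) * f = f * kconst c"
  by (induction f rule: poly_mapping_add_induct)
    (simp_all add: mult_single distrib_left distrib_right mult.commute)

lemma kconst_mult: "kconst c * kconst d = (kconst (c * d) :: 'm::monoid_add \<Rightarrow>\<^sub>0 complex)"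
  by (simp add: mult_single)

lemma kconst_sum: "kconst (sum f A) = (\<Sum>i\<in>A. kconst (f i) :: 'm::monoid_add \<Rightarrow>\<^sub>0 complex)"
  by (rule additive_sum) (simp_all add: single_add)

lemma FWord_Nil [simp]: "FWord [] = 0"
  unfolding zero_fword_def ..

lemma plus_fword [simp]: "FWord v + FWord w = FWord (v @ w)"
  by (simp add: plus_fword_def)

lemma falg_induct [case_names const gen add mult]:
  assumes k: "\<And>c. P (kconst c)" and u: "\<And>i j. P (ugen i j)"
    and a: "\<And>f g. P f \<Longrightarrow> P g \<Longrightarrow> P (f + g)" and m: "\<And>f g. P f \<Longrightarrow> P g \<Longrightarrow> P (f * g)"
  shows "P f"
proof (induction f rule: poly_mapping_add_induct)
  case (single w c)
  have "P (single (FWord xs) c)" for xs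
  proof (induction xs)
    case Nil
    then show ?case using k[of c] by simp
  next
    case (Cons x xs)
    obtain i j where x: "x = (i, j)" by force
    have "single (FWord (x # xs)) c = ugen i j * single (FWord xs) c"
      by (simp add: ugen_def x mult_single)
    then show ?case using m[OF u Cons] by simp
  qed
  then show ?case by (metis fword.exhaust)
qed (rule a)

definition good :: "nat \<Rightarrow> (nat \<times> nat) fword \<Rightarrow> bool"
  where "good N w \<longleftrightarrow> set (letters w) \<subseteq> {1..N} \<times> {1..N}"

lemma good_add [simp]: "good N (v + w) \<longleftrightarrow> good N v \<and> good N w"
  by (simp add: good_def plus_fword_def)

lemma letters_0 [simp]: "letters 0 = []"
  by (simp only: zero_fword_def fword.sel)

lemma good_0 [simp]: "good N 0"
  by (simp add: good_def)

abbreviation fcar :: "nat \<Rightarrow> falg set" where "fcar N \<equiv> carrier (free_alg N)"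

lemma fcar_iff: "f \<in> fcar N \<longleftrightarrow> (\<forall>w\<in>keys f. good N w)"
  by (simp add: free_alg_def good_def)

lemma fcar_add: "f \<in> fcar N \<Longrightarrow> g \<in> fcar N \<Longrightarrow> f + g \<in> fcar N"
  unfolding fcar_iff using subsetD[OF keys_add, of _ f g] by blast

lemma fcar_mult:
  assumes "f \<in> fcar N" "g \<in> fcar N"
  shows "f * g \<in> fcar N"
  unfolding fcar_iff
proof
  fix w assume "w \<in> keys (f * g)"
  then obtain a b where "w = a + b" "a \<in> keys f" "b \<in> keys g"
    using keys_mult[of f g] by blast
  then show "good N w" using assms by (simp add: fcar_iff)
qed

lemma fcar_minus: "f \<in> fcar N \<Longrightarrow> - f \<in> fcar N"
  unfolding fcar_iff in_keys_iff lookup_uminus by simp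

lemma fcar_diff: "f \<in> fcar N \<Longrightarrow> g \<in> fcar N \<Longrightarrow> f - g \<in> fcar N"
  using fcar_add[OF _ fcar_minus, of f N g] by simp

lemma fcar_const: "kconst c \<in> fcar N"
  by (auto simp: fcar_iff)

lemma fcar_0: "0 \<in> fcar N" and fcar_1: "1 \<in> fcar N"
  using fcar_const[of 0 N] fcar_const[of 1 N] by simp_all

lemma fcar_gen: "i \<in> {1..N} \<Longrightarrow> j \<in> {1..N} \<Longrightarrow> ugen i j \<in> fcar N"
  by (auto simp: fcar_iff ugen_def good_def)

lemma fcar_sum: "(\<And>i. i \<in> A \<Longrightarrow> f i \<in> fcar N) \<Longrightarrow> sum f A \<in> fcar N"
  by (induction A rule: infinite_finite_induct) (auto intro: fcar_add fcar_0)

lemmas fcar_intros = fcar_add fcar_mult fcar_diff fcar_const fcar_gen fcar_sum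

lemma free_alg_simps [simp]:
  "x \<otimes>\<^bsub>free_alg N\<^esub> y = x * y" "x \<oplus>\<^bsub>free_alg N\<^esub> y = x + y"
  "\<one>\<^bsub>free_alg N\<^esub> = 1" "\<zero>\<^bsub>free_alg N\<^esub> = 0"
  by (simp_all add: free_alg_def)

lemma ring_free_alg: "ring (free_alg N)"
proof (rule ringI)
  show "abelian_group (free_alg N)"
  proof (rule abelian_groupI)
    fix x assume "x \<in> fcar N"
    then show "\<exists>y\<in>fcar N. y \<oplus>\<^bsub>free_alg N\<^esub> x = \<zero>\<^bsub>free_alg N\<^esub>"
      by (intro bexI[of _ "- x"]) (auto intro: fcar_minus)
  qed (auto intro: fcar_add fcar_0 simp: add_ac)
  show "monoid (free_alg N)"
    by (rule monoidI) (auto intro: fcar_mult fcar_1 simp: mult.assoc)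
qed (simp_all add: distrib_left distrib_right)

text \<open>Words with a letter outside the index range are sent to \<open>0\<close>. This retracts the type of all
  noncommutative polynomials onto the free algebra on the \<open>N\<^sup>2\<close> letters, so that maps into the
  quotient can be treated as total functions.\<close>

definition res :: "nat \<Rightarrow> falg \<Rightarrow> falg"
  where "res N = lin_ext (\<lambda>w c. if good N w then single w c else 0)"

lemma res_add: "res N (f + g) = res N f + res N g"
  unfolding res_def by (rule lin_ext_add) (auto simp: single_add)

lemma res_mult: "res N (f * g) = res N f * res N g"
  unfolding res_def by (rule lin_ext_mult) (auto simp: single_add mult_single)

lemma res_single: "res N (single w c) = (if good N w then single w c else 0)"
  by (simp add: res_def)

lemma res_closed: "res N f \<in> fcar N"
proof (induction f rule: poly_mapping_add_induct)
  case (single w c)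
  then show ?case by (simp add: res_single fcar_iff)
next
  case (add f g)
  then show ?case unfolding res_add by (rule fcar_add)
qed

lemma res_id: "f \<in> fcar N \<Longrightarrow> res N f = f"
proof -
  assume "f \<in> fcar N"
  then have "res N f = (\<Sum>w\<in>keys f. single w (lookup f w))"
    unfolding res_def lin_ext_def fcar_iff by (intro sum.cong) auto
  then show ?thesis by (simp flip: poly_mapping_sum_single)
qed

lemma res_const: "res N (kconst c) = kconst c"
  by (rule res_id) (rule fcar_const)

lemma res_gen: "res N (ugen i j) = (if i \<in> {1..N} \<and> j \<in> {1..N} then ugen i j else 0)"
  by (auto simp: ugen_def res_single good_def)

section \<open>The quotient algebra\<close>

abbreviation relators :: "nat \<Rightarrow> complex \<Rightarrow> falg set" where
  "relators N h \<equiv> {rel_RTT N h i j k l | i j k l. {i, j, k, l} \<subseteq> {1..N}}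
     \<union> {rel_C1 N h i j | i j. {i, j} \<subseteq> {1..N}}
     \<union> {rel_C2 N h i j | i j. {i, j} \<subseteq> {1..N}}"

lemma relators_carrier: "relators N h \<subseteq> fcar N"
proof -
  have "rel_RTT N h i j k l \<in> fcar N" if "{i, j, k, l} \<subseteq> {1..N}" for i j k l
    unfolding rel_RTT_def by (intro fcar_intros) (use that in auto)
  moreover have "rel_C1 N h i j \<in> fcar N" if "{i, j} \<subseteq> {1..N}" for i j
    unfolding rel_C1_def by (intro fcar_intros) (use that in auto)
  moreover have "rel_C2 N h i j \<in> fcar N" if "{i, j} \<subseteq> {1..N}" for i j
    unfolding rel_C2_def by (intro fcar_intros) (use that in auto)
  ultimately show ?thesis
    by (intro subsetI, elim UnE CollectE exE conjE) (simp_all del: insert_subset)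
qed

lemma ideal_Oq: "ideal (Oq_ideal N h) (free_alg N)"
  unfolding Oq_ideal_def by (rule ring.genideal_ideal[OF ring_free_alg relators_carrier])

lemma Oq_ideal_props:
  shows "0 \<in> Oq_ideal N h"
    and "f \<in> Oq_ideal N h \<Longrightarrow> g \<in> Oq_ideal N h \<Longrightarrow> f + g \<in> Oq_ideal N h"
    and "f \<in> Oq_ideal N h \<Longrightarrow> - f \<in> Oq_ideal N h"
    and "Oq_ideal N h \<subseteq> fcar N" "relators N h \<subseteq> Oq_ideal N h"
proof -
  interpret ideal "Oq_ideal N h" "free_alg N" by (rule ideal_Oq)
  show "0 \<in> Oq_ideal N h" using additive_subgroup.zero_closed[OF additive_subgroup_axioms] by simp
  show "f \<in> Oq_ideal N h \<Longrightarrow> g \<in> Oq_ideal N h \<Longrightarrow> f + g \<in> Oq_ideal N h"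
    using additive_subgroup.a_closed[OF additive_subgroup_axioms, of f g] by simp
  show sub: "Oq_ideal N h \<subseteq> fcar N" by (rule a_subset)
  show "- f \<in> Oq_ideal N h" if "f \<in> Oq_ideal N h"
  proof -
    have "(- 1) \<otimes>\<^bsub>free_alg N\<^esub> f \<in> Oq_ideal N h"
      using that by (intro I_l_closed) (auto intro: fcar_minus fcar_1)
    then show ?thesis by simp
  qed
  show "relators N h \<subseteq> Oq_ideal N h"
    unfolding Oq_ideal_def by (rule ring.genideal_self[OF ring_free_alg relators_carrier])
qed

lemma cls_alt: "cls N h f = {g + f | g. g \<in> Oq_ideal N h}"
  by (auto simp: cls_def a_r_coset_def' )

lemma cls_eq_iff: "cls N h f = cls N h g \<longleftrightarrow> f - g \<in> Oq_ideal N h"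
proof
  assume "cls N h f = cls N h g"
  moreover have "f \<in> cls N h f" using Oq_ideal_props(1) by (force simp: cls_alt)
  ultimately show "f - g \<in> Oq_ideal N h" by (auto simp: cls_alt)
next
  assume *: "f - g \<in> Oq_ideal N h"
  then have "g - f \<in> Oq_ideal N h" using Oq_ideal_props(3)[of "f - g"] by simp
  have "a + f \<in> cls N h g" if "a \<in> Oq_ideal N h" for a
    using Oq_ideal_props(2)[OF that *]
    by (auto simp: cls_alt intro!: exI[of _ "a + (f - g)"])
  moreover have "a + g \<in> cls N h f" if "a \<in> Oq_ideal N h" for a
    using Oq_ideal_props(2)[OF that \<open>g - f \<in> _\<close>]
    by (auto simp: cls_alt intro!: exI[of _ "a + (g - f)"])
  ultimately show "cls N h f = cls N h g" by (auto simp: cls_alt)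
qed

lemma ring_Oq: "ring (Oq N h)"
  unfolding Oq_def by (rule ideal.quotient_is_ring[OF ideal_Oq])

lemma cls_hom: "cls N h \<in> ring_hom (free_alg N) (Oq N h)"
  using ideal.rcos_ring_hom[OF ideal_Oq, of N h] by (simp add: Oq_def cls_def[abs_def])

lemma carrier_Oq: "carrier (Oq N h) = cls N h ` fcar N"
  by (auto simp: Oq_def FactRing_def A_RCOSETS_def' cls_def)

definition ocl :: "nat \<Rightarrow> complex \<Rightarrow> falg \<Rightarrow> oq"
  where "ocl N h f = cls N h (res N f)"

lemma ocl_closed [simp, intro]: "ocl N h f \<in> carrier (Oq N h)"
  using res_closed by (auto simp: ocl_def carrier_Oq)

lemma ocl_surj: "a \<in> carrier (Oq N h) \<Longrightarrow> \<exists>f\<in>fcar N. a = ocl N h f"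
  by (auto simp: carrier_Oq ocl_def res_id)

lemma ocl_add: "ocl N h (f + g) = ocl N h f \<oplus>\<^bsub>Oq N h\<^esub> ocl N h g"
  using ring_hom_add[OF cls_hom[of N h] res_closed[of N f] res_closed[of N g]]
  by (simp add: ocl_def res_add)

lemma ocl_mult: "ocl N h (f * g) = ocl N h f \<otimes>\<^bsub>Oq N h\<^esub> ocl N h g"
  using ring_hom_mult[OF cls_hom[of N h] res_closed[of N f] res_closed[of N g]]
  by (simp add: ocl_def res_mult)

lemma ocl_1: "ocl N h 1 = \<one>\<^bsub>Oq N h\<^esub>"
  using ring_hom_one[OF cls_hom[of N h]] res_const[of N 1] by (simp add: ocl_def)

lemma ocl_0: "ocl N h 0 = \<zero>\<^bsub>Oq N h\<^esub>"
  using ring_hom_zero[OF cls_hom[of N h] ring_free_alg ring_Oq] res_const[of N 0]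
  by (simp add: ocl_def)

lemma ocl_eq_iff: "ocl N h f = ocl N h g \<longleftrightarrow> ocl N h (f - g) = \<zero>\<^bsub>Oq N h\<^esub>"
proof -
  have r: "res N (f - g) = res N f - res N g"
    using res_add[of N "f - g" g] by simp
  show ?thesis unfolding ocl_0[symmetric] by (simp add: ocl_def cls_eq_iff r res_def[of N, THEN fun_cong, of 0])
qed

lemma ocl_sum: "ocl N h (sum f A) = (\<Oplus>\<^bsub>Oq N h\<^esub>i\<in>A. ocl N h (f i))"
proof -
  interpret ring "Oq N h" by (rule ring_Oq)
  show ?thesis
  proof (induction A rule: infinite_finite_induct)
    case (insert x F)
    then show ?case by (simp add: ocl_add finsum_insert)
  qed (simp_all add: ocl_0)
qed

lemma ocl_const: "ocl N h (kconst c) = scal N h c"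
  by (simp add: ocl_def scal_def res_const)

lemma ocl_gen: "i \<in> {1..N} \<Longrightarrow> j \<in> {1..N} \<Longrightarrow> ocl N h (ugen i j) = ucls N h i j"
  by (simp add: ocl_def ucls_def res_gen)

lemma ocl_id: "f \<in> fcar N \<Longrightarrow> ocl N h f = cls N h f"
  by (simp add: ocl_def res_id)

lemma ocl_relator: "f \<in> relators N h \<Longrightarrow> ocl N h f = \<zero>\<^bsub>Oq N h\<^esub>"
proof -
  assume f: "f \<in> relators N h"
  then have "f \<in> fcar N" "f - 0 \<in> Oq_ideal N h"
    using subsetD[OF relators_carrier f] subsetD[OF Oq_ideal_props(5) f] by simp_all
  then have "cls N h f = cls N h 0" by (simp only: cls_eq_iff)
  then show ?thesis
    using \<open>f \<in> fcar N\<close> fcar_0 by (simp add: ocl_id flip: ocl_0)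
qed

text \<open>To see that something descends to the quotient it is enough to check the relators and the
  letters that are not allowed.\<close>

lemma ocl_kernel_minimal:
  assumes add: "\<And>f g. f \<in> H \<Longrightarrow> g \<in> H \<Longrightarrow> f + g \<in> H"
    and l: "\<And>f g. f \<in> H \<Longrightarrow> g * f \<in> H" and r: "\<And>f g. f \<in> H \<Longrightarrow> f * g \<in> H"
    and rel: "relators N h \<subseteq> H"
    and bad: "\<And>i j. \<not> (i \<in> {1..N} \<and> j \<in> {1..N}) \<Longrightarrow> ugen i j \<in> H"
    and f: "ocl N h f = \<zero>\<^bsub>Oq N h\<^esub>"
  shows "f \<in> H"
proof -
  have z: "0 \<in> H" using bad[of 0 0] l[of "ugen 0 0" 0] by simp
  have "ideal (H \<inter> fcar N) (free_alg N)"
  proof (rule idealI[OF ring_free_alg])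
    show "subgroup (H \<inter> fcar N) (add_monoid (free_alg N))"
    proof (rule group.subgroupI)
      show "group (add_monoid (free_alg N))"
        using ring_free_alg[of N] abelian_group.a_group ring_def by blast
      fix a assume a: "a \<in> H \<inter> fcar N"
      interpret ring "free_alg N" by (rule ring_free_alg)
      have "\<ominus>\<^bsub>free_alg N\<^esub> a = - a"
        using a by (intro minus_equality) (auto intro: fcar_minus)
      then show "inv\<^bsub>add_monoid (free_alg N)\<^esub> a \<in> H \<inter> fcar N"
        using a l[of a "- 1"] by (auto simp: a_inv_def intro: fcar_minus)
    qed (use z in \<open>auto intro!: fcar_0 fcar_add add\<close>)
  qed (auto intro: l r fcar_mult)
  then have "Oq_ideal N h \<subseteq> H \<inter> fcar N"
    unfolding Oq_ideal_def
    by (rule ring.genideal_minimal[OF ring_free_alg]) (intro Int_greatest rel relators_carrier)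
  moreover have "res N f - 0 \<in> Oq_ideal N h"
    using f unfolding ocl_0[symmetric] ocl_def cls_eq_iff by (simp add: res_def)
  ultimately have "res N f \<in> H" by auto
  moreover have "f - res N f \<in> H"
  proof (induction f rule: poly_mapping_add_induct)
    case (add f g)
    then show ?case using assms(1)[OF add] by (simp add: res_add algebra_simps)
  next
    case (single w c)
    have "single (FWord xs) c \<in> H" if "\<not> good N (FWord xs)" for xs
      using that
    proof (induction xs)
      case (Cons x xs)
      obtain i j where x: "x = (i, j)" by force
      have e: "single (FWord (x # xs)) c = ugen i j * single (FWord xs) c"
        by (simp add: ugen_def x mult_single)
      show ?case
      proof (cases "good N (FWord xs)")
        case True
        then have "ugen i j \<in> H" using Cons.prems by (intro bad) (auto simp: good_def x)
        then show ?thesis unfolding e by (rule r)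
      next
        case False
        then show ?thesis unfolding e by (intro l Cons.IH)
      qed
    qed simp
    then show ?case using z by (cases w) (auto simp: res_single)
  qed
  ultimately have "(f - res N f) + res N f \<in> H" by (rule add[rotated])
  then show ?thesis by simp
qed

declare One_nat_def [simp del]

section \<open>The coproduct\<close>

definition smul :: "complex \<Rightarrow> ('m::monoid_add \<Rightarrow>\<^sub>0 complex) \<Rightarrow> ('m \<Rightarrow>\<^sub>0 complex)" (infixr \<open>\<cdot>\<close> 75)
  where "c \<cdot> f = kconst c * f"

lemma smul_simps [simp]:
  "0 \<cdot> f = 0" "1 \<cdot> f = f" "c \<cdot> 0 = 0" "c \<cdot> d \<cdot> f = (c * d) \<cdot> f"
  "(c \<cdot> f) * g = c \<cdot> (f * g)" "f * (c \<cdot> g) = c \<cdot> (f * g)"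
  by (simp_all add: smul_def mult.assoc)
    (metis kconst_mult mult.assoc, metis kconst_central mult.assoc)

lemma smul_add: "c \<cdot> (f + g) = c \<cdot> f + c \<cdot> g" and smul_diff: "c \<cdot> (f - g) = c \<cdot> f - c \<cdot> g"
  and add_smul: "(c + d) \<cdot> f = c \<cdot> f + d \<cdot> f" and smul_minus: "c \<cdot> (- f) = - (c \<cdot> f)"
  by (simp_all add: smul_def distrib_left distrib_right right_diff_distrib single_add)

lemma smul_sum: "c \<cdot> sum f A = (\<Sum>i\<in>A. c \<cdot> f i)"
  by (simp add: smul_def sum_distrib_left)

lemma sum_smul: "sum c A \<cdot> f = (\<Sum>i\<in>A. c i \<cdot> f)"
  by (simp add: smul_def kconst_sum sum_distrib_right)

lemma kconst_smul: "kconst c = c \<cdot> 1"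
  by (simp add: smul_def)

lemma smul_single: "c \<cdot> single w d = single w (c * d)"
  by (simp add: smul_def)

lemma smul_if: "c \<cdot> (if P then f else g) = (if P then c \<cdot> f else c \<cdot> g)"
  "(if P then c else d) \<cdot> f = (if P then c \<cdot> f else d \<cdot> f)"
  by simp_all

lemma sum4_swap: "(\<Sum>a\<in>A. \<Sum>b\<in>B. \<Sum>m\<in>M. \<Sum>n\<in>S. f a b m n)
    = (\<Sum>m\<in>M. \<Sum>n\<in>S. \<Sum>a\<in>A. \<Sum>b\<in>B. f a b m n :: 'a::comm_monoid_add)"
proof -
  have "(\<Sum>a\<in>A. \<Sum>b\<in>B. \<Sum>m\<in>M. \<Sum>n\<in>S. f a b m n)
      = (\<Sum>a\<in>A. \<Sum>m\<in>M. \<Sum>b\<in>B. \<Sum>n\<in>S. f a b m n)"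
    by (intro sum.cong refl) (rule sum.swap)
  also have "\<dots> = (\<Sum>a\<in>A. \<Sum>m\<in>M. \<Sum>n\<in>S. \<Sum>b\<in>B. f a b m n)"
    by (intro sum.cong refl) (rule sum.swap)
  also have "\<dots> = (\<Sum>m\<in>M. \<Sum>a\<in>A. \<Sum>n\<in>S. \<Sum>b\<in>B. f a b m n)"
    by (rule sum.swap)
  also have "\<dots> = (\<Sum>m\<in>M. \<Sum>n\<in>S. \<Sum>a\<in>A. \<Sum>b\<in>B. f a b m n)"
    by (intro sum.cong refl) (rule sum.swap)
  finally show ?thesis .
qed

text \<open>\<open>falg2\<close> is the algebra \<open>F \<otimes> F\<close>; \<open>in1 f\<close> is \<open>f \<otimes> 1\<close>, \<open>in2 g\<close> is \<open>1 \<otimes> g\<close> and \<open>tn f g\<close> is \<open>f \<otimes> g\<close>.\<close>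

definition in1 :: "falg \<Rightarrow> falg2" where "in1 = lin_ext (\<lambda>w c. single (w, 0) c)"
definition in2 :: "falg \<Rightarrow> falg2" where "in2 = lin_ext (\<lambda>w c. single (0, w) c)"
definition tn :: "falg \<Rightarrow> falg \<Rightarrow> falg2" where "tn f g = in1 f * in2 g"

lemma in_add: "in1 (f + g) = in1 f + in1 g" "in2 (f + g) = in2 f + in2 g"
  unfolding in1_def in2_def by (rule lin_ext_add; simp add: single_add)+

lemma in_mult: "in1 (f * g) = in1 f * in1 g" "in2 (f * g) = in2 f * in2 g"
  unfolding in1_def in2_def by (rule lin_ext_mult; simp add: single_add mult_single)+

lemma in_single: "in1 (single w c) = single (w, 0) c" "in2 (single w c) = single (0, w) c"
  by (simp_all add: in1_def in2_def)

lemma in_commute: "in1 f * in2 g = in2 g * in1 f"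
proof (induction f rule: poly_mapping_add_induct)
  case (single v c)
  show ?case
    by (induction g rule: poly_mapping_add_induct)
      (simp_all add: in_single in_add mult_single distrib_left distrib_right mult.commute)
qed (simp add: in_add distrib_left distrib_right)

lemma in_const: "in1 (kconst c) = kconst c" "in2 (kconst c) = kconst c"
  by (simp_all add: in_single zero_prod_def)

lemma tn_add_left: "tn (f + f') g = tn f g + tn f' g"
  and tn_add_right: "tn f (g + g') = tn f g + tn f g'"
  by (simp_all add: tn_def in_add distrib_left distrib_right)

lemma tn_zero [simp]: "tn 0 g = 0" "tn f 0 = 0"
  using tn_add_left[of 0 0 g] tn_add_right[of f 0 0] by simp_all

lemma tn_minus: "tn (- f) g = - tn f g" "tn f (- g) = - tn f g"
  using tn_add_left[of f "- f" g] tn_add_right[of f g "- g"]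
  by (simp_all add: eq_neg_iff_add_eq_0 add.commute)

lemma tn_diff: "tn (f - f') g = tn f g - tn f' g" "tn f (g - g') = tn f g - tn f g'"
  using tn_add_left[of f "- f'" g] tn_add_right[of f g "- g'"] by (simp_all add: tn_minus)

lemma tn_sum_left: "tn (sum f A) g = (\<Sum>i\<in>A. tn (f i) g)"
  by (rule additive_sum[of "\<lambda>x. tn x g"]) (simp_all add: tn_add_left)

lemma tn_sum_right: "tn f (sum g A) = (\<Sum>i\<in>A. tn f (g i))"
  by (rule additive_sum[of "tn f"]) (simp_all add: tn_add_right)

lemma tn_mult: "tn f g * tn f' g' = tn (f * f') (g * g')"
proof -
  have "tn f g * tn f' g' = in1 f * (in2 g * in1 f') * in2 g'"
    by (simp add: tn_def mult.assoc)
  also have "\<dots> = tn (f * f') (g * g')"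
    by (simp add: tn_def in_mult mult.assoc flip: in_commute)
  finally show ?thesis .
qed

lemma tn_single: "tn (single v c) (single w d) = single (v, w) (c * d)"
  by (simp add: tn_def in_single mult_single)

lemma tn_1_1: "tn 1 1 = 1"
  using tn_single[of 0 1 0 1] by (simp add: zero_prod_def[symmetric])

lemma tn_smul [simp]: "tn (c \<cdot> f) g = c \<cdot> tn f g" "tn f (c \<cdot> g) = c \<cdot> tn f g"
proof -
  show "tn (c \<cdot> f) g = c \<cdot> tn f g"
    by (simp add: tn_def smul_def in_mult in_const mult.assoc)
  have "tn f (c \<cdot> g) = in1 f * (c \<cdot> in2 g)"
    by (simp add: tn_def smul_def in_mult in_const)
  then show "tn f (c \<cdot> g) = c \<cdot> tn f g" by (simp add: tn_def)
qed

lemma falg2_induct [case_names tn add]: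
  assumes "\<And>f g. P (tn f g)" "\<And>x y. P x \<Longrightarrow> P y \<Longrightarrow> P (x + y)"
  shows "P z"
proof (induction z rule: poly_mapping_add_induct)
  case (single w c)
  show ?case using assms(1)[of "single (fst w) c" "single (snd w) 1"] by (simp add: tn_single)
qed (rule assms(2))

abbreviation Dl :: "nat \<Rightarrow> falg \<Rightarrow> falg2" where "Dl \<equiv> coprod_free"

definition coprod_word :: "nat \<Rightarrow> (nat \<times> nat) fword \<Rightarrow> falg2" where
  "coprod_word N w = prod_list (map (\<lambda>(i, j). \<Sum>k\<in>{1..N}.
         single (FWord [(i, k)], FWord [(k, j)]) 1) (letters w))"

lemma Dl_alt: "Dl N = lin_ext (\<lambda>w c. kconst c * coprod_word N w)"
  by (rule ext) (simp add: coprod_free_def lin_ext_def coprod_word_def)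

lemma coprod_word_add: "coprod_word N (v + w) = coprod_word N v * coprod_word N w"
  by (simp add: coprod_word_def plus_fword_def)

lemma Dl_add: "Dl N (f + g) = Dl N f + Dl N g"
  unfolding Dl_alt by (rule lin_ext_add) (simp_all add: single_add distrib_right)

lemma Dl_mult: "Dl N (f * g) = Dl N f * Dl N g"
  unfolding Dl_alt
proof (rule lin_ext_mult)
  fix v w a b
  show "kconst (a * b) * coprod_word N (v + w) =
      kconst a * coprod_word N v * (kconst b * coprod_word N w)"
    unfolding coprod_word_add smul_def[symmetric] by (simp add: mult.commute)
qed (simp_all add: single_add distrib_right)

lemma Dl_const: "Dl N (kconst c) = kconst c"
  by (simp add: Dl_alt coprod_word_def)

lemma Dl_0 [simp]: "Dl N 0 = 0" and Dl_1: "Dl N 1 = 1"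
  using Dl_const[of N 0] Dl_const[of N 1] by simp_all

lemma Dl_minus: "Dl N (- f) = - Dl N f"
  using Dl_add[of N f "- f"] by (simp add: eq_neg_iff_add_eq_0 add.commute)

lemma Dl_diff: "Dl N (f - g) = Dl N f - Dl N g"
  using Dl_add[of N f "- g"] by (simp add: Dl_minus)

lemma Dl_sum: "Dl N (sum f A) = (\<Sum>i\<in>A. Dl N (f i))"
  by (rule additive_sum) (simp_all add: Dl_add)

lemma Dl_gen: "Dl N (ugen i j) = (\<Sum>k\<in>{1..N}. tn (ugen i k) (ugen k j))"
  by (simp add: Dl_alt ugen_def coprod_word_def tn_single)

lemma Dl_smul: "Dl N (c \<cdot> f) = c \<cdot> Dl N f"
  by (simp add: smul_def Dl_mult Dl_const)

lemma Dl_gen2: "Dl N (ugen a k * ugen b l) =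
    (\<Sum>m\<in>{1..N}. \<Sum>n\<in>{1..N}. tn (ugen a m * ugen b n) (ugen m k * ugen n l))"
  by (simp add: Dl_mult Dl_gen sum_product tn_mult)

lemma Dl_keys: "f \<in> fcar N \<Longrightarrow> (v, w) \<in> keys (Dl N f) \<Longrightarrow> good N v \<and> good N w"
proof -
  define Q :: "falg2 \<Rightarrow> bool" where "Q z \<longleftrightarrow> (\<forall>(v, w)\<in>keys z. good N v \<and> good N w)" for z
  have Qadd: "Q (y + z)" if "Q y" "Q z" for y z
    using that subsetD[OF keys_add, of _ y z] unfolding Q_def by blast
  have Qmult: "Q (y * z)" if yz: "Q y" "Q z" for y z
    unfolding Q_def
  proof clarify
    fix v w assume "(v, w) \<in> keys (y * z)"
    then obtain a b where "(v, w) = a + b" "a \<in> keys y" "b \<in> keys z"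
      using keys_mult[of y z] by blast
    then show "good N v \<and> good N w" using yz unfolding Q_def by (cases a; cases b) auto
  qed
  have Qsum: "Q (sum g A)" if "\<And>i. i \<in> A \<Longrightarrow> Q (g i)" for g :: "'i \<Rightarrow> falg2" and A
    using that by (induction A rule: infinite_finite_induct) (auto intro: Qadd simp: Q_def[of 0])
  have Qc: "Q (kconst c)" for c by (simp add: Q_def zero_prod_def)
  assume f: "f \<in> fcar N" and vg_wg: "(v, w) \<in> keys (Dl N f)"
  have "Q (coprod_word N x)" if "good N x" for x
  proof -
    have "Q (prod_list (map (\<lambda>(i, j). \<Sum>k\<in>{1..N}.
         single (FWord [(i, k)], FWord [(k, j)]) 1) xs))" if "set xs \<subseteq> {1..N} \<times> {1..N}" for xs
      using that
    proof (induction xs)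
      case Nil
      then show ?case using Qc[of 1] by simp
    next
      case (Cons x xs)
      then show ?case by (auto intro!: Qmult Qsum) (auto simp: Q_def good_def)
    qed
    then show ?thesis using that by (simp add: coprod_word_def good_def)
  qed
  then have "Q (Dl N f)"
    using f unfolding Dl_alt lin_ext_def fcar_iff by (auto intro!: Qsum Qmult Qc)
  then show ?thesis using vg_wg unfolding Q_def by blast
qed

subsection \<open>Relations in the tensor square\<close>

text \<open>The kernel of the projection from \<open>F \<otimes> F\<close> to the tensor square of the quotient.\<close>

inductive_set K2 :: "nat \<Rightarrow> complex \<Rightarrow> falg2 set" for N h where
  left: "ocl N h f = \<zero>\<^bsub>Oq N h\<^esub> \<Longrightarrow> tn f g \<in> K2 N h"
| right: "ocl N h g = \<zero>\<^bsub>Oq N h\<^esub> \<Longrightarrow> tn f g \<in> K2 N h"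
| add: "y \<in> K2 N h \<Longrightarrow> z \<in> K2 N h \<Longrightarrow> y + z \<in> K2 N h"

lemma ocl_0_mult:
  assumes "ocl N h f = \<zero>\<^bsub>Oq N h\<^esub>"
  shows "ocl N h (g * f) = \<zero>\<^bsub>Oq N h\<^esub>" "ocl N h (f * g) = \<zero>\<^bsub>Oq N h\<^esub>"
proof -
  interpret ring "Oq N h" by (rule ring_Oq)
  show "ocl N h (g * f) = \<zero>\<^bsub>Oq N h\<^esub>" "ocl N h (f * g) = \<zero>\<^bsub>Oq N h\<^esub>"
    by (simp_all add: ocl_mult assms)
qed

lemma K2_0: "0 \<in> K2 N h"
  using K2.left[of N h 0 0] ocl_0 by simp

lemma K2_mult_left: "z \<in> K2 N h \<Longrightarrow> y * z \<in> K2 N h"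
proof (induction y rule: falg2_induct)
  case (tn f g)
  then show ?case
    by (induction z rule: K2.induct)
      (simp_all add: tn_mult distrib_left K2.left K2.right K2.add ocl_0_mult)
qed (auto simp: distrib_right intro: K2.add)

lemma K2_mult_right: "z \<in> K2 N h \<Longrightarrow> z * y \<in> K2 N h"
proof (induction y rule: falg2_induct)
  case (tn f g)
  then show ?case
    by (induction z rule: K2.induct)
      (simp_all add: tn_mult distrib_right K2.left K2.right K2.add ocl_0_mult)
qed (auto simp: distrib_left intro: K2.add)

lemma K2_sum: "(\<And>i. i \<in> A \<Longrightarrow> f i \<in> K2 N h) \<Longrightarrow> sum f A \<in> K2 N h"
  by (induction A rule: infinite_finite_induct) (auto intro: K2.add K2_0)

lemma ocl_rels:
  assumes "i \<in> {1..N}" "j \<in> {1..N}"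
  shows "k \<in> {1..N} \<Longrightarrow> l \<in> {1..N} \<Longrightarrow> ocl N h (rel_RTT N h i j k l) = \<zero>\<^bsub>Oq N h\<^esub>"
    and "ocl N h (rel_C1 N h i j) = \<zero>\<^bsub>Oq N h\<^esub>" "ocl N h (rel_C2 N h i j) = \<zero>\<^bsub>Oq N h\<^esub>"
proof -
  show "ocl N h (rel_RTT N h i j k l) = \<zero>\<^bsub>Oq N h\<^esub>" if "k \<in> {1..N}" "l \<in> {1..N}"
    by (rule ocl_relator, rule UnI1, rule UnI1) (use assms that in \<open>simp del: atLeastAtMost_iff, fast\<close>)
  show "ocl N h (rel_C1 N h i j) = \<zero>\<^bsub>Oq N h\<^esub>"
    by (rule ocl_relator, rule UnI1, rule UnI2) (use assms in \<open>simp del: atLeastAtMost_iff, fast\<close>)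
  show "ocl N h (rel_C2 N h i j) = \<zero>\<^bsub>Oq N h\<^esub>"
    by (rule ocl_relator, rule UnI2) (use assms in \<open>simp del: atLeastAtMost_iff, fast\<close>)
qed

text \<open>Both sides of the relation \<open>\<hat>R(u \<otimes> u) = (u \<otimes> u)\<hat>R\<close>.\<close>

definition Ruu :: "nat \<Rightarrow> complex \<Rightarrow> nat \<Rightarrow> nat \<Rightarrow> nat \<Rightarrow> nat \<Rightarrow> falg" where
  "Ruu N h i j k l = (\<Sum>a\<in>{1..N}. \<Sum>b\<in>{1..N}. Rhat N h i j a b \<cdot> (ugen a k * ugen b l))"

definition uuR :: "nat \<Rightarrow> complex \<Rightarrow> nat \<Rightarrow> nat \<Rightarrow> nat \<Rightarrow> nat \<Rightarrow> falg" where
  "uuR N h i j k l = (\<Sum>a\<in>{1..N}. \<Sum>b\<in>{1..N}. Rhat N h a b k l \<cdot> (ugen i a * ugen j b))"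

lemma rel_RTT_alt: "rel_RTT N h i j k l = Ruu N h i j k l - uuR N h i j k l"
  by (simp add: rel_RTT_def Ruu_def uuR_def smul_def mult.assoc kconst_central)

lemma Dl_rel_RTT:
  assumes ij: "i \<in> {1..N}" "j \<in> {1..N}" and kl: "k \<in> {1..N}" "l \<in> {1..N}"
  shows "Dl N (rel_RTT N h i j k l) \<in> K2 N h"
proof -
  have DP: "Dl N (Ruu N h i j k l) = (\<Sum>m\<in>{1..N}. \<Sum>n\<in>{1..N}. tn (Ruu N h i j m n) (ugen m k * ugen n l))"
    by (simp add: Ruu_def Dl_sum Dl_smul Dl_gen2 smul_sum tn_sum_left) (rule sum4_swap)
  have DQ: "Dl N (uuR N h i j k l) = (\<Sum>m\<in>{1..N}. \<Sum>n\<in>{1..N}. tn (ugen i m * ugen j n) (uuR N h m n k l))"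
    by (simp add: uuR_def Dl_sum Dl_smul Dl_gen2 smul_sum tn_sum_right) (rule sum4_swap)
  have mid: "(\<Sum>m\<in>{1..N}. \<Sum>n\<in>{1..N}. tn (uuR N h i j m n) (ugen m k * ugen n l)) =
      (\<Sum>m\<in>{1..N}. \<Sum>n\<in>{1..N}. tn (ugen i m * ugen j n) (Ruu N h m n k l))"
    by (simp add: uuR_def Ruu_def tn_sum_left tn_sum_right) (rule sum4_swap)
  have "Dl N (rel_RTT N h i j k l) =
      (\<Sum>m\<in>{1..N}. \<Sum>n\<in>{1..N}. tn (rel_RTT N h i j m n) (ugen m k * ugen n l))
      + (\<Sum>m\<in>{1..N}. \<Sum>n\<in>{1..N}. tn (ugen i m * ugen j n) (rel_RTT N h m n k l))"
    unfolding rel_RTT_alt Dl_diff DP DQ by (simp add: tn_diff sum_subtractf mid)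
  also have "\<dots> \<in> K2 N h"
  proof (rule K2.add)
    show "(\<Sum>m\<in>{1..N}. \<Sum>n\<in>{1..N}. tn (rel_RTT N h i j m n) (ugen m k * ugen n l)) \<in> K2 N h"
      by (intro K2_sum K2.left ocl_rels ij)
    show "(\<Sum>m\<in>{1..N}. \<Sum>n\<in>{1..N}. tn (ugen i m * ugen j n) (rel_RTT N h m n k l)) \<in> K2 N h"
      by (intro K2_sum K2.right ocl_rels kl)
  qed
  finally show ?thesis .
qed

text \<open>The matrix \<open>u C u\<^sup>t\<close> equals \<open>C\<close> modulo the relations, and similarly \<open>u\<^sup>t C u\<close>.\<close>

definition uCut :: "nat \<Rightarrow> complex \<Rightarrow> nat \<Rightarrow> nat \<Rightarrow> falg" where
  "uCut N h i c = (\<Sum>a\<in>{1..N}. \<Sum>b\<in>{1..N}. Cmat N h a b \<cdot> (ugen i a * ugen c b))"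

definition utCu :: "nat \<Rightarrow> complex \<Rightarrow> nat \<Rightarrow> nat \<Rightarrow> falg" where
  "utCu N h a j = (\<Sum>b\<in>{1..N}. \<Sum>c\<in>{1..N}. Cmat N h b c \<cdot> (ugen b a * ugen c j))"

lemma rel_C1_alt: "rel_C1 N h i j =
    (\<Sum>c\<in>{1..N}. Cmat N h c j \<cdot> uCut N h i c) - of_bool (i = j) \<cdot> 1"
proof -
  have "rel_C1 N h i j = (\<Sum>a\<in>{1..N}. \<Sum>b\<in>{1..N}. \<Sum>c\<in>{1..N}.
        Cmat N h c j \<cdot> (Cmat N h a b \<cdot> (ugen i a * ugen c b))) - of_bool (i = j) \<cdot> 1"
    by (simp add: rel_C1_def kconst_smul mult.assoc mult.commute)
  also have "(\<Sum>a\<in>{1..N}. \<Sum>b\<in>{1..N}. \<Sum>c\<in>{1..N}.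
        Cmat N h c j \<cdot> (Cmat N h a b \<cdot> (ugen i a * ugen c b))) =
      (\<Sum>a\<in>{1..N}. \<Sum>c\<in>{1..N}. \<Sum>b\<in>{1..N}.
        Cmat N h c j \<cdot> (Cmat N h a b \<cdot> (ugen i a * ugen c b)))"
    by (rule sum.cong[OF refl]) (rule sum.swap)
  also have "\<dots> = (\<Sum>c\<in>{1..N}. \<Sum>a\<in>{1..N}. \<Sum>b\<in>{1..N}.
        Cmat N h c j \<cdot> (Cmat N h a b \<cdot> (ugen i a * ugen c b)))"
    by (rule sum.swap)
  finally show ?thesis by (simp add: uCut_def smul_sum)
qed

lemma rel_C2_alt: "rel_C2 N h i j =
    (\<Sum>a\<in>{1..N}. Cmat N h i a \<cdot> utCu N h a j) - of_bool (i = j) \<cdot> 1"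
  by (simp add: rel_C2_def utCu_def smul_sum kconst_smul mult.assoc mult.commute)

lemma Dl_uCut: "Dl N (uCut N h i c) =
    (\<Sum>m\<in>{1..N}. \<Sum>n\<in>{1..N}. tn (ugen i m * ugen c n) (uCut N h m n))"
  by (simp add: uCut_def Dl_sum Dl_smul Dl_gen2 smul_sum tn_sum_right) (rule sum4_swap)

lemma Dl_utCu: "Dl N (utCu N h a j) =
    (\<Sum>m\<in>{1..N}. \<Sum>n\<in>{1..N}. tn (utCu N h m n) (ugen m a * ugen n j))"
  by (simp add: utCu_def Dl_sum Dl_smul Dl_gen2 smul_sum tn_sum_left) (rule sum4_swap)

lemma ocl_cong:
  shows "ocl N h f = ocl N h f' \<Longrightarrow> ocl N h g = ocl N h g' \<Longrightarrow> ocl N h (f + g) = ocl N h (f' + g')"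
    and "ocl N h f = ocl N h f' \<Longrightarrow> ocl N h g = ocl N h g' \<Longrightarrow> ocl N h (f * g) = ocl N h (f' * g')"
    and "ocl N h f = ocl N h f' \<Longrightarrow> ocl N h (c \<cdot> f) = ocl N h (c \<cdot> f')"
  by (simp_all add: ocl_add ocl_mult smul_def)

lemma ocl_sum_cong:
  assumes "\<And>i. i \<in> A \<Longrightarrow> ocl N h (f i) = ocl N h (g i)"
  shows "ocl N h (sum f A) = ocl N h (sum g A)"
  using assms by (induction A rule: infinite_finite_induct) (simp_all add: ocl_add)

lemma ocl_rel_C:
  assumes "i \<in> {1..N}" "j \<in> {1..N}"
  shows "ocl N h (\<Sum>c\<in>{1..N}. Cmat N h c j \<cdot> uCut N h i c) = ocl N h (of_bool (i = j) \<cdot> 1)"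
    and "ocl N h (\<Sum>a\<in>{1..N}. Cmat N h i a \<cdot> utCu N h a j) = ocl N h (of_bool (i = j) \<cdot> 1)"
  unfolding ocl_eq_iff[of N h "sum _ _"] rel_C1_alt[symmetric] rel_C2_alt[symmetric]
  by (rule ocl_rels[OF assms])+

lemma sum_of_bool_smul:
  "finite A \<Longrightarrow> x \<in> A \<Longrightarrow> (\<Sum>i\<in>A. of_bool (i = x) \<cdot> F i) = F x"
  "finite A \<Longrightarrow> x \<in> A \<Longrightarrow> (\<Sum>i\<in>A. of_bool (x = i) \<cdot> F i) = F x"
  "finite A \<Longrightarrow> x \<in> A \<Longrightarrow> (\<Sum>i\<in>A. (c i * of_bool (i = x)) \<cdot> F i) = c x \<cdot> F x"
  "finite A \<Longrightarrow> x \<in> A \<Longrightarrow> (\<Sum>i\<in>A. (c i * of_bool (x = i)) \<cdot> F i) = c x \<cdot> F x"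
  by (simp_all add: of_bool_def smul_if if_distrib[of "\<lambda>x. _ * x"] cong: if_cong)

lemma ocl_uCut:
  assumes h: "h \<noteq> 0" and mn: "m \<in> {1..N}" "n \<in> {1..N}"
  shows "ocl N h (uCut N h m n) = ocl N h (Cmat N h m n \<cdot> 1)"
    and "ocl N h (utCu N h m n) = ocl N h (Cmat N h m n \<cdot> 1)"
proof -
  have "uCut N h m n = (\<Sum>c\<in>{1..N}. of_bool (c = n) \<cdot> uCut N h m c)"
    using mn by (simp only: sum_of_bool_smul finite_atLeastAtMost)
  also have "\<dots> = (\<Sum>c\<in>{1..N}. \<Sum>j\<in>{1..N}. Cmat N h j n \<cdot> Cmat N h c j \<cdot> uCut N h m c)"
    by (rule sum.cong[OF refl], subst Cmat_involutive[OF h, symmetric])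
      (use mn in \<open>simp_all only: sum_smul smul_simps mult.commute[of "Cmat _ _ _ n"]\<close>)
  also have "\<dots> = (\<Sum>j\<in>{1..N}. Cmat N h j n \<cdot> (\<Sum>c\<in>{1..N}. Cmat N h c j \<cdot> uCut N h m c))"
    by (subst sum.swap) (simp only: smul_sum)
  finally have "ocl N h (uCut N h m n) =
      ocl N h (\<Sum>j\<in>{1..N}. Cmat N h j n \<cdot> of_bool (m = j) \<cdot> 1)"
    by (simp only:) (intro ocl_sum_cong ocl_cong ocl_rel_C mn)
  also have "(\<Sum>j\<in>{1..N}. Cmat N h j n \<cdot> of_bool (m = j) \<cdot> 1) = (Cmat N h m n \<cdot> 1 :: falg)"
    using mn by (simp only: smul_simps sum_of_bool_smul finite_atLeastAtMost)
  finally show "ocl N h (uCut N h m n) = ocl N h (Cmat N h m n \<cdot> 1)" .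
  have "utCu N h m n = (\<Sum>c\<in>{1..N}. of_bool (m = c) \<cdot> utCu N h c n)"
    using mn by (simp only: sum_of_bool_smul finite_atLeastAtMost)
  also have "\<dots> = (\<Sum>c\<in>{1..N}. \<Sum>j\<in>{1..N}. Cmat N h m j \<cdot> Cmat N h j c \<cdot> utCu N h c n)"
    by (rule sum.cong[OF refl], subst Cmat_involutive[OF h, symmetric])
      (use mn in \<open>simp_all only: sum_smul smul_simps\<close>)
  also have "\<dots> = (\<Sum>j\<in>{1..N}. Cmat N h m j \<cdot> (\<Sum>c\<in>{1..N}. Cmat N h j c \<cdot> utCu N h c n))"
    by (subst sum.swap) (simp only: smul_sum)
  finally have "ocl N h (utCu N h m n) =
      ocl N h (\<Sum>j\<in>{1..N}. Cmat N h m j \<cdot> of_bool (j = n) \<cdot> 1)"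
    by (simp only:) (intro ocl_sum_cong ocl_cong ocl_rel_C mn)
  also have "(\<Sum>j\<in>{1..N}. Cmat N h m j \<cdot> of_bool (j = n) \<cdot> 1) = (Cmat N h m n \<cdot> 1 :: falg)"
    using mn by (simp only: smul_simps sum_of_bool_smul finite_atLeastAtMost)
  finally show "ocl N h (utCu N h m n) = ocl N h (Cmat N h m n \<cdot> 1)" .
qed

lemma Dl_rel_C1:
  assumes h: "h \<noteq> 0" and ij: "i \<in> {1..N}" "j \<in> {1..N}"
  shows "Dl N (rel_C1 N h i j) \<in> K2 N h"
proof -
  have 1: "Dl N (uCut N h i c) - tn (uCut N h i c) 1 \<in> K2 N h" for c
  proof -
    have "Dl N (uCut N h i c) - tn (uCut N h i c) 1 = (\<Sum>m\<in>{1..N}. \<Sum>n\<in>{1..N}.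
        tn (ugen i m * ugen c n) (uCut N h m n - Cmat N h m n \<cdot> 1))"
      unfolding Dl_uCut by (simp add: tn_diff sum_subtractf uCut_def[of N h i] tn_sum_left)
    also have "\<dots> \<in> K2 N h"
      using h by (intro K2_sum K2.right) (simp add: ocl_uCut flip: ocl_eq_iff)
    finally show ?thesis .
  qed
  have "Dl N (rel_C1 N h i j) =
     (\<Sum>c\<in>{1..N}. kconst (Cmat N h c j) * (Dl N (uCut N h i c) - tn (uCut N h i c) 1))
     + tn (rel_C1 N h i j) 1"
    unfolding rel_C1_alt smul_def[symmetric]
    by (simp add: Dl_diff Dl_sum Dl_smul Dl_1 tn_diff tn_sum_left smul_diff sum_subtractf tn_1_1)
  also have "\<dots> \<in> K2 N h"
    by (intro K2.add K2_sum K2_mult_left 1 K2.left ocl_rels ij)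
  finally show ?thesis .
qed

lemma Dl_rel_C2:
  assumes h: "h \<noteq> 0" and ij: "i \<in> {1..N}" "j \<in> {1..N}"
  shows "Dl N (rel_C2 N h i j) \<in> K2 N h"
proof -
  have 1: "Dl N (utCu N h a j) - tn 1 (utCu N h a j) \<in> K2 N h" for a
  proof -
    have "Dl N (utCu N h a j) - tn 1 (utCu N h a j) = (\<Sum>m\<in>{1..N}. \<Sum>n\<in>{1..N}.
        tn (utCu N h m n - Cmat N h m n \<cdot> 1) (ugen m a * ugen n j))"
      unfolding Dl_utCu by (simp add: tn_diff sum_subtractf utCu_def[of N h a] tn_sum_right)
    also have "\<dots> \<in> K2 N h"
      using h by (intro K2_sum K2.left) (simp add: ocl_uCut flip: ocl_eq_iff)
    finally show ?thesis .
  qed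
  have "Dl N (rel_C2 N h i j) =
     (\<Sum>a\<in>{1..N}. kconst (Cmat N h i a) * (Dl N (utCu N h a j) - tn 1 (utCu N h a j)))
     + tn 1 (rel_C2 N h i j)"
    unfolding rel_C2_alt smul_def[symmetric]
    by (simp add: Dl_diff Dl_sum Dl_smul Dl_1 tn_diff tn_sum_right smul_diff sum_subtractf tn_1_1)
  also have "\<dots> \<in> K2 N h"
    by (intro K2.add K2_sum K2_mult_left 1 K2.right ocl_rels ij)
  finally show ?thesis .
qed

lemma ocl_gen_bad:
  assumes "\<not> (a \<in> {1..N} \<and> b \<in> {1..N})"
  shows "ocl N h (ugen a b) = \<zero>\<^bsub>Oq N h\<^esub>"
proof -
  have "res N (ugen a b) = res N 0"
    unfolding res_gen if_not_P[OF assms] by (simp add: res_def)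
  then show ?thesis unfolding ocl_0[symmetric] by (simp add: ocl_def)
qed

text \<open>The relations span a coideal. For the quadratic relations this holds because \<open>\<Delta>\<close> is multiplicative
  on products of two matrix entries; for the orthogonality relations \<open>u C u\<^sup>t = C\<close> is used on both tensor
  factors.\<close>

theorem Dl_kernel:
  assumes h: "h \<noteq> 0" and f: "ocl N h f = \<zero>\<^bsub>Oq N h\<^esub>"
  shows "Dl N f \<in> K2 N h"
proof -
  have "f \<in> {f. Dl N f \<in> K2 N h}"
  proof (rule ocl_kernel_minimal[OF _ _ _ _ _ f])
    show "relators N h \<subseteq> {f. Dl N f \<in> K2 N h}"
      by (intro subsetI, elim UnE CollectE exE conjE)
        (simp_all del: atLeastAtMost_iff add: Dl_rel_RTT Dl_rel_C1[OF h] Dl_rel_C2[OF h])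
    fix i j assume ij: "\<not> (i \<in> {1..N} \<and> j \<in> {1..N})"
    have "tn (ugen i k) (ugen k j) \<in> K2 N h" for k
    proof (cases "i \<in> {1..N}")
      case True
      then show ?thesis using ij by (intro K2.right ocl_gen_bad) blast
    next
      case False
      then show ?thesis by (intro K2.left ocl_gen_bad) blast
    qed
    then show "ugen i j \<in> {f. Dl N f \<in> K2 N h}"
      by (simp add: Dl_gen K2_sum)
  qed (auto simp: Dl_add Dl_mult intro: K2.add K2_mult_left K2_mult_right)
  then show ?thesis by simp
qed

section \<open>Sweedler sums\<close>

definition bilin :: "(falg \<Rightarrow> falg \<Rightarrow> 'g::ab_group_add) \<Rightarrow> bool" where
  "bilin B \<longleftrightarrow> (\<forall>f f' g. B (f + f') g = B f g + B f' g) \<and> (\<forall>f g g'. B f (g + g') = B f g + B f g')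
    \<and> (\<forall>c f g. B (c \<cdot> f) g = B f (c \<cdot> g))"

lemma bilinI:
  assumes "\<And>f f' g. B (f + f') g = B f g + B f' g" "\<And>f g g'. B f (g + g') = B f g + B f g'"
    "\<And>c f g. B (c \<cdot> f) g = B f (c \<cdot> g)"
  shows "bilin B"
  using assms by (simp add: bilin_def)

lemma bilinD:
  assumes "bilin B"
  shows "B (f + f') g = B f g + B f' g" "B f (g + g') = B f g + B f g'"
    "B (c \<cdot> f) g = B f (c \<cdot> g)" "B 0 g = 0" "B f 0 = 0"
proof -
  show 1: "B (f + f') g = B f g + B f' g" "B f (g + g') = B f g + B f g'" "B (c \<cdot> f) g = B f (c \<cdot> g)"
    for f f' g g' c using assms by (simp_all add: bilin_def)
  show "B 0 g = 0" "B f 0 = 0" using 1(1)[of 0 0] 1(2)[of _ 0 0] by simp_all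
qed

text \<open>The linear map on \<open>F \<otimes> F\<close> induced by a bilinear map; applied to \<open>\<Delta>(f)\<close> it is a Sweedler sum.\<close>

definition blift :: "(falg \<Rightarrow> falg \<Rightarrow> 'g::ab_group_add) \<Rightarrow> falg2 \<Rightarrow> 'g" where
  "blift B = lin_ext (\<lambda>p c. B (single (fst p) c) (single (snd p) 1))"

lemma blift_add: "bilin B \<Longrightarrow> blift B (y + z) = blift B y + blift B z"
  unfolding blift_def by (rule lin_ext_add) (simp_all add: single_add bilinD)

lemma blift_0 [simp]: "blift B 0 = 0"
  by (simp add: blift_def)

lemma blift_sum: "bilin B \<Longrightarrow> blift B (sum f A) = (\<Sum>i\<in>A. blift B (f i))"
  by (rule additive_sum) (simp_all add: blift_add)

lemma blift_tn [simp]: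
  assumes B: "bilin B" shows "blift B (tn f g) = B f g"
proof (induction f rule: poly_mapping_add_induct)
  case (single v c)
  show ?case
  proof (induction g rule: poly_mapping_add_induct)
    case (single w d)
    have "blift B (tn (single v c) (single w d)) = B (single v (c * d)) (single w 1)"
      by (simp add: tn_single blift_def bilinD[OF B])
    also have "\<dots> = B (single v c) (single w d)"
      using bilinD(3)[OF B, of d "single v c" "single w 1"] by (simp add: smul_single mult.commute)
    finally show ?case .
  qed (simp add: tn_add_right blift_add B bilinD[OF B])
qed (simp add: tn_add_left blift_add B bilinD[OF B])

lemma blift_mult:
  fixes B :: "'i \<Rightarrow> 'i \<Rightarrow> falg \<Rightarrow> falg \<Rightarrow> 'r::ring"
  assumes B: "\<And>i k. bilin (B i k)"
    and m: "\<And>f f' g g'. B i k (f * f') (g * g') = (\<Sum>j\<in>I. B i j f g * B j k f' g')"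
  shows "blift (B i k) (y * z) = (\<Sum>j\<in>I. blift (B i j) y * blift (B j k) z)"
proof (induction y rule: falg2_induct)
  case (tn f g)
  show ?case
  proof (induction z rule: falg2_induct)
    case (tn f' g')
    show ?case by (simp add: tn_mult B m)
  qed (simp add: distrib_left blift_add B sum.distrib)
qed (simp add: distrib_right blift_add B sum.distrib)

lemma blift_K2:
  assumes B: "bilin B" and z: "z \<in> K2 N h"
    and "\<And>f g. ocl N h f = \<zero>\<^bsub>Oq N h\<^esub> \<Longrightarrow> B f g \<in> H" "\<And>f g. ocl N h g = \<zero>\<^bsub>Oq N h\<^esub> \<Longrightarrow> B f g \<in> H"
    and "\<And>x y. x \<in> H \<Longrightarrow> y \<in> H \<Longrightarrow> x + y \<in> H"
  shows "blift B z \<in> H"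
  using z by induction (simp_all add: blift_add B assms)

text \<open>Bilinear maps on the quotient with values in a group written multiplicatively, as needed for the
  coactions; \<open>glift\<close> is the counterpart of \<open>blift\<close> for them.\<close>

definition goodb :: "('g, 'm) monoid_scheme \<Rightarrow> nat \<Rightarrow> complex \<Rightarrow> (oq \<Rightarrow> oq \<Rightarrow> 'g) \<Rightarrow> bool" where
  "goodb G N h \<beta> \<longleftrightarrow>
    (\<forall>f g. \<beta> (ocl N h f) (ocl N h g) \<in> carrier G) \<and>
    (\<forall>f f' g. \<beta> (ocl N h (f + f')) (ocl N h g) = \<beta> (ocl N h f) (ocl N h g) \<otimes>\<^bsub>G\<^esub> \<beta> (ocl N h f') (ocl N h g)) \<and>
    (\<forall>f g g'. \<beta> (ocl N h f) (ocl N h (g + g')) = \<beta> (ocl N h f) (ocl N h g) \<otimes>\<^bsub>G\<^esub> \<beta> (ocl N h f) (ocl N h g')) \<and>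
    (\<forall>c f g. \<beta> (ocl N h (c \<cdot> f)) (ocl N h g) = \<beta> (ocl N h f) (ocl N h (c \<cdot> g)))"

lemma goodbI:
  assumes "\<And>f g. \<beta> (ocl N h f) (ocl N h g) \<in> carrier G"
    "\<And>f f' g. \<beta> (ocl N h (f + f')) (ocl N h g) = \<beta> (ocl N h f) (ocl N h g) \<otimes>\<^bsub>G\<^esub> \<beta> (ocl N h f') (ocl N h g)"
    "\<And>f g g'. \<beta> (ocl N h f) (ocl N h (g + g')) = \<beta> (ocl N h f) (ocl N h g) \<otimes>\<^bsub>G\<^esub> \<beta> (ocl N h f) (ocl N h g')"
    "\<And>c f g. \<beta> (ocl N h (c \<cdot> f)) (ocl N h g) = \<beta> (ocl N h f) (ocl N h (c \<cdot> g))"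
  shows "goodb G N h \<beta>"
  using assms by (simp add: goodb_def)

definition glift :: "('g, 'm) monoid_scheme \<Rightarrow> nat \<Rightarrow> complex \<Rightarrow> (oq \<Rightarrow> oq \<Rightarrow> 'g) \<Rightarrow> falg2 \<Rightarrow> 'g" where
  "glift G N h \<beta> z = finprod G
    (\<lambda>p. \<beta> (ocl N h (single (fst p) (lookup z p))) (ocl N h (single (snd p) 1))) (keys z)"

lemma rep_ocl:
  shows "rep (ocl N h f) \<in> fcar N" "ocl N h (rep (ocl N h f)) = ocl N h f"
proof -
  have "res N f \<in> ocl N h f"
    unfolding ocl_def cls_alt using Oq_ideal_props(1)[of N h] by force
  then have "rep (ocl N h f) \<in> ocl N h f" unfolding rep_def by (rule someI)
  then obtain g where g: "g \<in> Oq_ideal N h" "rep (ocl N h f) = g + res N f"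
    unfolding ocl_def cls_alt by blast
  then show c: "rep (ocl N h f) \<in> fcar N"
    using Oq_ideal_props(4)[of N h] res_closed[of N f] by (auto intro: fcar_add)
  show "ocl N h (rep (ocl N h f)) = ocl N h f"
    using g(1) by (subst ocl_id[OF c], subst g(2)) (simp add: ocl_def cls_eq_iff)
qed

lemma ocl_smul: "ocl N h (c \<cdot> f) = scal N h c \<otimes>\<^bsub>Oq N h\<^esub> ocl N h f"
  by (simp add: smul_def ocl_mult ocl_const)

lemma ocl_word: "good N w \<Longrightarrow> ocl N h (single w 1) = wcls N h w"
  "good N w \<Longrightarrow> ocl N h (single w c) = scal N h c \<otimes>\<^bsub>Oq N h\<^esub> wcls N h w"
proof -
  assume w: "good N w"
  then show 1: "ocl N h (single w 1) = wcls N h w"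
    by (simp add: wcls_def ocl_id fcar_iff)
  have "single w c = c \<cdot> single w 1" by (simp add: smul_single)
  then show "ocl N h (single w c) = scal N h c \<otimes>\<^bsub>Oq N h\<^esub> wcls N h w"
    by (simp only: ocl_smul 1)
qed

context
  fixes G :: "('g, 'm) monoid_scheme" and N :: nat and h :: complex and \<beta> :: "oq \<Rightarrow> oq \<Rightarrow> 'g"
  assumes G: "comm_group G" and \<beta>: "goodb G N h \<beta>"
begin

interpretation comm_group G by (rule G)

lemma goodbD:
  shows "\<beta> (ocl N h f) (ocl N h g) \<in> carrier G"
    "\<beta> (ocl N h (f + f')) (ocl N h g) = \<beta> (ocl N h f) (ocl N h g) \<otimes>\<^bsub>G\<^esub> \<beta> (ocl N h f') (ocl N h g)"
    "\<beta> (ocl N h f) (ocl N h (g + g')) = \<beta> (ocl N h f) (ocl N h g) \<otimes>\<^bsub>G\<^esub> \<beta> (ocl N h f) (ocl N h g')"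
    "\<beta> (ocl N h (c \<cdot> f)) (ocl N h g) = \<beta> (ocl N h f) (ocl N h (c \<cdot> g))"
    "\<beta> (ocl N h 0) (ocl N h g) = \<one>\<^bsub>G\<^esub>" "\<beta> (ocl N h f) (ocl N h 0) = \<one>\<^bsub>G\<^esub>"
proof -
  show c: "\<beta> (ocl N h f) (ocl N h g) \<in> carrier G" for f g using \<beta> by (simp add: goodb_def)
  show l: "\<beta> (ocl N h (f + f')) (ocl N h g) = \<beta> (ocl N h f) (ocl N h g) \<otimes>\<^bsub>G\<^esub> \<beta> (ocl N h f') (ocl N h g)"
    for f f' g using \<beta> by (simp add: goodb_def)
  show r: "\<beta> (ocl N h f) (ocl N h (g + g')) = \<beta> (ocl N h f) (ocl N h g) \<otimes>\<^bsub>G\<^esub> \<beta> (ocl N h f) (ocl N h g')"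
    for f g g' using \<beta> by (simp add: goodb_def)
  show "\<beta> (ocl N h (c \<cdot> f)) (ocl N h g) = \<beta> (ocl N h f) (ocl N h (c \<cdot> g))"
    using \<beta> by (simp add: goodb_def)
  show "\<beta> (ocl N h 0) (ocl N h g) = \<one>\<^bsub>G\<^esub>"
    using l[of 0 0 g] c[of 0 g] l_cancel_one' by force
  show "\<beta> (ocl N h f) (ocl N h 0) = \<one>\<^bsub>G\<^esub>"
    using r[of f 0 0] c[of f 0] l_cancel_one' by force
qed

lemma glift_closed: "glift G N h \<beta> z \<in> carrier G"
  unfolding glift_def by (intro finprod_closed) (simp add: goodbD)

lemma glift_superset:
  assumes "finite A" "keys z \<subseteq> A"
  shows "glift G N h \<beta> z = finprod G
    (\<lambda>p. \<beta> (ocl N h (single (fst p) (lookup z p))) (ocl N h (single (snd p) 1))) A"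
  unfolding glift_def using assms
  by (intro finprod_mono_neutral_cong_left) (auto simp: goodbD in_keys_iff)

lemma glift_add: "glift G N h \<beta> (y + z) = glift G N h \<beta> y \<otimes>\<^bsub>G\<^esub> glift G N h \<beta> z"
proof -
  let ?A = "keys y \<union> keys z"
  have "glift G N h \<beta> (y + z) = finprod G
    (\<lambda>p. \<beta> (ocl N h (single (fst p) (lookup (y + z) p))) (ocl N h (single (snd p) 1))) ?A"
    by (rule glift_superset) (simp_all add: keys_add)
  also have "\<dots> = finprod G (\<lambda>p. \<beta> (ocl N h (single (fst p) (lookup y p))) (ocl N h (single (snd p) 1))
      \<otimes>\<^bsub>G\<^esub> \<beta> (ocl N h (single (fst p) (lookup z p))) (ocl N h (single (snd p) 1))) ?A"
    by (intro finprod_cong) (simp_all add: lookup_add single_add goodbD)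
  also have "\<dots> = glift G N h \<beta> y \<otimes>\<^bsub>G\<^esub> glift G N h \<beta> z"
    by (subst finprod_multf) (simp_all add: goodbD glift_superset[of ?A y] glift_superset[of ?A z])
  finally show ?thesis .
qed

lemma glift_tn: "glift G N h \<beta> (tn f g) = \<beta> (ocl N h f) (ocl N h g)"
proof (induction f rule: poly_mapping_add_induct)
  case (single v c)
  show ?case
  proof (induction g rule: poly_mapping_add_induct)
    case (single w d)
    have "glift G N h \<beta> (tn (single v c) (single w d)) =
        \<beta> (ocl N h (single v (c * d))) (ocl N h (single w 1))"
      by (auto simp: tn_single glift_def goodbD)
    also have "\<dots> = \<beta> (ocl N h (single v c)) (ocl N h (single w d))"
      using goodbD(4)[of d "single v c" "single w 1"] by (simp add: smul_single mult.commute)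
    finally show ?case .
  qed (simp add: tn_add_right glift_add goodbD)
qed (simp add: tn_add_left glift_add goodbD)

lemma glift_K2: "z \<in> K2 N h \<Longrightarrow> glift G N h \<beta> z = \<one>\<^bsub>G\<^esub>"
  by (induction rule: K2.induct)
    (simp_all add: glift_tn glift_add, simp_all add: goodbD flip: ocl_0)

lemma glift_0: "glift G N h \<beta> 0 = \<one>\<^bsub>G\<^esub>"
  by (rule glift_K2[OF K2_0])

lemma glift_sum: "finite A \<Longrightarrow> glift G N h \<beta> (sum f A) = finprod G (\<lambda>i. glift G N h \<beta> (f i)) A"
  by (induction A rule: finite_induct) (simp_all add: glift_0 glift_add glift_closed)

text \<open>The Sweedler sum is formed with an arbitrary representative of the class of \<open>f\<close>. The result does
  not depend on it, because the coproduct of a relation lies in \<open>K2\<close>.\<close>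

lemma sweedler_glift:
  assumes h: "h \<noteq> 0"
  shows "sweedler G N h (ocl N h f) \<beta> = glift G N h \<beta> (Dl N f)"
proof -
  define f0 where "f0 = rep (ocl N h f)"
  have f0: "f0 \<in> fcar N" "ocl N h f0 = ocl N h f" by (simp_all add: f0_def rep_ocl)
  have "sweedler G N h (ocl N h f) \<beta> = glift G N h \<beta> (Dl N f0)"
    unfolding sweedler_def glift_def coprod_def f0_def[symmetric]
  proof (rule finprod_cong'[OF refl])
    fix p assume "p \<in> keys (Dl N f0)"
    then have "good N (fst p)" "good N (snd p)" using Dl_keys[OF f0(1), of "fst p" "snd p"] by auto
    then show "(case p of (v, w) \<Rightarrow> \<beta> (scal N h (lookup (Dl N f0) (v, w)) \<otimes>\<^bsub>Oq N h\<^esub> wcls N h v) (wcls N h w))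
        = \<beta> (ocl N h (single (fst p) (lookup (Dl N f0) p))) (ocl N h (single (snd p) 1))"
      by (simp add: case_prod_unfold ocl_word(1) ocl_word(2)[of N "fst p"])
  qed (simp_all add: goodbD)
  also have "\<dots> = glift G N h \<beta> (Dl N f + Dl N (f0 - f))"
    by (simp add: Dl_diff)
  also have "\<dots> = glift G N h \<beta> (Dl N f)"
    using glift_K2[OF Dl_kernel[OF h]] f0(2) by (simp add: glift_add glift_closed ocl_eq_iff)
  finally show ?thesis .
qed

end

lemma sweedler_A_blift:
  assumes h: "h \<noteq> 0" and B: "bilin B" and \<beta>: "\<And>x y. \<beta> (ocl N h x) (ocl N h y) = ocl N h (B x y)"
  shows "sweedler_A N h (ocl N h f) \<beta> = ocl N h (blift B (Dl N f))"
proof -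
  define G where "G = add_monoid (Oq N h)"
  have G: "comm_group G"
    unfolding G_def using ring_Oq[of N h] abelian_group.a_comm_group ring_def by blast
  have m: "x \<otimes>\<^bsub>G\<^esub> y = x \<oplus>\<^bsub>Oq N h\<^esub> y" "carrier G = carrier (Oq N h)" for x y
    by (simp_all add: G_def)
  have good: "goodb G N h \<beta>"
    by (rule goodbI) (simp_all add: \<beta> bilinD(1,2)[OF B] bilinD(3)[OF B] m flip: ocl_add)
  have "glift G N h \<beta> z = ocl N h (blift B z)" for z
    by (induction z rule: falg2_induct)
      (simp_all add: glift_tn[OF G good] \<beta> B glift_add[OF G good] blift_add ocl_add m)
  then show ?thesis unfolding G_def[symmetric] by (simp add: sweedler_glift[OF G good h])
qed

lemma sweedler_C_blift:
  assumes h: "h \<noteq> 0" and B: "bilin B" and \<beta>: "\<And>x y. \<beta> (ocl N h x) (ocl N h y) = B x y"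
    and s: "\<And>c x y. B (c \<cdot> x) y = c * B x y"
  shows "sweedler_C N h (ocl N h f) \<beta> = blift B (Dl N f)"
proof -
  define f0 where "f0 = rep (ocl N h f)"
  have f0: "f0 \<in> fcar N" "ocl N h f0 = ocl N h f" by (simp_all add: f0_def rep_ocl)
  have "sweedler_C N h (ocl N h f) \<beta> = blift B (Dl N f0)"
    unfolding sweedler_C_def blift_def lin_ext_def coprod_def f0_def[symmetric]
  proof (rule sum.cong[OF refl])
    fix p assume "p \<in> keys (Dl N f0)"
    then have "good N (fst p)" "good N (snd p)" using Dl_keys[OF f0(1), of "fst p" "snd p"] by auto
    moreover have "single (fst p) (lookup (Dl N f0) p) = lookup (Dl N f0) p \<cdot> single (fst p) 1"
      by (simp add: smul_single)
    ultimately show "(case p of (v, w) \<Rightarrow> lookup (Dl N f0) (v, w) * \<beta> (wcls N h v) (wcls N h w))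
        = B (single (fst p) (lookup (Dl N f0) p)) (single (snd p) 1)"
      by (simp only: s) (simp add: case_prod_unfold \<beta> flip: ocl_word)
  qed
  also have 1: "\<dots> = blift B (Dl N f) + blift B (Dl N (f0 - f))"
    by (simp add: Dl_diff B flip: blift_add)
  have "blift B (Dl N (f0 - f)) \<in> {0}"
  proof (rule blift_K2[OF B Dl_kernel[OF h]])
    show "ocl N h (f0 - f) = \<zero>\<^bsub>Oq N h\<^esub>" using f0(2) by (simp add: ocl_eq_iff)
    show "B x y \<in> {0}" if "ocl N h x = \<zero>\<^bsub>Oq N h\<^esub>" for x y
      using \<beta>[of x y] \<beta>[of 0 y] that by (simp add: ocl_0 bilinD[OF B])
    show "B x y \<in> {0}" if "ocl N h y = \<zero>\<^bsub>Oq N h\<^esub>" for x y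
      using \<beta>[of x y] \<beta>[of x 0] that by (simp add: ocl_0 bilinD[OF B])
  qed simp
  with 1 have "blift B (Dl N f0) = blift B (Dl N f)" by simp
  finally show ?thesis .
qed

section \<open>The characters\<close>

definition chr :: "nat \<Rightarrow> complex \<Rightarrow> falg \<Rightarrow> complex" where
  "chr N s = lin_ext (\<lambda>w c. c * prod_list (map (\<lambda>(i, j). s * of_bool (i = j \<and> i \<in> {1..N})) (letters w)))"

lemma chr_add: "chr N s (f + g) = chr N s f + chr N s g"
  unfolding chr_def by (rule lin_ext_add) (simp_all add: distrib_right)

lemma chr_mult: "chr N s (f * g) = chr N s f * chr N s g"
  unfolding chr_def by (rule lin_ext_mult) (simp_all add: distrib_right plus_fword_def)

lemma chr_const: "chr N s (kconst c) = c"
  by (simp add: chr_def)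

lemma chr_0 [simp]: "chr N s 0 = 0" and chr_1 [simp]: "chr N s 1 = 1"
  using chr_const[of N s 0] chr_const[of N s 1] by simp_all

lemma chr_smul [simp]: "chr N s (c \<cdot> f) = c * chr N s f"
  by (simp add: smul_def chr_mult chr_const)

lemma chr_gen: "chr N s (ugen i j) = s * of_bool (i = j \<and> i \<in> {1..N})"
  by (simp add: chr_def ugen_def)

lemma chr_sum: "chr N s (sum f A) = (\<Sum>i\<in>A. chr N s (f i))"
  by (rule additive_sum) (simp_all add: chr_add)

lemma chr_diff: "chr N s (f - g) = chr N s f - chr N s g"
  using chr_add[of N s "f - g" g] by simp

lemma sum_of_bool_conj:
  fixes F :: "nat \<Rightarrow> complex"
  assumes "finite A"
  shows "(\<Sum>i\<in>A. F i * of_bool (i = x)) = (if x \<in> A then F x else 0)"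
    "(\<Sum>i\<in>A. F i * of_bool (x = i)) = (if x \<in> A then F x else 0)"
    "(\<Sum>i\<in>A. of_bool (i = x) * F i) = (if x \<in> A then F x else 0)"
    "(\<Sum>i\<in>A. of_bool (x = i) * F i) = (if x \<in> A then F x else 0)"
  using assms by (simp_all add: of_bool_def if_distrib[of "\<lambda>x. _ * x"] if_distrib[of "\<lambda>x. x * _"] cong: if_cong)

lemma sum2_of_bool:
  fixes F :: "nat \<Rightarrow> nat \<Rightarrow> complex"
  assumes "finite A" "k \<in> A" "l \<in> A"
  shows "(\<Sum>a\<in>A. \<Sum>b\<in>A. F a b * (of_bool (a = k) * of_bool (b = l))) = F k l"
proof -
  have "(\<Sum>a\<in>A. \<Sum>b\<in>A. F a b * (of_bool (a = k) * of_bool (b = l))) =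
      (\<Sum>a\<in>A. \<Sum>b\<in>A. if b = l then (if a = k then F a l else 0) else 0)"
    by (intro sum.cong refl) auto
  then show ?thesis using assms by simp
qed

text \<open>The character respects the relations: the quadratic ones hold for any scalar matrix, and the
  orthogonality relations for \<open>s\<close> times the identity because \<open>s\<^sup>2 = 1\<close>.\<close>

lemma chr_kernel:
  assumes h: "h \<noteq> 0" and s: "s * s = 1" and f: "ocl N h f = \<zero>\<^bsub>Oq N h\<^esub>"
  shows "chr N s f = 0"
proof -
  have g: "chr N s (ugen a k * ugen b l) = of_bool (a = k) * of_bool (b = l)"
    if "k \<in> {1..N} \<or> a \<in> {1..N}" "l \<in> {1..N} \<or> b \<in> {1..N}" for a k b l
    using that s by (auto simp: chr_mult chr_gen of_bool_def)
  have "f \<in> {f. chr N s f = 0}"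
  proof (rule ocl_kernel_minimal[OF _ _ _ _ _ f])
    have c1: "chr N s (Ruu N h i j k l) = Rhat N h i j k l"
      if "k \<in> {1..N}" "l \<in> {1..N}" for i j k l
      unfolding Ruu_def chr_sum chr_smul
      by (subst sum2_of_bool[OF finite_atLeastAtMost that, symmetric], intro sum.cong refl)
        (simp only: g simp_thms)
    have c2: "chr N s (uuR N h i j k l) = Rhat N h i j k l"
      if "i \<in> {1..N}" "j \<in> {1..N}" for i j k l
      unfolding uuR_def chr_sum chr_smul
      by (subst sum2_of_bool[OF finite_atLeastAtMost that, symmetric], intro sum.cong refl)
        (simp only: g simp_thms eq_commute)
    have 1: "chr N s (rel_RTT N h i j k l) = 0" if "{i, j, k, l} \<subseteq> {1..N}" for i j k l
      using that by (simp add: rel_RTT_alt chr_diff c1 c2 del: atLeastAtMost_iff)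
    have c: "chr N s (uCut N h i j) = Cmat N h i j" "chr N s (utCu N h i j) = Cmat N h i j"
      if "i \<in> {1..N}" "j \<in> {1..N}" for i j
      unfolding uCut_def utCu_def chr_sum chr_smul
      by (subst sum2_of_bool[OF finite_atLeastAtMost that, symmetric], intro sum.cong refl,
        simp only: g simp_thms eq_commute)+
    have 2: "chr N s (rel_C1 N h i j) = 0" "chr N s (rel_C2 N h i j) = 0" if "{i, j} \<subseteq> {1..N}" for i j
      using that Cmat_involutive[OF h, of i N j]
      by (simp_all add: rel_C1_alt rel_C2_alt chr_diff chr_sum c mult.commute del: atLeastAtMost_iff)
    show "relators N h \<subseteq> {f. chr N s f = 0}"
      by (intro subsetI, elim UnE CollectE exE conjE)
        (simp_all only: mem_Collect_eq 1 2)
  qed (auto simp: chr_add chr_mult chr_gen)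
  then show ?thesis by simp
qed

lemma chi_chr:
  assumes h: "h \<noteq> 0" and s: "s * s = 1"
  shows "chi s (ocl N h f) = chr N s f"
proof -
  define f0 where "f0 = rep (ocl N h f)"
  have f0: "f0 \<in> fcar N" "ocl N h f0 = ocl N h f" by (simp_all add: f0_def rep_ocl)
  have "chi s (ocl N h f) = chr N s f0"
    unfolding chi_def chr_def lin_ext_def f0_def[symmetric]
  proof (rule sum.cong[OF refl])
    fix w assume "w \<in> keys f0"
    then have "good N w" using f0(1) by (simp add: fcar_iff)
    then have "map (\<lambda>(i, j). s * of_bool (i = j)) (letters w) =
        map (\<lambda>(i, j). s * of_bool (i = j \<and> i \<in> {1..N})) (letters w)"
      by (intro map_cong) (auto simp: good_def)
    then show "lookup f0 w * prod_list (map (\<lambda>(i, j). s * of_bool (i = j)) (letters w)) =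
      lookup f0 w * prod_list (map (\<lambda>(i, j). s * of_bool (i = j \<and> i \<in> {1..N})) (letters w))"
      by (simp only:)
  qed
  also have "\<dots> = chr N s f"
    using chr_kernel[OF h s, where f = "f0 - f"] f0(2) by (simp add: chr_diff ocl_eq_iff)
  finally show ?thesis .
qed

lemma counit_left:
  assumes h: "h \<noteq> 0"
  shows "ocl N h (blift (\<lambda>x y. chr N 1 x \<cdot> y) (Dl N f)) = ocl N h f"
    and "ocl N h (blift (\<lambda>x y. chr N 1 y \<cdot> x) (Dl N f)) = ocl N h f"
proof -
  let ?B = "\<lambda>x y. chr N 1 x \<cdot> y" and ?C = "\<lambda>x y. chr N 1 y \<cdot> x"
  have B: "bilin ?B" "bilin ?C"
    by (rule bilinI; simp add: chr_add add_smul smul_add mult.commute)+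
  have m: "blift ?B (y * z) = blift ?B y * blift ?B z" "blift ?C (y * z) = blift ?C y * blift ?C z" for y z
    using blift_mult[of "\<lambda>_ _. ?B" "()" "()" "{()}" y z] blift_mult[of "\<lambda>_ _. ?C" "()" "()" "{()}" y z]
    by (simp_all add: B chr_mult mult.commute)
  have gB: "ocl N h (\<Sum>k\<in>{1..N}. of_bool (i = k) \<cdot> ugen k j) = ocl N h (ugen i j)" for i j
  proof (cases "i \<in> {1..N}")
    case False
    then have "(\<Sum>k\<in>{1..N}. of_bool (i = k) \<cdot> ugen k j) = 0"
      by (intro sum.neutral) (auto simp: of_bool_def)
    then show ?thesis using False by (subst ocl_gen_bad[of i]) (simp_all add: ocl_0 del: atLeastAtMost_iff)
  qed (simp only: sum_of_bool_smul finite_atLeastAtMost)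
  have gC: "ocl N h (\<Sum>k\<in>{1..N}. of_bool (k = j) \<cdot> ugen i k) = ocl N h (ugen i j)" for i j
  proof (cases "j \<in> {1..N}")
    case False
    then have "(\<Sum>k\<in>{1..N}. of_bool (k = j) \<cdot> ugen i k) = 0"
      by (intro sum.neutral) (auto simp: of_bool_def)
    then show ?thesis using False by (subst ocl_gen_bad[of i]) (simp_all add: ocl_0 del: atLeastAtMost_iff)
  qed (simp only: sum_of_bool_smul finite_atLeastAtMost)
  have k: "Dl N (kconst c) = tn (c \<cdot> 1) 1" for c
    by (simp add: Dl_smul Dl_1 kconst_smul tn_1_1)
  show "ocl N h (blift ?B (Dl N f)) = ocl N h f"
  proof (induction f rule: falg_induct)
    case (const c)
    show ?case unfolding k blift_tn[OF B(1)] by (simp add: kconst_smul)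
  next
    case (gen i j)
    have "blift ?B (Dl N (ugen i j)) = (\<Sum>k\<in>{1..N}. of_bool (i = k) \<cdot> ugen k j)"
      unfolding Dl_gen blift_sum[OF B(1)] by (intro sum.cong refl) (auto simp: B chr_gen of_bool_def)
    then show ?case using gB by simp
  qed (simp_all add: Dl_add Dl_mult blift_add B m ocl_add ocl_mult)
  show "ocl N h (blift ?C (Dl N f)) = ocl N h f"
  proof (induction f rule: falg_induct)
    case (const c)
    show ?case unfolding k blift_tn[OF B(2)] by (simp add: kconst_smul)
  next
    case (gen i j)
    have "blift ?C (Dl N (ugen i j)) = (\<Sum>k\<in>{1..N}. of_bool (k = j) \<cdot> ugen i k)"
      unfolding Dl_gen blift_sum[OF B(2)] by (intro sum.cong refl) (auto simp: B chr_gen of_bool_def)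
    then show ?case using gC by simp
  qed (simp_all add: Dl_add Dl_mult blift_add B m ocl_add ocl_mult)
qed

section \<open>The structure functionals of the bimodule\<close>

abbreviation Id2 :: "nat \<Rightarrow> (nat \<times> nat) set" where "Id2 N \<equiv> {1..N} \<times> {1..N}"

lemma sum_Id2: "(\<Sum>I\<in>Id2 N. f I) = (\<Sum>i\<in>{1..N}. \<Sum>j\<in>{1..N}. f (i, j))"
  by (simp add: sum.cartesian_product)

text \<open>Applied to the matrix \<open>r(u, 1)\<close>, which is idempotent since \<open>1 \<cdot> 1 = 1\<close> and has a right inverse because
  the r-form is invertible for the convolution; this fixes the values of the r-form on the unit.\<close>

lemma idempotent_right_inverse:
  fixes E E' :: "nat \<Rightarrow> nat \<Rightarrow> complex"
  assumes idem: "\<And>k i. E k i = (\<Sum>m\<in>{1..N}. E k m * E m i)"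
    and inv: "\<And>k i. k \<in> {1..N} \<Longrightarrow> i \<in> {1..N} \<Longrightarrow> (\<Sum>m\<in>{1..N}. E k m * E' m i) = of_bool (k = i)"
    and ki: "k \<in> {1..N}" "i \<in> {1..N}"
  shows "E k i = of_bool (k = i)"
proof -
  have "E k i = (\<Sum>j\<in>{1..N}. E k j * of_bool (j = i))"
    using ki by (subst sum_of_bool_conj) auto
  also have "\<dots> = (\<Sum>j\<in>{1..N}. E k j * (\<Sum>m\<in>{1..N}. E j m * E' m i))"
    by (intro sum.cong refl) (simp only: inv ki(2))
  also have "\<dots> = (\<Sum>m\<in>{1..N}. (\<Sum>j\<in>{1..N}. E k j * E j m) * E' m i)"
    by (simp add: sum_distrib_left sum_distrib_right mult.assoc) (rule sum.swap)
  also have "\<dots> = of_bool (k = i)"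
    unfolding idem[symmetric] by (rule inv[OF ki])
  finally show ?thesis .
qed

locale rform =
  fixes N :: nat and h s :: complex and r :: "oq \<Rightarrow> oq \<Rightarrow> complex"
  assumes h0: "h \<noteq> 0" and s2: "s * s = 1" and U: "universal_r_form N h r"
    and rR: "\<And>a b c d. {a, b, c, d} \<subseteq> {1..N} \<Longrightarrow> r (ucls N h a b) (ucls N h c d) = Rmat N h a c b d"
begin

abbreviation "qc \<equiv> ocl N h"
abbreviation "A \<equiv> Oq N h"

definition rh :: "falg \<Rightarrow> falg \<Rightarrow> complex" where "rh f g = r (qc f) (qc g)"

lemma bilinear_formD:
  assumes "bilinear_form N h b"
  shows "b (qc (f + f')) (qc g) = b (qc f) (qc g) + b (qc f') (qc g)"
    "b (qc f) (qc (g + g')) = b (qc f) (qc g) + b (qc f) (qc g')"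
    "b (qc (c \<cdot> f)) (qc g) = c * b (qc f) (qc g)" "b (qc f) (qc (c \<cdot> g)) = c * b (qc f) (qc g)"
proof -
  note D = spec[OF bspec[OF bspec[OF bspec[OF assms[unfolded bilinear_form_def] ocl_closed] ocl_closed] ocl_closed]]
  show "b (qc (f + f')) (qc g) = b (qc f) (qc g) + b (qc f') (qc g)"
    unfolding ocl_add by (rule D[THEN conjunct1])
  show "b (qc f) (qc (g + g')) = b (qc f) (qc g) + b (qc f) (qc g')"
    unfolding ocl_add by (rule D[THEN conjunct2, THEN conjunct1])
  show "b (qc (c \<cdot> f)) (qc g) = c * b (qc f) (qc g)"
    unfolding ocl_smul by (rule D[THEN conjunct2, THEN conjunct2, THEN conjunct1])
  show "b (qc f) (qc (c \<cdot> g)) = c * b (qc f) (qc g)"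
    unfolding ocl_smul by (rule D[THEN conjunct2, THEN conjunct2, THEN conjunct2])
qed

lemma r_bilinear: "bilinear_form N h r"
  using U by (simp add: universal_r_form_def)

lemma rh_simps:
  "rh (f + f') g = rh f g + rh f' g" "rh f (g + g') = rh f g + rh f g'"
  "rh (c \<cdot> f) g = c * rh f g" "rh f (c \<cdot> g) = c * rh f g"
  by (simp_all add: rh_def bilinear_formD[OF r_bilinear])

lemma rh_mult:
  "rh (f * g) w = blift (\<lambda>x y. rh f x * rh g y) (Dl N w)"
  "rh f (g * w) = blift (\<lambda>x y. rh x w * rh y g) (Dl N f)"
proof -
  note M = bspec[OF bspec[OF bspec[OF U[unfolded universal_r_form_def, THEN conjunct2, THEN conjunct2,
    THEN conjunct1] ocl_closed] ocl_closed] ocl_closed]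
  have "rh (f * g) w = sweedler_C N h (qc w) (\<lambda>c1 c2. r (qc f) c1 * r (qc g) c2)"
    unfolding rh_def ocl_mult by (rule M[THEN conjunct1])
  also have "\<dots> = blift (\<lambda>x y. rh f x * rh g y) (Dl N w)"
    by (rule sweedler_C_blift[OF h0]) (auto intro!: bilinI simp: rh_simps distrib_left distrib_right, simp add: rh_def)
  finally show "rh (f * g) w = blift (\<lambda>x y. rh f x * rh g y) (Dl N w)" .
  have "rh f (g * w) = sweedler_C N h (qc f) (\<lambda>c1 c2. r c1 (qc w) * r c2 (qc g))"
    unfolding rh_def ocl_mult by (rule M[THEN conjunct2])
  also have "\<dots> = blift (\<lambda>x y. rh x w * rh y g) (Dl N f)"
    by (rule sweedler_C_blift[OF h0]) (auto intro!: bilinI simp: rh_simps distrib_left distrib_right, simp add: rh_def)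
  finally show "rh f (g * w) = blift (\<lambda>x y. rh x w * rh y g) (Dl N f)" .
qed

lemma bilin_rh: "bilin (\<lambda>x y. rh f x * rh g y)" "bilin (\<lambda>x y. rh x f * rh y g)"
  "bilin (\<lambda>x y. rh f x * rh y g)"
  by (rule bilinI; simp add: rh_simps distrib_left distrib_right)+

text \<open>On matrix coefficients the r-form is a matrix representation in one argument and an
  antirepresentation in the other.\<close>

lemma rh_gen_mult:
  "rh (ugen k i) (f * g) = (\<Sum>m\<in>{1..N}. rh (ugen k m) g * rh (ugen m i) f)"
  "rh (f * g) (ugen j l) = (\<Sum>m\<in>{1..N}. rh f (ugen j m) * rh g (ugen m l))"
  by (simp_all add: rh_mult Dl_gen blift_sum bilin_rh)

lemma rh_unit:
  assumes ki: "k \<in> {1..N}" "i \<in> {1..N}"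
  shows "rh (ugen k i) 1 = of_bool (k = i)" "rh 1 (ugen k i) = of_bool (k = i)"
proof -
  obtain r' where r'0: "bilinear_form N h r' \<and> (\<forall>a\<in>carrier A. \<forall>b\<in>carrier A.
        sweedler_C N h a (\<lambda>a1 a2. sweedler_C N h b (\<lambda>b1 b2. r a1 b1 * r' a2 b2))
          = counit a * counit b \<and>
        sweedler_C N h a (\<lambda>a1 a2. sweedler_C N h b (\<lambda>b1 b2. r' a1 b1 * r a2 b2))
          = counit a * counit b)"
    using U[unfolded universal_r_form_def, THEN conjunct2, THEN conjunct1] by (rule exE)
  note r' = r'0[THEN conjunct1]
  note conv = bspec[OF bspec[OF r'0[THEN conjunct2] ocl_closed] ocl_closed, THEN conjunct1]
  define rh' where "rh' f g = r' (qc f) (qc g)" for f g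
  have s': "rh' (f + f') g = rh' f g + rh' f' g" "rh' f (g + g') = rh' f g + rh' f g'"
    "rh' (c \<cdot> f) g = c * rh' f g" "rh' f (c \<cdot> g) = c * rh' f g" for f f' g g' c
    by (simp_all add: rh'_def bilinear_formD[OF r'])
  have b1: "bilin (\<lambda>p q. rh x p * rh' y q)" for x y
    by (rule bilinI) (simp_all add: rh_simps s' distrib_left distrib_right)
  have b2: "bilin (\<lambda>p q. rh p x * rh' q y)" for x y
    by (rule bilinI) (simp_all add: rh_simps s' distrib_left distrib_right)
  have inner: "sweedler_C N h (qc g) (\<lambda>b1 b2. r (qc x) b1 * r' (qc y) b2) =
      blift (\<lambda>p q. rh x p * rh' y q) (Dl N g)" for g x y
    by (rule sweedler_C_blift[OF h0 b1]) (simp_all add: rh_def rh'_def rh_simps[unfolded rh_def] bilinear_formD[OF r_bilinear])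
  have D1: "Dl N 1 = tn 1 1" by (simp add: Dl_1 tn_1_1)
  have c1: "(\<Sum>m\<in>{1..N}. rh (ugen k m) 1 * rh' (ugen m i) 1) = of_bool (k = i)"
    if "k \<in> {1..N}" "i \<in> {1..N}" for k i
  proof -
    have "sweedler_C N h (qc (ugen k i)) (\<lambda>a1 a2. sweedler_C N h (qc 1) (\<lambda>b1 b2. r a1 b1 * r' a2 b2))
        = blift (\<lambda>x y. rh x 1 * rh' y 1) (Dl N (ugen k i))"
      by (rule sweedler_C_blift[OF h0 b2]) (simp_all add: inner D1 b1 rh_simps)
    then show ?thesis
      using conv[of "ugen k i" 1] that
      by (simp add: chi_chr[OF h0] chr_gen Dl_gen blift_sum b2 del: atLeastAtMost_iff)
  qed
  show "rh (ugen k i) 1 = of_bool (k = i)"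
    by (rule idempotent_right_inverse[where E = "\<lambda>k i. rh (ugen k i) 1",
      OF rh_gen_mult(1)[of _ _ 1 1, unfolded mult_1_left] c1 ki])
  have c2: "(\<Sum>m\<in>{1..N}. rh 1 (ugen k m) * rh' 1 (ugen m i)) = of_bool (k = i)"
    if "k \<in> {1..N}" "i \<in> {1..N}" for k i
  proof -
    let ?B = "\<lambda>x y. \<Sum>m\<in>{1..N}. rh x (ugen k m) * rh' y (ugen m i)"
    have bb: "bilin ?B"
      by (rule bilinI) (simp_all add: rh_simps s' distrib_left distrib_right sum.distrib mult_ac)
    have val: "blift (\<lambda>p q. rh x p * rh' y q) (Dl N (ugen k i)) = ?B x y" for x y
      by (simp add: Dl_gen blift_sum b1)
    have "sweedler_C N h (qc 1) (\<lambda>a1 a2. sweedler_C N h (qc (ugen k i)) (\<lambda>b1 b2. r a1 b1 * r' a2 b2))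
        = blift ?B (Dl N 1)"
      by (rule sweedler_C_blift[OF h0 bb])
        (simp_all add: inner val rh_simps sum_distrib_left mult.assoc)
    then show ?thesis
      using conv[of 1 "ugen k i"] that
      by (simp add: chi_chr[OF h0] chr_gen D1 bb del: atLeastAtMost_iff)
  qed
  show "rh 1 (ugen k i) = of_bool (k = i)"
    by (rule idempotent_right_inverse[where E = "\<lambda>k i. rh 1 (ugen k i)",
      OF rh_gen_mult(2)[of 1 1, unfolded mult_1_left] c2 ki])
qed

lemma rh_gen: "a \<in> {1..N} \<Longrightarrow> b \<in> {1..N} \<Longrightarrow> c \<in> {1..N} \<Longrightarrow> d \<in> {1..N} \<Longrightarrow>
    rh (ugen a b) (ugen c d) = Rmat N h a c b d"
  using rR[of a b c d] by (simp add: rh_def ocl_gen)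

definition Gf :: "nat \<times> nat \<Rightarrow> nat \<times> nat \<Rightarrow> falg \<Rightarrow> complex" where
  "Gf I K f = blift (\<lambda>x y. rh (ugen (fst K) (fst I)) x * rh y (ugen (snd I) (snd K))) (Dl N f)"

text \<open>The functionals with \<open>\<theta>\<^sub>I a = \<Sum> a\<^sub>(\<^sub>1\<^sub>) F\<^sub>I\<^sub>K(a\<^sub>(\<^sub>2\<^sub>)) \<theta>\<^sub>K\<close>; they form a matrix representation of the algebra
  (\<open>F_mult\<close>).\<close>

definition F :: "nat \<times> nat \<Rightarrow> nat \<times> nat \<Rightarrow> falg \<Rightarrow> complex" where
  "F I K f = blift (\<lambda>x y. chr N s x * Gf I K y) (Dl N f)"

lemma blift_smul:
  assumes B: "bilin B" and c: "\<And>c f g. B (c \<cdot> f) g = (c::complex) * B f g"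
  shows "blift B (c \<cdot> z) = c * blift B z"
proof (induction z rule: falg2_induct)
  case (tn f g)
  have "blift B (c \<cdot> tn f g) = blift B (tn (c \<cdot> f) g)" by simp
  then show ?case by (simp only: blift_tn[OF B] c)
qed (simp add: smul_add blift_add B distrib_left)

lemma Gf_add: "Gf I K (f + g) = Gf I K f + Gf I K g"
  by (simp add: Gf_def Dl_add blift_add bilin_rh)

lemma Gf_smul: "Gf I K (c \<cdot> f) = c * Gf I K f"
  unfolding Gf_def Dl_smul by (rule blift_smul[OF bilin_rh(3)]) (simp add: rh_simps)

lemma Gf_mult: "Gf I K (f * g) = (\<Sum>J\<in>Id2 N. Gf I J f * Gf J K g)"
  unfolding Gf_def Dl_mult
proof (rule blift_mult)
  fix i k :: "nat \<times> nat" and f f' g g'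
  show "rh (ugen (fst k) (fst i)) (f * f') * rh (g * g') (ugen (snd i) (snd k)) =
       (\<Sum>j\<in>Id2 N. rh (ugen (fst j) (fst i)) f * rh g (ugen (snd i) (snd j)) *
           (rh (ugen (fst k) (fst j)) f' * rh g' (ugen (snd j) (snd k))))"
    by (simp add: rh_gen_mult sum_Id2 sum_product mult_ac) (rule sum.swap)
qed (rule bilin_rh)

lemma Gf_1: "I \<in> Id2 N \<Longrightarrow> K \<in> Id2 N \<Longrightarrow> Gf I K 1 = of_bool (I = K)"
proof -
  assume IK: "I \<in> Id2 N" "K \<in> Id2 N"
  have "Gf I K 1 = rh (ugen (fst K) (fst I)) 1 * rh 1 (ugen (snd I) (snd K))"
    unfolding Gf_def Dl_1 tn_1_1[symmetric] by (simp add: bilin_rh)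
  also have "\<dots> = of_bool (fst K = fst I) * of_bool (snd I = snd K)"
    using IK by (cases I; cases K) (simp add: rh_unit del: atLeastAtMost_iff)
  finally show ?thesis by (auto simp: prod_eq_iff)
qed

lemma bilin_F: "bilin (\<lambda>x y. chr N s x * Gf I K y)"
  by (rule bilinI) (simp_all add: chr_add Gf_add Gf_smul distrib_left distrib_right)

lemma F_add: "F I K (f + g) = F I K f + F I K g"
  by (simp add: F_def Dl_add blift_add bilin_F)

lemma F_smul: "F I K (c \<cdot> f) = c * F I K f"
  unfolding F_def Dl_smul by (rule blift_smul[OF bilin_F]) simp

lemma F_0 [simp]: "F I K 0 = 0"
  using F_smul[of I K 0 0] by simp

lemma F_mult: "F I K (f * g) = (\<Sum>J\<in>Id2 N. F I J f * F J K g)"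
  unfolding F_def Dl_mult
  by (rule blift_mult) (simp_all add: bilin_F chr_mult Gf_mult sum_distrib_left mult_ac)

lemma F_1: "I \<in> Id2 N \<Longrightarrow> K \<in> Id2 N \<Longrightarrow> F I K 1 = of_bool (I = K)"
  unfolding F_def Dl_1 tn_1_1[symmetric] by (subst blift_tn[OF bilin_F]) (simp add: Gf_1)

lemma F_gen:
  assumes "i \<in> {1..N}" "j \<in> {1..N}" "k \<in> {1..N}" "l \<in> {1..N}" and zy: "z \<in> {1..N}" "y \<in> {1..N}"
  shows "F (i, j) (k, l) (ugen z y) = (\<Sum>m\<in>{1..N}. s * (Rmat N h k z i m * Rmat N h m j y l))"
proof -
  have "F (i, j) (k, l) (ugen z y) = s * Gf (i, j) (k, l) (ugen z y)"
  proof -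
    have "F (i, j) (k, l) (ugen z y) = (\<Sum>a\<in>{1..N}. of_bool (z = a) * (s * Gf (i, j) (k, l) (ugen a y)))"
      unfolding F_def Dl_gen blift_sum[OF bilin_F] blift_tn[OF bilin_F]
      using zy by (intro sum.cong refl) (simp add: chr_gen)
    also have "\<dots> = s * Gf (i, j) (k, l) (ugen z y)"
      using zy by (subst sum_of_bool_conj) auto
    finally show ?thesis .
  qed
  also have "Gf (i, j) (k, l) (ugen z y) = (\<Sum>m\<in>{1..N}. Rmat N h k z i m * Rmat N h m j y l)"
    unfolding Gf_def Dl_gen blift_sum[OF bilin_rh(3)] blift_tn[OF bilin_rh(3)]
    by (intro sum.cong refl) (simp only: fst_conv snd_conv rh_gen assms)
  finally show ?thesis by (simp only: sum_distrib_left)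
qed

text \<open>The functional in the form in which it occurs in the right action, that is on classes. Since
  classes are its arguments, \<open>F\<close> depends only on the class.\<close>

definition fa :: "nat \<times> nat \<Rightarrow> nat \<times> nat \<Rightarrow> oq \<Rightarrow> complex" where
  "fa I K a = sweedler_C N h a (\<lambda>a2 a''. chi s a2 * sweedler_C N h a'' (\<lambda>a3 a4.
      r (ucls N h (fst K) (fst I)) a3 * r a4 (ucls N h (snd I) (snd K))))"

lemma fa_F: "I \<in> Id2 N \<Longrightarrow> K \<in> Id2 N \<Longrightarrow> fa I K (qc f) = F I K f"
proof -
  assume IK: "I \<in> Id2 N" "K \<in> Id2 N"
  have g: "sweedler_C N h (qc y) (\<lambda>a3 a4.
      r (ucls N h (fst K) (fst I)) a3 * r a4 (ucls N h (snd I) (snd K))) = Gf I K y" for y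
    unfolding Gf_def
    by (rule sweedler_C_blift[OF h0 bilin_rh(3)])
      (use IK in \<open>auto simp: rh_def ocl_gen rh_simps[unfolded rh_def] bilinear_formD[OF r_bilinear]\<close>)
  show ?thesis unfolding fa_def F_def
    by (rule sweedler_C_blift[OF h0 bilin_F]) (simp_all add: g chi_chr[OF h0 s2])
qed

lemma F_cong: "I \<in> Id2 N \<Longrightarrow> K \<in> Id2 N \<Longrightarrow> qc f = qc g \<Longrightarrow> F I K f = F I K g"
  by (metis fa_F)

text \<open>Convolution by \<open>F\<^sub>I\<^sub>K\<close> on either side: \<open>RR I K a = \<Sum> a\<^sub>(\<^sub>1\<^sub>) F\<^sub>I\<^sub>K(a\<^sub>(\<^sub>2\<^sub>))\<close> governs the right action on the
  \<open>\<theta>\<^sub>I\<close>, and \<open>LL I K a = \<Sum> F\<^sub>I\<^sub>K(a\<^sub>(\<^sub>1\<^sub>)) a\<^sub>(\<^sub>2\<^sub>)\<close> the one on the right-invariant elements.\<close>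

definition RR :: "nat \<times> nat \<Rightarrow> nat \<times> nat \<Rightarrow> falg \<Rightarrow> falg" where
  "RR I K f = blift (\<lambda>x y. F I K y \<cdot> x) (Dl N f)"

definition LL :: "nat \<times> nat \<Rightarrow> nat \<times> nat \<Rightarrow> falg \<Rightarrow> falg" where
  "LL I K f = blift (\<lambda>x y. F I K x \<cdot> y) (Dl N f)"

lemma bilin_RL: "bilin (\<lambda>x y. F I K y \<cdot> x)" "bilin (\<lambda>x y. F I K x \<cdot> y)"
  by (rule bilinI; simp add: F_add F_smul smul_add add_smul mult.commute)+

lemma theta_act_RR: "I \<in> Id2 N \<Longrightarrow> K \<in> Id2 N \<Longrightarrow> theta_act N h s r I K (qc f) = qc (RR I K f)"
proof -
  assume IK: "I \<in> Id2 N" "K \<in> Id2 N"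
  have "theta_act N h s r I K (qc f) =
      sweedler_A N h (qc f) (\<lambda>a1 a'. scal N h (fa I K a') \<otimes>\<^bsub>A\<^esub> a1)"
    by (cases I; cases K) (simp add: theta_act_def fa_def)
  also have "\<dots> = qc (RR I K f)"
    unfolding RR_def
    by (rule sweedler_A_blift[OF h0 bilin_RL(1)]) (simp add: fa_F[OF IK] ocl_smul)
  finally show ?thesis .
qed

lemma RR_add: "RR I K (f + g) = RR I K f + RR I K g" and LL_add: "LL I K (f + g) = LL I K f + LL I K g"
  by (simp_all add: RR_def LL_def Dl_add blift_add bilin_RL)

lemma RR_0 [simp]: "RR I K 0 = 0" and LL_0 [simp]: "LL I K 0 = 0"
  by (simp_all add: RR_def LL_def)

lemma RR_sum: "RR I K (sum f X) = (\<Sum>i\<in>X. RR I K (f i))" and LL_sum: "LL I K (sum f X) = (\<Sum>i\<in>X. LL I K (f i))"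
  by (rule additive_sum; simp add: RR_add LL_add)+

lemma blift_smul':
  assumes B: "bilin B" and c: "\<And>c f g. B (c \<cdot> f) g = c \<cdot> B f g"
  shows "blift B (c \<cdot> z) = (c \<cdot> blift B z :: falg)"
proof (induction z rule: falg2_induct)
  case (tn f g)
  have "blift B (c \<cdot> tn f g) = blift B (tn (c \<cdot> f) g)" by simp
  then show ?case by (simp only: blift_tn[OF B] c)
qed (simp add: smul_add blift_add B)

lemma RR_smul: "RR I K (c \<cdot> f) = c \<cdot> RR I K f" and LL_smul: "LL I K (c \<cdot> f) = c \<cdot> LL I K f"
  unfolding RR_def LL_def Dl_smul
  by (rule blift_smul'[OF bilin_RL(1)], simp add: mult.commute, rule blift_smul'[OF bilin_RL(2)], simp add: F_smul)

lemma RR_mult: "RR I K (f * g) = (\<Sum>J\<in>Id2 N. RR I J f * RR J K g)"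
  and LL_mult: "LL I K (f * g) = (\<Sum>J\<in>Id2 N. LL I J f * LL J K g)"
  unfolding RR_def LL_def Dl_mult
  by (rule blift_mult; simp add: bilin_RL F_mult sum_smul mult.commute)+

lemma RR_1: "I \<in> Id2 N \<Longrightarrow> K \<in> Id2 N \<Longrightarrow> RR I K 1 = of_bool (I = K) \<cdot> 1"
  and LL_1: "I \<in> Id2 N \<Longrightarrow> K \<in> Id2 N \<Longrightarrow> LL I K 1 = of_bool (I = K) \<cdot> 1"
  unfolding RR_def LL_def Dl_1 tn_1_1[symmetric]
  by (simp_all only: blift_tn[OF bilin_RL(1)] blift_tn[OF bilin_RL(2)] F_1)

lemma RR_gen: "RR I K (ugen i j) = (\<Sum>m\<in>{1..N}. F I K (ugen m j) \<cdot> ugen i m)"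
  and LL_gen: "LL I K (ugen i j) = (\<Sum>m\<in>{1..N}. F I K (ugen i m) \<cdot> ugen m j)"
  by (simp_all add: RR_def LL_def Dl_gen blift_sum bilin_RL)

lemma RR_cong: "I \<in> Id2 N \<Longrightarrow> K \<in> Id2 N \<Longrightarrow> qc f = qc g \<Longrightarrow> qc (RR I K f) = qc (RR I K g)"
  by (metis theta_act_RR)

text \<open>Left and right convolutions commute by coassociativity; on generators this is visible, and both
  sides are multiplicative.\<close>

lemma LL_RR: "LL M P (RR I K f) = RR I K (LL M P f)"
  if "I \<in> Id2 N" "K \<in> Id2 N" "M \<in> Id2 N" "P \<in> Id2 N"
  using that
proof (induction f arbitrary: I K M P rule: falg_induct)
  case (const c)
  then show ?case by (simp add: kconst_smul RR_smul LL_smul RR_1 LL_1 mult_ac)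
next
  case (gen i j)
  have "LL M P (RR I K (ugen i j)) =
      (\<Sum>m\<in>{1..N}. \<Sum>n\<in>{1..N}. (F I K (ugen m j) * F M P (ugen i n)) \<cdot> ugen n m)"
    by (simp add: RR_gen LL_gen LL_sum LL_smul smul_sum)
  also have "\<dots> = RR I K (LL M P (ugen i j))"
    by (subst sum.swap) (simp add: RR_gen LL_gen RR_sum RR_smul smul_sum mult.commute)
  finally show ?case .
next
  case (add f g)
  then show ?case by (simp add: RR_add LL_add)
next
  case (mult f g)
  have "LL M P (RR I K (f * g)) = (\<Sum>J\<in>Id2 N. \<Sum>Q\<in>Id2 N. LL M Q (RR I J f) * LL Q P (RR J K g))"
    by (simp add: RR_mult LL_sum LL_mult)
  also have "\<dots> = (\<Sum>Q\<in>Id2 N. \<Sum>J\<in>Id2 N. RR I J (LL M Q f) * RR J K (LL Q P g))"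
    using mult.prems by (subst sum.swap) (intro sum.cong refl; simp only: mult.IH)
  also have "\<dots> = RR I K (LL M P (f * g))"
    by (simp add: LL_mult RR_sum RR_mult)
  finally show ?case .
qed

end

section \<open>The right coaction matrix and its inverse\<close>

lemma sum3_rot: "(\<Sum>a\<in>A. \<Sum>b\<in>B. \<Sum>c\<in>C. f a b c)
    = (\<Sum>b\<in>B. \<Sum>c\<in>C. \<Sum>a\<in>A. f a b c :: 'a::comm_monoid_add)"
proof -
  have "(\<Sum>a\<in>A. \<Sum>b\<in>B. \<Sum>c\<in>C. f a b c) = (\<Sum>b\<in>B. \<Sum>a\<in>A. \<Sum>c\<in>C. f a b c)"
    by (rule sum.swap)
  also have "\<dots> = (\<Sum>b\<in>B. \<Sum>c\<in>C. \<Sum>a\<in>A. f a b c)"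
    by (rule sum.cong[OF refl]) (rule sum.swap)
  finally show ?thesis .
qed

lemma sum4_exchange: "(\<Sum>a\<in>A. \<Sum>b\<in>B. \<Sum>c\<in>C. \<Sum>d\<in>D. f a b c d)
    = (\<Sum>d\<in>D. \<Sum>b\<in>B. \<Sum>c\<in>C. \<Sum>a\<in>A. f a b c d :: 'a::comm_monoid_add)"
proof -
  have "(\<Sum>a\<in>A. \<Sum>b\<in>B. \<Sum>c\<in>C. \<Sum>d\<in>D. f a b c d)
      = (\<Sum>b\<in>B. \<Sum>c\<in>C. \<Sum>a\<in>A. \<Sum>d\<in>D. f a b c d)"
    by (rule sum3_rot)
  also have "\<dots> = (\<Sum>b\<in>B. \<Sum>c\<in>C. \<Sum>d\<in>D. \<Sum>a\<in>A. f a b c d)"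
    by (rule sum.cong[OF refl], rule sum.cong[OF refl]) (rule sum.swap)
  also have "\<dots> = (\<Sum>d\<in>D. \<Sum>b\<in>B. \<Sum>c\<in>C. \<Sum>a\<in>A. f a b c d)"
    by (rule sum3_rot[symmetric])
  finally show ?thesis .
qed

context rform begin

text \<open>\<open>Sg\<close> is the antipode matrix \<open>S(u)\<close>, \<open>Zg i j\<close> is the inverse antipode of \<open>u\<^sub>j\<^sub>i\<close>, and \<open>vg\<close> is the matrix of
  \<open>\<Delta>\<^sub>R\<close> on the \<open>\<theta>\<^sub>I\<close>. The inverse \<open>wg\<close> of \<open>vg\<close> defines the right-invariant elements
  \<open>\<eta>\<^sub>M = \<Sum> wg I M \<theta>\<^sub>I\<close>.\<close>

definition Sg :: "nat \<Rightarrow> nat \<Rightarrow> falg" where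
  "Sg i j = h powi (rho2 N j - rho2 N i) \<cdot> ugen (opp N j) (opp N i)"

definition Zg :: "nat \<Rightarrow> nat \<Rightarrow> falg" where
  "Zg i j = h powi (rho2 N j - rho2 N i) \<cdot> ugen (opp N i) (opp N j)"

definition vg :: "nat \<times> nat \<Rightarrow> nat \<times> nat \<Rightarrow> falg" where
  "vg P I = ugen (fst P) (fst I) * Sg (snd I) (snd P)"

definition wg :: "nat \<times> nat \<Rightarrow> nat \<times> nat \<Rightarrow> falg" where
  "wg I M = ugen (snd M) (snd I) * Zg (fst M) (fst I)"

lemma opp_in: "i \<in> {1..N} \<Longrightarrow> opp N i \<in> {1..N}"
  by (auto simp: opp_def)

lemma opp_opp: "i \<in> {1..N} \<Longrightarrow> opp N (opp N i) = i"
  by (auto simp: opp_def)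

lemma opp_eq: "i \<in> {1..N} \<Longrightarrow> j \<in> {1..N} \<Longrightarrow> opp N i = opp N j \<longleftrightarrow> i = j"
  by (metis opp_opp)

lemma rho2_opp: "i \<in> {1..N} \<Longrightarrow> rho2 N (opp N i) = - rho2 N i"
  by (auto simp: rho2_def opp_def)

lemma sum_opp: "(\<Sum>i\<in>{1..N}. f (opp N i)) = (\<Sum>i\<in>{1..N}. f i)"
  by (rule sum.reindex_bij_witness[where i = "opp N" and j = "opp N"])
    (simp_all only: opp_in opp_opp)

lemma sum_Cmat:
  fixes X :: "nat \<Rightarrow> nat \<Rightarrow> falg"
  shows "(\<Sum>a\<in>{1..N}. \<Sum>b\<in>{1..N}. Cmat N h a b \<cdot> X a b) =
      (\<Sum>b\<in>{1..N}. h powi (rho2 N b) \<cdot> X (opp N b) b)"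
    "(\<Sum>a\<in>{1..N}. \<Sum>b\<in>{1..N}. Cmat N h a b \<cdot> X a b) =
      (\<Sum>a\<in>{1..N}. h powi (- rho2 N a) \<cdot> X a (opp N a))"
proof -
  have "(\<Sum>a\<in>{1..N}. \<Sum>b\<in>{1..N}. Cmat N h a b \<cdot> X a b) =
      (\<Sum>b\<in>{1..N}. \<Sum>a\<in>{1..N}. if a = opp N b then h powi (- rho2 N (opp N b)) \<cdot> X (opp N b) b else 0)"
    by (subst sum.swap) (intro sum.cong refl, simp add: Cmat_def)
  also have "\<dots> = (\<Sum>b\<in>{1..N}. h powi (rho2 N b) \<cdot> X (opp N b) b)"
  proof (rule sum.cong[OF refl])
    fix b assume "b \<in> {1..N}"
    then show "(\<Sum>a\<in>{1..N}. if a = opp N b then h powi (- rho2 N (opp N b)) \<cdot> X (opp N b) b else 0)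
        = h powi (rho2 N b) \<cdot> X (opp N b) b"
      using opp_in[of b] by (simp add: rho2_opp del: atLeastAtMost_iff)
  qed
  finally show 1: "(\<Sum>a\<in>{1..N}. \<Sum>b\<in>{1..N}. Cmat N h a b \<cdot> X a b) =
      (\<Sum>b\<in>{1..N}. h powi (rho2 N b) \<cdot> X (opp N b) b)" .
  show "(\<Sum>a\<in>{1..N}. \<Sum>b\<in>{1..N}. Cmat N h a b \<cdot> X a b) =
      (\<Sum>a\<in>{1..N}. h powi (- rho2 N a) \<cdot> X a (opp N a))"
    unfolding 1
    by (subst sum_opp[symmetric]) (intro sum.cong refl, simp only: opp_opp rho2_opp)
qed

lemma Su_Sg: "i \<in> {1..N} \<Longrightarrow> j \<in> {1..N} \<Longrightarrow> Su N h i j = qc (Sg i j)"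
proof -
  assume ij: "i \<in> {1..N}" "j \<in> {1..N}"
  let ?f = "\<Sum>a\<in>{1..N}. \<Sum>b\<in>{1..N}. kconst (Cmat N h i a) * ugen b a * kconst (Cmat N h b j)"
  have "?f \<in> fcar N" by (intro fcar_intros)
  then have "Su N h i j = qc ?f" by (simp add: Su_def ocl_id)
  also have "?f = (\<Sum>a\<in>{1..N}. Cmat N h i a \<cdot> (\<Sum>b\<in>{1..N}. if b = opp N j then h powi (rho2 N j) \<cdot> ugen (opp N j) a else 0))"
  proof (rule sum.cong[OF refl])
    fix a assume "a \<in> {1..N}"
    show "(\<Sum>b\<in>{1..N}. kconst (Cmat N h i a) * ugen b a * kconst (Cmat N h b j)) =
      Cmat N h i a \<cdot> (\<Sum>b\<in>{1..N}. if b = opp N j then h powi (rho2 N j) \<cdot> ugen (opp N j) a else 0)"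
      unfolding smul_sum
      by (rule sum.cong[OF refl]) (use ij in \<open>simp add: kconst_smul Cmat_def rho2_opp mult.commute del: atLeastAtMost_iff\<close>)
  qed
  also have "\<dots> = (\<Sum>a\<in>{1..N}. if a = opp N i then h powi (- rho2 N i) \<cdot> h powi (rho2 N j) \<cdot> ugen (opp N j) (opp N i) else 0)"
  proof (intro sum.cong refl)
    fix a assume a: "a \<in> {1..N}"
    have "i = opp N a \<longleftrightarrow> a = opp N i" using a ij by (metis opp_opp)
    then show "Cmat N h i a \<cdot> (\<Sum>b\<in>{1..N}. if b = opp N j then h powi (rho2 N j) \<cdot> ugen (opp N j) a else 0) =
       (if a = opp N i then h powi (- rho2 N i) \<cdot> h powi (rho2 N j) \<cdot> ugen (opp N j) (opp N i) else 0)"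
      using opp_in[OF ij(2)] by (simp add: Cmat_def del: atLeastAtMost_iff)
  qed
  also have "\<dots> = Sg i j"
    using opp_in[OF ij(1)] h0
    by (simp add: Sg_def power_int_diff power_int_minus field_simps del: atLeastAtMost_iff)
  finally show ?thesis .
qed

lemma pw: "h powi (a - b) = h powi (- b) * h powi a"
  using h0 by (simp add: power_int_diff power_int_minus field_simps)

lemma antipode_relations:
  assumes i: "i \<in> {1..N}" and l: "l \<in> {1..N}"
  shows "qc (\<Sum>j\<in>{1..N}. ugen i j * Sg j l) = qc (of_bool (i = l) \<cdot> 1)"
    and "qc (\<Sum>j\<in>{1..N}. Sg i j * ugen j l) = qc (of_bool (i = l) \<cdot> 1)"
    and "qc (\<Sum>j\<in>{1..N}. Zg i j * ugen l j) = qc (of_bool (i = l) \<cdot> 1)"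
    and "qc (\<Sum>j\<in>{1..N}. ugen j i * Zg j l) = qc (of_bool (i = l) \<cdot> 1)"
proof -
  have e: "i = opp N (opp N l) \<longleftrightarrow> i = l" "opp N i = opp N l \<longleftrightarrow> i = l"
    using i l by (simp_all only: opp_opp opp_eq)
  have "(\<Sum>j\<in>{1..N}. ugen i j * Sg j l) = h powi (rho2 N l) \<cdot> uCut N h i (opp N l)"
    unfolding uCut_def sum_Cmat(2) by (simp add: Sg_def smul_sum pw mult.commute)
  then have "qc (\<Sum>j\<in>{1..N}. ugen i j * Sg j l) = qc (h powi (rho2 N l) \<cdot> Cmat N h i (opp N l) \<cdot> 1)"
    by (simp only:) (intro ocl_cong ocl_uCut h0 i opp_in[OF l])
  then show "qc (\<Sum>j\<in>{1..N}. ugen i j * Sg j l) = qc (of_bool (i = l) \<cdot> 1)"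
    using h0 by (simp add: Cmat_def e(1) power_int_minus)
  have "(\<Sum>j\<in>{1..N}. Sg i j * ugen j l) = h powi (- rho2 N i) \<cdot> utCu N h (opp N i) l"
    unfolding utCu_def sum_Cmat(1) by (simp add: Sg_def smul_sum pw)
  then have "qc (\<Sum>j\<in>{1..N}. Sg i j * ugen j l) = qc (h powi (- rho2 N i) \<cdot> Cmat N h (opp N i) l \<cdot> 1)"
    by (simp only:) (intro ocl_cong ocl_uCut h0 l opp_in[OF i])
  then show "qc (\<Sum>j\<in>{1..N}. Sg i j * ugen j l) = qc (of_bool (i = l) \<cdot> 1)"
    using h0 i by (auto simp add: Cmat_def e(2) rho2_opp power_int_minus simp del: atLeastAtMost_iff)
  have "(\<Sum>j\<in>{1..N}. Zg i j * ugen l j) = h powi (- rho2 N i) \<cdot> uCut N h (opp N i) l"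
    unfolding uCut_def sum_Cmat(1) by (simp add: Zg_def smul_sum pw)
  then have "qc (\<Sum>j\<in>{1..N}. Zg i j * ugen l j) = qc (h powi (- rho2 N i) \<cdot> Cmat N h (opp N i) l \<cdot> 1)"
    by (simp only:) (intro ocl_cong ocl_uCut h0 l opp_in[OF i])
  then show "qc (\<Sum>j\<in>{1..N}. Zg i j * ugen l j) = qc (of_bool (i = l) \<cdot> 1)"
    using h0 i by (auto simp add: Cmat_def e(2) rho2_opp power_int_minus simp del: atLeastAtMost_iff)
  have "(\<Sum>j\<in>{1..N}. ugen j i * Zg j l) = h powi (rho2 N l) \<cdot> utCu N h i (opp N l)"
    unfolding utCu_def sum_Cmat(2) by (simp add: Zg_def smul_sum pw mult.commute)
  then have "qc (\<Sum>j\<in>{1..N}. ugen j i * Zg j l) = qc (h powi (rho2 N l) \<cdot> Cmat N h i (opp N l) \<cdot> 1)"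
    by (simp only:) (intro ocl_cong ocl_uCut h0 i opp_in[OF l])
  then show "qc (\<Sum>j\<in>{1..N}. ugen j i * Zg j l) = qc (of_bool (i = l) \<cdot> 1)"
    using h0 by (simp add: Cmat_def e(1) power_int_minus)
qed

lemma wg_vg:
  assumes K: "K \<in> Id2 N" and P: "P \<in> Id2 N"
  shows "qc (\<Sum>I\<in>Id2 N. wg I P * vg K I) = qc (of_bool (K = P) \<cdot> 1)"
proof -
  obtain k l where k: "K = (k, l)" "k \<in> {1..N}" "l \<in> {1..N}" using K by auto
  obtain p p' where p: "P = (p, p')" "p \<in> {1..N}" "p' \<in> {1..N}" using P by auto
  have "(\<Sum>I\<in>Id2 N. wg I P * vg K I) =
      (\<Sum>j\<in>{1..N}. ugen p' j * ((\<Sum>i\<in>{1..N}. Zg p i * ugen k i) * Sg j l))"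
    unfolding sum_Id2 k p wg_def vg_def
    by (subst sum.swap) (simp add: sum_distrib_left sum_distrib_right mult.assoc)
  also have "qc \<dots> = qc (\<Sum>j\<in>{1..N}. ugen p' j * ((of_bool (p = k) \<cdot> 1) * Sg j l))"
    by ((rule ocl_sum_cong)+, rule ocl_cong(2)[OF refl], rule ocl_cong(2)[OF _ refl], rule antipode_relations(3); (assumption | rule p k))
  also have "(\<Sum>j\<in>{1..N}. ugen p' j * ((of_bool (p = k) \<cdot> 1) * Sg j l)) =
      of_bool (p = k) \<cdot> (\<Sum>j\<in>{1..N}. ugen p' j * Sg j l)"
    by (simp add: smul_sum)
  also have "qc \<dots> = qc (of_bool (p = k) \<cdot> of_bool (p' = l) \<cdot> 1)"
    by (intro ocl_cong(3) antipode_relations(1) p k)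
  also have "of_bool (p = k) \<cdot> of_bool (p' = l) \<cdot> (1::falg) = of_bool (K = P) \<cdot> 1"
    by (auto simp: k p)
  finally show ?thesis .
qed

lemma vg_wg:
  assumes I: "I \<in> Id2 N" and K: "K \<in> Id2 N"
  shows "qc (\<Sum>M\<in>Id2 N. vg M I * wg K M) = qc (of_bool (I = K) \<cdot> 1)"
proof -
  obtain k l where k: "K = (k, l)" "k \<in> {1..N}" "l \<in> {1..N}" using K by auto
  obtain i j where i: "I = (i, j)" "i \<in> {1..N}" "j \<in> {1..N}" using I by auto
  have "(\<Sum>M\<in>Id2 N. vg M I * wg K M) =
      (\<Sum>m\<in>{1..N}. ugen m i * ((\<Sum>n\<in>{1..N}. Sg j n * ugen n l) * Zg m k))"
    unfolding sum_Id2 k i wg_def vg_def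
    by (simp add: sum_distrib_left sum_distrib_right mult.assoc)
  also have "qc \<dots> = qc (\<Sum>m\<in>{1..N}. ugen m i * ((of_bool (j = l) \<cdot> 1) * Zg m k))"
    by ((rule ocl_sum_cong)+, rule ocl_cong(2)[OF refl], rule ocl_cong(2)[OF _ refl], rule antipode_relations(2); (assumption | rule i k))
  also have "(\<Sum>m\<in>{1..N}. ugen m i * ((of_bool (j = l) \<cdot> 1) * Zg m k)) =
      of_bool (j = l) \<cdot> (\<Sum>m\<in>{1..N}. ugen m i * Zg m k)"
    by (simp add: smul_sum)
  also have "qc \<dots> = qc (of_bool (j = l) \<cdot> of_bool (i = k) \<cdot> 1)"
    by (intro ocl_cong(3) antipode_relations(4) i k)
  also have "of_bool (j = l) \<cdot> of_bool (i = k) \<cdot> (1::falg) = of_bool (I = K) \<cdot> 1"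
    by (auto simp: k i)
  finally show ?thesis .
qed

lemma RTT:
  assumes "i \<in> {1..N}" "j \<in> {1..N}" "k \<in> {1..N}" "l \<in> {1..N}"
  shows "qc (\<Sum>a\<in>{1..N}. \<Sum>b\<in>{1..N}. Rmat N h j i a b \<cdot> (ugen a k * ugen b l)) =
    qc (\<Sum>a\<in>{1..N}. \<Sum>b\<in>{1..N}. Rmat N h b a k l \<cdot> (ugen i a * ugen j b))"
  using ocl_rels(1)[OF assms, of h] unfolding rel_RTT_alt ocl_eq_iff[symmetric] Ruu_def uuR_def Rhat_def .

text \<open>Multiplying the relation \<open>\<hat>R(u \<otimes> u) = (u \<otimes> u)\<hat>R\<close> by the antipode from the left and from the right
  gives the exchange rule of \<open>u\<close> and \<open>S(u)\<close>.\<close>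

lemma RTT_S:
  assumes z: "z \<in> {1..N}" and j: "j \<in> {1..N}" and y: "y \<in> {1..N}" and p: "p \<in> {1..N}"
  shows "qc (\<Sum>m\<in>{1..N}. \<Sum>l\<in>{1..N}. Rmat N h m j y l \<cdot> (ugen z m * Sg l p)) =
    qc (\<Sum>m\<in>{1..N}. \<Sum>n\<in>{1..N}. Rmat N h z m n p \<cdot> (Sg j m * ugen n y))"
proof -
  let ?E = "\<lambda>b. \<Sum>a\<in>{1..N}. Sg j a * ugen a b"
  have e1: "qc (\<Sum>m\<in>{1..N}. \<Sum>l\<in>{1..N}. Rmat N h m j y l \<cdot> (ugen z m * Sg l p)) = qc (\<Sum>m\<in>{1..N}. \<Sum>l\<in>{1..N}. \<Sum>b\<in>{1..N}. Rmat N h m b y l \<cdot> ((of_bool (j = b) \<cdot> 1) * (ugen z m * Sg l p)))"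
  proof -
    have "Rmat N h m j y l \<cdot> (ugen z m * Sg l p) =
      (\<Sum>b\<in>{1..N}. Rmat N h m b y l \<cdot> ((of_bool (j = b) \<cdot> 1) * (ugen z m * Sg l p)))" for m l
      using sum_of_bool_smul(4)[OF finite_atLeastAtMost j, of "\<lambda>b. Rmat N h m b y l" "\<lambda>b. ugen z m * Sg l p"]
      by simp
    then show ?thesis by (simp only:)
  qed
  have e2: "qc (\<Sum>m\<in>{1..N}. \<Sum>l\<in>{1..N}. \<Sum>b\<in>{1..N}. Rmat N h m b y l \<cdot> ((of_bool (j = b) \<cdot> 1) * (ugen z m * Sg l p))) = qc (\<Sum>m\<in>{1..N}. \<Sum>l\<in>{1..N}. \<Sum>b\<in>{1..N}. Rmat N h m b y l \<cdot> (?E b * (ugen z m * Sg l p)))"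
    by ((rule ocl_sum_cong)+, rule ocl_cong(3), rule ocl_cong(2)[OF _ refl], rule antipode_relations(2)[symmetric]; (assumption | rule j))
  have e3: "(\<Sum>m\<in>{1..N}. \<Sum>l\<in>{1..N}. \<Sum>b\<in>{1..N}. Rmat N h m b y l \<cdot> (?E b * (ugen z m * Sg l p))) = (\<Sum>a\<in>{1..N}. \<Sum>l\<in>{1..N}. Sg j a * ((\<Sum>b\<in>{1..N}. \<Sum>m\<in>{1..N}. Rmat N h m b y l \<cdot> (ugen a b * ugen z m)) * Sg l p))"
    by (simp only: sum_distrib_left sum_distrib_right smul_sum smul_simps mult.assoc, rule trans[OF sum4_exchange],
        (intro sum.cong refl; simp add: mult_ac))
  have e4: "qc (\<Sum>a\<in>{1..N}. \<Sum>l\<in>{1..N}. Sg j a * ((\<Sum>b\<in>{1..N}. \<Sum>m\<in>{1..N}. Rmat N h m b y l \<cdot> (ugen a b * ugen z m)) * Sg l p)) = qc (\<Sum>a\<in>{1..N}. \<Sum>l\<in>{1..N}. Sg j a * ((\<Sum>b\<in>{1..N}. \<Sum>m\<in>{1..N}. Rmat N h z a b m \<cdot> (ugen b y * ugen m l)) * Sg l p))"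
    by ((rule ocl_sum_cong)+, rule ocl_cong(2)[OF refl], rule ocl_cong(2)[OF _ refl], rule RTT[symmetric]; (assumption | rule z y))
  have e5: "(\<Sum>a\<in>{1..N}. \<Sum>l\<in>{1..N}. Sg j a * ((\<Sum>b\<in>{1..N}. \<Sum>m\<in>{1..N}. Rmat N h z a b m \<cdot> (ugen b y * ugen m l)) * Sg l p)) = (\<Sum>a\<in>{1..N}. \<Sum>b\<in>{1..N}. \<Sum>m\<in>{1..N}. Rmat N h z a b m \<cdot> (Sg j a * (ugen b y * (\<Sum>l\<in>{1..N}. ugen m l * Sg l p))))"
    by (simp only: sum_distrib_left sum_distrib_right smul_sum smul_simps mult.assoc, rule sum.cong[OF refl], rule trans[OF sum3_rot],
        (intro sum.cong refl; simp add: mult_ac))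
  have e6: "qc (\<Sum>a\<in>{1..N}. \<Sum>b\<in>{1..N}. \<Sum>m\<in>{1..N}. Rmat N h z a b m \<cdot> (Sg j a * (ugen b y * (\<Sum>l\<in>{1..N}. ugen m l * Sg l p)))) = qc (\<Sum>a\<in>{1..N}. \<Sum>b\<in>{1..N}. \<Sum>m\<in>{1..N}. Rmat N h z a b m \<cdot> (Sg j a * (ugen b y * (of_bool (m = p) \<cdot> 1))))"
    by ((rule ocl_sum_cong)+, rule ocl_cong(3), rule ocl_cong(2)[OF refl], rule ocl_cong(2)[OF refl], rule antipode_relations(1); (assumption | rule p))
  have e7: "(\<Sum>a\<in>{1..N}. \<Sum>b\<in>{1..N}. \<Sum>m\<in>{1..N}. Rmat N h z a b m \<cdot> (Sg j a * (ugen b y * (of_bool (m = p) \<cdot> 1)))) = (\<Sum>m\<in>{1..N}. \<Sum>n\<in>{1..N}. Rmat N h z m n p \<cdot> (Sg j m * ugen n y))"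
    using sum_of_bool_smul(3)[OF finite_atLeastAtMost p] by (intro sum.cong refl) simp
  show ?thesis
    by (rule trans[OF e1 trans[OF e2 trans[OF arg_cong[OF e3, of qc] trans[OF e4 trans[OF arg_cong[OF e5, of qc] trans[OF e6 arg_cong[OF e7, of qc]]]]]]])
qed

text \<open>The coaction matrix intertwines the two convolutions: this is the compatibility of \<open>\<Delta>\<^sub>R\<close> with the
  right action. On a generator it amounts to one use of \<open>RTT\<close> for the first factor of \<open>vg\<close> and one of
  \<open>RTT_S\<close> for the second.\<close>

lemma compat_gen:
  assumes I: "I \<in> Id2 N" and P: "P \<in> Id2 N" and xy: "x \<in> {1..N}" "y \<in> {1..N}"
  shows "qc (\<Sum>K\<in>Id2 N. RR I K (ugen x y) * vg P K) = qc (\<Sum>M\<in>Id2 N. vg M I * LL M P (ugen x y))"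
proof -
  obtain i j where i: "I = (i, j)" "i \<in> {1..N}" "j \<in> {1..N}" using I by auto
  obtain p p' where p: "P = (p, p')" "p \<in> {1..N}" "p' \<in> {1..N}" using P by auto
  let ?T1 = "\<lambda>k l z m. (s * (Rmat N h k z i m * Rmat N h m j y l)) \<cdot> (ugen x z * (ugen p k * Sg l p'))"
  let ?T2 = "\<lambda>k z m l. (s * (Rmat N h p x k z * Rmat N h m j y l)) \<cdot> (ugen k i * (ugen z m * Sg l p'))"
  let ?T3 = "\<lambda>k z m n. (s * (Rmat N h p x k z * Rmat N h z m n p')) \<cdot> (ugen k i * (Sg j m * ugen n y))"
  have e1: "(\<Sum>K\<in>Id2 N. RR I K (ugen x y) * vg P K) = (\<Sum>k\<in>{1..N}. \<Sum>l\<in>{1..N}. \<Sum>z\<in>{1..N}. \<Sum>m\<in>{1..N}. ?T1 k l z m)"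
    unfolding sum_Id2 i p RR_gen vg_def fst_conv snd_conv sum_distrib_right
  proof (intro sum.cong refl)
    fix k l z assume "k \<in> {1..N}" "l \<in> {1..N}" "z \<in> {1..N}"
    then show "F (i, j) (k, l) (ugen z y) \<cdot> ugen x z * (ugen p k * Sg l p') = (\<Sum>m\<in>{1..N}. ?T1 k l z m)"
      by (subst F_gen) (use i xy in \<open>simp_all add: sum_smul sum_distrib_right del: atLeastAtMost_iff\<close>)
  qed
  have e2: "(\<Sum>k\<in>{1..N}. \<Sum>l\<in>{1..N}. \<Sum>z\<in>{1..N}. \<Sum>m\<in>{1..N}. ?T1 k l z m) = (\<Sum>m\<in>{1..N}. \<Sum>l\<in>{1..N}. s \<cdot> Rmat N h m j y l \<cdot>
     ((\<Sum>z\<in>{1..N}. \<Sum>k\<in>{1..N}. Rmat N h k z i m \<cdot> (ugen x z * ugen p k)) * Sg l p'))"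
    by (simp only: sum_distrib_left sum_distrib_right smul_sum smul_simps mult.assoc, rule trans[OF sum4_exchange],
        (intro sum.cong refl; simp add: mult_ac))
  have e3: "qc (\<Sum>m\<in>{1..N}. \<Sum>l\<in>{1..N}. s \<cdot> Rmat N h m j y l \<cdot>
     ((\<Sum>z\<in>{1..N}. \<Sum>k\<in>{1..N}. Rmat N h k z i m \<cdot> (ugen x z * ugen p k)) * Sg l p')) = qc (\<Sum>m\<in>{1..N}. \<Sum>l\<in>{1..N}. s \<cdot> Rmat N h m j y l \<cdot>
     ((\<Sum>k\<in>{1..N}. \<Sum>z\<in>{1..N}. Rmat N h p x k z \<cdot> (ugen k i * ugen z m)) * Sg l p'))"
    by ((rule ocl_sum_cong)+, rule ocl_cong(3), rule ocl_cong(3), rule ocl_cong(2)[OF _ refl], rule RTT[symmetric]; (assumption | rule xy p i))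
  have e4: "(\<Sum>m\<in>{1..N}. \<Sum>l\<in>{1..N}. s \<cdot> Rmat N h m j y l \<cdot>
     ((\<Sum>k\<in>{1..N}. \<Sum>z\<in>{1..N}. Rmat N h p x k z \<cdot> (ugen k i * ugen z m)) * Sg l p')) = (\<Sum>k\<in>{1..N}. \<Sum>z\<in>{1..N}. s \<cdot> Rmat N h p x k z \<cdot> (ugen k i *
       (\<Sum>m\<in>{1..N}. \<Sum>l\<in>{1..N}. Rmat N h m j y l \<cdot> (ugen z m * Sg l p'))))"
    by (simp only: sum_distrib_left sum_distrib_right smul_sum smul_simps mult.assoc, rule trans[OF sum4_swap],
        (intro sum.cong refl; simp add: mult_ac))
  have e5: "qc (\<Sum>k\<in>{1..N}. \<Sum>z\<in>{1..N}. s \<cdot> Rmat N h p x k z \<cdot> (ugen k i *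
       (\<Sum>m\<in>{1..N}. \<Sum>l\<in>{1..N}. Rmat N h m j y l \<cdot> (ugen z m * Sg l p')))) = qc (\<Sum>k\<in>{1..N}. \<Sum>z\<in>{1..N}. s \<cdot> Rmat N h p x k z \<cdot> (ugen k i *
       (\<Sum>m\<in>{1..N}. \<Sum>n\<in>{1..N}. Rmat N h z m n p' \<cdot> (Sg j m * ugen n y))))"
    by ((rule ocl_sum_cong)+, rule ocl_cong(3), rule ocl_cong(3), rule ocl_cong(2)[OF refl], rule RTT_S; (assumption | rule xy p i))
  have e6: "(\<Sum>k\<in>{1..N}. \<Sum>z\<in>{1..N}. s \<cdot> Rmat N h p x k z \<cdot> (ugen k i *
       (\<Sum>m\<in>{1..N}. \<Sum>n\<in>{1..N}. Rmat N h z m n p' \<cdot> (Sg j m * ugen n y)))) = (\<Sum>k\<in>{1..N}. \<Sum>m\<in>{1..N}. \<Sum>n\<in>{1..N}. \<Sum>z\<in>{1..N}. ?T3 k z m n)"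
    by (simp only: sum_distrib_left sum_distrib_right smul_sum smul_simps mult.assoc, rule sum.cong[OF refl], rule trans[OF sum3_rot],
        (intro sum.cong refl; simp add: mult_ac))
  have e7: "(\<Sum>k\<in>{1..N}. \<Sum>m\<in>{1..N}. \<Sum>n\<in>{1..N}. \<Sum>z\<in>{1..N}. ?T3 k z m n) = (\<Sum>M\<in>Id2 N. vg M I * LL M P (ugen x y))"
    unfolding sum_Id2 i p LL_gen vg_def fst_conv snd_conv sum_distrib_left
  proof (intro sum.cong refl)
    fix k m n assume "k \<in> {1..N}" "m \<in> {1..N}" "n \<in> {1..N}"
    then show "(\<Sum>z\<in>{1..N}. ?T3 k z m n) =
        ugen k i * Sg j m * (F (k, m) (p, p') (ugen x n) \<cdot> ugen n y)"
      by (subst F_gen) (use p xy in \<open>simp_all add: sum_smul sum_distrib_left mult.assoc del: atLeastAtMost_iff\<close>)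
  qed
  show ?thesis
    by (rule trans[OF arg_cong[OF e1, of qc] trans[OF arg_cong[OF e2, of qc] trans[OF e3 trans[OF arg_cong[OF e4, of qc] trans[OF e5 trans[OF arg_cong[OF e6, of qc] arg_cong[OF e7, of qc]]]]]]])
qed

lemma compat:
  assumes "I \<in> Id2 N" "P \<in> Id2 N"
  shows "qc (\<Sum>K\<in>Id2 N. RR I K b * vg P K) = qc (\<Sum>M\<in>Id2 N. vg M I * LL M P b)"
  using assms
proof (induction b arbitrary: I P rule: falg_induct)
  case (const c)
  have "(\<Sum>K\<in>Id2 N. RR I K (kconst c) * vg P K) = (\<Sum>K\<in>Id2 N. if K = I then c \<cdot> vg P I else 0)"
    using const by (intro sum.cong refl) (auto simp: kconst_smul RR_smul RR_1)
  also have "\<dots> = c \<cdot> vg P I" using const by (subst sum.delta) auto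
  also have "\<dots> = (\<Sum>M\<in>Id2 N. if M = P then c \<cdot> vg P I else 0)"
    using const by (subst sum.delta) auto
  also have "\<dots> = (\<Sum>M\<in>Id2 N. vg M I * LL M P (kconst c))"
    using const by (intro sum.cong refl) (auto simp: kconst_smul LL_smul LL_1)
  finally show ?case by simp
next
  case (gen x y)
  show ?case
  proof (cases "x \<in> {1..N} \<and> y \<in> {1..N}")
    case True
    then show ?thesis by (intro compat_gen gen) simp_all
  next
    case False
    have z: "qc (ugen x y) = qc 0" unfolding ocl_gen_bad[OF False] ocl_0 ..
    have zl: "qc (LL M P (ugen x y)) = qc 0" if "M \<in> Id2 N" for M
    proof -
      have "LL M P (ugen x y) = (\<Sum>m\<in>{1..N}. F M P (ugen x m) \<cdot> ugen m y)" by (rule LL_gen)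
      also have "qc \<dots> = qc (\<Sum>m\<in>{1..N}. 0)"
      proof (rule ocl_sum_cong)
        fix m assume "m \<in> {1..N}"
        show "qc (F M P (ugen x m) \<cdot> ugen m y) = qc 0"
        proof (cases "x \<in> {1..N}")
          case True
          with False have "qc (ugen m y) = qc 0" by (simp only: ocl_gen_bad ocl_0 simp_thms)
          then show ?thesis using ocl_cong(3)[of N h "ugen m y" 0] by simp
        next
          case False
          then have "qc (ugen x m) = qc 0" by (simp only: ocl_gen_bad ocl_0 simp_thms)
          then have "F M P (ugen x m) = 0" using F_cong[OF that gen(2)] by fastforce
          then show ?thesis by simp
        qed
      qed
      finally show ?thesis by simp
    qed
    have zr: "qc (RR I K (ugen x y)) = qc 0" if "K \<in> Id2 N" for K
      using RR_cong[OF gen(1) that z] by simp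
    have "qc (\<Sum>K\<in>Id2 N. RR I K (ugen x y) * vg P K) = qc (\<Sum>K\<in>Id2 N. 0 * vg P K)"
      by (rule ocl_sum_cong, rule ocl_cong(2)[OF _ refl], rule zr)
    moreover have "qc (\<Sum>M\<in>Id2 N. vg M I * LL M P (ugen x y)) = qc (\<Sum>M\<in>Id2 N. vg M I * 0)"
      by (rule ocl_sum_cong, rule ocl_cong(2)[OF refl], rule zl)
    ultimately show ?thesis by simp
  qed
next
  case (add f g)
  have "qc (\<Sum>K\<in>Id2 N. RR I K (f + g) * vg P K) =
      qc ((\<Sum>K\<in>Id2 N. RR I K f * vg P K) + (\<Sum>K\<in>Id2 N. RR I K g * vg P K))"
    by (simp add: RR_add distrib_right sum.distrib)
  also have "\<dots> = qc ((\<Sum>M\<in>Id2 N. vg M I * LL M P f) + (\<Sum>M\<in>Id2 N. vg M I * LL M P g))"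
    by (intro ocl_cong(1) add)
  finally show ?case by (simp add: LL_add distrib_left sum.distrib)
next
  case (mult f g)
  have "(\<Sum>K\<in>Id2 N. RR I K (f * g) * vg P K) =
      (\<Sum>J\<in>Id2 N. RR I J f * (\<Sum>K\<in>Id2 N. RR J K g * vg P K))"
    by (simp add: RR_mult sum_distrib_left sum_distrib_right mult.assoc) (rule sum.swap)
  also have "qc \<dots> = qc (\<Sum>J\<in>Id2 N. RR I J f * (\<Sum>M\<in>Id2 N. vg M J * LL M P g))"
    by (rule ocl_sum_cong, rule ocl_cong(2)[OF refl], rule mult.IH(2)) (use mult.prems in auto)
  also have "(\<Sum>J\<in>Id2 N. RR I J f * (\<Sum>M\<in>Id2 N. vg M J * LL M P g)) =
     (\<Sum>M\<in>Id2 N. (\<Sum>J\<in>Id2 N. RR I J f * vg M J) * LL M P g)"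
    by (simp add: sum_distrib_left sum_distrib_right mult.assoc) (rule sum.swap)
  also have "qc \<dots> = qc (\<Sum>M\<in>Id2 N. (\<Sum>Q\<in>Id2 N. vg Q I * LL Q M f) * LL M P g)"
    by (rule ocl_sum_cong, rule ocl_cong(2)[OF _ refl], rule mult.IH(1)) (use mult.prems in auto)
  also have "(\<Sum>M\<in>Id2 N. (\<Sum>Q\<in>Id2 N. vg Q I * LL Q M f) * LL M P g) =
     (\<Sum>M\<in>Id2 N. vg M I * LL M P (f * g))"
    by (simp add: LL_mult sum_distrib_left sum_distrib_right mult.assoc) (rule sum.swap)
  finally show ?case .
qed

text \<open>Equivalently \<open>\<eta>\<^sub>M g = \<Sum> LL M P g \<eta>\<^sub>P\<close>.\<close>

lemma compat_inverse:
  assumes M: "M \<in> Id2 N" and J: "J \<in> Id2 N"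
  shows "qc (\<Sum>I\<in>Id2 N. wg I M * RR I J g) = qc (\<Sum>P\<in>Id2 N. LL M P g * wg J P)"
proof -
  have e1: "(\<Sum>I\<in>Id2 N. wg I M * RR I J g) = (\<Sum>I\<in>Id2 N. wg I M * (\<Sum>K\<in>Id2 N. RR I K g * (of_bool (K = J) \<cdot> 1)))"
    by (rule sum.cong[OF refl], simp only: smul_simps mult_1_right, subst sum_of_bool_smul(1)[OF _ J])
      simp_all
  have e2: "qc (\<Sum>I\<in>Id2 N. wg I M * (\<Sum>K\<in>Id2 N. RR I K g * (of_bool (K = J) \<cdot> 1))) = qc (\<Sum>I\<in>Id2 N. wg I M * (\<Sum>K\<in>Id2 N. RR I K g * (\<Sum>P\<in>Id2 N. vg P K * wg J P)))"
    by (rule ocl_sum_cong, rule ocl_cong(2)[OF refl], rule ocl_sum_cong, rule ocl_cong(2)[OF refl],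
        rule vg_wg[symmetric]; (assumption | rule J))
  have e3: "(\<Sum>I\<in>Id2 N. wg I M * (\<Sum>K\<in>Id2 N. RR I K g * (\<Sum>P\<in>Id2 N. vg P K * wg J P))) = (\<Sum>I\<in>Id2 N. \<Sum>P\<in>Id2 N. wg I M * ((\<Sum>K\<in>Id2 N. RR I K g * vg P K) * wg J P))"
    by (rule sum.cong[OF refl], simp add: sum_distrib_left sum_distrib_right mult.assoc) (rule sum.swap)
  have e4: "qc (\<Sum>I\<in>Id2 N. \<Sum>P\<in>Id2 N. wg I M * ((\<Sum>K\<in>Id2 N. RR I K g * vg P K) * wg J P)) = qc (\<Sum>I\<in>Id2 N. \<Sum>P\<in>Id2 N. wg I M * ((\<Sum>Q\<in>Id2 N. vg Q I * LL Q P g) * wg J P))"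
    by ((rule ocl_sum_cong)+, rule ocl_cong(2)[OF refl], rule ocl_cong(2)[OF _ refl], rule compat; (assumption | rule J))
  have e5: "(\<Sum>I\<in>Id2 N. \<Sum>P\<in>Id2 N. wg I M * ((\<Sum>Q\<in>Id2 N. vg Q I * LL Q P g) * wg J P)) = (\<Sum>P\<in>Id2 N. \<Sum>Q\<in>Id2 N. (\<Sum>I\<in>Id2 N. wg I M * vg Q I) * (LL Q P g * wg J P))"
    by (simp only: sum_distrib_left sum_distrib_right mult.assoc) (rule sum3_rot)
  have e6: "qc (\<Sum>P\<in>Id2 N. \<Sum>Q\<in>Id2 N. (\<Sum>I\<in>Id2 N. wg I M * vg Q I) * (LL Q P g * wg J P)) = qc (\<Sum>P\<in>Id2 N. \<Sum>Q\<in>Id2 N. (of_bool (Q = M) \<cdot> 1) * (LL Q P g * wg J P))"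
    by ((rule ocl_sum_cong)+, rule ocl_cong(2)[OF _ refl], rule wg_vg; (assumption | rule M))
  have e7: "(\<Sum>P\<in>Id2 N. \<Sum>Q\<in>Id2 N. (of_bool (Q = M) \<cdot> 1) * (LL Q P g * wg J P)) = (\<Sum>P\<in>Id2 N. LL M P g * wg J P)"
    using M by (intro sum.cong refl) (simp add: sum_of_bool_smul(1)[of "Id2 N" M])
  show ?thesis
    by (rule trans[OF arg_cong[OF e1, of qc] trans[OF e2 trans[OF arg_cong[OF e3, of qc] trans[OF e4 trans[OF arg_cong[OF e5, of qc] trans[OF e6 arg_cong[OF e7, of qc]]]]]]])
qed

lemma Dl_Sg: "Dl N (Sg i j) = (\<Sum>n\<in>{1..N}. tn (Sg n j) (Sg i n))"
proof -
  have "Dl N (Sg i j) = (\<Sum>n\<in>{1..N}. h powi (rho2 N j - rho2 N i) \<cdot> tn (ugen (opp N j) n) (ugen n (opp N i)))"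
    by (simp add: Sg_def Dl_smul Dl_gen smul_sum)
  also have "\<dots> = (\<Sum>n\<in>{1..N}. h powi (rho2 N j - rho2 N i) \<cdot> tn (ugen (opp N j) (opp N n)) (ugen (opp N n) (opp N i)))"
    by (rule sum_opp[symmetric])
  also have "\<dots> = (\<Sum>n\<in>{1..N}. tn (Sg n j) (Sg i n))"
    using h0 by (simp add: Sg_def flip: power_int_add)
  finally show ?thesis .
qed

lemma Dl_Zg: "Dl N (Zg i j) = (\<Sum>n\<in>{1..N}. tn (Zg i n) (Zg n j))"
proof -
  have "Dl N (Zg i j) = (\<Sum>n\<in>{1..N}. h powi (rho2 N j - rho2 N i) \<cdot> tn (ugen (opp N i) n) (ugen n (opp N j)))"
    by (simp add: Zg_def Dl_smul Dl_gen smul_sum)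
  also have "\<dots> = (\<Sum>n\<in>{1..N}. h powi (rho2 N j - rho2 N i) \<cdot> tn (ugen (opp N i) (opp N n)) (ugen (opp N n) (opp N j)))"
    by (rule sum_opp[symmetric])
  also have "\<dots> = (\<Sum>n\<in>{1..N}. tn (Zg i n) (Zg n j))"
    using h0 by (simp add: Zg_def flip: power_int_add)
  finally show ?thesis .
qed

lemma Dl_vg: "Dl N (vg P I) = (\<Sum>J\<in>Id2 N. tn (vg P J) (vg J I))"
  by (simp add: vg_def Dl_mult Dl_gen Dl_Sg sum_product tn_mult sum_Id2)

lemma Dl_wg: "Dl N (wg I M) = (\<Sum>P\<in>Id2 N. tn (wg P M) (wg I P))"
  by (simp add: wg_def Dl_mult Dl_gen Dl_Zg sum_product tn_mult sum_Id2) (rule sum.swap)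

lemma RR_vg: "RR I K (vg M J) = (\<Sum>P\<in>Id2 N. F I K (vg P J) \<cdot> vg M P)"
  unfolding RR_def Dl_vg by (simp add: blift_sum bilin_RL)

end

section \<open>Abelian groups given by generators and relations\<close>

text \<open>The tensor powers over the algebra and the tensor products over the complex numbers are both
  abelian groups with generators \<open>S\<close> and relations \<open>R\<close>; their common properties are derived once.\<close>

definition fker :: "'x set \<Rightarrow> ('x \<Rightarrow>\<^sub>0 int) set \<Rightarrow> ('x \<Rightarrow>\<^sub>0 int) set" where
  "fker S R = generate (free_Abelian_group S) R"

definition fgrp :: "'x set \<Rightarrow> ('x \<Rightarrow>\<^sub>0 int) set \<Rightarrow> ('x \<Rightarrow>\<^sub>0 int) set monoid" where
  "fgrp S R = free_Abelian_group S Mod fker S R"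

definition fcls :: "'x set \<Rightarrow> ('x \<Rightarrow>\<^sub>0 int) set \<Rightarrow> ('x \<Rightarrow>\<^sub>0 int) \<Rightarrow> ('x \<Rightarrow>\<^sub>0 int) set" where
  "fcls S R z = fker S R #>\<^bsub>free_Abelian_group S\<^esub> z"

lemma keys_addI: "keys a \<subseteq> S \<Longrightarrow> keys b \<subseteq> S \<Longrightarrow> keys (a + b) \<subseteq> S"
  and keys_diffI: "keys (a :: 'x \<Rightarrow>\<^sub>0 int) \<subseteq> S \<Longrightarrow> keys b \<subseteq> S \<Longrightarrow> keys (a - b) \<subseteq> S"
  for a b :: "'x \<Rightarrow>\<^sub>0 int"
  using keys_add[of a b] keys_diff[of a b] by blast+

lemma keys_sumI: "(\<And>i. i \<in> I \<Longrightarrow> keys (f i) \<subseteq> S) \<Longrightarrow> keys (sum f I) \<subseteq> S"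
  for f :: "'i \<Rightarrow> ('x \<Rightarrow>\<^sub>0 int)"
  using keys_sum[of f I] by blast

context
  fixes S :: "'x set" and R :: "('x \<Rightarrow>\<^sub>0 int) set"
  assumes R: "R \<subseteq> {c. keys c \<subseteq> S}"
begin

lemma R_carrier: "R \<subseteq> carrier (free_Abelian_group S)"
  using R by (simp add: free_Abelian_group_def)

lemma fker_subgroup: "subgroup (fker S R) (free_Abelian_group S)"
  unfolding fker_def by (rule group.generate_is_subgroup[OF group_free_Abelian_group R_carrier])

lemma fker_normal: "fker S R \<lhd> free_Abelian_group S"
  by (rule comm_group.normal_iff_subgroup[OF abelian_free_Abelian_group, THEN iffD2, OF fker_subgroup])

lemma fker_keys: "z \<in> fker S R \<Longrightarrow> keys z \<subseteq> S"
  using subgroup.subset[OF fker_subgroup] by (auto simp: free_Abelian_group_def)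

lemma fker_0: "0 \<in> fker S R"
  using subgroup.one_closed[OF fker_subgroup] by simp

lemma fker_add: "a \<in> fker S R \<Longrightarrow> b \<in> fker S R \<Longrightarrow> a + b \<in> fker S R"
  using subgroup.m_closed[OF fker_subgroup, of a b] by simp

lemma fker_minus: "a \<in> fker S R \<Longrightarrow> - a \<in> fker S R"
  using subgroup.m_inv_closed[OF fker_subgroup, of a] fker_keys[of a] by simp

lemma fker_diff: "a \<in> fker S R \<Longrightarrow> b \<in> fker S R \<Longrightarrow> a - b \<in> fker S R"
  using fker_add[of a "- b"] fker_minus[of b] by simp

lemma fker_sum: "(\<And>i. i \<in> I \<Longrightarrow> f i \<in> fker S R) \<Longrightarrow> sum f I \<in> fker S R"
  by (induction I rule: infinite_finite_induct) (auto intro: fker_0 fker_add)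

lemma fker_rel: "a \<in> R \<Longrightarrow> a \<in> fker S R"
  unfolding fker_def by (rule generate.incl)

lemma fker_map:
  fixes \<phi> :: "('x \<Rightarrow>\<^sub>0 int) \<Rightarrow> 'g::ab_group_add"
  assumes add: "\<And>a b. \<phi> (a + b) = \<phi> a + \<phi> b"
    and H: "0 \<in> H" "\<And>x y. x \<in> H \<Longrightarrow> y \<in> H \<Longrightarrow> x + y \<in> H" "\<And>x. x \<in> H \<Longrightarrow> - x \<in> H"
    and rel: "\<And>a. a \<in> R \<Longrightarrow> \<phi> a \<in> H"
    and z: "z \<in> fker S R"
  shows "\<phi> z \<in> H"
proof -
  have 0: "\<phi> 0 = 0" using add[of 0 0] by simp
  have m: "\<phi> (- a) = - \<phi> a" for a using add[of a "- a"] by (simp add: 0 eq_neg_iff_add_eq_0 add.commute)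
  show ?thesis using z unfolding fker_def
  proof (induction z rule: generate.induct)
    case (inv h)
    have "keys h \<subseteq> S" using R inv by blast
    then show ?case using inv rel m H(3) by simp
  qed (simp_all add: 0 H rel add)
qed

lemma fcls_alt: "keys z \<subseteq> S \<Longrightarrow> fcls S R z = {a + z | a. a \<in> fker S R}"
  by (auto simp: fcls_def r_coset_def)

lemma fcls_eq_iff:
  assumes "keys y \<subseteq> S" "keys z \<subseteq> S"
  shows "fcls S R y = fcls S R z \<longleftrightarrow> y - z \<in> fker S R"
proof
  assume "fcls S R y = fcls S R z"
  moreover have "y \<in> fcls S R y" using fker_0 assms by (force simp: fcls_alt)
  ultimately show "y - z \<in> fker S R" using assms by (auto simp: fcls_alt)
next
  assume *: "y - z \<in> fker S R"
  then have "z - y \<in> fker S R" using fker_minus[of "y - z"] by simp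
  have "a + y \<in> fcls S R z" if "a \<in> fker S R" for a
    using fker_add[OF that *] assms by (auto simp: fcls_alt intro!: exI[of _ "a + (y - z)"])
  moreover have "a + z \<in> fcls S R y" if "a \<in> fker S R" for a
    using fker_add[OF that \<open>z - y \<in> _\<close>] assms by (auto simp: fcls_alt intro!: exI[of _ "a + (z - y)"])
  ultimately show "fcls S R y = fcls S R z" using assms by (auto simp: fcls_alt)
qed

lemma fgrp_comm_group: "comm_group (fgrp S R)"
  unfolding fgrp_def by (rule comm_group.abelian_FactGroup[OF abelian_free_Abelian_group fker_subgroup])

lemma fgrp_carrier: "carrier (fgrp S R) = fcls S R ` {z. keys z \<subseteq> S}"
  by (auto simp: fgrp_def carrier_FactGroup fcls_def free_Abelian_group_def)

lemma fcls_closed: "keys z \<subseteq> S \<Longrightarrow> fcls S R z \<in> carrier (fgrp S R)"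
  by (auto simp: fgrp_carrier)

lemma fcls_mult: "keys y \<subseteq> S \<Longrightarrow> keys z \<subseteq> S \<Longrightarrow>
    fcls S R y \<otimes>\<^bsub>fgrp S R\<^esub> fcls S R z = fcls S R (y + z)"
  using normal.rcos_sum[OF fker_normal, of y z] by (simp add: fgrp_def fcls_def)

lemma fcls_0: "fcls S R 0 = \<one>\<^bsub>fgrp S R\<^esub>"
  by (simp add: fcls_alt fgrp_def)

lemma fcls_finprod: "(\<And>i. i \<in> I \<Longrightarrow> keys (f i) \<subseteq> S) \<Longrightarrow> finite I \<Longrightarrow>
    finprod (fgrp S R) (\<lambda>i. fcls S R (f i)) I = fcls S R (sum f I)"
proof -
  interpret comm_group "fgrp S R" by (rule fgrp_comm_group)
  assume "finite I" "\<And>i. i \<in> I \<Longrightarrow> keys (f i) \<subseteq> S"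
  then show ?thesis
  proof (induction I rule: finite_induct)
    case (insert x F)
    then have "(\<lambda>i. fcls S R (f i)) \<in> F \<rightarrow> carrier (fgrp S R)" by (auto intro: fcls_closed)
    with insert show ?case by (simp add: fcls_closed fcls_mult keys_sumI)
  qed (simp add: fcls_0)
qed

lemma fcls_inv: "keys z \<subseteq> S \<Longrightarrow> inv\<^bsub>fgrp S R\<^esub> fcls S R z = fcls S R (- z)"
proof -
  interpret comm_group "fgrp S R" by (rule fgrp_comm_group)
  assume z: "keys z \<subseteq> S"
  show ?thesis
    by (rule inv_equality) (use z in \<open>simp_all add: fcls_mult fcls_0 fcls_closed\<close>)
qed

lemma fcls_pow_sign: "keys z \<subseteq> S \<Longrightarrow> fcls S R z [^]\<^bsub>fgrp S R\<^esub> ((-1) ^ n :: int) = fcls S R (frag_cmul ((-1) ^ n) z)"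
proof -
  interpret comm_group "fgrp S R" by (rule fgrp_comm_group)
  assume z: "keys z \<subseteq> S"
  have "fcls S R z [^]\<^bsub>fgrp S R\<^esub> (- 1 :: int) = fcls S R (- z)"
    using z by (subst int_pow_neg) (simp_all add: fcls_closed fcls_inv int_pow_1)
  moreover have "fcls S R z [^]\<^bsub>fgrp S R\<^esub> (1 :: int) = fcls S R z"
    using z by (simp add: fcls_closed int_pow_1)
  ultimately show ?thesis by (cases "even n") simp_all
qed

lemma rep_fcls:
  assumes "keys z \<subseteq> S"
  shows "keys (rep (fcls S R z)) \<subseteq> S" "rep (fcls S R z) - z \<in> fker S R"
proof -
  have "z \<in> fcls S R z" using fker_0 assms by (force simp: fcls_alt)
  then have "rep (fcls S R z) \<in> fcls S R z" unfolding rep_def by (rule someI)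
  then obtain a where a: "a \<in> fker S R" "rep (fcls S R z) = a + z"
    using assms by (auto simp: fcls_alt)
  then show "keys (rep (fcls S R z)) \<subseteq> S" "rep (fcls S R z) - z \<in> fker S R"
    using keys_addI[OF fker_keys[OF a(1)] assms] a(1) by simp_all
qed

lemma fgrp_universal:
  assumes G: "comm_group G" and f: "\<And>x. x \<in> S \<Longrightarrow> f x \<in> carrier G"
    and rel: "\<And>h a. h \<in> hom (free_Abelian_group S) G \<Longrightarrow> (\<And>x. x \<in> S \<Longrightarrow> h (frag_of x) = f x) \<Longrightarrow>
      a \<in> R \<Longrightarrow> h a = \<one>\<^bsub>G\<^esub>"
  obtains \<psi> where "\<psi> \<in> hom (fgrp S R) G" "\<And>x. x \<in> S \<Longrightarrow> \<psi> (fcls S R (frag_of x)) = f x"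
proof -
  interpret G: comm_group G by (rule G)
  have im: "f ` S \<subseteq> carrier G" using f by auto
  obtain h where h: "h \<in> hom (free_Abelian_group S) G" "\<And>x. x \<in> S \<Longrightarrow> h (frag_of x) = f x"
    using G.free_Abelian_group_universal[OF im] by blast
  interpret h: group_hom "free_Abelian_group S" G h
    by (intro group_hom.intro group_hom_axioms.intro group_free_Abelian_group G.is_group h(1))
  have k: "h z = \<one>\<^bsub>G\<^esub>" if "z \<in> fker S R" for z
  proof -
    have "fker S R \<subseteq> kernel (free_Abelian_group S) G h"
      unfolding fker_def
    proof (rule group.generate_subgroup_incl[OF group_free_Abelian_group _ h.subgroup_kernel])
      show "R \<subseteq> kernel (free_Abelian_group S) G h"
        using R rel[OF h] by (auto simp: kernel_def)
    qed
    then show ?thesis using that by (auto simp: kernel_def)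
  qed
  define \<psi> where "\<psi> X = h (rep X)" for X
  have v: "\<psi> (fcls S R z) = h z" if z: "keys z \<subseteq> S" for z
  proof -
    have "h (rep (fcls S R z)) = h ((rep (fcls S R z) - z) \<otimes>\<^bsub>free_Abelian_group S\<^esub> z)" by simp
    also have "\<dots> = h (rep (fcls S R z) - z) \<otimes>\<^bsub>G\<^esub> h z"
      using rep_fcls[OF z] z by (intro h.hom_mult) (simp_all add: fker_keys)
    also have "\<dots> = h z"
      using k[OF rep_fcls(2)[OF z]] h.hom_closed[of z] z by simp
    finally show ?thesis by (simp add: \<psi>_def)
  qed
  have "\<psi> \<in> hom (fgrp S R) G"
  proof (rule homI)
    fix X assume "X \<in> carrier (fgrp S R)"
    then obtain z where "keys z \<subseteq> S" "X = fcls S R z" by (auto simp: fgrp_carrier)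
    then show "\<psi> X \<in> carrier G" using h.hom_closed[of z] by (simp add: v)
  next
    fix X Y assume "X \<in> carrier (fgrp S R)" "Y \<in> carrier (fgrp S R)"
    then obtain y z where "keys y \<subseteq> S" "Y = fcls S R y" "keys z \<subseteq> S" "X = fcls S R z"
      by (auto simp: fgrp_carrier)
    then show "\<psi> (X \<otimes>\<^bsub>fgrp S R\<^esub> Y) = \<psi> X \<otimes>\<^bsub>G\<^esub> \<psi> Y"
      using h.hom_mult[of z y] by (simp add: v fcls_mult keys_addI)
  qed
  moreover have "\<psi> (fcls S R (frag_of x)) = f x" if "x \<in> S" for x
    using that by (simp add: v h(2))
  ultimately show thesis by (rule that)
qed

end

lemma frag_extend_fun_diff:
  "frag_extend (\<lambda>x. f x - g x) c = frag_extend f c - frag_extend g c"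
  using subset_UNIV[of "keys c"]
  by (induction c rule: frag_induction) (auto simp: frag_extend_diff)

lemma frag_extend_in:
  assumes c: "keys c \<subseteq> S" and 0: "0 \<in> H" and d: "\<And>x y. x \<in> H \<Longrightarrow> y \<in> H \<Longrightarrow> x - y \<in> H"
    and f: "\<And>x. x \<in> S \<Longrightarrow> f x \<in> H"
  shows "frag_extend f c \<in> H"
  using c by (induction c rule: frag_induction) (auto simp: frag_extend_diff intro: assms)

section \<open>Tensor powers\<close>

locale bimod =
  fixes A :: "('a, 'r) ring_scheme" and M :: "('a, 'b, 'm) bimodule_scheme"
  assumes add_cl: "x \<in> carrier M \<Longrightarrow> y \<in> carrier M \<Longrightarrow> x \<oplus>\<^bsub>M\<^esub> y \<in> carrier M"
    and smult_cl: "a \<in> carrier A \<Longrightarrow> x \<in> carrier M \<Longrightarrow> a \<odot>\<^bsub>M\<^esub> x \<in> carrier M"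
    and rsmult_cl: "a \<in> carrier A \<Longrightarrow> x \<in> carrier M \<Longrightarrow> rsmult M x a \<in> carrier M"
    and smult_add: "a \<in> carrier A \<Longrightarrow> x \<in> carrier M \<Longrightarrow> y \<in> carrier M \<Longrightarrow>
        a \<odot>\<^bsub>M\<^esub> (x \<oplus>\<^bsub>M\<^esub> y) = (a \<odot>\<^bsub>M\<^esub> x) \<oplus>\<^bsub>M\<^esub> (a \<odot>\<^bsub>M\<^esub> y)"
    and rsmult_add: "a \<in> carrier A \<Longrightarrow> x \<in> carrier M \<Longrightarrow> y \<in> carrier M \<Longrightarrow>
        rsmult M (x \<oplus>\<^bsub>M\<^esub> y) a = rsmult M x a \<oplus>\<^bsub>M\<^esub> rsmult M y a"
    and bi: "a \<in> carrier A \<Longrightarrow> b \<in> carrier A \<Longrightarrow> x \<in> carrier M \<Longrightarrow>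
        rsmult M (a \<odot>\<^bsub>M\<^esub> x) b = a \<odot>\<^bsub>M\<^esub> rsmult M x b"
begin

abbreviation "Kt \<equiv> tensor_ker A M"
abbreviation "Tp \<equiv> tensor_power A M"
abbreviation "tc \<equiv> tensor_cls A M"
abbreviation "tup \<equiv> tuples M"

lemma tensor_folds:
  "fker (tup k) (tensor_rels A M k) = Kt k" "fgrp (tup k) (tensor_rels A M k) = Tp k"
  "fcls (tup k) (tensor_rels A M k) = tc k"
  by (simp_all add: fker_def fgrp_def fcls_def[abs_def] tensor_ker_def tensor_power_def tensor_cls_def[abs_def])

lemma tensor_rels_sub: "tensor_rels A M k \<subseteq> {c. keys c \<subseteq> tup k}"
proof
  fix c assume "c \<in> tensor_rels A M k"
  then consider xs x y ys where "c = frag_of (xs @ [x \<oplus>\<^bsub>M\<^esub> y] @ ys) - frag_of (xs @ [x] @ ys) - frag_of (xs @ [y] @ ys)"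
      "xs @ [x] @ ys \<in> tup k" "y \<in> carrier M"
    | xs x y ys a where "c = frag_of (xs @ [rsmult M x a, y] @ ys) - frag_of (xs @ [x, a \<odot>\<^bsub>M\<^esub> y] @ ys)"
      "xs @ [x, y] @ ys \<in> tup k" "a \<in> carrier A"
    unfolding tensor_rels_def by blast
  then show "c \<in> {c. keys c \<subseteq> tup k}"
  proof cases
    case 1
    show ?thesis unfolding 1(1)
      by (intro CollectI keys_diffI) (use 1 in \<open>simp_all add: tuples_def add_cl\<close>)
  next
    case 2
    show ?thesis unfolding 2(1)
      by (intro CollectI keys_diffI) (use 2 in \<open>simp_all add: tuples_def smult_cl rsmult_cl\<close>)
  qed
qed

lemmas Kt_0 = fker_0[OF tensor_rels_sub, unfolded tensor_folds]
  and Kt_add = fker_add[OF tensor_rels_sub, unfolded tensor_folds]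
  and Kt_minus = fker_minus[OF tensor_rels_sub, unfolded tensor_folds]
  and Kt_diff = fker_diff[OF tensor_rels_sub, unfolded tensor_folds]
  and Kt_sum = fker_sum[OF tensor_rels_sub, unfolded tensor_folds]
  and Kt_rel = fker_rel[OF tensor_rels_sub, unfolded tensor_folds]
  and Kt_map = fker_map[OF tensor_rels_sub, unfolded tensor_folds]
  and tc_eq_iff = fcls_eq_iff[OF tensor_rels_sub, unfolded tensor_folds]
  and Tp_comm_group = fgrp_comm_group[OF tensor_rels_sub, unfolded tensor_folds]
  and Tp_carrier = fgrp_carrier[OF tensor_rels_sub, unfolded tensor_folds]
  and tc_closed = fcls_closed[OF tensor_rels_sub, unfolded tensor_folds]
  and tc_mult = fcls_mult[OF tensor_rels_sub, unfolded tensor_folds]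
  and tc_0 = fcls_0[OF tensor_rels_sub, unfolded tensor_folds]
  and tc_finprod = fcls_finprod[OF tensor_rels_sub, unfolded tensor_folds]
  and tc_pow_sign = fcls_pow_sign[OF tensor_rels_sub, unfolded tensor_folds]
  and rep_tc = rep_fcls[OF tensor_rels_sub, unfolded tensor_folds]

lemma Kt_add_rel:
  assumes "set xs \<subseteq> carrier M" "set ys \<subseteq> carrier M" "x \<in> carrier M" "y \<in> carrier M"
    "length xs + length ys + 1 = k"
  shows "frag_of (xs @ (x \<oplus>\<^bsub>M\<^esub> y) # ys) - frag_of (xs @ x # ys) - frag_of (xs @ y # ys) \<in> Kt k"
  by (rule Kt_rel, unfold tensor_rels_def, rule UnI1, rule CollectI,
      rule exI[of _ xs], rule exI[of _ x], rule exI[of _ y], rule exI[of _ ys])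
    (use assms in \<open>simp add: tuples_def\<close>)

lemma Kt_bal_rel:
  assumes "set xs \<subseteq> carrier M" "set ys \<subseteq> carrier M" "x \<in> carrier M" "y \<in> carrier M" "a \<in> carrier A"
    "length xs + length ys + 2 = k"
  shows "frag_of (xs @ rsmult M x a # y # ys) - frag_of (xs @ x # (a \<odot>\<^bsub>M\<^esub> y) # ys) \<in> Kt k"
  by (rule Kt_rel, unfold tensor_rels_def, rule UnI2, rule CollectI,
      rule exI[of _ xs], rule exI[of _ x], rule exI[of _ y], rule exI[of _ ys], rule exI[of _ a])
    (use assms in \<open>simp add: tuples_def\<close>)

text \<open>A map on tuples factors through the tensor power when it respects the relations. Membership in a
  set \<open>H\<close> replaces equality to \<open>0\<close>, so that targets which are themselves quotients are covered.\<close>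

lemma Kt_extend:
  assumes add: "\<And>a b. \<phi> (a + b) = \<phi> a + \<phi> (b :: 'b list \<Rightarrow>\<^sub>0 int)"
    and H: "0 \<in> H" "\<And>x y. x \<in> H \<Longrightarrow> y \<in> H \<Longrightarrow> x + y \<in> H" "\<And>x. x \<in> H \<Longrightarrow> - x \<in> (H :: 'g::ab_group_add set)"
    and r1: "\<And>xs x y ys. set xs \<subseteq> carrier M \<Longrightarrow> set ys \<subseteq> carrier M \<Longrightarrow> x \<in> carrier M \<Longrightarrow> y \<in> carrier M \<Longrightarrow>
      length xs + length ys + 1 = k \<Longrightarrow>
      \<phi> (frag_of (xs @ (x \<oplus>\<^bsub>M\<^esub> y) # ys)) - \<phi> (frag_of (xs @ x # ys)) - \<phi> (frag_of (xs @ y # ys)) \<in> H"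
    and r2: "\<And>xs x y ys a. set xs \<subseteq> carrier M \<Longrightarrow> set ys \<subseteq> carrier M \<Longrightarrow> x \<in> carrier M \<Longrightarrow> y \<in> carrier M \<Longrightarrow>
      a \<in> carrier A \<Longrightarrow> length xs + length ys + 2 = k \<Longrightarrow>
      \<phi> (frag_of (xs @ rsmult M x a # y # ys)) - \<phi> (frag_of (xs @ x # (a \<odot>\<^bsub>M\<^esub> y) # ys)) \<in> H"
    and z: "z \<in> Kt k"
  shows "\<phi> z \<in> H"
proof (rule Kt_map[OF add H _ z])
  have d: "\<phi> (a - b) = \<phi> a - \<phi> b" for a b using add[of "a - b" b] by simp
  fix c assume "c \<in> tensor_rels A M k"
  then consider xs x y ys where "c = frag_of (xs @ [x \<oplus>\<^bsub>M\<^esub> y] @ ys) - frag_of (xs @ [x] @ ys) - frag_of (xs @ [y] @ ys)"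
      "xs @ [x] @ ys \<in> tup k" "y \<in> carrier M"
    | xs x y ys a where "c = frag_of (xs @ [rsmult M x a, y] @ ys) - frag_of (xs @ [x, a \<odot>\<^bsub>M\<^esub> y] @ ys)"
      "xs @ [x, y] @ ys \<in> tup k" "a \<in> carrier A"
    unfolding tensor_rels_def by blast
  then show "\<phi> c \<in> H"
  proof cases
    case 1
    then show ?thesis using r1[of xs ys x y] by (simp add: d tuples_def)
  next
    case 2
    then show ?thesis using r2[of xs ys x y a] by (simp add: d tuples_def)
  qed
qed

lemma Kt2_extend:
  assumes add: "\<And>a b. \<phi> (a + b) = \<phi> a + \<phi> (b :: 'b list \<Rightarrow>\<^sub>0 int)"
    and H: "0 \<in> H" "\<And>x y. x \<in> H \<Longrightarrow> y \<in> H \<Longrightarrow> x + y \<in> H" "\<And>x. x \<in> H \<Longrightarrow> - x \<in> (H :: 'g::ab_group_add set)"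
    and r1: "\<And>x x' y. x \<in> carrier M \<Longrightarrow> x' \<in> carrier M \<Longrightarrow> y \<in> carrier M \<Longrightarrow>
      \<phi> (frag_of [x \<oplus>\<^bsub>M\<^esub> x', y]) - \<phi> (frag_of [x, y]) - \<phi> (frag_of [x', y]) \<in> H"
    and r1': "\<And>x y y'. x \<in> carrier M \<Longrightarrow> y' \<in> carrier M \<Longrightarrow> y \<in> carrier M \<Longrightarrow>
      \<phi> (frag_of [x, y \<oplus>\<^bsub>M\<^esub> y']) - \<phi> (frag_of [x, y]) - \<phi> (frag_of [x, y']) \<in> H"
    and r2: "\<And>x y a. x \<in> carrier M \<Longrightarrow> y \<in> carrier M \<Longrightarrow> a \<in> carrier A \<Longrightarrow>
      \<phi> (frag_of [rsmult M x a, y]) - \<phi> (frag_of [x, a \<odot>\<^bsub>M\<^esub> y]) \<in> H"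
    and z: "z \<in> Kt 2"
  shows "\<phi> z \<in> H"
proof (rule Kt_extend[OF add H _ _ z])
  fix xs ys :: "'b list" and x y
  assume a: "set xs \<subseteq> carrier M" "set ys \<subseteq> carrier M" "x \<in> carrier M" "y \<in> carrier M"
  {
    assume "length xs + length ys + 1 = 2"
    then consider w where "xs = []" "ys = [w]" | w where "xs = [w]" "ys = []"
      by (cases xs; cases ys) auto
    then show "\<phi> (frag_of (xs @ (x \<oplus>\<^bsub>M\<^esub> y) # ys)) - \<phi> (frag_of (xs @ x # ys)) - \<phi> (frag_of (xs @ y # ys)) \<in> H"
      using a by cases (simp_all add: r1 r1')
  next
    fix b assume "b \<in> carrier A" "length xs + length ys + 2 = 2"
    then show "\<phi> (frag_of (xs @ rsmult M x b # y # ys)) - \<phi> (frag_of (xs @ x # (b \<odot>\<^bsub>M\<^esub> y) # ys)) \<in> H"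
      using a by (simp add: r2)
  }
qed

lemma tens_closed: "set xs \<subseteq> carrier M \<Longrightarrow> tens A M xs \<in> carrier (Tp (length xs))"
  unfolding tens_def by (rule tc_closed) (auto simp: tuples_def)

lemma tens2: "tens A M [x, y] = tc 2 (frag_of [x, y])"
  by (simp add: tens_def numeral_2_eq_2)

lemma tup2: "[x, y] \<in> tup 2 \<longleftrightarrow> x \<in> carrier M \<and> y \<in> carrier M"
  by (simp add: tuples_def)

lemma tup2_cases: "ys \<in> tup 2 \<Longrightarrow> \<exists>x y. ys = [x, y] \<and> x \<in> carrier M \<and> y \<in> carrier M"
  by (auto simp: tuples_def length_Suc_conv numeral_2_eq_2)

lemma lact_tc:
  assumes a: "a \<in> carrier A" and z: "keys z \<subseteq> tup 2"
  shows "tensor_lact A M 2 a (tc 2 z) = tc 2 (frag_extend (\<lambda>xs. frag_of ((a \<odot>\<^bsub>M\<^esub> hd xs) # tl xs)) z)"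
    and "keys (frag_extend (\<lambda>xs. frag_of ((a \<odot>\<^bsub>M\<^esub> hd xs) # tl xs)) z) \<subseteq> tup 2"
proof -
  let ?f = "\<lambda>xs. frag_of ((a \<odot>\<^bsub>M\<^esub> hd xs) # tl xs)"
  have k: "keys (frag_extend ?f z) \<subseteq> tup 2" if "keys z \<subseteq> tup 2" for z
    using keys_frag_extend[of ?f z] that a by (fastforce dest: tup2_cases simp: tup2 smult_cl)
  show "keys (frag_extend ?f z) \<subseteq> tup 2" by (rule k[OF z])
  have "frag_extend ?f y \<in> Kt 2" if "y \<in> Kt 2" for y
  proof (rule Kt2_extend[OF frag_extend_add Kt_0 Kt_add Kt_minus _ _ _ that])
    fix x x' y assume "x \<in> carrier M" "x' \<in> carrier M" "y \<in> carrier M"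
    then show "frag_extend ?f (frag_of [x \<oplus>\<^bsub>M\<^esub> x', y]) - frag_extend ?f (frag_of [x, y]) - frag_extend ?f (frag_of [x', y]) \<in> Kt 2"
      using Kt_add_rel[of "[]" "[y]" "a \<odot>\<^bsub>M\<^esub> x" "a \<odot>\<^bsub>M\<^esub> x'" 2] a by (simp add: smult_add smult_cl)
  next
    fix x y' y assume "x \<in> carrier M" "y' \<in> carrier M" "y \<in> carrier M"
    then show "frag_extend ?f (frag_of [x, y \<oplus>\<^bsub>M\<^esub> y']) - frag_extend ?f (frag_of [x, y]) - frag_extend ?f (frag_of [x, y']) \<in> Kt 2"
      using Kt_add_rel[of "[a \<odot>\<^bsub>M\<^esub> x]" "[]" y y' 2] a by (simp add: smult_cl)
  next
    fix x y b assume "x \<in> carrier M" "y \<in> carrier M" "b \<in> carrier A"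
    then show "frag_extend ?f (frag_of [rsmult M x b, y]) - frag_extend ?f (frag_of [x, b \<odot>\<^bsub>M\<^esub> y]) \<in> Kt 2"
      using Kt_bal_rel[of "[]" "[]" "a \<odot>\<^bsub>M\<^esub> x" y b 2] a by (simp add: smult_cl bi)
  qed
  from this[OF rep_tc(2)[OF z]]
  show "tensor_lact A M 2 a (tc 2 z) = tc 2 (frag_extend ?f z)"
    unfolding tensor_lact_def by (subst tc_eq_iff) (simp_all add: k z rep_tc frag_extend_diff)
qed

lemma ract_tc:
  assumes a: "a \<in> carrier A" and z: "keys z \<subseteq> tup 2"
  shows "tensor_ract A M 2 (tc 2 z) a = tc 2 (frag_extend (\<lambda>xs. frag_of (butlast xs @ [rsmult M (last xs) a])) z)"
    and "keys (frag_extend (\<lambda>xs. frag_of (butlast xs @ [rsmult M (last xs) a])) z) \<subseteq> tup 2"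
proof -
  let ?f = "\<lambda>xs. frag_of (butlast xs @ [rsmult M (last xs) a])"
  have k: "keys (frag_extend ?f z) \<subseteq> tup 2" if "keys z \<subseteq> tup 2" for z
    using keys_frag_extend[of ?f z] that a by (fastforce dest: tup2_cases simp: tup2 rsmult_cl)
  show "keys (frag_extend ?f z) \<subseteq> tup 2" by (rule k[OF z])
  have "frag_extend ?f y \<in> Kt 2" if "y \<in> Kt 2" for y
  proof (rule Kt2_extend[OF frag_extend_add Kt_0 Kt_add Kt_minus _ _ _ that])
    fix x x' y assume "x \<in> carrier M" "x' \<in> carrier M" "y \<in> carrier M"
    then show "frag_extend ?f (frag_of [x \<oplus>\<^bsub>M\<^esub> x', y]) - frag_extend ?f (frag_of [x, y]) - frag_extend ?f (frag_of [x', y]) \<in> Kt 2"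
      using Kt_add_rel[of "[]" "[rsmult M y a]" x x' 2] a by (simp add: rsmult_cl)
  next
    fix x y' y assume "x \<in> carrier M" "y' \<in> carrier M" "y \<in> carrier M"
    then show "frag_extend ?f (frag_of [x, y \<oplus>\<^bsub>M\<^esub> y']) - frag_extend ?f (frag_of [x, y]) - frag_extend ?f (frag_of [x, y']) \<in> Kt 2"
      using Kt_add_rel[of "[x]" "[]" "rsmult M y a" "rsmult M y' a" 2] a by (simp add: rsmult_add rsmult_cl)
  next
    fix x y b assume "x \<in> carrier M" "y \<in> carrier M" "b \<in> carrier A"
    then show "frag_extend ?f (frag_of [rsmult M x b, y]) - frag_extend ?f (frag_of [x, b \<odot>\<^bsub>M\<^esub> y]) \<in> Kt 2"
      using Kt_bal_rel[of "[]" "[]" x "rsmult M y a" b 2] a by (simp add: rsmult_cl bi)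
  qed
  from this[OF rep_tc(2)[OF z]]
  show "tensor_ract A M 2 (tc 2 z) a = tc 2 (frag_extend ?f z)"
    unfolding tensor_ract_def by (subst tc_eq_iff) (simp_all add: k z rep_tc frag_extend_diff)
qed

subsection \<open>Acting on two neighbouring factors\<close>

text \<open>Completes a tensor in some neighbouring factors by the factors \<open>u\<close> before and \<open>v\<close> after them.\<close>

definition ins :: "'b list \<Rightarrow> 'b list \<Rightarrow> ('b list \<Rightarrow>\<^sub>0 int) \<Rightarrow> ('b list \<Rightarrow>\<^sub>0 int)" where
  "ins u v = frag_extend (\<lambda>ys. frag_of (u @ ys @ v))"

lemma ins_of [simp]: "ins u v (frag_of ys) = frag_of (u @ ys @ v)"
  by (simp add: ins_def)

lemma ins_add: "ins u v (y + z) = ins u v y + ins u v z" and ins_diff: "ins u v (y - z) = ins u v y - ins u v z"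
  by (simp_all add: ins_def frag_extend_add frag_extend_diff)

lemma ins_keys:
  assumes "keys z \<subseteq> tup m" "set u \<subseteq> carrier M" "set v \<subseteq> carrier M" "length u + m + length v = k"
  shows "keys (ins u v z) \<subseteq> tup k"
  unfolding ins_def using keys_frag_extend[of "\<lambda>ys. frag_of (u @ ys @ v)" z] assms
  by (fastforce simp: tuples_def)

lemma ins_Kt:
  assumes uv: "set u \<subseteq> carrier M" "set v \<subseteq> carrier M" "length u + m + length v = k" and z: "z \<in> Kt m"
  shows "ins u v z \<in> Kt k"
proof (rule Kt_extend[OF ins_add Kt_0 Kt_add Kt_minus _ _ z])
  fix xs ys :: "'b list" and x y
  assume a: "set xs \<subseteq> carrier M" "set ys \<subseteq> carrier M" "x \<in> carrier M" "y \<in> carrier M"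
  {
    assume "length xs + length ys + 1 = m"
    then show "ins u v (frag_of (xs @ (x \<oplus>\<^bsub>M\<^esub> y) # ys)) - ins u v (frag_of (xs @ x # ys)) - ins u v (frag_of (xs @ y # ys)) \<in> Kt k"
      using a uv Kt_add_rel[of "u @ xs" "ys @ v" x y k] by simp
  next
    fix b assume "b \<in> carrier A" "length xs + length ys + 2 = m"
    then show "ins u v (frag_of (xs @ rsmult M x b # y # ys)) - ins u v (frag_of (xs @ x # (b \<odot>\<^bsub>M\<^esub> y) # ys)) \<in> Kt k"
      using a uv Kt_bal_rel[of "u @ xs" "ys @ v" x y b k] by simp
  }
qed

lemma ins_outer_add:
  assumes z: "keys z \<subseteq> tup 2" and c: "set u \<subseteq> carrier M" "set u' \<subseteq> carrier M" "set v \<subseteq> carrier M"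
      "x \<in> carrier M" "y \<in> carrier M"
  shows "length u + length u' + length v + 3 = k \<Longrightarrow>
      ins (u @ (x \<oplus>\<^bsub>M\<^esub> y) # u') v z - ins (u @ x # u') v z - ins (u @ y # u') v z \<in> Kt k"
    and "length u + length u' + length v + 3 = k \<Longrightarrow>
      ins u (u' @ (x \<oplus>\<^bsub>M\<^esub> y) # v) z - ins u (u' @ x # v) z - ins u (u' @ y # v) z \<in> Kt k"
proof -
  assume k: "length u + length u' + length v + 3 = k"
  show "ins (u @ (x \<oplus>\<^bsub>M\<^esub> y) # u') v z - ins (u @ x # u') v z - ins (u @ y # u') v z \<in> Kt k"
    unfolding ins_def frag_extend_fun_diff[symmetric]
  proof (rule frag_extend_in[OF z Kt_0 Kt_diff])
    fix ys assume "ys \<in> tup 2"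
    then show "frag_of ((u @ (x \<oplus>\<^bsub>M\<^esub> y) # u') @ ys @ v) - frag_of ((u @ x # u') @ ys @ v)
        - frag_of ((u @ y # u') @ ys @ v) \<in> Kt k"
      using Kt_add_rel[of u "u' @ ys @ v" x y k] c k by (simp add: tuples_def)
  qed
  show "ins u (u' @ (x \<oplus>\<^bsub>M\<^esub> y) # v) z - ins u (u' @ x # v) z - ins u (u' @ y # v) z \<in> Kt k"
    unfolding ins_def frag_extend_fun_diff[symmetric]
  proof (rule frag_extend_in[OF z Kt_0 Kt_diff])
    fix ys assume "ys \<in> tup 2"
    then show "frag_of (u @ ys @ u' @ (x \<oplus>\<^bsub>M\<^esub> y) # v) - frag_of (u @ ys @ u' @ x # v)
        - frag_of (u @ ys @ u' @ y # v) \<in> Kt k"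
      using Kt_add_rel[of "u @ ys @ u'" v x y k] c k by (simp add: tuples_def)
  qed
qed

lemma ins_outer_bal:
  assumes z: "keys z \<subseteq> tup 2" and c: "set u \<subseteq> carrier M" "set u' \<subseteq> carrier M" "set v \<subseteq> carrier M"
      "x \<in> carrier M" "y \<in> carrier M" "a \<in> carrier A"
  shows "length u + length u' + length v + 4 = k \<Longrightarrow>
      ins (u @ rsmult M x a # y # u') v z - ins (u @ x # (a \<odot>\<^bsub>M\<^esub> y) # u') v z \<in> Kt k"
    and "length u + length u' + length v + 4 = k \<Longrightarrow>
      ins u (u' @ rsmult M x a # y # v) z - ins u (u' @ x # (a \<odot>\<^bsub>M\<^esub> y) # v) z \<in> Kt k"
proof -
  assume k: "length u + length u' + length v + 4 = k"
  show "ins (u @ rsmult M x a # y # u') v z - ins (u @ x # (a \<odot>\<^bsub>M\<^esub> y) # u') v z \<in> Kt k"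
    unfolding ins_def frag_extend_fun_diff[symmetric]
  proof (rule frag_extend_in[OF z Kt_0 Kt_diff])
    fix ys assume "ys \<in> tup 2"
    then show "frag_of ((u @ rsmult M x a # y # u') @ ys @ v) - frag_of ((u @ x # (a \<odot>\<^bsub>M\<^esub> y) # u') @ ys @ v) \<in> Kt k"
      using Kt_bal_rel[of u "u' @ ys @ v" x y a k] c k by (simp add: tuples_def)
  qed
  show "ins u (u' @ rsmult M x a # y # v) z - ins u (u' @ x # (a \<odot>\<^bsub>M\<^esub> y) # v) z \<in> Kt k"
    unfolding ins_def frag_extend_fun_diff[symmetric]
  proof (rule frag_extend_in[OF z Kt_0 Kt_diff])
    fix ys assume "ys \<in> tup 2"
    then show "frag_of (u @ ys @ u' @ rsmult M x a # y # v) - frag_of (u @ ys @ u' @ x # (a \<odot>\<^bsub>M\<^esub> y) # v) \<in> Kt k"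
      using Kt_bal_rel[of "u @ ys @ u'" v x y a k] c k by (simp add: tuples_def)
  qed
qed

text \<open>A coefficient passes from the factor before a tensor square into it by the left action, and by the
  right action into the factor after it.\<close>

lemma ins_lact:
  assumes z: "keys z \<subseteq> tup 2" and c: "set u \<subseteq> carrier M" "set v \<subseteq> carrier M" "x \<in> carrier M" "a \<in> carrier A"
    and k: "length u + length v + 3 = k"
  shows "ins (u @ [rsmult M x a]) v z - ins (u @ [x]) v (frag_extend (\<lambda>xs. frag_of ((a \<odot>\<^bsub>M\<^esub> hd xs) # tl xs)) z) \<in> Kt k"
  using z
proof (induction z rule: frag_induction)
  case zero
  then show ?case by (simp add: ins_def Kt_0)
next
  case (one ys)
  then obtain y w where "ys = [y, w]" "y \<in> carrier M" "w \<in> carrier M" using tup2_cases by blast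
  then show ?case using Kt_bal_rel[of u "w # v" x y a k] c k by simp
next
  case (diff y z)
  from Kt_diff[OF this] show ?case by (simp add: ins_diff frag_extend_diff algebra_simps)
qed

lemma ins_ract:
  assumes z: "keys z \<subseteq> tup 2" and c: "set u \<subseteq> carrier M" "set v \<subseteq> carrier M" "x \<in> carrier M" "a \<in> carrier A"
    and k: "length u + length v + 3 = k"
  shows "ins u (x # v) (frag_extend (\<lambda>xs. frag_of (butlast xs @ [rsmult M (last xs) a])) z) - ins u ((a \<odot>\<^bsub>M\<^esub> x) # v) z \<in> Kt k"
  using z
proof (induction z rule: frag_induction)
  case zero
  then show ?case by (simp add: ins_def Kt_0)
next
  case (one ys)
  then obtain y w where "ys = [y, w]" "y \<in> carrier M" "w \<in> carrier M" using tup2_cases by blast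
  then show ?case using Kt_bal_rel[of "u @ [y]" v w x a k] c k by simp
next
  case (diff y z)
  from Kt_diff[OF this] show ?case by (simp add: ins_diff frag_extend_diff algebra_simps)
qed

end

section \<open>Permutations and words in neighbour transpositions\<close>

lemma perm_of_word_Nil [simp]: "perm_of_word [] = id"
  by (simp add: perm_of_word_def)

lemma perm_of_word_Cons [simp]: "perm_of_word (i # is) = transpose i (Suc i) \<circ> perm_of_word is"
  by (simp add: perm_of_word_def)

lemma perm_of_word_append: "perm_of_word (is @ js) = perm_of_word is \<circ> perm_of_word js"
  by (induction "is") (simp_all add: comp_assoc)

lemma transpose_word:
  assumes "a \<in> {1..k}" "b \<in> {1..k}" "a < b"
  shows "\<exists>is. set is \<subseteq> {1..<k} \<and> perm_of_word is = transpose a b"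
  using assms
proof (induction b)
  case (Suc b)
  show ?case
  proof (cases "a = b")
    case True
    then show ?thesis using Suc.prems by (intro exI[of _ "[b]"]) auto
  next
    case False
    then obtain "is" where i: "set is \<subseteq> {1..<k}" "perm_of_word is = transpose a b"
      using Suc by auto
    have "perm_of_word (b # is @ [b]) = transpose a (Suc b)"
      using False Suc.prems by (auto simp: perm_of_word_append i fun_eq_iff transpose_def)
    then show ?thesis using i Suc.prems False by (intro exI[of _ "b # is @ [b]"]) auto
  qed
qed simp

lemma word_exists:
  assumes "w permutes {1..k}"
  shows "\<exists>is. set is \<subseteq> {1..<k} \<and> perm_of_word is = w"
  using assms finite_atLeastAtMost
proof (induction rule: permutes_induct)
  case id
  show ?case by (intro exI[of _ "[]"]) simp
next
  case (swap a b p)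
  then obtain js where js: "set js \<subseteq> {1..<k}" "perm_of_word js = p" by blast
  consider "a < b" | "b < a" | "a = b" by linarith
  then obtain "is" where "set is \<subseteq> {1..<k}" "perm_of_word is = transpose a b"
  proof cases
    case 1
    with transpose_word[OF swap(1,2)] that show ?thesis by blast
  next
    case 2
    with transpose_word[OF swap(2,1)] that show ?thesis by (metis transpose_commute)
  next
    case 3
    then show ?thesis by (intro that[of "[]"]) auto
  qed
  then show ?case using js by (intro exI[of _ "is @ js"]) (auto simp: perm_of_word_append)
qed

lemma some_reduced_word:
  assumes "w permutes {1..k}"
  shows "set (some_reduced_word k w) \<subseteq> {1..<k}" "perm_of_word (some_reduced_word k w) = w"
proof -
  obtain "is" where "set is \<subseteq> {1..<k} \<and> perm_of_word is = w"
    using word_exists[OF assms] by blast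
  then obtain js where "set js \<subseteq> {1..<k} \<and> perm_of_word js = w"
    "\<forall>y. set y \<subseteq> {1..<k} \<and> perm_of_word y = w \<longrightarrow> length js \<le> length y"
    using ex_has_least_nat[of "\<lambda>is. set is \<subseteq> {1..<k} \<and> perm_of_word is = w" "is" length] by blast
  then have "reduced_word k w js" by (simp add: reduced_word_def)
  then have "reduced_word k w (some_reduced_word k w)"
    unfolding some_reduced_word_def by (rule someI)
  then show "set (some_reduced_word k w) \<subseteq> {1..<k}" "perm_of_word (some_reduced_word k w) = w"
    by (simp_all add: reduced_word_def)
qed

text \<open>Only for the identity does the antisymmetrizer contain a term without a braiding.\<close>

lemma some_reduced_word_id: "some_reduced_word k id = []"
proof -
  have "reduced_word k id []" by (simp add: reduced_word_def)
  then have "reduced_word k id (some_reduced_word k id)"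
    unfolding some_reduced_word_def by (rule someI)
  then have "length (some_reduced_word k id) \<le> length ([] :: nat list)"
    unfolding reduced_word_def by (elim conjE allE[of _ "[]"]) simp
  then show ?thesis by simp
qed

section \<open>The antisymmetrizer of a braiding\<close>

lemma list_split2:
  assumes "n + 2 \<le> length ys"
  shows "\<exists>u c d v. ys = u @ c # d # v \<and> length u = n"
proof -
  have "ys = take n ys @ ys ! n # ys ! Suc n # drop (Suc (Suc n)) ys"
    using assms by (metis Cons_nth_drop_Suc Suc_le_lessD add_2_eq_Suc' append_take_drop_id less_Suc_eq less_le_trans)
  then show ?thesis using assms by (metis length_take min.absorb2 add_leD1)
qed

locale braided = bimod A M
  for A :: "('a, 'r) ring_scheme" and M :: "('a, 'b, 'm) bimodule_scheme" +
  fixes L R :: "'b set" and \<sigma> :: "('b list \<Rightarrow>\<^sub>0 int) set \<Rightarrow> ('b list \<Rightarrow>\<^sub>0 int) set"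
  assumes br: "is_braiding A M L R \<sigma>"
begin

text \<open>A representative of \<open>\<sigma>(x \<otimes> y)\<close>, namely the one chosen in the definition of \<open>\<sigma>\<^sub>i\<close>.\<close>

definition rb :: "'b \<Rightarrow> 'b \<Rightarrow> ('b list \<Rightarrow>\<^sub>0 int)" where "rb x y = rep (\<sigma> (tens A M [x, y]))"

lemma rb:
  assumes "x \<in> carrier M" "y \<in> carrier M"
  shows "keys (rb x y) \<subseteq> tup 2" "tc 2 (rb x y) = \<sigma> (tens A M [x, y])"
proof -
  have "tens A M [x, y] \<in> carrier (Tp 2)" using tens_closed[of "[x, y]"] assms by (simp add: numeral_2_eq_2)
  then have "\<sigma> (tens A M [x, y]) \<in> carrier (Tp 2)"
    using br unfolding is_braiding_def hom_def by blast
  then obtain z where z: "keys z \<subseteq> tup 2" "\<sigma> (tens A M [x, y]) = tc 2 z"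
    by (auto simp: Tp_carrier)
  show "keys (rb x y) \<subseteq> tup 2" using rep_tc(1)[OF z(1)] by (simp add: rb_def z(2))
  show "tc 2 (rb x y) = \<sigma> (tens A M [x, y])"
    using rep_tc[OF z(1)] z by (simp add: rb_def tc_eq_iff)
qed

lemma tens2_add:
  assumes "x \<in> carrier M" "x' \<in> carrier M" "y \<in> carrier M"
  shows "tens A M [x \<oplus>\<^bsub>M\<^esub> x', y] = tens A M [x, y] \<otimes>\<^bsub>Tp 2\<^esub> tens A M [x', y]"
    and "tens A M [y, x \<oplus>\<^bsub>M\<^esub> x'] = tens A M [y, x] \<otimes>\<^bsub>Tp 2\<^esub> tens A M [y, x']"
  using Kt_add_rel[of "[]" "[y]" x x' 2] Kt_add_rel[of "[y]" "[]" x x' 2] assms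
  by (simp_all add: tens2 tc_mult tc_eq_iff tup2 add_cl keys_addI diff_diff_eq)

lemma sigma_mult: "X \<in> carrier (Tp 2) \<Longrightarrow> Y \<in> carrier (Tp 2) \<Longrightarrow> \<sigma> (X \<otimes>\<^bsub>Tp 2\<^esub> Y) = \<sigma> X \<otimes>\<^bsub>Tp 2\<^esub> \<sigma> Y"
  using br unfolding is_braiding_def hom_def by blast

lemma tens2_closed: "x \<in> carrier M \<Longrightarrow> y \<in> carrier M \<Longrightarrow> tens A M [x, y] \<in> carrier (Tp 2)"
  by (simp add: tens2 tc_closed tup2)

lemma rb_add:
  assumes "x \<in> carrier M" "x' \<in> carrier M" "y \<in> carrier M"
  shows "rb (x \<oplus>\<^bsub>M\<^esub> x') y - rb x y - rb x' y \<in> Kt 2"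
    and "rb y (x \<oplus>\<^bsub>M\<^esub> x') - rb y x - rb y x' \<in> Kt 2"
proof -
  have "tc 2 (rb (x \<oplus>\<^bsub>M\<^esub> x') y) = tc 2 (rb x y + rb x' y)"
    using assms by (simp add: rb add_cl tens2_add sigma_mult tens2_closed flip: tc_mult)
  then show "rb (x \<oplus>\<^bsub>M\<^esub> x') y - rb x y - rb x' y \<in> Kt 2"
    unfolding diff_diff_eq
    by (rule tc_eq_iff[THEN iffD1, rotated 2]) (simp_all add: rb(1) assms add_cl keys_addI)
  have "tc 2 (rb y (x \<oplus>\<^bsub>M\<^esub> x')) = tc 2 (rb y x + rb y x')"
    using assms by (simp add: rb add_cl tens2_add sigma_mult tens2_closed flip: tc_mult)
  then show "rb y (x \<oplus>\<^bsub>M\<^esub> x') - rb y x - rb y x' \<in> Kt 2"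
    unfolding diff_diff_eq
    by (rule tc_eq_iff[THEN iffD1, rotated 2]) (simp_all add: rb(1) assms add_cl keys_addI)
qed

lemma rb_bal:
  assumes "x \<in> carrier M" "y \<in> carrier M" "a \<in> carrier A"
  shows "rb (rsmult M x a) y = rb x (a \<odot>\<^bsub>M\<^esub> y)"
proof -
  have "tens A M [rsmult M x a, y] = tens A M [x, a \<odot>\<^bsub>M\<^esub> y]"
    using Kt_bal_rel[of "[]" "[]" x y a 2] assms by (simp add: tens2 tc_eq_iff tup2 rsmult_cl smult_cl)
  then show ?thesis by (simp add: rb_def)
qed

lemma rb_lact:
  assumes "x \<in> carrier M" "y \<in> carrier M" "a \<in> carrier A"
  shows "rb (a \<odot>\<^bsub>M\<^esub> x) y - frag_extend (\<lambda>xs. frag_of ((a \<odot>\<^bsub>M\<^esub> hd xs) # tl xs)) (rb x y) \<in> Kt 2"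
proof -
  have "tens A M [a \<odot>\<^bsub>M\<^esub> x, y] = tensor_lact A M 2 a (tens A M [x, y])"
    using assms by (simp add: tens2 lact_tc tup2)
  then have "tc 2 (rb (a \<odot>\<^bsub>M\<^esub> x) y) = tensor_lact A M 2 a (tc 2 (rb x y))"
    using assms br tens2_closed[of x y] by (simp add: rb smult_cl is_braiding_def)
  then show ?thesis unfolding lact_tc(1)[OF assms(3) rb(1)[OF assms(1,2)]]
    by (rule tc_eq_iff[THEN iffD1, rotated 2]) (simp_all add: rb(1) lact_tc(2) assms smult_cl)
qed

lemma rb_ract:
  assumes "x \<in> carrier M" "y \<in> carrier M" "a \<in> carrier A"
  shows "rb x (rsmult M y a) - frag_extend (\<lambda>xs. frag_of (butlast xs @ [rsmult M (last xs) a])) (rb x y) \<in> Kt 2"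
proof -
  have "tens A M [x, rsmult M y a] = tensor_ract A M 2 (tens A M [x, y]) a"
    using assms by (simp add: tens2 ract_tc tup2)
  then have "tc 2 (rb x (rsmult M y a)) = tensor_ract A M 2 (tc 2 (rb x y)) a"
    using assms br tens2_closed[of x y] by (simp add: rb rsmult_cl is_braiding_def)
  then show ?thesis unfolding ract_tc(1)[OF assms(3) rb(1)[OF assms(1,2)]]
    by (rule tc_eq_iff[THEN iffD1, rotated 2]) (simp_all add: rb(1) ract_tc(2) assms rsmult_cl)
qed

definition Bf :: "nat \<Rightarrow> 'b list \<Rightarrow> ('b list \<Rightarrow>\<^sub>0 int)" where
  "Bf i xs = ins (take (i - 1) xs) (drop (i + 1) xs) (rb (xs ! (i - 1)) (xs ! i))"

lemma Bf_eq: "Suc (length u) = i \<Longrightarrow> Bf i (u @ a # b # v) = ins u v (rb a b)"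
  by (auto simp: Bf_def nth_append)

lemma Bf_keys: "xs \<in> tup k \<Longrightarrow> 1 \<le> i \<Longrightarrow> i < k \<Longrightarrow> keys (Bf i xs) \<subseteq> tup k"
proof -
  assume xs: "xs \<in> tup k" and i: "1 \<le> i" "i < k"
  then have l: "length xs = k" and c: "set xs \<subseteq> carrier M" by (simp_all add: tuples_def)
  have "xs ! j \<in> carrier M" if "j < k" for j using nth_mem[of j xs] that l c by blast
  moreover have "set (take (i - 1) xs) \<subseteq> carrier M" "set (drop (i + 1) xs) \<subseteq> carrier M"
    using c set_take_subset[of "i - 1" xs] set_drop_subset[of "i + 1" xs] by blast+
  ultimately show "keys (Bf i xs) \<subseteq> tup k"
    unfolding Bf_def using i l by (intro ins_keys[OF rb(1)]) auto
qed

text \<open>The map \<open>\<sigma>\<^sub>i\<close> is well defined on the tensor power. If the relation lies inside the two factors on which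
  \<open>\<sigma>\<close> acts, it is a relation of the tensor square; if it straddles the boundary, the left and right
  linearity of \<open>\<sigma>\<close> are needed.\<close>

lemma Bf_Kt:
  assumes i: "1 \<le> i" "i < k" and z: "z \<in> Kt k"
  shows "frag_extend (Bf i) z \<in> Kt k"
proof (rule Kt_extend[OF frag_extend_add Kt_0 Kt_add Kt_minus _ _ z])
  fix xs ys :: "'b list" and x y
  assume a: "set xs \<subseteq> carrier M" "set ys \<subseteq> carrier M" "x \<in> carrier M" "y \<in> carrier M"
  {
    assume k: "length xs + length ys + 1 = k"
    let ?w = "x \<oplus>\<^bsub>M\<^esub> y"
    consider "length xs + 1 < i" | "length xs + 1 = i" | "length xs = i" | "i < length xs" by linarith
    then have "Bf i (xs @ ?w # ys) - Bf i (xs @ x # ys) - Bf i (xs @ y # ys) \<in> Kt k"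
    proof cases
      case 1
      then have "(i - 2 - length xs) + 2 \<le> length ys" using i k by linarith
      then obtain u c d v where y: "ys = u @ c # d # v" "length u = i - 2 - length xs"
        using list_split2 by metis
      have B: "Bf i (xs @ g # ys) = ins (xs @ g # u) v (rb c d)" for g
        using Bf_eq[of "xs @ g # u" i c d v] y 1 by simp
      show ?thesis unfolding B using a k y by (intro ins_outer_add rb) auto
    next
      case 2
      then obtain d v where y: "ys = d # v" using i k by (cases ys) auto
      have B: "Bf i (xs @ g # ys) = ins xs v (rb g d)" for g
        using Bf_eq[of xs i g d v] y 2 by simp
      show ?thesis unfolding B ins_diff[symmetric]
        using a k y by (intro ins_Kt[where m = 2] rb_add) auto
    next
      case 3
      then obtain u c where y: "xs = u @ [c]" using i by (cases xs rule: rev_cases) auto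
      have B: "Bf i (xs @ g # ys) = ins u ys (rb c g)" for g
        using Bf_eq[of u i c g ys] y 3 by simp
      show ?thesis unfolding B ins_diff[symmetric]
        using a k y by (intro ins_Kt[where m = 2] rb_add) auto
    next
      case 4
      then have "(i - 1) + 2 \<le> length xs" using i by linarith
      then obtain u c d v where y: "xs = u @ c # d # v" "length u = i - 1"
        using list_split2 by metis
      have B: "Bf i (xs @ g # ys) = ins u (v @ g # ys) (rb c d)" for g
        using Bf_eq[of u i c d "v @ g # ys"] y i by simp
      show ?thesis unfolding B using a k y by (intro ins_outer_add rb) auto
    qed
    then show "frag_extend (Bf i) (frag_of (xs @ ?w # ys)) - frag_extend (Bf i) (frag_of (xs @ x # ys))
        - frag_extend (Bf i) (frag_of (xs @ y # ys)) \<in> Kt k" by simp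
  next
    fix b assume b: "b \<in> carrier A" and k: "length xs + length ys + 2 = k"
    let ?x = "rsmult M x b" and ?y = "b \<odot>\<^bsub>M\<^esub> y"
    have xy: "?x \<in> carrier M" "?y \<in> carrier M" using a b by (simp_all add: rsmult_cl smult_cl)
    consider "length xs + 2 < i" | "length xs + 2 = i" | "length xs + 1 = i" | "length xs = i" | "i < length xs" by linarith
    then have "Bf i (xs @ ?x # y # ys) - Bf i (xs @ x # ?y # ys) \<in> Kt k"
    proof cases
      case 1
      then have "(i - 3 - length xs) + 2 \<le> length ys" using i k by linarith
      then obtain u c d v where y: "ys = u @ c # d # v" "length u = i - 3 - length xs"
        using list_split2 by metis
      have B: "Bf i (xs @ g # f # ys) = ins (xs @ g # f # u) v (rb c d)" for g f
        using Bf_eq[of "xs @ g # f # u" i c d v] y 1 by simp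
      show ?thesis unfolding B using a k y b by (intro ins_outer_bal rb) auto
    next
      case 2
      then obtain d v where y: "ys = d # v" using i k by (cases ys) auto
      have d: "d \<in> carrier M" using a y by simp
      have B: "Bf i (xs @ g # f # ys) = ins (xs @ [g]) v (rb f d)" for g f
        using Bf_eq[of "xs @ [g]" i f d v] y 2 by simp
      let ?l = "frag_extend (\<lambda>xs. frag_of ((b \<odot>\<^bsub>M\<^esub> hd xs) # tl xs)) (rb y d)"
      have "ins (xs @ [?x]) v (rb y d) - ins (xs @ [x]) v ?l \<in> Kt k"
        using a b k y by (intro ins_lact rb) auto
      moreover have "ins (xs @ [x]) v (rb ?y d - ?l) \<in> Kt k"
        using a b k y by (intro ins_Kt[where m = 2] rb_lact) auto
      ultimately have "(ins (xs @ [?x]) v (rb y d) - ins (xs @ [x]) v ?l) - ins (xs @ [x]) v (rb ?y d - ?l) \<in> Kt k"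
        by (rule Kt_diff)
      then show ?thesis unfolding B by (simp add: ins_diff)
    next
      case 3
      have B: "Bf i (xs @ g # f # ys) = ins xs ys (rb g f)" for g f
        using Bf_eq[of xs i g f ys] 3 by simp
      show ?thesis unfolding B using a b by (simp add: rb_bal Kt_0)
    next
      case 4
      then obtain u c where y: "xs = u @ [c]" using i by (cases xs rule: rev_cases) auto
      have B: "Bf i (xs @ g # f # ys) = ins u (f # ys) (rb c g)" for g f
        using Bf_eq[of u i c g "f # ys"] y 4 by simp
      let ?l = "frag_extend (\<lambda>xs. frag_of (butlast xs @ [rsmult M (last xs) b])) (rb c x)"
      have "ins u (y # ys) ?l - ins u (?y # ys) (rb c x) \<in> Kt k"
        using a b k \<open>xs = u @ [c]\<close> by (intro ins_ract rb) auto
      moreover have "ins u (y # ys) (rb c ?x - ?l) \<in> Kt k"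
        using a b k \<open>xs = u @ [c]\<close> by (intro ins_Kt[where m = 2] rb_ract) auto
      ultimately have "(ins u (y # ys) ?l - ins u (?y # ys) (rb c x)) + ins u (y # ys) (rb c ?x - ?l) \<in> Kt k"
        by (rule Kt_add)
      then show ?thesis unfolding B by (simp add: ins_diff)
    next
      case 5
      then have "(i - 1) + 2 \<le> length xs" using i by linarith
      then obtain u c d v where y: "xs = u @ c # d # v" "length u = i - 1"
        using list_split2 by metis
      have B: "Bf i (xs @ g # f # ys) = ins u (v @ g # f # ys) (rb c d)" for g f
        using Bf_eq[of u i c d "v @ g # f # ys"] y i by simp
      show ?thesis unfolding B using a k y b by (intro ins_outer_bal rb) auto
    qed
    then show "frag_extend (Bf i) (frag_of (xs @ ?x # y # ys)) - frag_extend (Bf i) (frag_of (xs @ x # ?y # ys)) \<in> Kt k"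
      by simp
  }
qed

lemma frag_Bf_keys:
  assumes "1 \<le> i" "i < k" "keys z \<subseteq> tup k"
  shows "keys (frag_extend (Bf i) z) \<subseteq> tup k"
  using keys_frag_extend[of "Bf i" z] Bf_keys[of _ k i] assms by blast

lemma braid_at_tc:
  assumes i: "1 \<le> i" "i < k" and z: "keys z \<subseteq> tup k"
  shows "braid_at A M \<sigma> k i (tc k z) = tc k (frag_extend (Bf i) z)"
proof -
  have "braid_at A M \<sigma> k i (tc k z) = tc k (frag_extend (Bf i) (rep (tc k z)))"
    unfolding braid_at_def Bf_def[abs_def] ins_def rb_def ..
  also have "\<dots> = tc k (frag_extend (Bf i) z)"
    using Bf_Kt[OF i rep_tc(2)[OF z]] rep_tc(1)[OF z] i z
    by (simp add: tc_eq_iff frag_Bf_keys frag_extend_diff)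
  finally show ?thesis .
qed

definition Bw :: "nat list \<Rightarrow> ('b list \<Rightarrow>\<^sub>0 int) \<Rightarrow> ('b list \<Rightarrow>\<^sub>0 int)" where
  "Bw is z = foldr (\<lambda>i. frag_extend (Bf i)) is z"

lemma Bw_simps [simp]: "Bw [] z = z" "Bw (i # is) z = frag_extend (Bf i) (Bw is z)"
  by (simp_all add: Bw_def)

lemma braid_word_tc:
  assumes "set is \<subseteq> {1..<k}" "keys z \<subseteq> tup k"
  shows "foldr (\<lambda>i f. braid_at A M \<sigma> k i \<circ> f) is id (tc k z) = tc k (Bw is z) \<and> keys (Bw is z) \<subseteq> tup k"
  using assms by (induction "is") (auto simp: braid_at_tc frag_Bf_keys[THEN subsetD])

definition Az :: "nat \<Rightarrow> ('b list \<Rightarrow>\<^sub>0 int) \<Rightarrow> ('b list \<Rightarrow>\<^sub>0 int)" where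
  "Az k z = (\<Sum>w | w permutes {1..k}. frag_cmul ((-1) ^ perm_length k w) (Bw (some_reduced_word k w) z))"

lemma antisymmetrizer_tc:
  assumes z: "keys z \<subseteq> tup k"
  shows "antisymmetrizer A M \<sigma> k (tc k z) = tc k (Az k z)" "keys (Az k z) \<subseteq> tup k"
proof -
  interpret comm_group "Tp k" by (rule Tp_comm_group)
  have 1: "keys (frag_cmul ((-1) ^ perm_length k w) (Bw (some_reduced_word k w) z)) \<subseteq> tup k"
    "braid_perm A M \<sigma> k w (tc k z) [^]\<^bsub>Tp k\<^esub> ((-1) ^ perm_length k w :: int) =
       tc k (frag_cmul ((-1) ^ perm_length k w) (Bw (some_reduced_word k w) z))"
    if w: "w permutes {1..k}" for w
  proof -
    have b: "braid_perm A M \<sigma> k w (tc k z) = tc k (Bw (some_reduced_word k w) z)"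
      "keys (Bw (some_reduced_word k w) z) \<subseteq> tup k"
      using braid_word_tc[OF some_reduced_word(1)[OF w] z] by (simp_all add: braid_perm_def)
    show "keys (frag_cmul ((-1) ^ perm_length k w) (Bw (some_reduced_word k w) z)) \<subseteq> tup k"
      using keys_cmul b(2) by (rule order_trans)
    show "braid_perm A M \<sigma> k w (tc k z) [^]\<^bsub>Tp k\<^esub> ((-1) ^ perm_length k w :: int) =
       tc k (frag_cmul ((-1) ^ perm_length k w) (Bw (some_reduced_word k w) z))"
      unfolding b(1) by (rule tc_pow_sign[OF b(2)])
  qed
  show "keys (Az k z) \<subseteq> tup k" unfolding Az_def by (rule keys_sumI) (simp add: 1)
  have "antisymmetrizer A M \<sigma> k (tc k z) = finprod (Tp k)
     (\<lambda>w. tc k (frag_cmul ((-1) ^ perm_length k w) (Bw (some_reduced_word k w) z))) {w. w permutes {1..k}}"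
    unfolding antisymmetrizer_def
    by (rule finprod_cong'[OF refl]) (auto simp: 1 tc_closed)
  also have "\<dots> = tc k (Az k z)"
    unfolding Az_def by (rule tc_finprod) (simp_all add: 1 finite_permutations)
  finally show "antisymmetrizer A M \<sigma> k (tc k z) = tc k (Az k z)" .
qed

text \<open>A tensor whose antisymmetrization is not zero represents a nonzero form.\<close>

lemma external_power_nontrivial:
  assumes z: "keys z \<subseteq> tup k" and nz: "Az k z \<notin> Kt k"
  shows "carrier (external_power A M \<sigma> k) \<noteq> {\<one>\<^bsub>external_power A M \<sigma> k\<^esub>}"
proof
  interpret comm_group "Tp k" by (rule Tp_comm_group)
  let ?H = "kernel (Tp k) (Tp k) (antisymmetrizer A M \<sigma> k)"
  assume "carrier (external_power A M \<sigma> k) = {\<one>\<^bsub>external_power A M \<sigma> k\<^esub>}"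
  moreover have "?H #>\<^bsub>Tp k\<^esub> tc k z \<in> carrier (external_power A M \<sigma> k)"
    using tc_closed[OF z] by (auto simp: external_power_def carrier_FactGroup)
  ultimately have H: "?H #>\<^bsub>Tp k\<^esub> tc k z = ?H"
    by (simp add: external_power_def)
  have B0: "Bw is 0 = 0" for "is" by (induction "is") simp_all
  have "antisymmetrizer A M \<sigma> k (tc k 0) = tc k 0"
    using antisymmetrizer_tc(1)[of 0 k] by (simp add: Az_def B0)
  then have "\<one>\<^bsub>Tp k\<^esub> \<in> ?H" by (simp add: kernel_def tc_0)
  then have "tc k z \<in> ?H #>\<^bsub>Tp k\<^esub> tc k z"
    using tc_closed[OF z] by (force simp: r_coset_def)
  then have "tc k (Az k z) = tc k 0"
    unfolding H by (simp add: kernel_def antisymmetrizer_tc(1)[OF z] tc_0)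
  then show False using nz antisymmetrizer_tc(2)[OF z] by (simp add: tc_eq_iff)
qed

end

section \<open>The bimodule\<close>

context rform begin

text \<open>\<open>gm X\<close> is \<open>\<Sum> X\<^sub>I \<theta>\<^sub>I\<close> with coefficients given by representatives, and \<open>hat\<close> recovers coefficients.\<close>

definition gm :: "(nat \<times> nat \<Rightarrow> falg) \<Rightarrow> gam" where
  "gm X = (\<lambda>I\<in>Id2 N. qc (X I))"

abbreviation "Gm \<equiv> Gamma N h s r"

lemma gm_in [simp]: "gm X \<in> carrier Gm"
  by (auto simp: gm_def Gamma_def)

lemma gm_eqI: "(\<And>I. I \<in> Id2 N \<Longrightarrow> qc (X I) = qc (Y I)) \<Longrightarrow> gm X = gm Y"
  unfolding gm_def by (rule restrict_ext)

lemma gm_apply: "I \<in> Id2 N \<Longrightarrow> gm X I = qc (X I)"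
  unfolding gm_def by (rule restrict_apply')

definition hat :: "gam \<Rightarrow> nat \<times> nat \<Rightarrow> falg" where "hat x I = rep (x I)"

lemma gm_hat: "x \<in> carrier Gm \<Longrightarrow> gm (hat x) = x"
proof -
  assume x: "x \<in> carrier Gm"
  then have x': "x \<in> Id2 N \<rightarrow>\<^sub>E carrier A" by (simp add: Gamma_def)
  have q: "qc (rep a) = a" if "a \<in> carrier A" for a
    using ocl_surj[OF that] rep_ocl(2) by metis
  show ?thesis
  proof (rule extensionalityI[of _ "Id2 N"])
    show "gm (hat x) \<in> extensional (Id2 N)" unfolding gm_def by (rule restrict_extensional)
    show "x \<in> extensional (Id2 N)" using x' by (simp add: PiE_def)
    fix I assume I: "I \<in> Id2 N"
    then have "x I \<in> carrier A" using x' by (rule PiE_mem[rotated])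
    then show "gm (hat x) I = x I" unfolding gm_apply[OF I] hat_def by (rule q)
  qed
qed

lemma Gm_cases: "x \<in> carrier Gm \<Longrightarrow> (\<And>X. x = gm X \<Longrightarrow> P) \<Longrightarrow> P"
  using gm_hat by metis

lemma A_cases: "a \<in> carrier A \<Longrightarrow> (\<And>f. a = qc f \<Longrightarrow> P) \<Longrightarrow> P"
  using ocl_surj by blast

lemma gm_add: "gm X \<oplus>\<^bsub>Gm\<^esub> gm Y = gm (\<lambda>I. X I + Y I)"
  by (simp add: Gamma_def gm_def ocl_add cong: restrict_cong)

lemma gm_smult: "qc f \<odot>\<^bsub>Gm\<^esub> gm X = gm (\<lambda>I. f * X I)"
  by (simp add: Gamma_def gm_def ocl_mult cong: restrict_cong)

lemma gm_rsmult: "rsmult Gm (gm X) (qc f) = gm (\<lambda>J. \<Sum>I\<in>Id2 N. X I * RR I J f)"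
proof -
  interpret ring A by (rule ring_Oq)
  have "rsmult Gm (gm X) (qc f) = (\<lambda>J\<in>Id2 N. \<Oplus>\<^bsub>A\<^esub>I\<in>Id2 N. gm X I \<otimes>\<^bsub>A\<^esub> theta_act N h s r I J (qc f))"
    by (simp add: Gamma_def)
  also have "\<dots> = (\<lambda>J\<in>Id2 N. \<Oplus>\<^bsub>A\<^esub>I\<in>Id2 N. qc (X I * RR I J f))"
    by (intro restrict_ext finsum_cong' refl) (simp_all only: gm_apply theta_act_RR ocl_mult, simp_all)
  also have "\<dots> = gm (\<lambda>J. \<Sum>I\<in>Id2 N. X I * RR I J f)"
    by (simp add: gm_def ocl_sum)
  finally show ?thesis .
qed

sublocale bm: bimod A Gm
proof (unfold_locales)
  fix x y a b assume x: "x \<in> carrier Gm"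
  obtain X where X: "x = gm X" using Gm_cases[OF x] .
  {
    assume "y \<in> carrier Gm"
    then obtain Y where Y: "y = gm Y" by (rule Gm_cases)
    show "x \<oplus>\<^bsub>Gm\<^esub> y \<in> carrier Gm" by (simp add: X Y gm_add)
    assume "a \<in> carrier A"
    then obtain f where f: "a = qc f" by (rule A_cases)
    show "a \<odot>\<^bsub>Gm\<^esub> (x \<oplus>\<^bsub>Gm\<^esub> y) = a \<odot>\<^bsub>Gm\<^esub> x \<oplus>\<^bsub>Gm\<^esub> a \<odot>\<^bsub>Gm\<^esub> y"
      by (simp add: X Y f gm_add gm_smult distrib_left)
    show "rsmult Gm (x \<oplus>\<^bsub>Gm\<^esub> y) a = rsmult Gm x a \<oplus>\<^bsub>Gm\<^esub> rsmult Gm y a"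
      by (simp add: X Y f gm_add gm_rsmult distrib_right sum.distrib)
  next
    assume "a \<in> carrier A"
    then obtain f where f: "a = qc f" by (rule A_cases)
    show "a \<odot>\<^bsub>Gm\<^esub> x \<in> carrier Gm" "rsmult Gm x a \<in> carrier Gm"
      by (simp_all add: X f gm_smult gm_rsmult)
    assume "b \<in> carrier A"
    then obtain g where g: "b = qc g" by (rule A_cases)
    show "rsmult Gm (a \<odot>\<^bsub>Gm\<^esub> x) b = a \<odot>\<^bsub>Gm\<^esub> rsmult Gm x b"
      by (simp add: X f g gm_smult gm_rsmult sum_distrib_left mult.assoc)
  }
qed

definition theta_coeff :: "nat \<times> nat \<Rightarrow> nat \<times> nat \<Rightarrow> falg" where "theta_coeff I J = of_bool (J = I) \<cdot> 1"

lemma theta_gm: "theta N h I = gm (theta_coeff I)"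
proof -
  have "theta N h I = (\<lambda>J\<in>Id2 N. if J = I then qc 1 else qc 0)"
    by (simp only: theta_def ocl_1 ocl_0)
  also have "\<dots> = gm (theta_coeff I)"
    unfolding gm_def by (rule restrict_ext) (simp add: theta_coeff_def)
  finally show ?thesis .
qed

lemma sum_theta_coeff: "I \<in> Id2 N \<Longrightarrow> (\<Sum>J\<in>Id2 N. X J * theta_coeff I J) = X I" "I \<in> Id2 N \<Longrightarrow> (\<Sum>J\<in>Id2 N. theta_coeff I J * X J) = X I"
  by (simp_all add: theta_coeff_def sum_of_bool_smul(1)[of "Id2 N" I])

lemma sum_theta_coeff': "J \<in> Id2 N \<Longrightarrow> (\<Sum>I\<in>Id2 N. X I * theta_coeff I J) = X J"
  by (simp add: theta_coeff_def sum_of_bool_smul(2)[of "Id2 N" J])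

subsection \<open>Calculating with elementary tensors\<close>

abbreviation "Kg \<equiv> tensor_ker A Gm"

text \<open>An elementary tensor, displayed as a function of the coefficients of one of its factors.\<close>

definition slot_tensor :: "gam list \<Rightarrow> (nat \<times> nat \<Rightarrow> falg) \<Rightarrow> gam list \<Rightarrow> (gam list \<Rightarrow>\<^sub>0 int)" where
  "slot_tensor u X v = frag_of (u @ gm X # v)"

lemma slot_tensor_add: "set u \<subseteq> carrier Gm \<Longrightarrow> set v \<subseteq> carrier Gm \<Longrightarrow>
    slot_tensor u (\<lambda>J. X J + Y J) v - (slot_tensor u X v + slot_tensor u Y v) \<in> Kg (length u + length v + 1)"
  using bm.Kt_add_rel[of u v "gm X" "gm Y"] by (simp add: slot_tensor_def gm_add diff_diff_eq)

lemma slot_tensor_zero: "set u \<subseteq> carrier Gm \<Longrightarrow> set v \<subseteq> carrier Gm \<Longrightarrow>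
    slot_tensor u (\<lambda>J. 0) v \<in> Kg (length u + length v + 1)"
  using slot_tensor_add[of u v "\<lambda>J. 0" "\<lambda>J. 0"] bm.Kt_minus by fastforce

lemma slot_tensor_sum:
  assumes "finite S" "set u \<subseteq> carrier Gm" "set v \<subseteq> carrier Gm" "k = length u + length v + 1"
  shows "slot_tensor u (\<lambda>J. \<Sum>i\<in>S. X i J) v - (\<Sum>i\<in>S. slot_tensor u (X i) v) \<in> Kg k"
  using assms(1)
proof (induction S rule: finite_induct)
  case empty
  then show ?case using slot_tensor_zero assms by simp
next
  case (insert x F)
  have "slot_tensor u (\<lambda>J. X x J + (\<Sum>i\<in>F. X i J)) v - (slot_tensor u (X x) v + slot_tensor u (\<lambda>J. \<Sum>i\<in>F. X i J) v) \<in> Kg k"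
    using slot_tensor_add assms by simp
  from bm.Kt_add[OF this insert.IH] show ?case using insert.hyps by (simp add: algebra_simps)
qed

lemma slot_tensor_cong: "(\<And>I. I \<in> Id2 N \<Longrightarrow> qc (X I) = qc (Y I)) \<Longrightarrow> slot_tensor u X v = slot_tensor u Y v"
  unfolding slot_tensor_def by (simp cong: gm_eqI)

lemma gm_rsmult_const: "rsmult Gm (gm X) (qc (c \<cdot> 1)) = gm (\<lambda>J. c \<cdot> X J)"
  unfolding gm_rsmult
proof (rule gm_eqI)
  fix J assume J: "J \<in> Id2 N"
  have "(\<Sum>I\<in>Id2 N. X I * RR I J (c \<cdot> 1)) = (\<Sum>I\<in>Id2 N. of_bool (I = J) \<cdot> (c \<cdot> X I))"
    using J by (intro sum.cong refl) (simp only: RR_smul RR_1 smul_simps mult_1_right mult.commute[of c])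
  also have "\<dots> = c \<cdot> X J" using J by (subst sum_of_bool_smul(1)) auto
  finally show "qc (\<Sum>I\<in>Id2 N. X I * RR I J (c \<cdot> 1)) = qc (c \<cdot> X J)" by simp
qed

lemma slot_tensor_scal:
  assumes "set u \<subseteq> carrier Gm" "set v \<subseteq> carrier Gm" "k = length u + length v + 2"
  shows "slot_tensor u (\<lambda>J. c \<cdot> X J) (gm Y # v) - slot_tensor (u @ [gm X]) (\<lambda>J. c \<cdot> Y J) v \<in> Kg k"
  using bm.Kt_bal_rel[of u v "gm X" "gm Y" "qc (c \<cdot> 1)" k] assms
  by (simp add: slot_tensor_def gm_rsmult_const gm_smult)

text \<open>The tensor \<open>f \<eta>\<^sub>P \<otimes> \<theta>\<^sub>I\<close>.\<close>

definition eta_theta :: "nat \<times> nat \<Rightarrow> nat \<times> nat \<Rightarrow> falg \<Rightarrow> (gam list \<Rightarrow>\<^sub>0 int)" where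
  "eta_theta P I f = slot_tensor [] (\<lambda>J. f * wg J P) [theta N h I]"

lemma theta_in [simp]: "theta N h I \<in> carrier Gm"
  by (simp add: theta_gm)

lemma eta_theta_cong: "qc f = qc g \<Longrightarrow> eta_theta P I f = eta_theta P I g"
  unfolding eta_theta_def by (rule slot_tensor_cong) (rule ocl_cong(2)[OF _ refl])

lemma eta_theta_sum: "finite S \<Longrightarrow> eta_theta P I (\<Sum>i\<in>S. f i) - (\<Sum>i\<in>S. eta_theta P I (f i)) \<in> Kg 2"
  using slot_tensor_sum[of S "[]" "[theta N h I]" 2 "\<lambda>i J. f i * wg J P"] by (simp add: eta_theta_def sum_distrib_right)

lemma eta_theta_add: "eta_theta P I (f + g) - (eta_theta P I f + eta_theta P I g) \<in> Kg 2"
  using slot_tensor_add[of "[]" "[theta N h I]" "\<lambda>J. f * wg J P" "\<lambda>J. g * wg J P"]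
  by (simp add: eta_theta_def distrib_right)

lemma eta_theta_keys: "keys (eta_theta P I f) \<subseteq> tuples Gm 2"
  by (simp add: eta_theta_def slot_tensor_def tuples_def)

text \<open>Every tensor \<open>x \<otimes> y\<close> is \<open>\<Sum> c\<^sub>P\<^sub>I \<theta>\<^sub>I \<otimes> \<eta>\<^sub>P\<close> with these coefficients \<open>c\<^sub>P\<^sub>I\<close> (\<open>tensor_expand\<close>): write
  \<open>y = \<Sum> y'\<^sub>P \<eta>\<^sub>P\<close> with \<open>y'\<^sub>P = \<Sum> y\<^sub>J v\<^sub>P\<^sub>J\<close> and move \<open>y'\<^sub>P\<close> to the left factor. The braiding must then send
  \<open>x \<otimes> y\<close> to \<open>\<Sum> c\<^sub>P\<^sub>I \<eta>\<^sub>P \<otimes> \<theta>\<^sub>I\<close>, which is \<open>braid_frag\<close>.\<close>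

definition braid_coeff :: "(nat \<times> nat \<Rightarrow> falg) \<Rightarrow> (nat \<times> nat \<Rightarrow> falg) \<Rightarrow> nat \<times> nat \<Rightarrow> nat \<times> nat \<Rightarrow> falg" where
  "braid_coeff X Y P I = (\<Sum>K\<in>Id2 N. X K * RR K I (\<Sum>J\<in>Id2 N. Y J * vg P J))"

definition braid_frag :: "(nat \<times> nat \<Rightarrow> falg) \<Rightarrow> (nat \<times> nat \<Rightarrow> falg) \<Rightarrow> (gam list \<Rightarrow>\<^sub>0 int)" where
  "braid_frag X Y = (\<Sum>P\<in>Id2 N. \<Sum>I\<in>Id2 N. eta_theta P I (braid_coeff X Y P I))"

lemma braid_frag_cong:
  assumes X: "\<And>I. I \<in> Id2 N \<Longrightarrow> qc (X I) = qc (X' I)" and Y: "\<And>I. I \<in> Id2 N \<Longrightarrow> qc (Y I) = qc (Y' I)"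
  shows "braid_frag X Y = braid_frag X' Y'"
  unfolding braid_frag_def braid_coeff_def
  by (intro sum.cong refl eta_theta_cong ocl_sum_cong ocl_cong(2) X RR_cong Y)

lemma gm_eq_iff: "gm X = gm Y \<longleftrightarrow> (\<forall>I\<in>Id2 N. qc (X I) = qc (Y I))"
  using gm_eqI gm_apply by metis

definition braid_frag' :: "gam list \<Rightarrow> (gam list \<Rightarrow>\<^sub>0 int)" where
  "braid_frag' xs = braid_frag (hat (xs ! 0)) (hat (xs ! 1))"

lemma braid_frag'_gm: "braid_frag' [gm X, gm Y] = braid_frag X Y"
proof -
  have "gm (hat (gm X)) = gm X" "gm (hat (gm Y)) = gm Y" by (simp_all add: gm_hat)
  then have e: "qc (hat (gm X) I) = qc (X I)" "qc (hat (gm Y) I) = qc (Y I)" if "I \<in> Id2 N" for I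
    using that unfolding gm_eq_iff by blast+
  have "braid_frag' [gm X, gm Y] = braid_frag (hat (gm X)) (hat (gm Y))" by (simp add: braid_frag'_def One_nat_def)
  also have "\<dots> = braid_frag X Y" by (rule braid_frag_cong) (rule e, assumption)+
  finally show ?thesis .
qed

lemma braid_frag_keys: "keys (braid_frag X Y) \<subseteq> tuples Gm 2"
  unfolding braid_frag_def by (intro keys_sumI eta_theta_keys)

lemma Kg_trans: "a - b \<in> Kg k \<Longrightarrow> b - c \<in> Kg k \<Longrightarrow> a - c \<in> Kg k"
  using bm.Kt_add[of "a - b" k "b - c"] by simp

lemma Kg_sym: "a - b \<in> Kg k \<Longrightarrow> b - a \<in> Kg k"
  using bm.Kt_minus[of "a - b" k] by simp

lemma Kg_sum: "(\<And>i. i \<in> S \<Longrightarrow> f i - g i \<in> Kg k) \<Longrightarrow> sum f S - sum g S \<in> Kg k"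
  using bm.Kt_sum[of S "\<lambda>i. f i - g i" k] by (simp add: sum_subtractf)

lemma braid_frag_add:
  "braid_frag (\<lambda>I. X I + X' I) Y - (braid_frag X Y + braid_frag X' Y) \<in> Kg 2"
  "braid_frag X (\<lambda>I. Y I + Y' I) - (braid_frag X Y + braid_frag X Y') \<in> Kg 2"
proof -
  have 1: "braid_coeff (\<lambda>I. X I + X' I) Y P I = braid_coeff X Y P I + braid_coeff X' Y P I"
    "braid_coeff X (\<lambda>I. Y I + Y' I) P I = braid_coeff X Y P I + braid_coeff X Y' P I" for P I
    by (simp_all add: braid_coeff_def distrib_right distrib_left sum.distrib RR_add)
  show "braid_frag (\<lambda>I. X I + X' I) Y - (braid_frag X Y + braid_frag X' Y) \<in> Kg 2"
    "braid_frag X (\<lambda>I. Y I + Y' I) - (braid_frag X Y + braid_frag X Y') \<in> Kg 2"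
    unfolding braid_frag_def 1 sum.distrib[symmetric] by (intro Kg_sum eta_theta_add)+
qed

text \<open>Both sides have the same coefficients, since only the product of \<open>x\<close> with elements of the algebra
  enters.\<close>

lemma braid_frag_bal: "braid_frag (\<lambda>J. \<Sum>I\<in>Id2 N. X I * RR I J f) Y = braid_frag X (\<lambda>I. f * Y I)"
proof -
  have "braid_coeff (\<lambda>J. \<Sum>I\<in>Id2 N. X I * RR I J f) Y P I = braid_coeff X (\<lambda>I. f * Y I) P I" for P I
  proof -
    define y where "y = (\<Sum>J\<in>Id2 N. Y J * vg P J)"
    have "(\<Sum>J\<in>Id2 N. f * Y J * vg P J) = f * y"
      by (simp add: y_def sum_distrib_left mult.assoc)
    then show ?thesis
      unfolding braid_coeff_def y_def[symmetric]
      by (simp add: RR_mult sum_distrib_left sum_distrib_right mult.assoc) (rule sum.swap)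
  qed
  then show ?thesis by (simp add: braid_frag_def)
qed

lemma braid_frag'_Kt: "z \<in> Kg 2 \<Longrightarrow> frag_extend braid_frag' z \<in> Kg 2"
proof (rule bm.Kt2_extend[OF frag_extend_add bm.Kt_0 bm.Kt_add bm.Kt_minus])
  fix x x' y assume "x \<in> carrier Gm" "x' \<in> carrier Gm" "y \<in> carrier Gm"
  then obtain X X' Y where "x = gm X" "x' = gm X'" "y = gm Y" by (elim Gm_cases)
  then show "frag_extend braid_frag' (frag_of [x \<oplus>\<^bsub>Gm\<^esub> x', y]) - frag_extend braid_frag' (frag_of [x, y]) - frag_extend braid_frag' (frag_of [x', y]) \<in> Kg 2"
    using braid_frag_add(1)[of X X' Y] by (simp add: gm_add braid_frag'_gm diff_diff_eq)
next
  fix x y' y assume "x \<in> carrier Gm" "y' \<in> carrier Gm" "y \<in> carrier Gm"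
  then obtain X Y' Y where "x = gm X" "y' = gm Y'" "y = gm Y" by (elim Gm_cases)
  then show "frag_extend braid_frag' (frag_of [x, y \<oplus>\<^bsub>Gm\<^esub> y']) - frag_extend braid_frag' (frag_of [x, y]) - frag_extend braid_frag' (frag_of [x, y']) \<in> Kg 2"
    using braid_frag_add(2)[of X Y Y'] by (simp add: gm_add braid_frag'_gm diff_diff_eq)
next
  fix x y a assume "x \<in> carrier Gm" "y \<in> carrier Gm" "a \<in> carrier A"
  then obtain X Y f where "x = gm X" "y = gm Y" "a = qc f" by (elim Gm_cases A_cases)
  then show "frag_extend braid_frag' (frag_of [rsmult Gm x a, y]) - frag_extend braid_frag' (frag_of [x, a \<odot>\<^bsub>Gm\<^esub> y]) \<in> Kg 2"
    using braid_frag_bal[of X f Y] by (simp add: gm_rsmult gm_smult braid_frag'_gm bm.Kt_0)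
qed

lemma braid_frag_lact: "frag_extend (\<lambda>xs. frag_of ((qc f \<odot>\<^bsub>Gm\<^esub> hd xs) # tl xs)) (braid_frag X Y) = braid_frag (\<lambda>I. f * X I) Y"
proof -
  have "braid_coeff (\<lambda>I. f * X I) Y P I = f * braid_coeff X Y P I" for P I
    by (simp add: braid_coeff_def sum_distrib_left mult.assoc)
  then show ?thesis
    by (simp add: braid_frag_def eta_theta_def slot_tensor_def frag_extend_sum o_def gm_smult mult.assoc)
qed

lemma eta_rsmult:
  assumes P: "P \<in> Id2 N"
  shows "rsmult Gm (gm (\<lambda>J. f * wg J P)) (qc g) = gm (\<lambda>J. \<Sum>Q\<in>Id2 N. (f * LL P Q g) * wg J Q)"
  unfolding gm_rsmult
proof (rule gm_eqI)
  fix J assume J: "J \<in> Id2 N"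
  have "(\<Sum>I\<in>Id2 N. f * wg I P * RR I J g) = f * (\<Sum>I\<in>Id2 N. wg I P * RR I J g)"
    by (simp add: sum_distrib_left mult.assoc)
  also have "qc \<dots> = qc (f * (\<Sum>Q\<in>Id2 N. LL P Q g * wg J Q))"
    by (rule ocl_cong(2)[OF refl compat_inverse[OF P J]])
  finally show "qc (\<Sum>I\<in>Id2 N. f * wg I P * RR I J g) = qc (\<Sum>Q\<in>Id2 N. f * LL P Q g * wg J Q)"
    by (simp add: sum_distrib_left mult.assoc)
qed

text \<open>Moving a coefficient \<open>g\<close> from the right through \<open>\<theta>\<^sub>I\<close> and then through \<open>\<eta>\<^sub>P\<close> produces first \<open>RR\<close>, then
  \<open>LL\<close>.\<close>

lemma eta_theta_ract:
  assumes P: "P \<in> Id2 N" and I: "I \<in> Id2 N"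
  shows "frag_extend (\<lambda>xs. frag_of (butlast xs @ [rsmult Gm (last xs) (qc g)])) (eta_theta P I f)
    - (\<Sum>Q\<in>Id2 N. \<Sum>K\<in>Id2 N. eta_theta Q K (f * LL P Q (RR I K g))) \<in> Kg 2"
proof -
  let ?e = "gm (\<lambda>J. f * wg J P)"
  have "frag_extend (\<lambda>xs. frag_of (butlast xs @ [rsmult Gm (last xs) (qc g)])) (eta_theta P I f)
      = slot_tensor [?e] (\<lambda>K. RR I K g) []"
  proof -
    have "rsmult Gm (theta N h I) (qc g) = gm (\<lambda>K. RR I K g)"
      unfolding theta_gm gm_rsmult using sum_theta_coeff(2)[OF I] by simp
    then show ?thesis by (simp add: eta_theta_def slot_tensor_def)
  qed
  also have "\<dots> = slot_tensor [?e] (\<lambda>L. \<Sum>K\<in>Id2 N. RR I K g * theta_coeff K L) []"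
    by (rule slot_tensor_cong) (simp only: sum_theta_coeff')
  finally have 0: "frag_extend (\<lambda>xs. frag_of (butlast xs @ [rsmult Gm (last xs) (qc g)])) (eta_theta P I f)
      = slot_tensor [?e] (\<lambda>L. \<Sum>K\<in>Id2 N. RR I K g * theta_coeff K L) []" .
  have 1: "slot_tensor [?e] (\<lambda>L. \<Sum>K\<in>Id2 N. RR I K g * theta_coeff K L) [] -
      (\<Sum>K\<in>Id2 N. slot_tensor [?e] (\<lambda>L. RR I K g * theta_coeff K L) []) \<in> Kg 2"
    by (rule slot_tensor_sum) simp_all
  have 2: "slot_tensor [?e] (\<lambda>L. RR I K g * theta_coeff K L) [] - (\<Sum>Q\<in>Id2 N. eta_theta Q K (f * LL P Q (RR I K g))) \<in> Kg 2" for K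
  proof -
    have m1: "frag_of [rsmult Gm ?e (qc (RR I K g)), gm (theta_coeff K)] - slot_tensor [?e] (\<lambda>L. RR I K g * theta_coeff K L) [] \<in> Kg 2"
      using bm.Kt_bal_rel[of "[]" "[]" ?e "gm (theta_coeff K)" "qc (RR I K g)" 2] by (simp add: slot_tensor_def gm_smult)
    have m2: "frag_of [rsmult Gm ?e (qc (RR I K g)), gm (theta_coeff K)] =
        slot_tensor [] (\<lambda>J. \<Sum>Q\<in>Id2 N. (f * LL P Q (RR I K g)) * wg J Q) [theta N h K]"
      by (simp add: eta_rsmult[OF P] slot_tensor_def theta_gm)
    have m3: "slot_tensor [] (\<lambda>J. \<Sum>Q\<in>Id2 N. (f * LL P Q (RR I K g)) * wg J Q) [theta N h K]
        - (\<Sum>Q\<in>Id2 N. eta_theta Q K (f * LL P Q (RR I K g))) \<in> Kg 2"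
      unfolding eta_theta_def by (rule slot_tensor_sum) simp_all
    show ?thesis by (rule Kg_trans[OF Kg_sym[OF m1[unfolded m2]] m3])
  qed
  have "slot_tensor [?e] (\<lambda>L. \<Sum>K\<in>Id2 N. RR I K g * theta_coeff K L) [] -
      (\<Sum>K\<in>Id2 N. \<Sum>Q\<in>Id2 N. eta_theta Q K (f * LL P Q (RR I K g))) \<in> Kg 2"
    by (rule Kg_trans[OF 1]) (intro Kg_sum 2)
  then show ?thesis unfolding 0 by (subst sum.swap)
qed

text \<open>Right linearity of the braiding. Computed before the flip, \<open>g\<close> passes \<open>\<eta>\<close> first and \<open>\<theta>\<close> second; after
  the flip the order is reversed. The results agree because \<open>LL\<close> and \<open>RR\<close> commute.\<close>

lemma braid_frag_ract: "braid_frag X (\<lambda>J. \<Sum>I\<in>Id2 N. Y I * RR I J g)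
    - frag_extend (\<lambda>xs. frag_of (butlast xs @ [rsmult Gm (last xs) (qc g)])) (braid_frag X Y) \<in> Kg 2"
proof -
  let ?r = "frag_extend (\<lambda>xs. frag_of (butlast xs @ [rsmult Gm (last xs) (qc g)]))"
  let ?Y' = "\<lambda>J. \<Sum>I\<in>Id2 N. Y I * RR I J g" and ?y = "\<lambda>P. \<Sum>J\<in>Id2 N. Y J * vg P J"
  have y': "qc (\<Sum>J\<in>Id2 N. ?Y' J * vg P J) = qc (\<Sum>M\<in>Id2 N. ?y M * LL M P g)" if P: "P \<in> Id2 N" for P
  proof -
    have "(\<Sum>J\<in>Id2 N. ?Y' J * vg P J) = (\<Sum>I\<in>Id2 N. Y I * (\<Sum>J\<in>Id2 N. RR I J g * vg P J))"
      by (simp add: sum_distrib_left sum_distrib_right mult.assoc) (rule sum.swap)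
    also have "qc \<dots> = qc (\<Sum>I\<in>Id2 N. Y I * (\<Sum>M\<in>Id2 N. vg M I * LL M P g))"
      by (rule ocl_sum_cong, rule ocl_cong(2)[OF refl], rule compat[OF _ P])
    also have "(\<Sum>I\<in>Id2 N. Y I * (\<Sum>M\<in>Id2 N. vg M I * LL M P g)) = (\<Sum>M\<in>Id2 N. ?y M * LL M P g)"
      by (simp add: sum_distrib_left sum_distrib_right mult.assoc) (rule sum.swap)
    finally show ?thesis .
  qed
  have c: "qc (braid_coeff X ?Y' P I) = qc (\<Sum>M\<in>Id2 N. \<Sum>Q\<in>Id2 N. braid_coeff X Y M Q * RR Q I (LL M P g))"
    if P: "P \<in> Id2 N" and I: "I \<in> Id2 N" for P I
  proof -
    have "qc (braid_coeff X ?Y' P I) = qc (\<Sum>K\<in>Id2 N. X K * RR K I (\<Sum>M\<in>Id2 N. ?y M * LL M P g))"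
      unfolding braid_coeff_def by (rule ocl_sum_cong, rule ocl_cong(2)[OF refl], rule RR_cong[OF _ I y'[OF P]])
    also have "(\<Sum>K\<in>Id2 N. X K * RR K I (\<Sum>M\<in>Id2 N. ?y M * LL M P g)) =
        (\<Sum>K\<in>Id2 N. \<Sum>M\<in>Id2 N. \<Sum>Q\<in>Id2 N. X K * (RR K Q (?y M) * RR Q I (LL M P g)))"
      by (simp only: RR_sum RR_mult sum_distrib_left)
    also have "\<dots> = (\<Sum>M\<in>Id2 N. \<Sum>Q\<in>Id2 N. braid_coeff X Y M Q * RR Q I (LL M P g))"
      unfolding braid_coeff_def sum_distrib_right mult.assoc by (rule sum3_rot)
    finally show ?thesis .
  qed
  have 1: "braid_frag X ?Y' - (\<Sum>P\<in>Id2 N. \<Sum>I\<in>Id2 N. \<Sum>M\<in>Id2 N. \<Sum>Q\<in>Id2 N. eta_theta P I (braid_coeff X Y M Q * RR Q I (LL M P g))) \<in> Kg 2"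
    unfolding braid_frag_def
  proof (intro Kg_sum)
    fix P I assume PI: "P \<in> Id2 N" "I \<in> Id2 N"
    have m1: "eta_theta P I (braid_coeff X ?Y' P I) = eta_theta P I (\<Sum>M\<in>Id2 N. \<Sum>Q\<in>Id2 N. braid_coeff X Y M Q * RR Q I (LL M P g))"
      by (rule eta_theta_cong[OF c[OF PI]])
    have m2: "eta_theta P I (\<Sum>M\<in>Id2 N. \<Sum>Q\<in>Id2 N. braid_coeff X Y M Q * RR Q I (LL M P g)) -
        (\<Sum>M\<in>Id2 N. eta_theta P I (\<Sum>Q\<in>Id2 N. braid_coeff X Y M Q * RR Q I (LL M P g))) \<in> Kg 2"
      by (rule eta_theta_sum) simp
    have m3: "(\<Sum>M\<in>Id2 N. eta_theta P I (\<Sum>Q\<in>Id2 N. braid_coeff X Y M Q * RR Q I (LL M P g))) -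
        (\<Sum>M\<in>Id2 N. \<Sum>Q\<in>Id2 N. eta_theta P I (braid_coeff X Y M Q * RR Q I (LL M P g))) \<in> Kg 2"
      by (intro Kg_sum eta_theta_sum) simp
    show "eta_theta P I (braid_coeff X ?Y' P I) -
        (\<Sum>M\<in>Id2 N. \<Sum>Q\<in>Id2 N. eta_theta P I (braid_coeff X Y M Q * RR Q I (LL M P g))) \<in> Kg 2"
      unfolding m1 by (rule Kg_trans[OF m2 m3])
  qed
  have rs: "?r (braid_frag X Y) = (\<Sum>M\<in>Id2 N. \<Sum>Q\<in>Id2 N. ?r (eta_theta M Q (braid_coeff X Y M Q)))"
    by (simp add: braid_frag_def frag_extend_sum o_def)
  have 2: "?r (braid_frag X Y) - (\<Sum>M\<in>Id2 N. \<Sum>Q\<in>Id2 N. \<Sum>P\<in>Id2 N. \<Sum>I\<in>Id2 N. eta_theta P I (braid_coeff X Y M Q * LL M P (RR Q I g))) \<in> Kg 2"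
    unfolding rs by (intro Kg_sum eta_theta_ract)
  have e: "(\<Sum>M\<in>Id2 N. \<Sum>Q\<in>Id2 N. \<Sum>P\<in>Id2 N. \<Sum>I\<in>Id2 N. eta_theta P I (braid_coeff X Y M Q * LL M P (RR Q I g))) =
     (\<Sum>P\<in>Id2 N. \<Sum>I\<in>Id2 N. \<Sum>M\<in>Id2 N. \<Sum>Q\<in>Id2 N. eta_theta P I (braid_coeff X Y M Q * RR Q I (LL M P g)))"
    by (subst sum4_swap) (intro sum.cong refl, simp only: LL_RR)
  show ?thesis by (rule Kg_trans[OF 1 Kg_sym[OF 2[unfolded e]]])
qed

definition braid_map :: "(gam list \<Rightarrow>\<^sub>0 int) set \<Rightarrow> (gam list \<Rightarrow>\<^sub>0 int) set" where
  "braid_map = (\<lambda>X\<in>carrier (tensor_power A Gm 2). tensor_cls A Gm 2 (frag_extend braid_frag' (rep X)))"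

lemma braid_frag'_keys: "keys z \<subseteq> tuples Gm 2 \<Longrightarrow> keys (frag_extend braid_frag' z) \<subseteq> tuples Gm 2"
proof -
  assume z: "keys z \<subseteq> tuples Gm 2"
  have "keys (braid_frag' xs) \<subseteq> tuples Gm 2" for xs unfolding braid_frag'_def by (rule braid_frag_keys)
  then show ?thesis using keys_frag_extend[of braid_frag' z] by blast
qed

lemma braid_map_tc: "keys z \<subseteq> tuples Gm 2 \<Longrightarrow> braid_map (tensor_cls A Gm 2 z) = tensor_cls A Gm 2 (frag_extend braid_frag' z)"
  unfolding braid_map_def using braid_frag'_Kt[OF bm.rep_tc(2), of z]
  by (simp add: bm.tc_closed bm.tc_eq_iff braid_frag'_keys bm.rep_tc frag_extend_diff)

lemma braid_map_tens: "braid_map (tens A Gm [gm X, gm Y]) = tensor_cls A Gm 2 (braid_frag X Y)"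
  by (simp add: bm.tens2 braid_map_tc bm.tup2 braid_frag'_gm)

lemma braid_map_bimodule_hom:
  shows "braid_map \<in> hom (tensor_power A Gm 2) (tensor_power A Gm 2)"
    and "a \<in> carrier A \<Longrightarrow> \<xi> \<in> carrier (tensor_power A Gm 2) \<Longrightarrow>
      braid_map (tensor_lact A Gm 2 a \<xi>) = tensor_lact A Gm 2 a (braid_map \<xi>)"
    and "a \<in> carrier A \<Longrightarrow> \<xi> \<in> carrier (tensor_power A Gm 2) \<Longrightarrow>
      braid_map (tensor_ract A Gm 2 \<xi> a) = tensor_ract A Gm 2 (braid_map \<xi>) a"
proof -
  show "braid_map \<in> hom (tensor_power A Gm 2) (tensor_power A Gm 2)"
    by (rule homI)
      (auto simp: bm.Tp_carrier braid_map_tc braid_frag'_keys bm.tc_mult keys_addI frag_extend_add)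
  assume a: "a \<in> carrier A" and x: "\<xi> \<in> carrier (tensor_power A Gm 2)"
  obtain f where f: "a = qc f" using A_cases[OF a] .
  obtain z where z: "keys z \<subseteq> tuples Gm 2" "\<xi> = tensor_cls A Gm 2 z" using x by (auto simp: bm.Tp_carrier)
  let ?l = "frag_extend (\<lambda>xs. frag_of ((a \<odot>\<^bsub>Gm\<^esub> hd xs) # tl xs))"
  let ?r = "frag_extend (\<lambda>xs. frag_of (butlast xs @ [rsmult Gm (last xs) a]))"
  have "frag_extend braid_frag' (?l z) - ?l (frag_extend braid_frag' z) \<in> Kg 2"
    using z(1)
  proof (induction z rule: frag_induction)
    case (one xs)
    then obtain x y where "xs = [x, y]" "x \<in> carrier Gm" "y \<in> carrier Gm" using bm.tup2_cases by blast
    then obtain X Y where "xs = [gm X, gm Y]" by (elim Gm_cases) auto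
    then show ?case by (simp add: f gm_smult braid_frag'_gm braid_frag_lact bm.Kt_0)
  next
    case (diff u v)
    from bm.Kt_diff[OF this] show ?case by (simp add: frag_extend_diff algebra_simps)
  qed (simp add: bm.Kt_0)
  then show "braid_map (tensor_lact A Gm 2 a \<xi>) = tensor_lact A Gm 2 a (braid_map \<xi>)"
    using z a by (simp add: bm.lact_tc braid_map_tc braid_frag'_keys bm.tc_eq_iff)
  have "frag_extend braid_frag' (?r z) - ?r (frag_extend braid_frag' z) \<in> Kg 2"
    using z(1)
  proof (induction z rule: frag_induction)
    case (one xs)
    then obtain x y where "xs = [x, y]" "x \<in> carrier Gm" "y \<in> carrier Gm" using bm.tup2_cases by blast
    then obtain X Y where "xs = [gm X, gm Y]" by (elim Gm_cases) auto
    then show ?case using braid_frag_ract[of X Y f] by (simp add: f gm_rsmult braid_frag'_gm)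
  next
    case (diff u v)
    from bm.Kt_diff[OF this] show ?case by (simp add: frag_extend_diff algebra_simps)
  qed (simp add: bm.Kt_0)
  then show "braid_map (tensor_ract A Gm 2 \<xi> a) = tensor_ract A Gm 2 (braid_map \<xi>) a"
    using z a by (simp add: bm.ract_tc braid_map_tc braid_frag'_keys bm.tc_eq_iff)
qed

end

section \<open>Tensor products over the complex numbers\<close>

lemma hom_finprod:
  assumes G: "comm_group G" and H: "comm_group H" and f: "f \<in> hom G H"
    and g: "\<And>i. i \<in> S \<Longrightarrow> g i \<in> carrier G" and fin: "finite S"
  shows "f (finprod G g S) = finprod H (\<lambda>i. f (g i)) S"
proof -
  interpret G: comm_group G by (rule G)
  interpret H: comm_group H by (rule H)
  interpret f: group_hom G H f
    by (intro group_hom.intro group_hom_axioms.intro f G.is_group H.is_group)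
  show ?thesis using fin g
  proof (induction S rule: finite_induct)
    case (insert x F)
    then have "g \<in> F \<rightarrow> carrier G" "(\<lambda>i. f (g i)) \<in> F \<rightarrow> carrier H" by auto
    with insert show ?case by simp
  qed simp
qed

text \<open>The properties of a pair of modules that make the defining relations of \<open>ctensor\<close> well formed.\<close>

locale ctens_data =
  fixes \<kappa> :: "complex \<Rightarrow> 'a" and M :: "('a, 'b, 'm) module_scheme" and M' :: "('a, 'c, 'n) module_scheme"
  assumes addM: "x \<in> carrier M \<Longrightarrow> y \<in> carrier M \<Longrightarrow> x \<oplus>\<^bsub>M\<^esub> y \<in> carrier M"
    and addM': "x' \<in> carrier M' \<Longrightarrow> y' \<in> carrier M' \<Longrightarrow> x' \<oplus>\<^bsub>M'\<^esub> y' \<in> carrier M'"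
    and smM: "x \<in> carrier M \<Longrightarrow> \<kappa> c \<odot>\<^bsub>M\<^esub> x \<in> carrier M"
    and smM': "x' \<in> carrier M' \<Longrightarrow> \<kappa> c \<odot>\<^bsub>M'\<^esub> x' \<in> carrier M'"
begin

definition "crel =
    {frag_of (x \<oplus>\<^bsub>M\<^esub> x', y) - frag_of (x, y) - frag_of (x', y)
       | x x' y. x \<in> carrier M \<and> x' \<in> carrier M \<and> y \<in> carrier M'}
     \<union> {frag_of (x, y \<oplus>\<^bsub>M'\<^esub> y') - frag_of (x, y) - frag_of (x, y')
       | x y y'. x \<in> carrier M \<and> y \<in> carrier M' \<and> y' \<in> carrier M'}
     \<union> {frag_of (\<kappa> c \<odot>\<^bsub>M\<^esub> x, y) - frag_of (x, \<kappa> c \<odot>\<^bsub>M'\<^esub> y)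
       | c x y. x \<in> carrier M \<and> y \<in> carrier M'}"

abbreviation "cS \<equiv> carrier M \<times> carrier M'"

lemma crel_sub: "crel \<subseteq> {c. keys c \<subseteq> cS}"
proof
  fix c assume "c \<in> crel"
  then consider x x' y where "c = frag_of (x \<oplus>\<^bsub>M\<^esub> x', y) - frag_of (x, y) - frag_of (x', y)"
      "x \<in> carrier M" "x' \<in> carrier M" "y \<in> carrier M'"
    | x y y' where "c = frag_of (x, y \<oplus>\<^bsub>M'\<^esub> y') - frag_of (x, y) - frag_of (x, y')"
      "x \<in> carrier M" "y \<in> carrier M'" "y' \<in> carrier M'"
    | d x y where "c = frag_of (\<kappa> d \<odot>\<^bsub>M\<^esub> x, y) - frag_of (x, \<kappa> d \<odot>\<^bsub>M'\<^esub> y)" "x \<in> carrier M" "y \<in> carrier M'"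
    unfolding crel_def by blast
  then show "c \<in> {c. keys c \<subseteq> cS}"
  proof cases
    case 1
    show ?thesis unfolding 1(1) by (intro CollectI keys_diffI) (use 1 in \<open>simp_all add: addM\<close>)
  next
    case 2
    show ?thesis unfolding 2(1) by (intro CollectI keys_diffI) (use 2 in \<open>simp_all add: addM'\<close>)
  next
    case 3
    show ?thesis unfolding 3(1) by (intro CollectI keys_diffI) (use 3 in \<open>simp_all add: smM smM'\<close>)
  qed
qed

lemma crel_intros:
  assumes "x \<in> carrier M" "y \<in> carrier M'"
  shows "x' \<in> carrier M \<Longrightarrow> frag_of (x \<oplus>\<^bsub>M\<^esub> x', y) - frag_of (x, y) - frag_of (x', y) \<in> crel"
    and "y' \<in> carrier M' \<Longrightarrow> frag_of (x, y \<oplus>\<^bsub>M'\<^esub> y') - frag_of (x, y) - frag_of (x, y') \<in> crel"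
    and "frag_of (\<kappa> c \<odot>\<^bsub>M\<^esub> x, y) - frag_of (x, \<kappa> c \<odot>\<^bsub>M'\<^esub> y) \<in> crel"
  using assms unfolding crel_def by blast+

lemma ct_folds:
  "fker cS crel = ctensor_ker \<kappa> M M'" "fgrp cS crel = ctensor \<kappa> M M'"
  "fcls cS crel (frag_of (x, y)) = ctens \<kappa> M M' x y"
  by (simp_all add: fker_def fgrp_def fcls_def ctensor_ker_def ctensor_def ctens_def crel_def)

lemma ct_comm_group: "comm_group (ctensor \<kappa> M M')"
  using fgrp_comm_group[OF crel_sub] by (simp add: ct_folds)

lemma ct_closed: "x \<in> carrier M \<Longrightarrow> y \<in> carrier M' \<Longrightarrow> ctens \<kappa> M M' x y \<in> carrier (ctensor \<kappa> M M')"
  using fcls_closed[OF crel_sub, of "frag_of (x, y)"] by (simp add: ct_folds)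

lemma ct_add:
  assumes "x \<in> carrier M" "y \<in> carrier M'"
  shows "x' \<in> carrier M \<Longrightarrow> ctens \<kappa> M M' (x \<oplus>\<^bsub>M\<^esub> x') y =
      ctens \<kappa> M M' x y \<otimes>\<^bsub>ctensor \<kappa> M M'\<^esub> ctens \<kappa> M M' x' y"
    and "y' \<in> carrier M' \<Longrightarrow> ctens \<kappa> M M' x (y \<oplus>\<^bsub>M'\<^esub> y') =
      ctens \<kappa> M M' x y \<otimes>\<^bsub>ctensor \<kappa> M M'\<^esub> ctens \<kappa> M M' x y'"
    and "ctens \<kappa> M M' (\<kappa> c \<odot>\<^bsub>M\<^esub> x) y = ctens \<kappa> M M' x (\<kappa> c \<odot>\<^bsub>M'\<^esub> y)"
proof -
  note F = ct_folds[symmetric]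
  have e: "fcls cS crel a = fcls cS crel b" if "keys a \<subseteq> cS" "keys b \<subseteq> cS" "a - b \<in> crel" for a b
    using that fcls_eq_iff[OF crel_sub] fker_rel[OF crel_sub] by blast
  show "ctens \<kappa> M M' (x \<oplus>\<^bsub>M\<^esub> x') y = ctens \<kappa> M M' x y \<otimes>\<^bsub>ctensor \<kappa> M M'\<^esub> ctens \<kappa> M M' x' y"
    if "x' \<in> carrier M"
  proof -
    have "fcls cS crel (frag_of (x \<oplus>\<^bsub>M\<^esub> x', y)) = fcls cS crel (frag_of (x, y) + frag_of (x', y))"
      by (rule e) (use assms that crel_intros(1)[OF assms that] in \<open>simp_all add: addM keys_addI diff_diff_eq\<close>)
    then show ?thesis unfolding F using assms that by (simp add: fcls_mult[OF crel_sub])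
  qed
  show "ctens \<kappa> M M' x (y \<oplus>\<^bsub>M'\<^esub> y') = ctens \<kappa> M M' x y \<otimes>\<^bsub>ctensor \<kappa> M M'\<^esub> ctens \<kappa> M M' x y'"
    if "y' \<in> carrier M'"
  proof -
    have "fcls cS crel (frag_of (x, y \<oplus>\<^bsub>M'\<^esub> y')) = fcls cS crel (frag_of (x, y) + frag_of (x, y'))"
      by (rule e) (use assms that crel_intros(2)[OF assms that] in \<open>simp_all add: addM' keys_addI diff_diff_eq\<close>)
    then show ?thesis unfolding F using assms that by (simp add: fcls_mult[OF crel_sub])
  qed
  show "ctens \<kappa> M M' (\<kappa> c \<odot>\<^bsub>M\<^esub> x) y = ctens \<kappa> M M' x (\<kappa> c \<odot>\<^bsub>M'\<^esub> y)"
    unfolding F using assms crel_intros(3)[OF assms]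
    by (intro e) (simp_all add: smM smM')
qed

text \<open>The universal property, the means to show that two elements of a tensor product differ.\<close>

lemma ct_universal:
  assumes G: "comm_group G" and cl: "\<And>x y. x \<in> carrier M \<Longrightarrow> y \<in> carrier M' \<Longrightarrow> f x y \<in> carrier G"
    and f1: "\<And>x x' y. x \<in> carrier M \<Longrightarrow> x' \<in> carrier M \<Longrightarrow> y \<in> carrier M' \<Longrightarrow> f (x \<oplus>\<^bsub>M\<^esub> x') y = f x y \<otimes>\<^bsub>G\<^esub> f x' y"
    and f2: "\<And>x y y'. x \<in> carrier M \<Longrightarrow> y \<in> carrier M' \<Longrightarrow> y' \<in> carrier M' \<Longrightarrow> f x (y \<oplus>\<^bsub>M'\<^esub> y') = f x y \<otimes>\<^bsub>G\<^esub> f x y'"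
    and f3: "\<And>c x y. x \<in> carrier M \<Longrightarrow> y \<in> carrier M' \<Longrightarrow> f (\<kappa> c \<odot>\<^bsub>M\<^esub> x) y = f x (\<kappa> c \<odot>\<^bsub>M'\<^esub> y)"
  obtains \<psi> where "\<psi> \<in> hom (ctensor \<kappa> M M') G"
    "\<And>x y. x \<in> carrier M \<Longrightarrow> y \<in> carrier M' \<Longrightarrow> \<psi> (ctens \<kappa> M M' x y) = f x y"
proof -
  interpret G: comm_group G by (rule G)
  have "\<exists>\<psi>. \<psi> \<in> hom (fgrp cS crel) G \<and> (\<forall>p\<in>cS. \<psi> (fcls cS crel (frag_of p)) = f (fst p) (snd p))"
  proof (rule fgrp_universal[OF crel_sub G, of "\<lambda>p. f (fst p) (snd p)"])
    show "f (fst p) (snd p) \<in> carrier G" if "p \<in> cS" for p using that cl by auto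
    fix H a assume H: "H \<in> hom (free_Abelian_group cS) G" "\<And>p. p \<in> cS \<Longrightarrow> H (frag_of p) = f (fst p) (snd p)"
      and a: "a \<in> crel"
    interpret H: group_hom "free_Abelian_group cS" G H
      by (intro group_hom.intro group_hom_axioms.intro group_free_Abelian_group G.is_group H(1))
    have d: "H (u - v) = H u \<otimes>\<^bsub>G\<^esub> inv\<^bsub>G\<^esub> H v" if "keys u \<subseteq> cS" "keys v \<subseteq> cS" for u v
      using H.hom_mult[of u "- v"] H.hom_inv[of v] that by simp
    from a consider x x' y where "a = frag_of (x \<oplus>\<^bsub>M\<^esub> x', y) - frag_of (x, y) - frag_of (x', y)"
        "x \<in> carrier M" "x' \<in> carrier M" "y \<in> carrier M'"
      | x y y' where "a = frag_of (x, y \<oplus>\<^bsub>M'\<^esub> y') - frag_of (x, y) - frag_of (x, y')"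
        "x \<in> carrier M" "y \<in> carrier M'" "y' \<in> carrier M'"
      | d x y where "a = frag_of (\<kappa> d \<odot>\<^bsub>M\<^esub> x, y) - frag_of (x, \<kappa> d \<odot>\<^bsub>M'\<^esub> y)" "x \<in> carrier M" "y \<in> carrier M'"
      unfolding crel_def by blast
    then show "H a = \<one>\<^bsub>G\<^esub>"
    proof cases
      case 1
      have "H a = f (x \<oplus>\<^bsub>M\<^esub> x') y \<otimes>\<^bsub>G\<^esub> inv\<^bsub>G\<^esub> f x y \<otimes>\<^bsub>G\<^esub> inv\<^bsub>G\<^esub> f x' y"
        unfolding 1(1) using 1 by (subst d, (intro keys_diffI)?, simp_all add: addM)+ (simp add: H(2) addM)
      then show ?thesis using 1 by (simp add: f1 cl G.m_ac G.r_inv flip: G.m_assoc)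
    next
      case 2
      have "H a = f x (y \<oplus>\<^bsub>M'\<^esub> y') \<otimes>\<^bsub>G\<^esub> inv\<^bsub>G\<^esub> f x y \<otimes>\<^bsub>G\<^esub> inv\<^bsub>G\<^esub> f x y'"
        unfolding 2(1) using 2 by (subst d, (intro keys_diffI)?, simp_all add: addM')+ (simp add: H(2) addM')
      then show ?thesis using 2 by (simp add: f2 cl G.m_ac G.r_inv flip: G.m_assoc)
    next
      case 3
      have "H a = f (\<kappa> d \<odot>\<^bsub>M\<^esub> x) y \<otimes>\<^bsub>G\<^esub> inv\<^bsub>G\<^esub> f x (\<kappa> d \<odot>\<^bsub>M'\<^esub> y)"
        unfolding 3(1) using 3 by (subst d) (simp_all add: H(2) smM smM')
      then show ?thesis using 3 by (simp add: f3 cl smM')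
    qed
  qed blast
  then show thesis using that unfolding ct_folds(2) by (auto simp: ct_folds(3)[symmetric])
qed

end

lemma (in comm_group) finprod_swap:
  assumes "finite S" "finite U" "\<And>i j. i \<in> S \<Longrightarrow> j \<in> U \<Longrightarrow> f i j \<in> carrier G"
  shows "finprod G (\<lambda>i. finprod G (\<lambda>j. f i j) U) S = finprod G (\<lambda>j. finprod G (\<lambda>i. f i j) S) U"
  using assms(1,3)
proof (induction S rule: finite_induct)
  case (insert x F)
  have "finprod G (\<lambda>j. finprod G (\<lambda>i. f i j) (insert x F)) U =
      finprod G (\<lambda>j. f x j \<otimes> finprod G (\<lambda>i. f i j) F) U"
    using insert by (intro finprod_cong'[OF refl]) (auto intro!: m_closed finprod_closed)
  also have "\<dots> = finprod G (\<lambda>j. f x j) U \<otimes> finprod G (\<lambda>j. finprod G (\<lambda>i. f i j) F) U"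
    using insert by (intro finprod_multf) (auto intro!: finprod_closed)
  finally show ?case
    using insert by (simp add: insert.IH finprod_closed Pi_def)
qed simp

section \<open>Invariant elements and the canonical braiding\<close>

context rform begin

abbreviation "Am \<equiv> regular_module A"

lemma regular_simps [simp]: "carrier Am = carrier A" "x \<oplus>\<^bsub>Am\<^esub> y = x \<oplus>\<^bsub>A\<^esub> y" "x \<odot>\<^bsub>Am\<^esub> y = x \<otimes>\<^bsub>A\<^esub> y"
  by (simp_all add: regular_module_def)

lemma scal_qc: "scal N h c = qc (c \<cdot> 1)"
  by (simp add: smul_def ocl_const)

lemma A_add: "a \<in> carrier A \<Longrightarrow> b \<in> carrier A \<Longrightarrow> a \<oplus>\<^bsub>A\<^esub> b \<in> carrier A"
  by (elim A_cases) (simp flip: ocl_add)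

lemma A_mult: "a \<in> carrier A \<Longrightarrow> b \<in> carrier A \<Longrightarrow> a \<otimes>\<^bsub>A\<^esub> b \<in> carrier A"
  by (elim A_cases) (simp flip: ocl_mult)

lemma scal_closed: "scal N h c \<in> carrier A"
  by (simp add: scal_qc)

sublocale cl: ctens_data "scal N h" Am Gm
  by unfold_locales (simp_all add: A_add A_mult scal_closed bm.add_cl bm.smult_cl)

sublocale cr: ctens_data "scal N h" Gm Am
  by unfold_locales (simp_all add: A_add A_mult scal_closed bm.add_cl bm.smult_cl)

abbreviation "TL \<equiv> ctensor (scal N h) Am Gm"
abbreviation "TR \<equiv> ctensor (scal N h) Gm Am"
abbreviation "ctl \<equiv> ctens (scal N h) Am Gm"
abbreviation "ctr \<equiv> ctens (scal N h) Gm Am"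

lemma tl_simps:
  "ctl (qc (f + f')) (gm Y) = ctl (qc f) (gm Y) \<otimes>\<^bsub>TL\<^esub> ctl (qc f') (gm Y)"
  "ctl (qc f) (gm (\<lambda>J. Y J + Y' J)) = ctl (qc f) (gm Y) \<otimes>\<^bsub>TL\<^esub> ctl (qc f) (gm Y')"
  "ctl (qc (c \<cdot> f)) (gm Y) = ctl (qc f) (gm (\<lambda>J. c \<cdot> Y J))"
  "ctl (qc f) (gm Y) \<in> carrier TL"
  using cl.ct_add[of "qc f" "gm Y"] cl.ct_closed[of "qc f" "gm Y"]
  by (simp_all add: ocl_add gm_add[symmetric] ocl_smul) (simp add: scal_qc gm_smult)

lemma tr_simps:
  "ctr (gm Y) (qc (f + f')) = ctr (gm Y) (qc f) \<otimes>\<^bsub>TR\<^esub> ctr (gm Y) (qc f')"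
  "ctr (gm (\<lambda>J. Y J + Y' J)) (qc f) = ctr (gm Y) (qc f) \<otimes>\<^bsub>TR\<^esub> ctr (gm Y') (qc f)"
  "ctr (gm (\<lambda>J. c \<cdot> Y J)) (qc f) = ctr (gm Y) (qc (c \<cdot> f))"
  "ctr (gm Y) (qc f) \<in> carrier TR"
  using cr.ct_add[of "gm Y" "qc f"] cr.ct_closed[of "gm Y" "qc f"]
  by (simp_all add: ocl_add gm_add[symmetric] ocl_smul) (simp add: scal_qc gm_smult)

lemma A_group: "comm_group (add_monoid A)"
  using ring_Oq[of N h] abelian_group.a_comm_group ring_def by blast

lemma chi_gm: "I \<in> Id2 N \<Longrightarrow> chi 1 (gm Y I) = chr N 1 (Y I)"
  by (simp only: gm_apply chi_chr[OF h0] mult_1)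

text \<open>The map \<open>a \<otimes> y \<mapsto> a \<epsilon>(y\<^sub>I)\<close>. It turns the invariance of \<open>x\<close> into the statement that each coefficient
  \<open>x\<^sub>I\<close> is the scalar \<open>\<epsilon>(x\<^sub>I)\<close>.\<close>

lemma eval_left:
  assumes I: "I \<in> Id2 N"
  obtains \<psi> where "\<psi> \<in> hom TL (add_monoid A)" "\<And>f Y. \<psi> (ctl (qc f) (gm Y)) = qc (chr N 1 (Y I) \<cdot> f)"
proof (rule cl.ct_universal[OF A_group, of "\<lambda>a y. scal N h (chi 1 (y I)) \<otimes>\<^bsub>A\<^esub> a"])
  fix \<psi> assume p: "\<psi> \<in> hom TL (add_monoid A)"
    "\<And>x y. x \<in> carrier Am \<Longrightarrow> y \<in> carrier Gm \<Longrightarrow> \<psi> (ctl x y) = scal N h (chi 1 (y I)) \<otimes>\<^bsub>A\<^esub> x"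
  then show thesis by (intro that[of \<psi>]) (simp_all add: chi_gm[OF I] ocl_smul)
next
  fix x y x' y' c assume x: "x \<in> carrier Am" and y: "y \<in> carrier Gm"
  obtain f Y where f: "x = qc f" and Y: "y = gm Y" using x y by (auto elim!: Gm_cases A_cases)
  show "scal N h (chi 1 (y I)) \<otimes>\<^bsub>A\<^esub> x \<in> carrier (add_monoid A)"
    using x by (simp add: A_mult scal_closed)
  show "scal N h (chi 1 (y I)) \<otimes>\<^bsub>A\<^esub> (scal N h c \<odot>\<^bsub>Am\<^esub> x) = scal N h (chi 1 ((scal N h c \<odot>\<^bsub>Gm\<^esub> y) I)) \<otimes>\<^bsub>A\<^esub> x"
    unfolding f Y regular_simps scal_qc[of c] gm_smult chi_gm[OF I] ocl_mult[symmetric] ocl_smul[symmetric]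
    by (simp add: mult.commute)
  {
    assume "x' \<in> carrier Am"
    then obtain f' where f': "x' = qc f'" by (auto elim!: A_cases)
    show "scal N h (chi 1 (y I)) \<otimes>\<^bsub>A\<^esub> (x \<oplus>\<^bsub>Am\<^esub> x') =
        (scal N h (chi 1 (y I)) \<otimes>\<^bsub>A\<^esub> x) \<otimes>\<^bsub>add_monoid A\<^esub> (scal N h (chi 1 (y I)) \<otimes>\<^bsub>A\<^esub> x')"
      by (simp add: f f' smul_add flip: ocl_smul ocl_add)
  next
    assume "y' \<in> carrier Gm"
    then obtain Y' where Y': "y' = gm Y'" by (auto elim!: Gm_cases)
    show "scal N h (chi 1 ((y \<oplus>\<^bsub>Gm\<^esub> y') I)) \<otimes>\<^bsub>A\<^esub> x =
        (scal N h (chi 1 (y I)) \<otimes>\<^bsub>A\<^esub> x) \<otimes>\<^bsub>add_monoid A\<^esub> (scal N h (chi 1 (y' I)) \<otimes>\<^bsub>A\<^esub> x)"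
      unfolding Y Y' gm_add chi_gm[OF I] f by (simp add: chr_add add_smul flip: ocl_smul ocl_add)
  }
qed

text \<open>The map \<open>y \<otimes> a \<mapsto> \<epsilon>(y\<^sub>J) a\<close>, used in the same way for right-invariant elements.\<close>

lemma eval_right:
  assumes I: "I \<in> Id2 N"
  obtains \<psi> where "\<psi> \<in> hom TR (add_monoid A)" "\<And>f Y. \<psi> (ctr (gm Y) (qc f)) = qc (chr N 1 (Y I) \<cdot> f)"
proof (rule cr.ct_universal[OF A_group, of "\<lambda>y a. scal N h (chi 1 (y I)) \<otimes>\<^bsub>A\<^esub> a"])
  fix \<psi> assume p: "\<psi> \<in> hom TR (add_monoid A)"
    "\<And>y x. y \<in> carrier Gm \<Longrightarrow> x \<in> carrier Am \<Longrightarrow> \<psi> (ctr y x) = scal N h (chi 1 (y I)) \<otimes>\<^bsub>A\<^esub> x"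
  then show thesis by (intro that[of \<psi>]) (simp_all add: chi_gm[OF I] ocl_smul)
next
  fix x y x' y' c assume y: "y \<in> carrier Gm" and x: "x \<in> carrier Am"
  obtain f Y where f: "x = qc f" and Y: "y = gm Y" using x y by (auto elim!: Gm_cases A_cases)
  show "scal N h (chi 1 (y I)) \<otimes>\<^bsub>A\<^esub> x \<in> carrier (add_monoid A)"
    using x by (simp add: A_mult scal_closed)
  show "scal N h (chi 1 ((scal N h c \<odot>\<^bsub>Gm\<^esub> y) I)) \<otimes>\<^bsub>A\<^esub> x = scal N h (chi 1 (y I)) \<otimes>\<^bsub>A\<^esub> (scal N h c \<odot>\<^bsub>Am\<^esub> x)"
    unfolding f Y regular_simps scal_qc[of c] gm_smult chi_gm[OF I] ocl_mult[symmetric] ocl_smul[symmetric]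
    by (simp add: mult.commute)
  {
    assume "x' \<in> carrier Am"
    then obtain f' where f': "x' = qc f'" by (auto elim!: A_cases)
    show "scal N h (chi 1 (y I)) \<otimes>\<^bsub>A\<^esub> (x \<oplus>\<^bsub>Am\<^esub> x') =
        (scal N h (chi 1 (y I)) \<otimes>\<^bsub>A\<^esub> x) \<otimes>\<^bsub>add_monoid A\<^esub> (scal N h (chi 1 (y I)) \<otimes>\<^bsub>A\<^esub> x')"
      by (simp add: f f' smul_add flip: ocl_smul ocl_add)
  next
    assume "y' \<in> carrier Gm"
    then obtain Y' where Y': "y' = gm Y'" by (auto elim!: Gm_cases)
    show "scal N h (chi 1 ((y \<oplus>\<^bsub>Gm\<^esub> y') I)) \<otimes>\<^bsub>A\<^esub> x =
        (scal N h (chi 1 (y I)) \<otimes>\<^bsub>A\<^esub> x) \<otimes>\<^bsub>add_monoid A\<^esub> (scal N h (chi 1 (y' I)) \<otimes>\<^bsub>A\<^esub> x)"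
      unfolding Y Y' gm_add chi_gm[OF I] f by (simp add: chr_add add_smul flip: ocl_smul ocl_add)
  }
qed

lemma hom_glift:
  assumes G: "comm_group G" and \<psi>: "\<psi> \<in> hom G (add_monoid A)" and \<beta>: "goodb G N h \<beta>" and B: "bilin B"
    and v: "\<And>f g. \<psi> (\<beta> (qc f) (qc g)) = qc (B f g)"
  shows "\<psi> (glift G N h \<beta> z) = qc (blift B z)"
proof (induction z rule: falg2_induct)
  case (tn f g)
  show ?case by (simp add: glift_tn[OF G \<beta>] v B)
next
  case (add x y)
  have "\<psi> (glift G N h \<beta> (x + y)) = \<psi> (glift G N h \<beta> x) \<oplus>\<^bsub>A\<^esub> \<psi> (glift G N h \<beta> y)"
    using hom_mult[OF \<psi> glift_closed[OF G \<beta>] glift_closed[OF G \<beta>]] by (simp add: glift_add[OF G \<beta>])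
  then show ?case by (simp add: add B blift_add ocl_add)
qed

lemma goodb_left: "goodb TL N h (\<lambda>a1 a2. ctl a1 (a2 \<odot>\<^bsub>Gm\<^esub> theta N h I))"
  by (rule goodbI) (simp_all add: theta_gm gm_smult tl_simps distrib_right)

lemma goodb_right: "goodb TR N h (\<lambda>a1 a2. ctr (a1 \<odot>\<^bsub>Gm\<^esub> theta N h J) (a2 \<otimes>\<^bsub>A\<^esub> qc b))"
  by (rule goodbI) (simp_all add: theta_gm gm_smult tr_simps distrib_right flip: ocl_mult)

lemma left_coaction_gm:
  "left_coaction N h s r (gm X) = finprod TL
    (\<lambda>I. glift TL N h (\<lambda>a1 a2. ctl a1 (a2 \<odot>\<^bsub>Gm\<^esub> theta N h I)) (Dl N (X I))) (Id2 N)"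
proof -
  interpret T: comm_group TL by (rule cl.ct_comm_group)
  show ?thesis unfolding left_coaction_def Let_def
    by (rule T.finprod_cong'[OF refl])
      (simp_all only: gm_apply sweedler_glift[OF cl.ct_comm_group goodb_left h0],
        simp add: glift_closed[OF cl.ct_comm_group goodb_left])
qed

lemma vcoef_vg: "I \<in> Id2 N \<Longrightarrow> J \<in> Id2 N \<Longrightarrow> vcoef N h J I = qc (vg J I)"
proof -
  assume "I \<in> Id2 N" "J \<in> Id2 N"
  then obtain i j k l where "I = (i, j)" "J = (k, l)" "i \<in> {1..N}" "j \<in> {1..N}" "k \<in> {1..N}" "l \<in> {1..N}" by auto
  then show ?thesis by (simp add: vcoef_def vg_def ocl_mult Su_Sg ocl_gen del: atLeastAtMost_iff)
qed

lemma right_coaction_gm: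
  "right_coaction N h s r (gm X) = finprod TR (\<lambda>I. finprod TR
    (\<lambda>J. glift TR N h (\<lambda>a1 a2. ctr (a1 \<odot>\<^bsub>Gm\<^esub> theta N h J) (a2 \<otimes>\<^bsub>A\<^esub> qc (vg J I))) (Dl N (X I))) (Id2 N)) (Id2 N)"
proof -
  interpret T: comm_group TR by (rule cr.ct_comm_group)
  show ?thesis unfolding right_coaction_def Let_def
    by (rule T.finprod_cong'[OF refl], simp add: glift_closed[OF cr.ct_comm_group goodb_right],
        rule T.finprod_cong'[OF refl], simp add: glift_closed[OF cr.ct_comm_group goodb_right])
      (simp only: gm_apply vcoef_vg sweedler_glift[OF cr.ct_comm_group goodb_right h0])
qed

lemma finsum_qc: "finite S \<Longrightarrow> finprod (add_monoid A) (\<lambda>i. qc (f i)) S = qc (sum f S)"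
  by (simp add: ocl_sum finsum_def)

lemma theta_left_invariant: "I \<in> Id2 N \<Longrightarrow> gm (theta_coeff I) \<in> left_invariants N h s r"
proof -
  assume I: "I \<in> Id2 N"
  interpret T: comm_group TL by (rule cl.ct_comm_group)
  have g: "glift TL N h (\<lambda>a1 a2. ctl a1 (a2 \<odot>\<^bsub>Gm\<^esub> theta N h J)) (Dl N (theta_coeff I J)) =
      (if I = J then ctl (qc 1) (gm (theta_coeff J)) else \<one>\<^bsub>TL\<^esub>)" for J
  proof (cases "I = J")
    case True
    have "Dl N (theta_coeff I J) = tn 1 1" using True by (simp add: theta_coeff_def Dl_1 tn_1_1)
    then show ?thesis using True
      by (simp only: glift_tn[OF cl.ct_comm_group goodb_left] if_True) (simp add: theta_gm gm_smult)
  next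
    case False
    then have "Dl N (theta_coeff I J) = 0" by (simp add: theta_coeff_def)
    then show ?thesis using False by (simp only: glift_0[OF cl.ct_comm_group goodb_left] if_False)
  qed
  have "left_coaction N h s r (gm (theta_coeff I)) = ctl (qc 1) (gm (theta_coeff I))"
    unfolding left_coaction_gm g using I by (subst T.finprod_singleton) (simp_all add: tl_simps)
  then show ?thesis by (simp add: left_invariants_def ocl_1)
qed

lemma left_invariant_cases:
  assumes "x \<in> left_invariants N h s r"
  obtains c where "x = gm (\<lambda>I. c I \<cdot> 1)"
proof -
  obtain X where X: "x = gm X" using assms unfolding left_invariants_def by (auto elim!: Gm_cases)
  have "qc (X I) = qc (chr N 1 (X I) \<cdot> 1)" if I: "I \<in> Id2 N" for I
  proof -
    obtain \<psi> where p: "\<psi> \<in> hom TL (add_monoid A)" "\<And>f Y. \<psi> (ctl (qc f) (gm Y)) = qc (chr N 1 (Y I) \<cdot> f)"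
      using eval_left[OF I] by blast
    let ?B = "\<lambda>J f g. (chr N 1 (g * theta_coeff J I)) \<cdot> f"
    have B: "bilin (?B J)" for J
      by (rule bilinI) (simp_all add: chr_mult chr_add distrib_right add_smul smul_add mult_ac)
    have v: "\<psi> (glift TL N h (\<lambda>a1 a2. ctl a1 (a2 \<odot>\<^bsub>Gm\<^esub> theta N h J)) z) = qc (blift (?B J) z)" for J z
      by (rule hom_glift[OF cl.ct_comm_group p(1) goodb_left B]) (simp add: theta_gm gm_smult p(2))
    have b: "blift (?B J) z = of_bool (J = I) \<cdot> blift (\<lambda>f g. chr N 1 g \<cdot> f) z" for J z
    proof (induction z rule: falg2_induct)
      case (tn f g)
      have C: "bilin (\<lambda>f g. chr N 1 g \<cdot> f)" by (rule bilinI) (simp_all add: chr_add add_smul smul_add mult.commute)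
      then show ?case
        by (simp only: blift_tn[OF B] blift_tn[OF C]) (simp add: chr_mult theta_coeff_def)
    next
      case (add y z)
      have C: "bilin (\<lambda>f g. chr N 1 g \<cdot> f)" by (rule bilinI) (simp_all add: chr_add add_smul smul_add mult.commute)
      then show ?case by (simp only: add blift_add[OF B] blift_add[OF C] smul_add)
    qed
    have "\<psi> (left_coaction N h s r (gm X)) = finprod (add_monoid A) (\<lambda>J. qc (blift (?B J) (Dl N (X J)))) (Id2 N)"
      unfolding left_coaction_gm
      by (subst hom_finprod[OF cl.ct_comm_group A_group p(1)])
        (simp_all add: v glift_closed[OF cl.ct_comm_group goodb_left])
    also have "\<dots> = qc (\<Sum>J\<in>Id2 N. of_bool (J = I) \<cdot> blift (\<lambda>f g. chr N 1 g \<cdot> f) (Dl N (X J)))"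
      by (simp only: finsum_qc finite_cartesian_product finite_atLeastAtMost b)
    also have "\<dots> = qc (X I)"
      by (subst sum_of_bool_smul(1)[OF _ I]) (simp_all add: counit_left(2)[OF h0])
    finally have 1: "\<psi> (left_coaction N h s r (gm X)) = qc (X I)" .
    have 2: "left_coaction N h s r (gm X) = ctl (qc 1) (gm X)"
      using assms by (simp add: left_invariants_def X ocl_1)
    show ?thesis using 1 unfolding 2 p(2) by (rule sym)
  qed
  then have "gm X = gm (\<lambda>I. chr N 1 (X I) \<cdot> 1)" by (rule gm_eqI)
  then show thesis using that[of "\<lambda>I. chr N 1 (X I)"] X by simp
qed

lemma tr_sum_right:
  "finite S \<Longrightarrow> finprod TR (\<lambda>i. ctr (gm Y) (qc (f i))) S = ctr (gm Y) (qc (sum f S))"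
proof (induction S rule: finite_induct)
  interpret T: comm_group TR by (rule cr.ct_comm_group)
  case empty
  have "ctr (gm Y) (qc 0) \<otimes>\<^bsub>TR\<^esub> ctr (gm Y) (qc 0) = ctr (gm Y) (qc 0)"
    using tr_simps(1)[of Y 0 0] by simp
  then have "ctr (gm Y) (qc 0) = \<one>\<^bsub>TR\<^esub>"
    using T.l_cancel_one'[OF tr_simps(4) tr_simps(4), of Y 0 Y 0] by simp
  then show ?case by simp
next
  interpret T: comm_group TR by (rule cr.ct_comm_group)
  case (insert x F)
  then show ?case by (simp add: tr_simps)
qed

lemma tr_sum_left:
  "finite S \<Longrightarrow> finprod TR (\<lambda>i. ctr (gm (Y i)) (qc f)) S = ctr (gm (\<lambda>J. \<Sum>i\<in>S. Y i J)) (qc f)"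
proof (induction S rule: finite_induct)
  interpret T: comm_group TR by (rule cr.ct_comm_group)
  case empty
  have "ctr (gm (\<lambda>J. 0)) (qc f) \<otimes>\<^bsub>TR\<^esub> ctr (gm (\<lambda>J. 0)) (qc f) = ctr (gm (\<lambda>J. 0)) (qc f)"
    using tr_simps(2)[of "\<lambda>J. 0" "\<lambda>J. 0" f] by simp
  then have "ctr (gm (\<lambda>J. 0)) (qc f) = \<one>\<^bsub>TR\<^esub>"
    using T.l_cancel_one'[OF tr_simps(4) tr_simps(4), of "\<lambda>J. 0" f "\<lambda>J. 0" f] by simp
  then show ?case by simp
next
  interpret T: comm_group TR by (rule cr.ct_comm_group)
  case (insert x F)
  then show ?case by (simp add: tr_simps)
qed

text \<open>From \<open>\<Delta>(w\<^sub>I\<^sub>P) = \<Sum> w\<^sub>Q\<^sub>P \<otimes> w\<^sub>I\<^sub>Q\<close> one gets \<open>\<Delta>\<^sub>R(\<eta>\<^sub>P) = \<Sum> w\<^sub>Q\<^sub>P \<theta>\<^sub>J \<otimes> w\<^sub>I\<^sub>Q v\<^sub>J\<^sub>I\<close>, and the second factors sum to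
  \<open>\<delta>\<^sub>J\<^sub>Q\<close>.\<close>

lemma eta_right_invariant:
  assumes P: "P \<in> Id2 N"
  shows "gm (\<lambda>J. wg J P) \<in> right_invariants N h s r"
proof -
  interpret T: comm_group TR by (rule cr.ct_comm_group)
  let ?t = "\<lambda>I J Q. ctr (gm (\<lambda>L. wg Q P * theta_coeff J L)) (qc (wg I Q * vg J I))"
  have "right_coaction N h s r (gm (\<lambda>J. wg J P)) =
      finprod TR (\<lambda>I. finprod TR (\<lambda>J. finprod TR (\<lambda>Q. ?t I J Q) (Id2 N)) (Id2 N)) (Id2 N)"
    unfolding right_coaction_gm Dl_wg
    by (simp only: glift_sum[OF cr.ct_comm_group goodb_right] finite_cartesian_product finite_atLeastAtMost
        glift_tn[OF cr.ct_comm_group goodb_right], simp only: theta_gm gm_smult ocl_mult[symmetric])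
  also have "\<dots> = finprod TR (\<lambda>J. finprod TR (\<lambda>I. finprod TR (\<lambda>Q. ?t I J Q) (Id2 N)) (Id2 N)) (Id2 N)"
    by (rule T.finprod_swap)
      (simp_all only: finite_cartesian_product finite_atLeastAtMost, auto intro!: T.finprod_closed tr_simps(4))
  also have "\<dots> = finprod TR (\<lambda>J. finprod TR (\<lambda>Q. finprod TR (\<lambda>I. ?t I J Q) (Id2 N)) (Id2 N)) (Id2 N)"
    by (rule T.finprod_cong'[OF refl], (auto intro!: T.finprod_closed tr_simps(4))[1], rule T.finprod_swap)
      (simp_all only: finite_cartesian_product finite_atLeastAtMost tr_simps(4))
  also have "\<dots> = finprod TR (\<lambda>J. finprod TR (\<lambda>Q. ctr (gm (\<lambda>L. of_bool (J = Q) \<cdot> (wg Q P * theta_coeff J L))) (qc 1)) (Id2 N)) (Id2 N)"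
  proof (rule T.finprod_cong'[OF refl], (auto intro!: T.finprod_closed tr_simps(4))[1],
      rule T.finprod_cong'[OF refl], (auto intro!: T.finprod_closed tr_simps(4))[1])
    fix J Q assume J: "J \<in> Id2 N" and Q: "Q \<in> Id2 N"
    show "finprod TR (\<lambda>I. ?t I J Q) (Id2 N) = ctr (gm (\<lambda>L. of_bool (J = Q) \<cdot> (wg Q P * theta_coeff J L))) (qc 1)"
      by (simp only: tr_sum_right finite_cartesian_product finite_atLeastAtMost wg_vg[OF J Q] tr_simps(3))
  qed
  also have "\<dots> = ctr (gm (\<lambda>L. \<Sum>J\<in>Id2 N. \<Sum>Q\<in>Id2 N. of_bool (J = Q) \<cdot> (wg Q P * theta_coeff J L))) (qc 1)"
    by (simp only: tr_sum_left finite_cartesian_product finite_atLeastAtMost)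
  also have "gm (\<lambda>L. \<Sum>J\<in>Id2 N. \<Sum>Q\<in>Id2 N. of_bool (J = Q) \<cdot> (wg Q P * theta_coeff J L)) = gm (\<lambda>J. wg J P)"
  proof (rule gm_eqI)
    fix L assume L: "L \<in> Id2 N"
    have "(\<Sum>J\<in>Id2 N. \<Sum>Q\<in>Id2 N. of_bool (J = Q) \<cdot> (wg Q P * theta_coeff J L)) = (\<Sum>J\<in>Id2 N. wg J P * theta_coeff J L)"
      by (intro sum.cong refl) (rule sum_of_bool_smul(2), simp_all)
    then show "qc (\<Sum>J\<in>Id2 N. \<Sum>Q\<in>Id2 N. of_bool (J = Q) \<cdot> (wg Q P * theta_coeff J L)) = qc (wg L P)"
      by (simp only: sum_theta_coeff'[OF L])
  qed
  finally show ?thesis by (simp add: right_invariants_def ocl_1)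
qed

text \<open>Applying \<open>\<epsilon>\<close> to the first factor of \<open>\<Delta>\<^sub>R(x) = x \<otimes> 1\<close> gives \<open>\<Sum> x\<^sub>I v\<^sub>J\<^sub>I = \<epsilon>(x\<^sub>J)\<close>, which is solved for \<open>x\<close> with
  the inverse matrix \<open>w\<close>.\<close>

lemma right_invariant_cases:
  assumes "x \<in> right_invariants N h s r"
  obtains d where "x = gm (\<lambda>J. \<Sum>P\<in>Id2 N. d P \<cdot> wg J P)"
proof -
  obtain X where X: "x = gm X" using assms unfolding right_invariants_def by (auto elim!: Gm_cases)
  have key: "qc (\<Sum>I\<in>Id2 N. X I * vg J I) = qc (chr N 1 (X J) \<cdot> 1)" if J: "J \<in> Id2 N" for J
  proof -
    obtain \<psi> where p: "\<psi> \<in> hom TR (add_monoid A)" "\<And>f Y. \<psi> (ctr (gm Y) (qc f)) = qc (chr N 1 (Y J) \<cdot> f)"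
      using eval_right[OF J] by blast
    let ?B = "\<lambda>I K f g. (chr N 1 (f * theta_coeff K J)) \<cdot> (g * vg K I)"
    let ?C = "\<lambda>f g. chr N 1 f \<cdot> g"
    have B: "bilin (?B I K)" for I K
      by (rule bilinI) (simp_all add: chr_mult chr_add distrib_right add_smul smul_add mult_ac)
    have C: "bilin ?C" by (rule bilinI) (simp_all add: chr_add add_smul smul_add mult.commute)
    have v: "\<psi> (glift TR N h (\<lambda>a1 a2. ctr (a1 \<odot>\<^bsub>Gm\<^esub> theta N h K) (a2 \<otimes>\<^bsub>A\<^esub> qc (vg K I))) z) = qc (blift (?B I K) z)" for I K z
      by (rule hom_glift[OF cr.ct_comm_group p(1) goodb_right B]) (simp add: theta_gm gm_smult p(2) flip: ocl_mult)
    have b: "blift (?B I K) z = of_bool (K = J) \<cdot> (blift ?C z * vg K I)" for I K z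
    proof (induction z rule: falg2_induct)
      case (tn f g)
      show ?case by (simp only: blift_tn[OF B] blift_tn[OF C]) (simp add: chr_mult theta_coeff_def mult.commute)
    next
      case (add y z)
      then show ?case by (simp only: blift_add[OF B] blift_add[OF C] distrib_right smul_add)
    qed
    interpret T: comm_group TR by (rule cr.ct_comm_group)
    have cl: "glift TR N h (\<lambda>a1 a2. ctr (a1 \<odot>\<^bsub>Gm\<^esub> theta N h K) (a2 \<otimes>\<^bsub>A\<^esub> qc (vg K I))) z \<in> carrier TR" for I K z
      by (rule glift_closed[OF cr.ct_comm_group goodb_right])
    have "\<psi> (right_coaction N h s r (gm X)) =
       finprod (add_monoid A) (\<lambda>I. finprod (add_monoid A) (\<lambda>K. qc (blift (?B I K) (Dl N (X I)))) (Id2 N)) (Id2 N)"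
    proof -
      have in1: "\<psi> (finprod TR (\<lambda>J. glift TR N h (\<lambda>a1 a2. ctr (a1 \<odot>\<^bsub>Gm\<^esub> theta N h J) (a2 \<otimes>\<^bsub>A\<^esub> qc (vg J I))) (Dl N (X I))) (Id2 N))
          = finprod (add_monoid A) (\<lambda>K. qc (blift (?B I K) (Dl N (X I)))) (Id2 N)" for I
        by (subst hom_finprod[OF cr.ct_comm_group A_group p(1)]) (simp_all only: cl v finite_cartesian_product finite_atLeastAtMost)
      show ?thesis unfolding right_coaction_gm
        by (subst hom_finprod[OF cr.ct_comm_group A_group p(1)])
          (auto intro!: T.finprod_closed cl simp only: in1 finite_cartesian_product finite_atLeastAtMost)
    qed
    also have "\<dots> = qc (\<Sum>I\<in>Id2 N. \<Sum>K\<in>Id2 N. of_bool (K = J) \<cdot> (blift ?C (Dl N (X I)) * vg K I))"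
      by (simp only: finsum_qc finite_cartesian_product finite_atLeastAtMost b)
    also have "(\<Sum>I\<in>Id2 N. \<Sum>K\<in>Id2 N. of_bool (K = J) \<cdot> (blift ?C (Dl N (X I)) * vg K I)) =
        (\<Sum>I\<in>Id2 N. blift ?C (Dl N (X I)) * vg J I)"
      by (intro sum.cong refl, rule sum_of_bool_smul(1)[OF _ J]) simp
    also have "qc \<dots> = qc (\<Sum>I\<in>Id2 N. X I * vg J I)"
      by (rule ocl_sum_cong, rule ocl_cong(2)[OF _ refl], rule counit_left(1)[OF h0])
    finally have 1: "\<psi> (right_coaction N h s r (gm X)) = qc (\<Sum>I\<in>Id2 N. X I * vg J I)" .
    have 2: "right_coaction N h s r (gm X) = ctr (gm X) (qc 1)"
      using assms by (simp add: right_invariants_def X ocl_1)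
    show ?thesis using 1 unfolding 2 p(2) by (rule sym)
  qed
  have "gm X = gm (\<lambda>J. \<Sum>P\<in>Id2 N. chr N 1 (X P) \<cdot> wg J P)"
  proof (rule gm_eqI)
    fix K assume K: "K \<in> Id2 N"
    have e1: "X K = (\<Sum>I\<in>Id2 N. X I * (of_bool (I = K) \<cdot> 1))"
      by (simp only: smul_simps mult_1_right, subst sum_of_bool_smul(1)[OF _ K]) simp_all
    have e2: "qc (\<Sum>I\<in>Id2 N. X I * (of_bool (I = K) \<cdot> 1)) = qc (\<Sum>I\<in>Id2 N. X I * (\<Sum>J\<in>Id2 N. vg J I * wg K J))"
      by (rule ocl_sum_cong, rule ocl_cong(2)[OF refl], rule vg_wg[symmetric, OF _ K])
    have e3: "(\<Sum>I\<in>Id2 N. X I * (\<Sum>J\<in>Id2 N. vg J I * wg K J)) = (\<Sum>J\<in>Id2 N. (\<Sum>I\<in>Id2 N. X I * vg J I) * wg K J)"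
      by (simp add: sum_distrib_left sum_distrib_right mult.assoc) (rule sum.swap)
    have e4: "qc (\<Sum>J\<in>Id2 N. (\<Sum>I\<in>Id2 N. X I * vg J I) * wg K J) = qc (\<Sum>J\<in>Id2 N. (chr N 1 (X J) \<cdot> 1) * wg K J)"
      by (rule ocl_sum_cong, rule ocl_cong(2)[OF _ refl], rule key)
    show "qc (X K) = qc (\<Sum>P\<in>Id2 N. chr N 1 (X P) \<cdot> wg K P)"
      using trans[OF arg_cong[OF e1, of qc] trans[OF e2 trans[OF arg_cong[OF e3, of qc] e4]]] by simp
  qed
  then show thesis using that[of "\<lambda>P. chr N 1 (X P)"] X by simp
qed

lemma braid_frag_flip:
  "braid_frag (\<lambda>I. c I \<cdot> 1) (\<lambda>J. \<Sum>P\<in>Id2 N. d P \<cdot> wg J P)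
    - frag_of [gm (\<lambda>J. \<Sum>P\<in>Id2 N. d P \<cdot> wg J P), gm (\<lambda>I. c I \<cdot> 1)] \<in> Kg 2"
proof -
  let ?X = "\<lambda>I. c I \<cdot> 1 :: falg" and ?Y = "\<lambda>J. \<Sum>P\<in>Id2 N. d P \<cdot> wg J P"
  have y: "qc (\<Sum>J\<in>Id2 N. ?Y J * vg M J) = qc (d M \<cdot> 1)" if M: "M \<in> Id2 N" for M
  proof -
    have "(\<Sum>J\<in>Id2 N. ?Y J * vg M J) = (\<Sum>P\<in>Id2 N. d P \<cdot> (\<Sum>J\<in>Id2 N. wg J P * vg M J))"
      by (simp add: smul_sum sum_distrib_right) (rule sum.swap)
    also have "qc \<dots> = qc (\<Sum>P\<in>Id2 N. d P \<cdot> of_bool (M = P) \<cdot> 1)"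
      by (rule ocl_sum_cong, rule ocl_cong(3), rule wg_vg[OF M])
    also have "(\<Sum>P\<in>Id2 N. d P \<cdot> of_bool (M = P) \<cdot> 1) = (d M \<cdot> 1 :: falg)"
      by (simp only: smul_simps, rule sum_of_bool_smul(4)[OF _ M]) simp
    finally show ?thesis .
  qed
  have braid_coeff: "qc (braid_coeff ?X ?Y M I) = qc ((c I * d M) \<cdot> 1)" if M: "M \<in> Id2 N" and I: "I \<in> Id2 N" for M I
  proof -
    have "qc (braid_coeff ?X ?Y M I) = qc (\<Sum>K\<in>Id2 N. ?X K * RR K I (d M \<cdot> 1))"
      unfolding braid_coeff_def by (rule ocl_sum_cong, rule ocl_cong(2)[OF refl], rule RR_cong[OF _ I y[OF M]])
    also have "(\<Sum>K\<in>Id2 N. ?X K * RR K I (d M \<cdot> 1)) = (\<Sum>K\<in>Id2 N. of_bool (K = I) \<cdot> (c K * d M) \<cdot> 1)"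
      using I by (intro sum.cong refl) (simp add: RR_smul RR_1 mult_ac)
    also have "\<dots> = (c I * d M) \<cdot> 1"
      by (rule sum_of_bool_smul(1)[OF _ I]) simp
    finally show ?thesis .
  qed
  let ?s = "\<Sum>I\<in>Id2 N. \<Sum>P\<in>Id2 N. eta_theta P I ((c I * d P) \<cdot> 1)"
  have 1: "braid_frag ?X ?Y = ?s"
    unfolding braid_frag_def by (subst sum.swap) (intro sum.cong refl eta_theta_cong braid_coeff)
  have 2: "frag_of [gm ?Y, gm ?X] = slot_tensor [gm ?Y] (\<lambda>L. \<Sum>I\<in>Id2 N. c I \<cdot> theta_coeff I L) []"
  proof -
    have "frag_of [gm ?Y, gm ?X] = slot_tensor [gm ?Y] ?X []" by (simp add: slot_tensor_def)
    also have "\<dots> = slot_tensor [gm ?Y] (\<lambda>L. \<Sum>I\<in>Id2 N. c I \<cdot> theta_coeff I L) []"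
    proof (rule slot_tensor_cong)
      fix L assume "L \<in> Id2 N"
      then have "(\<Sum>I\<in>Id2 N. (c I \<cdot> 1) * theta_coeff I L) = c L \<cdot> 1" by (rule sum_theta_coeff')
      then show "qc (c L \<cdot> 1) = qc (\<Sum>I\<in>Id2 N. c I \<cdot> theta_coeff I L)" by simp
    qed
    finally show ?thesis .
  qed
  have 3: "slot_tensor [gm ?Y] (\<lambda>L. \<Sum>I\<in>Id2 N. c I \<cdot> theta_coeff I L) [] - (\<Sum>I\<in>Id2 N. slot_tensor [gm ?Y] (\<lambda>L. c I \<cdot> theta_coeff I L) []) \<in> Kg 2"
    by (rule slot_tensor_sum) simp_all
  have 4: "(\<Sum>I\<in>Id2 N. slot_tensor [gm ?Y] (\<lambda>L. c I \<cdot> theta_coeff I L) []) - ?s \<in> Kg 2"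
  proof (intro Kg_sum)
    fix I
    have a: "slot_tensor [] (\<lambda>J. c I \<cdot> ?Y J) [gm (theta_coeff I)] - slot_tensor [gm ?Y] (\<lambda>L. c I \<cdot> theta_coeff I L) [] \<in> Kg 2"
      using slot_tensor_scal[of "[]" "[]" 2 "c I" ?Y "theta_coeff I"] by simp
    have b: "slot_tensor [] (\<lambda>J. c I \<cdot> ?Y J) [gm (theta_coeff I)] = slot_tensor [] (\<lambda>J. \<Sum>P\<in>Id2 N. ((c I * d P) \<cdot> 1) * wg J P) [gm (theta_coeff I)]"
      by (rule slot_tensor_cong) (simp add: smul_sum)
    have e: "slot_tensor [] (\<lambda>J. \<Sum>P\<in>Id2 N. ((c I * d P) \<cdot> 1) * wg J P) [gm (theta_coeff I)] - (\<Sum>P\<in>Id2 N. eta_theta P I ((c I * d P) \<cdot> 1)) \<in> Kg 2"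
      unfolding eta_theta_def theta_gm by (rule slot_tensor_sum) simp_all
    show "slot_tensor [gm ?Y] (\<lambda>L. c I \<cdot> theta_coeff I L) [] - (\<Sum>P\<in>Id2 N. eta_theta P I ((c I * d P) \<cdot> 1)) \<in> Kg 2"
      by (rule Kg_trans[OF Kg_sym[OF a[unfolded b]] e])
  qed
  show ?thesis unfolding 1 2 by (rule Kg_sym[OF Kg_trans[OF 3 4]])
qed

abbreviation "Li \<equiv> left_invariants N h s r"
abbreviation "Ri \<equiv> right_invariants N h s r"

lemma braid_map_is_braiding: "is_braiding A Gm Li Ri braid_map"
  unfolding is_braiding_def
proof (intro conjI ballI)
  fix \<omega> \<eta> assume i: "\<omega> \<in> Li" "\<eta> \<in> Ri"
  obtain c where c: "\<omega> = gm (\<lambda>I. c I \<cdot> 1)" using left_invariant_cases[OF i(1)] .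
  obtain d where d: "\<eta> = gm (\<lambda>J. \<Sum>P\<in>Id2 N. d P \<cdot> wg J P)" using right_invariant_cases[OF i(2)] .
  show "braid_map (tens A Gm [\<omega>, \<eta>]) = tens A Gm [\<eta>, \<omega>]"
    unfolding c d braid_map_tens unfolding bm.tens2
    by (subst bm.tc_eq_iff) (simp_all only: braid_frag_keys braid_frag_flip, simp add: bm.tup2)
qed (simp_all add: braid_map_bimodule_hom)

text \<open>Left-invariant times right-invariant elements generate the tensor square as a left module.\<close>

lemma tensor_expand: "frag_of [gm X, gm Y]
    - (\<Sum>M\<in>Id2 N. \<Sum>I\<in>Id2 N. frag_of [qc (braid_coeff X Y M I) \<odot>\<^bsub>Gm\<^esub> gm (theta_coeff I), gm (\<lambda>J. wg J M)]) \<in> Kg 2"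
proof -
  let ?y = "\<lambda>M. \<Sum>J\<in>Id2 N. Y J * vg M J"
  have Y: "qc (Y L) = qc (\<Sum>M\<in>Id2 N. ?y M * wg L M)" if L: "L \<in> Id2 N" for L
  proof -
    have e1: "Y L = (\<Sum>I\<in>Id2 N. Y I * (of_bool (I = L) \<cdot> 1))"
      by (simp only: smul_simps mult_1_right, subst sum_of_bool_smul(1)[OF _ L]) simp_all
    have e2: "qc (\<Sum>I\<in>Id2 N. Y I * (of_bool (I = L) \<cdot> 1)) = qc (\<Sum>I\<in>Id2 N. Y I * (\<Sum>J\<in>Id2 N. vg J I * wg L J))"
      by (rule ocl_sum_cong, rule ocl_cong(2)[OF refl], rule vg_wg[symmetric, OF _ L])
    have e3: "(\<Sum>I\<in>Id2 N. Y I * (\<Sum>J\<in>Id2 N. vg J I * wg L J)) = (\<Sum>M\<in>Id2 N. ?y M * wg L M)"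
      by (simp add: sum_distrib_left sum_distrib_right mult.assoc) (rule sum.swap)
    show ?thesis by (rule trans[OF arg_cong[OF e1, of qc] trans[OF e2 arg_cong[OF e3, of qc]]])
  qed
  have 1: "frag_of [gm X, gm Y] = slot_tensor [gm X] (\<lambda>L. \<Sum>M\<in>Id2 N. ?y M * wg L M) []"
  proof -
    have "frag_of [gm X, gm Y] = slot_tensor [gm X] Y []" by (simp add: slot_tensor_def)
    also have "\<dots> = slot_tensor [gm X] (\<lambda>L. \<Sum>M\<in>Id2 N. ?y M * wg L M) []" by (rule slot_tensor_cong[OF Y])
    finally show ?thesis .
  qed
  have 2: "slot_tensor [gm X] (\<lambda>L. \<Sum>M\<in>Id2 N. ?y M * wg L M) [] - (\<Sum>M\<in>Id2 N. slot_tensor [gm X] (\<lambda>L. ?y M * wg L M) []) \<in> Kg 2"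
    by (rule slot_tensor_sum) simp_all
  have 3: "slot_tensor [gm X] (\<lambda>L. ?y M * wg L M) [] -
      (\<Sum>I\<in>Id2 N. frag_of [qc (braid_coeff X Y M I) \<odot>\<^bsub>Gm\<^esub> gm (theta_coeff I), gm (\<lambda>J. wg J M)]) \<in> Kg 2" for M
  proof -
    have a: "frag_of [rsmult Gm (gm X) (qc (?y M)), gm (\<lambda>J. wg J M)] - slot_tensor [gm X] (\<lambda>L. ?y M * wg L M) [] \<in> Kg 2"
      using bm.Kt_bal_rel[of "[]" "[]" "gm X" "gm (\<lambda>J. wg J M)" "qc (?y M)" 2] by (simp add: slot_tensor_def gm_smult)
    have b: "frag_of [rsmult Gm (gm X) (qc (?y M)), gm (\<lambda>J. wg J M)] =
        slot_tensor [] (\<lambda>L. \<Sum>I\<in>Id2 N. braid_coeff X Y M I * theta_coeff I L) [gm (\<lambda>J. wg J M)]"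
    proof -
      have "frag_of [rsmult Gm (gm X) (qc (?y M)), gm (\<lambda>J. wg J M)] = slot_tensor [] (\<lambda>I. braid_coeff X Y M I) [gm (\<lambda>J. wg J M)]"
        by (simp add: gm_rsmult slot_tensor_def braid_coeff_def)
      also have "\<dots> = slot_tensor [] (\<lambda>L. \<Sum>I\<in>Id2 N. braid_coeff X Y M I * theta_coeff I L) [gm (\<lambda>J. wg J M)]"
        by (rule slot_tensor_cong) (simp only: sum_theta_coeff')
      finally show ?thesis .
    qed
    have e: "slot_tensor [] (\<lambda>L. \<Sum>I\<in>Id2 N. braid_coeff X Y M I * theta_coeff I L) [gm (\<lambda>J. wg J M)] -
        (\<Sum>I\<in>Id2 N. slot_tensor [] (\<lambda>L. braid_coeff X Y M I * theta_coeff I L) [gm (\<lambda>J. wg J M)]) \<in> Kg 2"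
      by (rule slot_tensor_sum) simp_all
    have f: "slot_tensor [] (\<lambda>L. braid_coeff X Y M I * theta_coeff I L) [gm (\<lambda>J. wg J M)] =
        frag_of [qc (braid_coeff X Y M I) \<odot>\<^bsub>Gm\<^esub> gm (theta_coeff I), gm (\<lambda>J. wg J M)]" for I
      by (simp add: slot_tensor_def gm_smult)
    show ?thesis using Kg_trans[OF Kg_sym[OF a[unfolded b]] e] unfolding f .
  qed
  show ?thesis unfolding 1 by (rule Kg_trans[OF 2 Kg_sum[OF 3]])
qed

text \<open>A left linear map is determined by its values on the tensors \<open>\<theta>\<^sub>I \<otimes> \<eta>\<^sub>M\<close>.\<close>

lemma braiding_unique:
  assumes b: "is_braiding A Gm Li Ri \<tau>" and X: "\<xi> \<in> carrier (tensor_power A Gm 2)"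
  shows "\<tau> \<xi> = braid_map \<xi>"
proof -
  let ?T = "tensor_power A Gm 2" and ?c = "tensor_cls A Gm 2"
  interpret T: comm_group ?T by (rule bm.Tp_comm_group)
  have theta_coeff: "\<tau> \<in> hom ?T ?T" using b by (simp add: is_braiding_def)
  interpret t: group_hom ?T ?T \<tau>
    by (intro group_hom.intro group_hom_axioms.intro T.is_group theta_coeff)
  interpret g: group_hom ?T ?T braid_map
    by (intro group_hom.intro group_hom_axioms.intro T.is_group braid_map_bimodule_hom)
  have v: "\<tau> (?c (frag_of [qc f \<odot>\<^bsub>Gm\<^esub> gm (theta_coeff I), gm (\<lambda>J. wg J M)])) = ?c (eta_theta M I f)"
    if M: "M \<in> Id2 N" and I: "I \<in> Id2 N" for f M I
  proof -
    let ?x = "tens A Gm [gm (theta_coeff I), gm (\<lambda>J. wg J M)]" and ?y = "tens A Gm [gm (\<lambda>J. wg J M), gm (theta_coeff I)]"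
    have 1: "?c (frag_of [qc f \<odot>\<^bsub>Gm\<^esub> gm (theta_coeff I), gm (\<lambda>J. wg J M)]) = tensor_lact A Gm 2 (qc f) ?x"
      by (simp add: bm.tens2 bm.lact_tc bm.tup2)
    have "?x \<in> carrier ?T" unfolding bm.tens2 by (rule bm.tc_closed) (simp add: bm.tup2)
    then have 2: "\<tau> (tensor_lact A Gm 2 (qc f) ?x) = tensor_lact A Gm 2 (qc f) (\<tau> ?x)"
      using b unfolding is_braiding_def by (metis ocl_closed)
    have 3: "\<tau> ?x = ?y"
      using b theta_left_invariant[OF I] eta_right_invariant[OF M] unfolding is_braiding_def by blast
    have 4: "tensor_lact A Gm 2 (qc f) ?y = ?c (eta_theta M I f)"
      by (simp add: bm.tens2 bm.lact_tc bm.tup2 eta_theta_def slot_tensor_def gm_smult theta_gm)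
    show ?thesis unfolding 1 2 3 4 ..
  qed
  have pair: "\<tau> (?c (frag_of [gm X, gm Y])) = braid_map (?c (frag_of [gm X, gm Y]))" for X Y
  proof -
    let ?e = "\<lambda>p. frag_of [qc (braid_coeff X Y (fst p) (snd p)) \<odot>\<^bsub>Gm\<^esub> gm (theta_coeff (snd p)), gm (\<lambda>J. wg J (fst p))]"
    let ?S = "Id2 N \<times> Id2 N"
    have k: "keys (?e p) \<subseteq> tuples Gm 2" for p by (simp add: bm.tup2 bm.smult_cl)
    let ?t = "\<lambda>p. eta_theta (fst p) (snd p) (braid_coeff X Y (fst p) (snd p))"
    have ks: "keys (\<Sum>p\<in>?S. ?e p) \<subseteq> tuples Gm 2" by (rule keys_sumI[OF k])
    have e: "(\<Sum>p\<in>?S. ?e p) = (\<Sum>M\<in>Id2 N. \<Sum>I\<in>Id2 N. ?e (M, I))"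
      by (simp only: sum.cartesian_product case_prod_unfold prod.collapse)
    have 1: "?c (frag_of [gm X, gm Y]) = ?c (\<Sum>p\<in>?S. ?e p)"
      by (subst bm.tc_eq_iff[OF _ ks]) (simp add: bm.tup2, simp only: e fst_conv snd_conv tensor_expand)
    have 2: "?c (\<Sum>p\<in>?S. ?e p) = finprod ?T (\<lambda>p. ?c (?e p)) ?S"
      by (rule bm.tc_finprod[symmetric, OF k]) (intro finite_cartesian_product finite_atLeastAtMost)
    have 3: "\<tau> (finprod ?T (\<lambda>p. ?c (?e p)) ?S) = finprod ?T (\<lambda>p. \<tau> (?c (?e p))) ?S"
      by (rule hom_finprod[OF bm.Tp_comm_group bm.Tp_comm_group theta_coeff bm.tc_closed[OF k]])
        (intro finite_cartesian_product finite_atLeastAtMost)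
    have 4: "finprod ?T (\<lambda>p. \<tau> (?c (?e p))) ?S = finprod ?T (\<lambda>p. ?c (?t p)) ?S"
    proof (rule T.finprod_cong'[OF refl])
      show "(\<lambda>p. ?c (?t p)) \<in> ?S \<rightarrow> carrier ?T" by (rule Pi_I) (rule bm.tc_closed[OF eta_theta_keys])
      fix p assume "p \<in> ?S"
      then show "\<tau> (?c (?e p)) = ?c (?t p)" by (intro v) (simp_all only: mem_Times_iff)
    qed
    have 5: "finprod ?T (\<lambda>p. ?c (?t p)) ?S = ?c (\<Sum>p\<in>?S. ?t p)"
      by (rule bm.tc_finprod[OF eta_theta_keys]) (intro finite_cartesian_product finite_atLeastAtMost)
    have 6: "(\<Sum>p\<in>?S. ?t p) = braid_frag X Y"
      by (simp only: braid_frag_def sum.cartesian_product case_prod_unfold)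
    have 7: "braid_map (?c (frag_of [gm X, gm Y])) = ?c (braid_frag X Y)"
      using braid_map_tens[of X Y] by (simp only: bm.tens2)
    show ?thesis unfolding 7 unfolding 1 2 3 4 5 6 ..
  qed
  obtain z where z: "keys z \<subseteq> tuples Gm 2" "\<xi> = ?c z" using X by (auto simp: bm.Tp_carrier)
  have "keys z \<subseteq> tuples Gm 2 \<and> \<tau> (?c z) = braid_map (?c z)"
    using z(1)
  proof (induction z rule: frag_induction)
    case zero
    then show ?case by (simp add: bm.tc_0)
  next
    case (one xs)
    then obtain x y where "xs = [x, y]" "x \<in> carrier Gm" "y \<in> carrier Gm" using bm.tup2_cases by blast
    then obtain X Y where "xs = [gm X, gm Y]" by (elim Gm_cases) auto
    then show ?case using one by (simp add: pair)
  next
    case (diff u w)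
    have m: "?c (u - w) \<otimes>\<^bsub>?T\<^esub> ?c w = ?c u"
      using diff by (simp add: bm.tc_mult keys_diffI)
    have c: "?c (u - w) \<in> carrier ?T" "?c w \<in> carrier ?T"
      using diff by (simp_all add: bm.tc_closed keys_diffI)
    have "\<tau> (?c (u - w)) \<otimes>\<^bsub>?T\<^esub> \<tau> (?c w) = braid_map (?c (u - w)) \<otimes>\<^bsub>?T\<^esub> braid_map (?c w)"
      using t.hom_mult[OF c] g.hom_mult[OF c] diff unfolding m by simp
    then have "\<tau> (?c (u - w)) = braid_map (?c (u - w))"
      using diff c by simp
    then show ?case using diff by (simp add: keys_diffI)
  qed
  then show ?thesis using z by simp
qed

theorem canonical_braiding_eq: "canonical_braiding A Gm Li Ri = braid_map"
  unfolding canonical_braiding_def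
proof (rule the_equality)
  have ex: "braid_map \<in> extensional (carrier (tensor_power A Gm 2))"
    unfolding braid_map_def by (rule restrict_extensional)
  then show "braid_map \<in> extensional (carrier (tensor_power A Gm 2)) \<and> is_braiding A Gm Li Ri braid_map"
    using braid_map_is_braiding by blast
  fix \<tau> assume t: "\<tau> \<in> extensional (carrier (tensor_power A Gm 2)) \<and> is_braiding A Gm Li Ri \<tau>"
  show "\<tau> = braid_map"
    by (rule extensionalityI[OF conjunct1[OF t] ex]) (rule braiding_unique[OF conjunct2[OF t]])
qed

sublocale brd: braided A Gm Li Ri braid_map
  by unfold_locales (rule braid_map_is_braiding)

end

section \<open>Coordinates on the tensor powers\<close>

text \<open>The additive extension of a map on generators to a free abelian group.\<close>

definition fsum :: "('x \<Rightarrow> 'b::ring_1) \<Rightarrow> ('x \<Rightarrow>\<^sub>0 int) \<Rightarrow> 'b" where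
  "fsum f z = (\<Sum>x\<in>keys z. of_int (lookup z x) * f x)"

lemma fsum_superset: "finite T \<Longrightarrow> keys z \<subseteq> T \<Longrightarrow> fsum f z = (\<Sum>x\<in>T. of_int (lookup z x) * f x)"
  unfolding fsum_def by (rule sum.mono_neutral_left) (auto simp: in_keys_iff)

lemma fsum_of [simp]: "fsum f (frag_of x) = f x"
  by (simp add: fsum_def)

lemma fsum_0 [simp]: "fsum f 0 = 0"
  by (simp add: fsum_def)

lemma fsum_add: "fsum f (a + b) = fsum f a + fsum f b"
proof -
  let ?T = "keys a \<union> keys b"
  have "fsum f (a + b) = (\<Sum>x\<in>?T. of_int (lookup (a + b) x) * f x)"
    using keys_add[of a b] by (intro fsum_superset) auto
  also have "\<dots> = (\<Sum>x\<in>?T. of_int (lookup a x) * f x) + (\<Sum>x\<in>?T. of_int (lookup b x) * f x)"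
    by (simp add: lookup_add distrib_right sum.distrib)
  also have "\<dots> = fsum f a + fsum f b"
    by (simp add: fsum_superset[of ?T a] fsum_superset[of ?T b])
  finally show ?thesis .
qed

lemma fsum_diff: "fsum f (a - b) = fsum f a - fsum f b"
  using fsum_add[of f "a - b" b] by simp

lemma fsum_sum: "fsum f (sum g X) = (\<Sum>i\<in>X. fsum f (g i))"
  by (rule additive_sum) (simp_all add: fsum_add)

lemma fsum_cong: "(\<And>x. x \<in> keys z \<Longrightarrow> f x = g x) \<Longrightarrow> fsum f z = fsum g z"
  by (simp add: fsum_def)

lemma fsum_frag_extend: "fsum f (frag_extend g z) = fsum (\<lambda>x. fsum f (g x)) z"
  using subset_UNIV by (induction z rule: frag_induction) (simp_all add: frag_extend_diff fsum_diff)

lemma fsum_additive: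
  assumes "\<And>a b. T (a - b) = T a - T b"
  shows "T (fsum f z) = fsum (\<lambda>x. T (f x)) z"
proof -
  have 0: "T 0 = 0" using assms[of 0 0] by simp
  show ?thesis
    using subset_UNIV by (induction z rule: frag_induction) (simp_all add: 0 fsum_diff assms)
qed

lemma fsum_lin: "fsum (\<lambda>x. \<Sum>i\<in>X. c i * f i x) z = (\<Sum>i\<in>X. c i * fsum (f i) z)" for c :: "'i \<Rightarrow> complex"
  unfolding fsum_def sum_distrib_left by (subst sum.swap) (simp add: mult_ac)

context rform begin

lemma qc_diff: "qc f = qc g \<Longrightarrow> qc (f - g) = qc 0"
  using ocl_cong(1)[of N h f g "- g" "- g"] by simp

lemma chr_cong: "qc f = qc g \<Longrightarrow> chr N 1 f = chr N 1 g"
  using chi_chr[OF h0, of 1 N f] chi_chr[OF h0, of 1 N g] by simp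

text \<open>The coefficient at \<open>I\<close> of \<open>(\<Sum> X\<^sub>L \<theta>\<^sub>L) f\<close>.\<close>

definition ract_coeff :: "(nat \<times> nat \<Rightarrow> falg) \<Rightarrow> nat \<times> nat \<Rightarrow> falg \<Rightarrow> falg" where
  "ract_coeff X I f = (\<Sum>L\<in>Id2 N. X L * RR L I f)"

lemma ract_coeff_add: "ract_coeff X I (f + g) = ract_coeff X I f + ract_coeff X I g" and ract_coeff_smul: "ract_coeff X I (c \<cdot> f) = c \<cdot> ract_coeff X I f"
  and ract_coeff_add_left: "ract_coeff (\<lambda>L. X L + Y L) I f = ract_coeff X I f + ract_coeff Y I f"
  by (simp_all add: ract_coeff_def RR_add RR_smul distrib_left distrib_right sum.distrib smul_sum)

lemma ract_coeff_sum: "ract_coeff X I (sum f S) = (\<Sum>i\<in>S. ract_coeff X I (f i))"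
  by (simp only: ract_coeff_def RR_sum sum_distrib_left) (rule sum.swap)

lemma ract_coeff_diff: "ract_coeff X I (f - g) = ract_coeff X I f - ract_coeff X I g"
  using ract_coeff_add[of X I "f - g" g] by simp

lemma ract_coeff_cong:
  assumes "\<And>L. L \<in> Id2 N \<Longrightarrow> qc (X L) = qc (Y L)" "qc f = qc g" "I \<in> Id2 N"
  shows "qc (ract_coeff X I f) = qc (ract_coeff Y I g)"
  unfolding ract_coeff_def by (rule ocl_sum_cong, rule ocl_cong(2)) (use assms RR_cong in blast)+

lemma ract_coeff_mult: "ract_coeff (\<lambda>M. ract_coeff X M f) I g = ract_coeff X I (f * g)"
  unfolding ract_coeff_def RR_mult by (simp add: sum_distrib_left sum_distrib_right mult.assoc) (rule sum.swap)

lemma ract_coeff_1: "I \<in> Id2 N \<Longrightarrow> ract_coeff X I 1 = X I"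
proof -
  assume I: "I \<in> Id2 N"
  have "ract_coeff X I 1 = (\<Sum>L\<in>Id2 N. of_bool (L = I) \<cdot> X L)"
    unfolding ract_coeff_def using I by (intro sum.cong refl) (simp add: RR_1)
  also have "\<dots> = X I" by (rule sum_of_bool_smul(1)[OF _ I]) simp
  finally show ?thesis .
qed

lemma hat_gm: "L \<in> Id2 N \<Longrightarrow> qc (hat (gm X) L) = qc (X L)"
  using gm_hat[OF gm_in, of X] unfolding gm_eq_iff by blast

text \<open>The coefficient at the word \<open>w\<close> of \<open>x\<^sub>1 \<otimes> \<dots> \<otimes> x\<^sub>k f\<close> with respect to the basis of tensors of the
  \<open>\<theta>\<^sub>I\<close>: the coefficients of the last factor move through the factors before it. The extra
  argument \<open>f\<close> makes concatenation of tuples a composition of maps (\<open>coord_append\<close>).\<close>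

primrec coord :: "gam list \<Rightarrow> (nat \<times> nat) list \<Rightarrow> falg \<Rightarrow> falg" where
  "coord [] w f = f"
| "coord (x # xs) w f = ract_coeff (hat x) (hd w) (coord xs (tl w) f)"

lemma coord_append: "coord (xs @ ys) w f = coord xs w (coord ys (drop (length xs) w) f)"
  by (induction xs arbitrary: w) (simp_all add: drop_Suc)

lemma coord_add: "coord xs w (f + g) = coord xs w f + coord xs w g" and coord_smul: "coord xs w (c \<cdot> f) = c \<cdot> coord xs w f"
  and coord_diff: "coord xs w (f - g) = coord xs w f - coord xs w g"
  by (induction xs arbitrary: w) (simp_all add: ract_coeff_add ract_coeff_smul ract_coeff_diff)

lemma coord_sum: "coord xs w (sum f S) = (\<Sum>i\<in>S. coord xs w (f i))"
  by (induction xs arbitrary: w) (simp_all add: ract_coeff_sum)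

lemma coord_cong:
  assumes "qc f = qc g" "set w \<subseteq> Id2 N" "length xs \<le> length w"
  shows "qc (coord xs w f) = qc (coord xs w g)"
  using assms
proof (induction xs arbitrary: w)
  case (Cons x xs)
  then obtain I v where w: "w = I # v" by (cases w) auto
  have I: "I \<in> Id2 N" and v: "set v \<subseteq> Id2 N" using Cons.prems(2) unfolding w by auto
  have "qc (coord xs v f) = qc (coord xs v g)" using Cons.prems(3) w by (intro Cons.IH[OF assms(1) v]) simp
  then show ?case unfolding w by (simp only: coord.simps list.sel) (rule ract_coeff_cong[OF refl _ I])
qed simp

abbreviation "word k \<equiv> {w. length w = k \<and> set w \<subseteq> Id2 N}"

lemma word_nth: "w \<in> word k \<Longrightarrow> i < k \<Longrightarrow> w ! i \<in> Id2 N"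
  by (metis (mono_tags, lifting) mem_Collect_eq nth_mem subsetD)

lemma coord_wcong:
  assumes "qc f = qc g" "w \<in> word k" "length xs \<le> k"
  shows "qc (coord xs w f) = qc (coord xs w g)"
  by (rule coord_cong) (use assms in auto)

lemma coord_Kg:
  assumes z: "z \<in> Kg k" and w: "w \<in> word k"
  shows "qc (fsum (\<lambda>xs. coord xs w f) z) = qc 0"
proof -
  let ?H = "{g. qc g = qc 0}"
  have "fsum (\<lambda>xs. coord xs w f) z \<in> ?H"
  proof (rule bm.Kt_extend[OF fsum_add, where z = z and k = k])
    show "0 \<in> ?H" by simp
    show "a + b \<in> ?H" if "a \<in> ?H" "b \<in> ?H" for a b
      using that ocl_cong(1)[of N h a 0 b 0] by simp
    show "- a \<in> ?H" if "a \<in> ?H" for a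
      using qc_diff[of 0 a] that by simp
    fix xs ys :: "gam list" and x y
    assume a: "x \<in> carrier Gm" "y \<in> carrier Gm"
    obtain X Y where x: "x = gm X" and y: "y = gm Y" using a by (elim Gm_cases)
    {
      assume k: "length xs + length ys + 1 = k"
      let ?I = "hd (drop (length xs) w)" and ?F = "coord ys (tl (drop (length xs) w)) f"
      have I: "?I \<in> Id2 N" using word_nth[OF w, of "length xs"] k w by (simp add: hd_drop_conv_nth)
      have "qc (ract_coeff (hat (gm (\<lambda>I. X I + Y I))) ?I ?F) = qc (ract_coeff (\<lambda>L. hat (gm X) L + hat (gm Y) L) ?I ?F)"
        by (rule ract_coeff_cong[OF _ refl I]) (simp only: hat_gm ocl_add)
      then have "qc (coord xs w (ract_coeff (hat (gm (\<lambda>I. X I + Y I))) ?I ?F)) = qc (coord xs w (ract_coeff (hat (gm X)) ?I ?F + ract_coeff (hat (gm Y)) ?I ?F))"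
        unfolding ract_coeff_add_left using w k by (intro coord_wcong[OF _ w]) auto
      from qc_diff[OF this]
      show "fsum (\<lambda>xs. coord xs w f) (frag_of (xs @ (x \<oplus>\<^bsub>Gm\<^esub> y) # ys)) - fsum (\<lambda>xs. coord xs w f) (frag_of (xs @ x # ys))
          - fsum (\<lambda>xs. coord xs w f) (frag_of (xs @ y # ys)) \<in> ?H"
        by (simp add: x y gm_add coord_append coord_add diff_diff_eq)
    next
      fix b assume "b \<in> carrier A" and k: "length xs + length ys + 2 = k"
      obtain g where b: "b = qc g" using A_cases[OF \<open>b \<in> carrier A\<close>] .
      let ?w = "drop (length xs) w"
      let ?I = "hd ?w" and ?J = "hd (tl ?w)" and ?F = "coord ys (tl (tl ?w)) f"
      have I: "?I \<in> Id2 N" using word_nth[OF w, of "length xs"] k w by (simp add: hd_drop_conv_nth)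
      have J: "?J \<in> Id2 N" using word_nth[OF w, of "Suc (length xs)"] k w
        by (simp add: tl_drop drop_Suc[symmetric] hd_drop_conv_nth)
      have "qc (ract_coeff (hat (gm (\<lambda>M. ract_coeff X M g))) ?I (ract_coeff (hat (gm Y)) ?J ?F)) = qc (ract_coeff (\<lambda>M. ract_coeff X M g) ?I (ract_coeff Y ?J ?F))"
        by (intro ract_coeff_cong hat_gm refl I J)
      also have "\<dots> = qc (ract_coeff (hat (gm X)) ?I (ract_coeff (hat (gm (\<lambda>L. g * Y L))) ?J ?F))"
      proof -
        have e: "ract_coeff (\<lambda>M. ract_coeff X M g) ?I (ract_coeff Y ?J ?F) = ract_coeff X ?I (ract_coeff (\<lambda>L. g * Y L) ?J ?F)"
          unfolding ract_coeff_mult by (simp add: ract_coeff_def[of Y] ract_coeff_def[of "\<lambda>L. g * Y L"] sum_distrib_left mult.assoc)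
        show ?thesis unfolding e by (intro ract_coeff_cong hat_gm[symmetric] refl I J)
      qed
      finally have "qc (coord xs w (ract_coeff (hat (gm (\<lambda>M. ract_coeff X M g))) ?I (ract_coeff (hat (gm Y)) ?J ?F))) =
          qc (coord xs w (ract_coeff (hat (gm X)) ?I (ract_coeff (hat (gm (\<lambda>L. g * Y L))) ?J ?F)))"
        using k by (intro coord_wcong[OF _ w]) auto
      from qc_diff[OF this]
      show "fsum (\<lambda>xs. coord xs w f) (frag_of (xs @ rsmult Gm x b # y # ys))
          - fsum (\<lambda>xs. coord xs w f) (frag_of (xs @ x # (b \<odot>\<^bsub>Gm\<^esub> y) # ys)) \<in> ?H"
        by (simp add: x y b gm_rsmult gm_smult coord_append ract_coeff_def[of X])
    }
  qed (rule z)
  then show ?thesis by simp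
qed

lemma coord_Kg_diff:
  assumes z: "y - z \<in> Kg k" and w: "w \<in> word k"
  shows "qc (fsum (\<lambda>xs. coord xs w f) y) = qc (fsum (\<lambda>xs. coord xs w f) z)"
proof -
  have d: "qc (fsum (\<lambda>xs. coord xs w f) y - fsum (\<lambda>xs. coord xs w f) z) = qc 0"
    using coord_Kg[OF assms] by (simp add: fsum_diff)
  show ?thesis
    using ocl_cong(1)[OF d refl[of "qc (fsum (\<lambda>xs. coord xs w f) z)"]] by (simp only: diff_add_cancel add_0)
qed

subsection \<open>The braiding in these coordinates\<close>

lemma coord_eta_theta:
  assumes PK: "P \<in> Id2 N" "K \<in> Id2 N" and I: "I \<in> Id2 N"
  shows "qc (fsum (\<lambda>xs. coord xs [P, K] 1) (eta_theta M I f)) = qc (of_bool (I = K) \<cdot> (f * wg P M))"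
proof -
  let ?X = "\<lambda>J. f * wg J M"
  have "fsum (\<lambda>xs. coord xs [P, K] 1) (eta_theta M I f) = ract_coeff (hat (gm ?X)) P (ract_coeff (hat (gm (theta_coeff I))) K 1)"
    by (simp add: eta_theta_def slot_tensor_def theta_gm)
  also have "qc \<dots> = qc (ract_coeff ?X P (ract_coeff (theta_coeff I) K 1))"
    by (intro ract_coeff_cong hat_gm PK refl)
  also have "ract_coeff ?X P (ract_coeff (theta_coeff I) K 1) = of_bool (I = K) \<cdot> ract_coeff ?X P 1"
    unfolding ract_coeff_1[OF PK(2)] theta_coeff_def ract_coeff_smul by (simp only: eq_commute[of K I])
  also have "\<dots> = of_bool (I = K) \<cdot> (f * wg P M)" by (simp only: ract_coeff_1[OF PK(1)])
  finally show ?thesis .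
qed

text \<open>In \<open>\<Sum> c\<^sub>M\<^sub>I \<eta>\<^sub>M \<otimes> \<theta>\<^sub>I\<close> the coefficient at \<open>(P, K)\<close> is \<open>\<Sum> c\<^sub>M\<^sub>K w\<^sub>P\<^sub>M\<close>. Expanding \<open>c\<^sub>M\<^sub>K\<close> and
  \<open>\<Delta>(v\<^sub>M\<^sub>J) = \<Sum> v\<^sub>M\<^sub>R \<otimes> v\<^sub>R\<^sub>J\<close>, the factors \<open>v\<^sub>M\<^sub>R w\<^sub>P\<^sub>M\<close> cancel and the numbers \<open>F\<^sub>Q\<^sub>K(v\<^sub>P\<^sub>J)\<close> remain.\<close>

lemma coord_braid_frag_1:
  assumes PK: "P \<in> Id2 N" "K \<in> Id2 N"
  shows "qc (fsum (\<lambda>xs. coord xs [P, K] 1) (braid_frag X Y)) =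
    qc (\<Sum>Q\<in>Id2 N. \<Sum>J\<in>Id2 N. F Q K (vg P J) \<cdot> ract_coeff X Q (Y J))"
proof -
  have "fsum (\<lambda>xs. coord xs [P, K] 1) (braid_frag X Y) = (\<Sum>M\<in>Id2 N. \<Sum>I\<in>Id2 N. fsum (\<lambda>xs. coord xs [P, K] 1) (eta_theta M I (braid_coeff X Y M I)))"
    by (simp only: braid_frag_def fsum_sum)
  also have "qc \<dots> = qc (\<Sum>M\<in>Id2 N. \<Sum>I\<in>Id2 N. of_bool (I = K) \<cdot> (braid_coeff X Y M I * wg P M))"
    by (rule ocl_sum_cong, rule ocl_sum_cong, rule coord_eta_theta[OF PK])
  also have "(\<Sum>M\<in>Id2 N. \<Sum>I\<in>Id2 N. of_bool (I = K) \<cdot> (braid_coeff X Y M I * wg P M)) = (\<Sum>M\<in>Id2 N. braid_coeff X Y M K * wg P M)"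
    by (intro sum.cong refl) (rule sum_of_bool_smul(1)[OF _ PK(2)], simp)
  also have "(\<Sum>M\<in>Id2 N. braid_coeff X Y M K * wg P M) =
      (\<Sum>M\<in>Id2 N. (\<Sum>J\<in>Id2 N. ract_coeff X K (Y J * vg M J)) * wg P M)"
    by (simp only: braid_coeff_def ract_coeff_sum flip: ract_coeff_def)
  also have "\<dots> = (\<Sum>M\<in>Id2 N. \<Sum>J\<in>Id2 N. \<Sum>Q\<in>Id2 N. \<Sum>R\<in>Id2 N. F Q K (vg R J) \<cdot> (ract_coeff X Q (Y J) * (vg M R * wg P M)))"
    unfolding ract_coeff_mult[symmetric] by (simp add: ract_coeff_def[of "\<lambda>M. ract_coeff X M _"] RR_vg sum_distrib_left sum_distrib_right mult.assoc)
  also have "\<dots> = (\<Sum>J\<in>Id2 N. \<Sum>Q\<in>Id2 N. \<Sum>R\<in>Id2 N. F Q K (vg R J) \<cdot> (ract_coeff X Q (Y J) * (\<Sum>M\<in>Id2 N. vg M R * wg P M)))"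
    unfolding sum_distrib_left smul_sum by (subst sum.swap, rule sum.cong[OF refl], rule sum3_rot)
  also have "qc \<dots> = qc (\<Sum>J\<in>Id2 N. \<Sum>Q\<in>Id2 N. \<Sum>R\<in>Id2 N. F Q K (vg R J) \<cdot> (ract_coeff X Q (Y J) * (of_bool (R = P) \<cdot> 1)))"
    by (rule ocl_sum_cong, rule ocl_sum_cong, rule ocl_sum_cong, rule ocl_cong(3), rule ocl_cong(2)[OF refl], rule vg_wg[OF _ PK(1)])
  also have "(\<Sum>J\<in>Id2 N. \<Sum>Q\<in>Id2 N. \<Sum>R\<in>Id2 N. F Q K (vg R J) \<cdot> (ract_coeff X Q (Y J) * (of_bool (R = P) \<cdot> 1))) =
      (\<Sum>J\<in>Id2 N. \<Sum>Q\<in>Id2 N. F Q K (vg P J) \<cdot> ract_coeff X Q (Y J))"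
    by (intro sum.cong refl) (simp only: smul_simps mult_1_right, rule sum_of_bool_smul(3)[OF _ PK(1)], simp)
  also have "\<dots> = (\<Sum>Q\<in>Id2 N. \<Sum>J\<in>Id2 N. F Q K (vg P J) \<cdot> ract_coeff X Q (Y J))" by (rule sum.swap)
  finally show ?thesis .
qed

text \<open>A coefficient \<open>f\<close> on the right is absorbed by the right linearity of the braiding.\<close>

lemma coord_braid_frag:
  assumes PK: "P \<in> Id2 N" "K \<in> Id2 N"
  shows "qc (fsum (\<lambda>xs. coord xs [P, K] f) (braid_frag X Y)) =
    qc (\<Sum>Q\<in>Id2 N. \<Sum>J\<in>Id2 N. F Q K (vg P J) \<cdot> ract_coeff X Q (ract_coeff Y J f))"
proof -
  let ?r = "frag_extend (\<lambda>xs. frag_of (butlast xs @ [rsmult Gm (last xs) (qc f)]))"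
  have w: "[P, K] \<in> word 2" using PK by (simp add: numeral_2_eq_2 One_nat_def del: mem_Times_iff)
  have k: "qc (fsum (\<lambda>xs. coord xs [P, K] f) z) = qc (fsum (\<lambda>xs. coord xs [P, K] 1) (?r z))" if "keys z \<subseteq> tuples Gm 2" for z
    using that
  proof (induction z rule: frag_induction)
    case (one xs)
    then obtain x y where "xs = [x, y]" "x \<in> carrier Gm" "y \<in> carrier Gm" using bm.tup2_cases by blast
    then obtain X Y where e: "xs = [gm X, gm Y]" by (elim Gm_cases) auto
    have ract_coeff: "qc (ract_coeff (hat (gm (\<lambda>J. ract_coeff Y J f))) K 1) = qc (ract_coeff (hat (gm Y)) K f)"
    proof -
      have "qc (ract_coeff (hat (gm (\<lambda>J. ract_coeff Y J f))) K 1) = qc (ract_coeff (\<lambda>J. ract_coeff Y J f) K 1)"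
        by (intro ract_coeff_cong hat_gm PK refl)
      also have "\<dots> = qc (ract_coeff Y K f)" by (simp only: ract_coeff_1[OF PK(2)])
      also have "\<dots> = qc (ract_coeff (hat (gm Y)) K f)"
        by (intro ract_coeff_cong hat_gm[symmetric] PK refl)
      finally show ?thesis .
    qed
    have "qc (ract_coeff (hat (gm X)) P (ract_coeff (hat (gm Y)) K f)) = qc (ract_coeff (hat (gm X)) P (ract_coeff (hat (gm (\<lambda>J. ract_coeff Y J f))) K 1))"
      by (rule ract_coeff_cong[OF refl ract_coeff[symmetric] PK(1)])
    then show ?case by (simp add: e gm_rsmult ract_coeff_def[of Y])
  next
    case (diff a b)
    have m: "qc (- u) = qc (- v)" if "qc u = qc v" for u v :: falg
      using ocl_cong(3)[OF that, of "- 1"] by (simp add: smul_def single_uminus)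
    show ?case using ocl_cong(1)[OF diff(1) m[OF diff(2)]] by (simp add: frag_extend_diff fsum_diff)
  qed simp
  have "qc (fsum (\<lambda>xs. coord xs [P, K] f) (braid_frag X Y)) = qc (fsum (\<lambda>xs. coord xs [P, K] 1) (?r (braid_frag X Y)))"
    by (rule k[OF braid_frag_keys])
  also have "\<dots> = qc (fsum (\<lambda>xs. coord xs [P, K] 1) (braid_frag X (\<lambda>J. ract_coeff Y J f)))"
    unfolding ract_coeff_def by (rule coord_Kg_diff[OF Kg_sym[OF braid_frag_ract] w])
  also have "\<dots> = qc (\<Sum>Q\<in>Id2 N. \<Sum>J\<in>Id2 N. F Q K (vg P J) \<cdot> ract_coeff X Q (ract_coeff Y J f))"
    by (rule coord_braid_frag_1[OF PK])
  finally show ?thesis .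
qed

lemma rb_braid_frag: "brd.rb (gm X) (gm Y) - braid_frag X Y \<in> Kg 2"
proof -
  have "tensor_cls A Gm 2 (brd.rb (gm X) (gm Y)) = tensor_cls A Gm 2 (braid_frag X Y)"
    using brd.rb(2)[of "gm X" "gm Y"] braid_map_tens[of X Y] by simp
  then show ?thesis by (subst (asm) bm.tc_eq_iff) (simp_all add: brd.rb(1) braid_frag_keys)
qed

text \<open>The counit of the coefficient at \<open>w\<close>: a complex number, on which the braiding acts by a matrix.\<close>

definition word_coeff :: "(nat \<times> nat) list \<Rightarrow> (gam list \<Rightarrow>\<^sub>0 int) \<Rightarrow> complex" where
  "word_coeff w z = fsum (\<lambda>xs. chr N 1 (coord xs w 1)) z"

lemma word_coeff_coord: "word_coeff w z = chr N 1 (fsum (\<lambda>xs. coord xs w 1) z)"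
  unfolding word_coeff_def by (rule fsum_additive[symmetric]) (rule chr_diff)

lemma word_coeff_Kg: "z \<in> Kg k \<Longrightarrow> w \<in> word k \<Longrightarrow> word_coeff w z = 0"
  unfolding word_coeff_coord using chr_cong[OF coord_Kg] by simp

lemma word_coeff_braid:
  assumes z: "keys z \<subseteq> tuples Gm k" and w: "w \<in> word k" and i: "1 \<le> i" "i < k"
  shows "word_coeff w (frag_extend (brd.Bf i) z) = (\<Sum>p\<in>Id2 N \<times> Id2 N.
    F (fst p) (w ! i) (vg (w ! (i - 1)) (snd p)) * word_coeff (w[i - 1 := fst p, i := snd p]) z)"
proof -
  have "word_coeff w (brd.Bf i xs) = (\<Sum>p\<in>Id2 N \<times> Id2 N.
      F (fst p) (w ! i) (vg (w ! (i - 1)) (snd p)) * chr N 1 (coord xs (w[i - 1 := fst p, i := snd p]) 1))"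
    if xs: "xs \<in> tuples Gm k" for xs
  proof -
    obtain u x y v where e: "xs = u @ x # y # v" "length u = i - 1"
      using list_split2[of "i - 1" xs] xs i by (auto simp: tuples_def)
    have uk: "length u \<le> k" using e(2) i by simp
    have "x \<in> carrier Gm" "y \<in> carrier Gm" using e(1) xs by (auto simp: tuples_def)
    then obtain X Y where x: "x = gm X" "y = gm Y" by (elim Gm_cases)
    obtain a P K b where a: "w = a @ P # K # b" "length a = i - 1"
      using list_split2[of "i - 1" w] w i by auto
    have PK: "P \<in> Id2 N" "K \<in> Id2 N" using w unfolding a by auto
    then have w2: "[P, K] \<in> word 2" by (simp add: numeral_2_eq_2 One_nat_def del: mem_Times_iff)
    have wi: "w ! (i - 1) = P" "w ! i = K" using a i by (auto simp: nth_append)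
    have up: "w[i - 1 := Q, i := J] = a @ Q # J # b" for Q J
      using a i by (auto simp: list_update_append split: nat.splits)
    let ?f = "coord v b 1"
    let ?g = "fsum (\<lambda>ys. coord ys [P, K] ?f) (brd.rb (gm X) (gm Y))"
    have sp: "coord (u @ c # d # v) (a @ Q # J # b) 1 = coord u (a @ Q # J # b) (ract_coeff (hat c) Q (ract_coeff (hat d) J ?f))" for c d Q J
      using e a by (simp add: coord_append)
    have au: "coord u (a @ c) g = coord u (a @ d) g" for c d g
      using e(2) a(2)
    proof -
      have "length u = length a \<Longrightarrow> coord u (a @ c) g = coord u (a @ d) g" for u a
        by (induction u a rule: list_induct2) simp_all
      then show ?thesis using e(2) a(2) by simp
    qed
    have "word_coeff w (brd.Bf i xs) = fsum (\<lambda>ys. chr N 1 (coord (u @ ys @ v) w 1)) (brd.rb (gm X) (gm Y))"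
      unfolding e(1) x by (subst brd.Bf_eq) (use e i in \<open>simp_all add: word_coeff_def bm.ins_def fsum_frag_extend\<close>)
    also have "\<dots> = fsum (\<lambda>ys. chr N 1 (coord u w (coord ys [P, K] ?f))) (brd.rb (gm X) (gm Y))"
    proof (rule fsum_cong)
      fix ys assume "ys \<in> keys (brd.rb (gm X) (gm Y))"
      then have "ys \<in> tuples Gm 2" using brd.rb(1)[of "gm X" "gm Y"] by auto
      then obtain c d where "ys = [c, d]" using bm.tup2_cases by blast
      then show "chr N 1 (coord (u @ ys @ v) w 1) = chr N 1 (coord u w (coord ys [P, K] ?f))"
        unfolding a(1) by (simp add: sp)
    qed
    also have "\<dots> = chr N 1 (coord u w ?g)"
      by (rule fsum_additive[symmetric]) (simp only: coord_diff chr_diff)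
    also have "\<dots> = chr N 1 (coord u w (\<Sum>Q\<in>Id2 N. \<Sum>J\<in>Id2 N. F Q K (vg P J) \<cdot> ract_coeff X Q (ract_coeff Y J ?f)))"
    proof (rule chr_cong, rule coord_wcong[OF _ w])
      show "qc ?g = qc (\<Sum>Q\<in>Id2 N. \<Sum>J\<in>Id2 N. F Q K (vg P J) \<cdot> ract_coeff X Q (ract_coeff Y J ?f))"
        by (rule trans[OF coord_Kg_diff[OF rb_braid_frag w2] coord_braid_frag[OF PK]])
      show "length u \<le> k" by (rule uk)
    qed
    also have "\<dots> = (\<Sum>Q\<in>Id2 N. \<Sum>J\<in>Id2 N. F Q K (vg P J) * chr N 1 (coord u w (ract_coeff X Q (ract_coeff Y J ?f))))"
      by (simp only: coord_sum coord_smul chr_sum chr_smul)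
    also have "\<dots> = (\<Sum>Q\<in>Id2 N. \<Sum>J\<in>Id2 N. F Q K (vg P J) * chr N 1 (coord xs (a @ Q # J # b) 1))"
    proof (intro sum.cong refl)
      fix Q J assume Q: "Q \<in> Id2 N" and J: "J \<in> Id2 N"
      have "chr N 1 (coord u w (ract_coeff X Q (ract_coeff Y J ?f))) = chr N 1 (coord u w (ract_coeff (hat (gm X)) Q (ract_coeff (hat (gm Y)) J ?f)))"
        by (rule chr_cong, rule coord_wcong[OF _ w], intro ract_coeff_cong hat_gm[symmetric] Q J refl) (assumption | rule uk)+
      then show "F Q K (vg P J) * chr N 1 (coord u w (ract_coeff X Q (ract_coeff Y J ?f))) = F Q K (vg P J) * chr N 1 (coord xs (a @ Q # J # b) 1)"
        unfolding e(1) x sp unfolding a(1) by (simp only: au[of "P # K # b" _ "Q # J # b"])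
    qed
    finally show ?thesis
      by (simp only: wi up sum.cartesian_product case_prod_unfold)
  qed
  then have "word_coeff w (frag_extend (brd.Bf i) z) = fsum (\<lambda>xs. \<Sum>p\<in>Id2 N \<times> Id2 N.
      F (fst p) (w ! i) (vg (w ! (i - 1)) (snd p)) * chr N 1 (coord xs (w[i - 1 := fst p, i := snd p]) 1)) z"
    unfolding word_coeff_def fsum_frag_extend using z by (intro fsum_cong) (simp add: word_coeff_def subset_iff)
  then show ?thesis unfolding word_coeff_def fsum_lin .
qed

lemma word_coeff_theta:
  assumes "w \<in> word k" "w' \<in> word k"
  shows "word_coeff w (frag_of (map (theta N h) w')) = of_bool (w = w')"
proof -
  have "length v = length w \<Longrightarrow> set w \<subseteq> Id2 N \<Longrightarrow> set v \<subseteq> Id2 N \<Longrightarrow>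
      qc (coord (map (theta N h) v) w 1) = qc (of_bool (w = v) \<cdot> 1)" for v w
  proof (induction v arbitrary: w)
    case (Cons I v)
    then obtain J u where w: "w = J # u" by (cases w) auto
    have J: "J \<in> Id2 N" using Cons.prems unfolding w by auto
    have "qc (coord (map (theta N h) (I # v)) w 1) = qc (ract_coeff (theta_coeff I) J (of_bool (u = v) \<cdot> 1))"
      unfolding w by (simp only: list.map coord.simps theta_gm list.sel) (rule ract_coeff_cong[OF hat_gm _ J],
        assumption, rule Cons.IH, use Cons.prems w in auto)
    also have "ract_coeff (theta_coeff I) J (of_bool (u = v) \<cdot> 1) = of_bool (w = I # v) \<cdot> 1"
      unfolding ract_coeff_smul ract_coeff_1[OF J] w by (simp add: theta_coeff_def)
    finally show ?case .
  qed simp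
  from chr_cong[OF this, of w' w] assms show ?thesis by (simp add: word_coeff_def)
qed

end

section \<open>The entries of the R-matrix\<close>

text \<open>In each sum of matrix units at most one summand contributes.\<close>

lemma Rmat_eval:
  assumes "a \<in> {1..N}" "b \<in> {1..N}" "c \<in> {1..N}" "d \<in> {1..N}"
  shows "Rmat N h a b c d =
    h\<^sup>2 * of_bool (a = c \<and> b = d \<and> a = b \<and> a \<noteq> opp N a)
    + of_bool (a = c \<and> b = d \<and> a = b \<and> a = opp N a)
    + of_bool (a = c \<and> b = d \<and> a \<noteq> b \<and> a \<noteq> opp N b)
    + inverse (h\<^sup>2) * of_bool (a = c \<and> b = d \<and> a = opp N b \<and> b \<noteq> opp N b)
    + (h\<^sup>2 - inverse (h\<^sup>2)) * (of_bool (c < a \<and> b = c \<and> d = a)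
       - h powi (rho2 N a - rho2 N c) * of_bool (c < a \<and> b = opp N a \<and> d = opp N c))"
proof -
  have D: "(\<Sum>i\<in>S. if i = x then v else 0) = (if x \<in> S then v else 0)" if "finite S" for S x and v :: complex
    using that by (simp add: sum.delta)
  have fin: "finite {i. i \<in> {1..N} \<and> P i}" "finite {(i, j). i \<in> {1..N} \<and> j \<in> {1..N} \<and> Q i j}" for P Q
    by simp (rule finite_subset[of _ "{1..N} \<times> {1..N}"], auto)
  have 1: "munit2 i i i i a b c d = (if i = a then of_bool (c = a \<and> b = a \<and> d = a) else 0)" for i
    by (auto simp: munit2_def munit_def)
  have 2: "munit2 i i j j a b c d = (if (i, j) = (a, b) then of_bool (c = a \<and> d = b) else 0)" for i j
    by (auto simp: munit2_def munit_def)
  have 3: "munit2 (opp N i) (opp N i) i i a b c d = (if i = b then of_bool (d = b \<and> a = opp N b \<and> c = a) else 0)" for i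
    by (auto simp: munit2_def munit_def)
  have 4: "munit2 i j j i a b c d - h powi (rho2 N i - rho2 N j) * munit2 i j (opp N i) (opp N j) a b c d =
      (if (i, j) = (a, c) then of_bool (b = c \<and> d = a) - h powi (rho2 N a - rho2 N c) * of_bool (b = opp N a \<and> d = opp N c) else 0)" for i j
    by (cases "i = a"; cases "j = c") (simp_all add: munit2_def munit_def)
  have s1: "(\<Sum>i | i \<in> {1..N} \<and> P i. munit2 i i i i a b c d) = of_bool (P a \<and> c = a \<and> b = a \<and> d = a)" for P
    unfolding 1 D[OF fin(1)] using assms by simp
  have s2: "(\<Sum>(i, j) | i \<in> {1..N} \<and> j \<in> {1..N} \<and> Q i j. munit2 i i j j a b c d) = of_bool (Q a b \<and> c = a \<and> d = b)" for Q
    unfolding 2 case_prod_eta case_prod_unfold prod.collapse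
    by (subst D, rule finite_subset[of _ "{1..N} \<times> {1..N}"]) (use assms in auto)
  have s3: "(\<Sum>i | i \<in> {1..N} \<and> P i. munit2 (opp N i) (opp N i) i i a b c d) = of_bool (P b \<and> d = b \<and> a = opp N b \<and> c = a)" for P
    unfolding 3 D[OF fin(1)] using assms by simp
  have s4: "(\<Sum>(i, j) | i \<in> {1..N} \<and> j \<in> {1..N} \<and> j < i. munit2 i j j i a b c d
       - h powi (rho2 N i - rho2 N j) * munit2 i j (opp N i) (opp N j) a b c d) =
     (if c < a then of_bool (b = c \<and> d = a) - h powi (rho2 N a - rho2 N c) * of_bool (b = opp N a \<and> d = opp N c) else 0)"
    unfolding 4 case_prod_unfold prod.collapse
    by (subst D, rule finite_subset[of _ "{1..N} \<times> {1..N}"]) (use assms in auto)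
  have c: "(a \<noteq> opp N a \<and> c = a \<and> b = a \<and> d = a) = (a = c \<and> b = d \<and> a = b \<and> a \<noteq> opp N a)"
    "(a = opp N a \<and> c = a \<and> b = a \<and> d = a) = (a = c \<and> b = d \<and> a = b \<and> a = opp N a)"
    "((a \<noteq> b \<and> a \<noteq> opp N b) \<and> c = a \<and> d = b) = (a = c \<and> b = d \<and> a \<noteq> b \<and> a \<noteq> opp N b)"
    "(b \<noteq> opp N b \<and> d = b \<and> a = opp N b \<and> c = a) = (a = c \<and> b = d \<and> a = opp N b \<and> b \<noteq> opp N b)"
    by (blast intro: sym)+
  show ?thesis
    unfolding Rmat_def Let_def s1 s2 s3 s4 c by (cases "c < a") simp_all
qed

text \<open>The rings \<open>\<int>[x]\<close> and the ideal \<open>x \<int>[x]\<close>, as sets of numbers; for a transcendental number \<open>x\<close> membership in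
  the ideal means divisibility by \<open>x\<close>.\<close>

definition int_poly_values :: "complex \<Rightarrow> complex set" where
  "int_poly_values x = {poly P x | P. \<forall>i. coeff P i \<in> \<int>}"

definition small_values :: "complex \<Rightarrow> complex set" where
  "small_values x = {poly P x | P. (\<forall>i. coeff P i \<in> \<int>) \<and> coeff P 0 = 0}"

lemma coeff_mult_Ints: "(\<And>i. coeff P i \<in> \<int>) \<Longrightarrow> (\<And>i. coeff Q i \<in> \<int>) \<Longrightarrow> coeff (P * Q) i \<in> \<int>"
  for P Q :: "complex poly"
  by (simp add: coeff_mult Ints_sum)

lemma int_poly_values_add: "a \<in> int_poly_values x \<Longrightarrow> b \<in> int_poly_values x \<Longrightarrow> a + b \<in> int_poly_values x"
  unfolding int_poly_values_def by (clarify, rename_tac P Q, rule_tac x = "P + Q" in exI) simp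

lemma int_poly_values_mult: "a \<in> int_poly_values x \<Longrightarrow> b \<in> int_poly_values x \<Longrightarrow> a * b \<in> int_poly_values x"
  unfolding int_poly_values_def by (clarify, rename_tac P Q, rule_tac x = "P * Q" in exI) (simp add: coeff_mult_Ints)

lemma int_poly_values_minus: "a \<in> int_poly_values x \<Longrightarrow> - a \<in> int_poly_values x"
  unfolding int_poly_values_def by (clarify, rename_tac P, rule_tac x = "- P" in exI) simp

lemma int_poly_values_diff: "a \<in> int_poly_values x \<Longrightarrow> b \<in> int_poly_values x \<Longrightarrow> a - b \<in> int_poly_values x"
  using int_poly_values_add[of a x "- b"] int_poly_values_minus[of b x] by simp

lemma small_values_add: "a \<in> small_values x \<Longrightarrow> b \<in> small_values x \<Longrightarrow> a + b \<in> small_values x"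
  unfolding small_values_def by (clarify, rename_tac P Q, rule_tac x = "P + Q" in exI) simp

lemma small_values_mult: "a \<in> int_poly_values x \<Longrightarrow> b \<in> small_values x \<Longrightarrow> a * b \<in> small_values x"
  unfolding int_poly_values_def small_values_def
  by (clarify, rename_tac P Q, rule_tac x = "P * Q" in exI) (simp add: coeff_mult_Ints coeff_mult_0)

lemma int_poly_values_of_bool: "of_bool b \<in> int_poly_values x"
  unfolding int_poly_values_def by (rule CollectI, rule exI[of _ "[:of_bool b:]"]) (simp add: coeff_pCons split: nat.split)

lemma small_values_0: "0 \<in> small_values x"
  unfolding small_values_def by (rule CollectI, rule exI[of _ 0]) simp

lemma small_values_power: "0 < n \<Longrightarrow> x ^ n \<in> small_values x"
  unfolding small_values_def by (rule CollectI, rule exI[of _ "monom 1 n"]) (simp add: poly_monom)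

lemma int_poly_values_power: "x ^ n \<in> int_poly_values x"
  unfolding int_poly_values_def by (rule CollectI, rule exI[of _ "monom 1 n"]) (simp add: poly_monom)

lemma small_values_sum: "(\<And>i. i \<in> S \<Longrightarrow> f i \<in> small_values x) \<Longrightarrow> sum f S \<in> small_values x"
  by (induction S rule: infinite_finite_induct) (auto intro: small_values_0 small_values_add)

lemma even_odd_split:
  fixes P :: "complex poly"
  assumes "\<forall>i. coeff P i \<in> \<int>"
  shows "\<exists>E D. (\<forall>i. coeff E i \<in> \<int>) \<and> (\<forall>i. coeff D i \<in> \<int>) \<and> coeff E 0 = coeff P 0 \<and>
    poly P x = poly E (x\<^sup>2) + x * poly D (x\<^sup>2)"
  using assms
proof (induction P)
  case 0
  show ?case by (intro exI[of _ 0]) simp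
next
  case (pCons a P)
  have "coeff P i \<in> \<int>" for i using spec[OF pCons.prems, of "Suc i"] by simp
  then obtain E D where ED: "\<forall>i. coeff E i \<in> \<int>" "\<forall>i. coeff D i \<in> \<int>"
      "poly P x = poly E (x\<^sup>2) + x * poly D (x\<^sup>2)" using pCons.IH by blast
  have "a \<in> \<int>" using spec[OF pCons.prems, of 0] by simp
  then show ?case
    using ED by (intro exI[of _ E, THEN exI[of _ "pCons a D"]])
      (auto simp: coeff_pCons algebra_simps power2_eq_square split: nat.split)
qed

text \<open>Otherwise \<open>E(x\<^sup>2) + x D(x\<^sup>2) = 0\<close> with integer polynomials \<open>E\<close> and \<open>D\<close> and \<open>E(0) = 1\<close>. Then
  \<open>E(y)\<^sup>2 - y D(y)\<^sup>2\<close> has constant term \<open>1\<close> and vanishes at \<open>y = x\<^sup>2 = q\<^sup>-\<^sup>1\<close>.\<close>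

lemma one_add_small_values_nonzero:
  assumes q: "\<not> algebraic q" and h: "h\<^sup>2 = q" and a: "a \<in> small_values (inverse h)"
  shows "1 + a \<noteq> 0"
proof
  assume e: "1 + a = 0"
  let ?x = "inverse h"
  obtain P where P: "\<forall>i. coeff P i \<in> \<int>" "coeff P 0 = 0" "a = poly P ?x" using a by (auto simp: small_values_def)
  have "\<forall>i. coeff (1 + P) i \<in> \<int>" using P(1) by (simp add: coeff_1)
  then obtain E D where ED: "\<forall>i. coeff E i \<in> \<int>" "\<forall>i. coeff D i \<in> \<int>" "coeff E 0 = coeff (1 + P) 0"
      "poly (1 + P) ?x = poly E (?x\<^sup>2) + ?x * poly D (?x\<^sup>2)"
    using even_odd_split by blast
  have E0: "coeff E 0 = 1" using ED(3) P(2) by simp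
  have "poly E (?x\<^sup>2) = - (?x * poly D (?x\<^sup>2))" using ED(4) e P(3) by (simp add: eq_neg_iff_add_eq_0)
  then have v: "poly E (?x\<^sup>2) * poly E (?x\<^sup>2) = ?x\<^sup>2 * (poly D (?x\<^sup>2) * poly D (?x\<^sup>2))"
    by (simp add: power2_eq_square mult_ac)
  let ?p = "E * E - pCons 0 (D * D)"
  have "algebraic (?x\<^sup>2)"
  proof (rule algebraicI)
    show "coeff ?p i \<in> \<int>" for i
      using coeff_mult_Ints[of E E i] coeff_mult_Ints[of D D] ED(1,2)
      by (auto simp: coeff_pCons split: nat.split intro!: Ints_diff)
    have "coeff ?p 0 = 1" by (simp add: coeff_mult_0 E0)
    then show "?p \<noteq> 0" by auto
    show "poly ?p (?x\<^sup>2) = 0" using v by simp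
  qed
  then have "algebraic (inverse (?x\<^sup>2))" by (rule algebraic_inverse)
  then show False using q h by (simp add: power_inverse)
qed

definition scaled_R :: "nat \<Rightarrow> complex \<Rightarrow> nat \<Rightarrow> nat \<Rightarrow> nat \<Rightarrow> nat \<Rightarrow> complex" where
  "scaled_R N h a b c d = inverse (h\<^sup>2) * Rmat N h a b c d"

lemma rho2_antimono: "c < a \<Longrightarrow> a \<le> N \<Longrightarrow> 1 \<le> c \<Longrightarrow> rho2 N a \<le> rho2 N c"
  by (auto simp: rho2_def opp_def)

lemma scaled_R_eval:
  assumes h: "h \<noteq> 0" and abcd: "a \<in> {1..N}" "b \<in> {1..N}" "c \<in> {1..N}" "d \<in> {1..N}"
  shows "scaled_R N h a b c d =
    of_bool (a = c \<and> b = d \<and> a = b \<and> a \<noteq> opp N a)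
    + inverse h ^ 2 * of_bool (a = c \<and> b = d \<and> a = b \<and> a = opp N a)
    + inverse h ^ 2 * of_bool (a = c \<and> b = d \<and> a \<noteq> b \<and> a \<noteq> opp N b)
    + inverse h ^ 4 * of_bool (a = c \<and> b = d \<and> a = opp N b \<and> b \<noteq> opp N b)
    + (1 - inverse h ^ 4) * (of_bool (c < a \<and> b = c \<and> d = a)
       - inverse h ^ nat (rho2 N c - rho2 N a) * of_bool (c < a \<and> b = opp N a \<and> d = opp N c))"
proof -
  have p: "h powi (rho2 N a - rho2 N c) = inverse h ^ nat (rho2 N c - rho2 N a)" if "c < a"
    using rho2_antimono[OF that, of N] abcd by (simp add: power_int_def)
  have e: "inverse (h\<^sup>2) * h\<^sup>2 = 1" "inverse (h\<^sup>2) = inverse h ^ 2" "inverse h ^ 4 = inverse h ^ 2 * inverse h ^ 2"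
    using h by (simp_all add: power_inverse) (simp flip: power_add power_inverse)
  have f: "inverse h ^ 2 * h\<^sup>2 = 1" using e by simp
  show ?thesis
    unfolding scaled_R_def Rmat_eval[OF abcd]
    by (cases "c < a") (simp_all only: p e distrib_left right_diff_distrib left_diff_distrib mult.assoc[symmetric] f, simp_all add: mult_ac)
qed

lemma scaled_R_int_poly_values:
  assumes "h \<noteq> 0" "a \<in> {1..N}" "b \<in> {1..N}" "c \<in> {1..N}" "d \<in> {1..N}"
  shows "scaled_R N h a b c d \<in> int_poly_values (inverse h)"
  using int_poly_values_of_bool[of True] unfolding scaled_R_eval[OF assms]
  by (intro int_poly_values_add int_poly_values_mult int_poly_values_diff int_poly_values_power int_poly_values_of_bool) simp

text \<open>In the column \<open>(c, N + 1 - c)\<close> there is no entry \<open>q\<close> of the R-matrix, so the diagonal terms are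
  divisible by \<open>x\<^sup>2\<close> after scaling. Among the terms with \<open>i > j\<close>, the flip term \<open>e\<^sub>i\<^sub>j \<otimes> e\<^sub>j\<^sub>i\<close> occurs in this
  column only for even \<open>N\<close>, and there it cancels against the other term with the same \<open>i\<close> and \<open>j\<close>. What
  remains carries a positive power of \<open>x\<close>, as \<open>\<rho>\<^sub>c = 0\<close> and \<open>\<rho>\<close> is negative on the larger indices.\<close>

lemma scaled_R_small_values:
  assumes h: "h \<noteq> 0" and ab: "a \<in> {1..N}" "b \<in> {1..N}"
    and m: "m = (N + 1) div 2" and c: "c = m \<or> c = opp N m" and N: "N \<ge> 3"
  shows "scaled_R N h a b c (opp N c) \<in> small_values (inverse h)"
proof -
  have c1: "c \<in> {1..N}" using c m N by (auto simp: opp_def)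
  have d1: "opp N c \<in> {1..N}" and cc: "opp N (opp N c) = c" using c1 by (auto simp: opp_def)
  have mN: "N = 2 * m \<or> N + 1 = 2 * m" using m by arith
  have r0: "rho2 N c = 0" "rho2 N (opp N c) = 0"
    using c mN by (elim disjE; simp add: rho2_def opp_def)+
  have neg: "rho2 N a < 0" if "c < a" "a \<noteq> opp N c"
    using c mN that ab(1) unfolding rho2_def opp_def by (elim disjE; simp split: if_splits)
  let ?x = "inverse h"
  have t: "of_bool (c < a \<and> b = c \<and> opp N c = a)
       - ?x ^ nat (rho2 N c - rho2 N a) * of_bool (c < a \<and> b = opp N a \<and> opp N c = opp N c) \<in> small_values ?x"
  proof (cases "c < a \<and> a \<noteq> opp N c")
    case True
    have "?x ^ nat (rho2 N c - rho2 N a) \<in> small_values ?x"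
      using neg True r0 by (intro small_values_power) simp
    from small_values_mult[OF int_poly_values_minus[OF int_poly_values_of_bool] this, of "c < a \<and> b = opp N a \<and> opp N c = opp N c"]
    show ?thesis using True by (simp add: mult.commute)
  next
    case False
    then have "of_bool (c < a \<and> b = c \<and> opp N c = a)
       - ?x ^ nat (rho2 N c - rho2 N a) * of_bool (c < a \<and> b = opp N a \<and> opp N c = opp N c) = 0"
      using r0 cc by auto
    then show ?thesis using small_values_0 by simp
  qed
  have o: "1 \<in> int_poly_values ?x" using int_poly_values_of_bool[of True] by simp
  have p: "?x ^ n * of_bool P \<in> small_values ?x" if "0 < n" for n P
    using small_values_mult[OF int_poly_values_of_bool small_values_power[OF that]] by (simp add: mult.commute)
  have z: "of_bool (a = c \<and> b = opp N c \<and> a = b \<and> a \<noteq> opp N a) = (0 :: complex)" by auto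
  show ?thesis
    unfolding scaled_R_eval[OF h ab c1 d1] z
    by (intro small_values_add small_values_mult[OF int_poly_values_diff[OF o int_poly_values_power] t] p small_values_0) simp_all
qed

text \<open>The matrix \<open>d = diag(q, 1, \<dots>, 1, q\<^sup>-\<^sup>1)\<close>, for which \<open>d \<otimes> d\<close> commutes with the R-matrix (\<open>Rmat_weight\<close>). It
  measures by how much the braiding differs from \<open>q\<^sup>-\<^sup>1 \<hat>R\<close>.\<close>

definition dq :: "nat \<Rightarrow> complex \<Rightarrow> nat \<Rightarrow> complex" where
  "dq N h a = (if a = 1 then h\<^sup>2 else if a = N then inverse (h\<^sup>2) else 1)"

lemma dq_nonzero: "h \<noteq> 0 \<Longrightarrow> dq N h a \<noteq> 0"
  by (simp add: dq_def)

lemma Rmat_weight: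
  assumes "h \<noteq> 0" "N \<ge> 3" "a \<in> {1..N}" "b \<in> {1..N}" "c \<in> {1..N}" "d \<in> {1..N}" "Rmat N h a b c d \<noteq> 0"
  shows "dq N h a * dq N h b = dq N h c * dq N h d"
proof -
  have o: "dq N h i * dq N h (opp N i) = 1" if "i \<in> {1..N}" for i
    using that assms(1,2) by (auto simp: dq_def opp_def)
  have "a = c \<and> b = d \<or> b = c \<and> d = a \<or> b = opp N a \<and> d = opp N c"
    using assms(7) unfolding Rmat_eval[OF assms(3-6)] by (auto simp: of_bool_def split: if_splits)
  then show ?thesis using o assms by (auto simp: mult.commute)
qed

lemma Rmat_N:
  assumes "h \<noteq> 0" "N \<ge> 3" "t \<in> {1..N}" "j \<in> {1..N}" "n \<in> {1..N}"
  shows "Rmat N h t N j n = of_bool (t = j \<and> n = N) * inverse (dq N h j)"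
proof -
  have "N \<in> {1..N}" using assms by simp
  note e = Rmat_eval[OF assms(3) this assms(4,5)]
  have f: "opp N N = 1" "(j < t \<and> N = j \<and> n = t) = False" "(j < t \<and> N = opp N t \<and> n = opp N j) = False"
    using assms by (auto simp: opp_def)
  show ?thesis
  proof (cases "t = j \<and> n = N")
    case True
    then show ?thesis unfolding e f dq_def using assms(2) f(1) by (cases "j = 1"; cases "j = N") simp_all
  next
    case False
    then have "(t = j \<and> N = n \<and> B) = False" for B by blast
    then show ?thesis unfolding e f using False by (simp only: of_bool_eq mult_zero_right mult_zero_left add_0 diff_0 minus_zero)
  qed
qed

lemma Rmat_1:
  assumes "h \<noteq> 0" "N \<ge> 3" "k \<in> {1..N}" "b \<in> {1..N}" "m \<in> {1..N}"
  shows "Rmat N h k b m 1 = of_bool (k = m \<and> b = 1) * dq N h k"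
proof -
  have "1 \<in> {1..N}" using assms by simp
  note e = Rmat_eval[OF assms(3-5) this]
  have f: "opp N 1 = N" "opp N N = 1" "(m < k \<and> b = m \<and> 1 = k) = False" "(m < k \<and> b = opp N k \<and> 1 = opp N m) = False"
    using assms by (auto simp: opp_def)
  show ?thesis
  proof (cases "k = m \<and> b = 1")
    case True
    then show ?thesis unfolding e f dq_def using assms(2) f(1,2) by (cases "k = 1"; cases "k = N") simp_all
  next
    case False
    then have "(k = m \<and> b = 1 \<and> B) = False" for B by blast
    then show ?thesis unfolding e f using False by (simp only: of_bool_eq mult_zero_right mult_zero_left add_0 diff_0 minus_zero)
  qed
qed

context rform begin

text \<open>Of the sum that defines \<open>F\<close> on the product \<open>u\<^sub>p\<^sub>j S(u\<^sub>N\<^sub>p')\<close> one term survives, because entries of the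
  R-matrix with second upper index \<open>N\<close> or second lower index \<open>1\<close> vanish off the diagonal (\<open>Rmat_N\<close>, \<open>Rmat_1\<close>). In particular
  the span of the \<open>\<theta>\<^sub>i\<^sub>N\<close> is stable under the braiding. The sign enters as \<open>s\<^sup>2 = 1\<close>.\<close>

lemma F_invariant_line:
  assumes N: "N \<ge> 3" and i: "i \<in> {1..N}" "j \<in> {1..N}" "k \<in> {1..N}" "l \<in> {1..N}" "p \<in> {1..N}" "p' \<in> {1..N}"
  shows "F (i, N) (k, l) (vg (p, p') (j, N)) =
    of_bool (l = N \<and> p' = N) * (scaled_R N h k p i j * (dq N h k * inverse (dq N h j)))"
proof -
  have N1: "N \<in> {1..N}" "1 \<in> {1..N}" using N by auto
  have oN: "opp N N = 1" by (simp add: opp_def)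
  have op: "opp N p' \<in> {1..N}" and op1: "opp N p' = 1 \<longleftrightarrow> p' = N" using i(6) by (auto simp: opp_def)
  have u: "F (i, N) (m, n) (ugen p j) = of_bool (n = N) * (s * (Rmat N h m p i j * inverse (dq N h j)))"
    if m: "m \<in> {1..N}" and n: "n \<in> {1..N}" for m n
  proof -
    have "F (i, N) (m, n) (ugen p j) = (\<Sum>t\<in>{1..N}. (s * Rmat N h m p i t * of_bool (n = N) * inverse (dq N h j)) * of_bool (t = j))"
      unfolding F_gen[OF i(1) N1(1) m n i(5,2)]
      by (intro sum.cong refl) (simp add: Rmat_N[OF h0 N _ i(2) n] of_bool_conj mult_ac del: atLeastAtMost_iff)
    then show ?thesis unfolding sum_of_bool_conj[OF finite_atLeastAtMost] using i(2) by (simp only: if_True mult_ac)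
  qed
  have v: "F (m, N) (k, l) (Sg N p') = of_bool (m = k) * (of_bool (l = N \<and> p' = N) * (s * (dq N h k * inverse (h\<^sup>2))))"
    if m: "m \<in> {1..N}" for m
  proof -
    have "F (m, N) (k, l) (ugen (opp N p') 1) =
        (\<Sum>t\<in>{1..N}. (s * Rmat N h k (opp N p') m t * of_bool (l = N) * inverse (dq N h 1)) * of_bool (t = 1))"
      unfolding F_gen[OF m N1(1) i(3,4) op N1(2)]
      by (intro sum.cong refl) (simp add: Rmat_N[OF h0 N _ N1(2) i(4)] of_bool_conj mult_ac del: atLeastAtMost_iff)
    also have "\<dots> = s * Rmat N h k (opp N p') m 1 * of_bool (l = N) * inverse (dq N h 1)"
      using N1(2) by (simp only: sum_of_bool_conj[OF finite_atLeastAtMost] if_True)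
    also have "\<dots> = s * (of_bool (k = m \<and> p' = N) * dq N h k) * of_bool (l = N) * inverse (dq N h 1)"
      unfolding Rmat_1[OF h0 N i(3) op m] op1 ..
    finally have e: "F (m, N) (k, l) (ugen (opp N p') 1) =
      s * (of_bool (k = m \<and> p' = N) * dq N h k) * of_bool (l = N) * inverse (dq N h 1)" .
    show ?thesis unfolding Sg_def F_smul oN e by (cases "p' = N") (simp_all add: dq_def of_bool_conj mult_ac eq_commute[of k m])
  qed
  have "F (i, N) (k, l) (vg (p, p') (j, N)) = (\<Sum>m\<in>{1..N}. \<Sum>n\<in>{1..N}.
      F (i, N) (m, n) (ugen p j) * F (m, n) (k, l) (Sg N p'))"
    unfolding vg_def F_mult sum_Id2 by simp
  also have "\<dots> = (\<Sum>m\<in>{1..N}. \<Sum>n\<in>{1..N}.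
      (s * (Rmat N h m p i j * inverse (dq N h j)) * F (m, n) (k, l) (Sg N p')) * of_bool (n = N))"
    by (intro sum.cong refl) (simp add: u mult_ac del: atLeastAtMost_iff)
  also have "\<dots> = (\<Sum>m\<in>{1..N}. s * (Rmat N h m p i j * inverse (dq N h j)) * F (m, N) (k, l) (Sg N p'))"
    using N1 by (simp only: sum_of_bool_conj[OF finite_atLeastAtMost] if_True)
  also have "\<dots> = (\<Sum>m\<in>{1..N}. (s * (Rmat N h m p i j * inverse (dq N h j)) *
      (of_bool (l = N \<and> p' = N) * (s * (dq N h k * inverse (h\<^sup>2))))) * of_bool (m = k))"
    by (intro sum.cong refl) (simp add: v mult_ac del: atLeastAtMost_iff)
  also have "\<dots> = s * (Rmat N h k p i j * inverse (dq N h j)) *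
      (of_bool (l = N \<and> p' = N) * (s * (dq N h k * inverse (h\<^sup>2))))"
    using i(3) by (simp only: sum_of_bool_conj[OF finite_atLeastAtMost] if_True)
  also have "\<dots> = (s * s) * (of_bool (l = N \<and> p' = N) * (scaled_R N h k p i j * (dq N h k * inverse (dq N h j))))"
    unfolding scaled_R_def by (simp only: mult_ac)
  finally show ?thesis by (simp only: s2 mult_1)
qed

end

section \<open>The antisymmetrizer on the alternating word\<close>

definition wtp :: "nat \<Rightarrow> complex \<Rightarrow> (nat \<times> nat) list \<Rightarrow> complex" where
  "wtp N h w = (\<Prod>I\<leftarrow>w. dq N h (fst I))"

text \<open>The weight \<open>\<Prod>\<^sub>t d(w\<^sub>t)\<^sup>t\<close> with positions counted from \<open>0\<close>: every letter is weighted once for each letter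
  before it. Conjugating by these weights turns the factors \<open>d\<^sub>k / d\<^sub>j\<close> of \<open>F_invariant_line\<close> into \<open>1\<close>
  (\<open>wt_swap\<close>).\<close>

primrec wt :: "nat \<Rightarrow> complex \<Rightarrow> (nat \<times> nat) list \<Rightarrow> complex" where
  "wt N h [] = 1"
| "wt N h (I # w) = wtp N h w * wt N h w"

lemma wtp_simps [simp]: "wtp N h [] = 1" "wtp N h (I # w) = dq N h (fst I) * wtp N h w"
  by (simp_all add: wtp_def)

lemma wt_nonzero: "h \<noteq> 0 \<Longrightarrow> wtp N h w \<noteq> 0 \<and> wt N h w \<noteq> 0"
  by (induction w) (simp_all add: dq_nonzero)

lemma wt_swap:
  assumes "h \<noteq> 0" "dq N h (fst P) * dq N h (fst K) = dq N h (fst Q) * dq N h (fst J)"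
  shows "wtp N h (a @ P # K # b) = wtp N h (a @ Q # J # b) \<and>
    wt N h (a @ Q # J # b) * dq N h (fst K) = wt N h (a @ P # K # b) * dq N h (fst J)"
  using assms by (induction a) (simp_all add: mult_ac)

context rform begin

definition line :: "(nat \<times> nat) list \<Rightarrow> bool" where "line w \<longleftrightarrow> snd ` set w \<subseteq> {N}"

lemma fsum_cmul: "fsum f (frag_cmul c z) = of_int c * fsum f z"
proof -
  have "fsum f (frag_cmul c z) = (\<Sum>x\<in>keys z. of_int (lookup (frag_cmul c z) x) * f x)"
    by (rule fsum_superset) (simp_all add: keys_cmul)
  then show ?thesis by (simp add: fsum_def sum_distrib_left mult.assoc)
qed

text \<open>One application of \<open>\<sigma>\<^sub>i\<close> in rescaled coordinates. The set \<open>Y\<close> will be \<open>x \<int>[x]\<close>; the hypothesis on the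
  products with entries of \<open>q\<^sup>-\<^sup>1 R\<close> holds at the first step because of the chosen columns, and at
  later steps because \<open>x \<int>[x]\<close> is an ideal. The constant \<open>c\<close> serves to normalize the weight of the
  initial word.\<close>

lemma braid_step:
  assumes N: "N \<ge> 3" and z: "keys z \<subseteq> tuples Gm k" and i: "1 \<le> i" "i < k"
    and off: "\<And>w. w \<in> word k \<Longrightarrow> \<not> line w \<Longrightarrow> word_coeff w z = 0"
    and Y: "0 \<in> Y" "\<And>a b. a \<in> Y \<Longrightarrow> b \<in> Y \<Longrightarrow> a + b \<in> Y"
    and on: "\<And>w a b. w \<in> word k \<Longrightarrow> line w \<Longrightarrow> a \<in> {1..N} \<Longrightarrow> b \<in> {1..N} \<Longrightarrow>
      scaled_R N h a b (fst (w ! (i - 1))) (fst (w ! i)) * (c * inverse (wt N h w) * word_coeff w z) \<in> Y"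
    and w: "w \<in> word k"
  shows "if line w then c * inverse (wt N h w) * word_coeff w (frag_extend (brd.Bf i) z) \<in> Y
    else word_coeff w (frag_extend (brd.Bf i) z) = 0"
proof -
  obtain a P K b where a: "w = a @ P # K # b" "length a = i - 1"
    using list_split2[of "i - 1" w] w i by auto
  have wi: "w ! (i - 1) = P" "w ! i = K" using a i by (auto simp: nth_append)
  have up: "w[i - 1 := Q, i := J] = a @ Q # J # b" for Q J
    using a i by (auto simp: list_update_append split: nat.splits)
  have ui: "(a @ Q # J # b) ! (i - 1) = Q" "(a @ Q # J # b) ! i = J" for Q J using a i by (auto simp: nth_append)
  have PK: "P \<in> Id2 N" "K \<in> Id2 N" using w unfolding a by auto
  obtain p p' k' l where pk: "P = (p, p')" "K = (k', l)" "p \<in> {1..N}" "p' \<in> {1..N}" "k' \<in> {1..N}" "l \<in> {1..N}"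
    using PK by (cases P; cases K) auto
  let ?T = "\<lambda>x. F (fst x) K (vg P (snd x)) * word_coeff (a @ fst x # snd x # b) z"
  have S: "word_coeff w (frag_extend (brd.Bf i) z) = (\<Sum>x\<in>Id2 N \<times> Id2 N. ?T x)"
    using word_coeff_braid[OF z w i] unfolding wi up .
  have ww: "a @ fst x # snd x # b \<in> word k" if "x \<in> Id2 N \<times> Id2 N" for x
    using w a(1) that by auto
  have T: "?T x = of_bool (l = N \<and> p' = N) * (scaled_R N h k' p (fst (fst x)) (fst (snd x)) *
      (dq N h k' * inverse (dq N h (fst (snd x)))) * word_coeff (a @ fst x # snd x # b) z)"
    if x: "x \<in> Id2 N \<times> Id2 N" and l: "line (a @ fst x # snd x # b)" for x
  proof -
    obtain m n where mn: "fst x = (m, N)" "snd x = (n, N)" "m \<in> {1..N}" "n \<in> {1..N}"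
      using x l by (cases x) (auto simp: line_def)
    show ?thesis unfolding mn(1,2) pk(1,2) F_invariant_line[OF N mn(3,4) pk(5,6,3,4)] by (simp add: mult.assoc)
  qed
  show ?thesis
  proof (cases "line w")
    case True
    then have pl: "p' = N" "l = N" using a(1) pk by (auto simp: line_def)
    have "c * inverse (wt N h w) * ?T x \<in> Y" if x: "x \<in> Id2 N \<times> Id2 N" for x
    proof (cases "line (a @ fst x # snd x # b)")
      case False
      then show ?thesis using off[OF ww[OF x]] Y(1) by simp
    next
      case l: True
      let ?w = "a @ fst x # snd x # b" and ?m = "fst (fst x)" and ?n = "fst (snd x)"
      have mn: "?m \<in> {1..N}" "?n \<in> {1..N}" using x by (auto simp: mem_Times_iff)
      have o: "scaled_R N h k' p ?m ?n * (c * inverse (wt N h ?w) * word_coeff ?w z) \<in> Y"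
        using on[OF ww[OF x] l pk(5,3)] unfolding ui .
      have eq: "c * inverse (wt N h w) * ?T x = scaled_R N h k' p ?m ?n * (c * inverse (wt N h ?w) * word_coeff ?w z)"
      proof (cases "Rmat N h k' p ?m ?n = 0")
        case True
        then show ?thesis unfolding T[OF x l] by (simp add: scaled_R_def)
      next
        case False
        have "dq N h k' * dq N h p = dq N h ?m * dq N h ?n"
          by (rule Rmat_weight[OF h0 N pk(5,3) mn False])
        then have "wt N h ?w * dq N h k' = wt N h w * dq N h ?n"
          using wt_swap[OF h0, of N P K "fst x" "snd x" a b] unfolding a(1) pk(1,2) by (simp add: mult.commute)
        then have e: "inverse (wt N h w) * (dq N h k' * inverse (dq N h ?n)) = inverse (wt N h ?w)"
          using wt_nonzero[OF h0] dq_nonzero[OF h0] by (simp add: field_simps)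
        have "c * inverse (wt N h w) * ?T x = scaled_R N h k' p ?m ?n *
            (c * (inverse (wt N h w) * (dq N h k' * inverse (dq N h ?n))) * word_coeff ?w z)"
          unfolding T[OF x l] pl by (simp add: mult_ac)
        then show ?thesis unfolding e .
      qed
      show ?thesis unfolding eq by (rule o)
    qed
    then have "(\<Sum>x\<in>U. c * inverse (wt N h w) * ?T x) \<in> Y" if "U \<subseteq> Id2 N \<times> Id2 N" for U
      using that by (induction U rule: infinite_finite_induct) (auto intro: Y)
    then show ?thesis using True unfolding S sum_distrib_left by simp
  next
    case False
    have "?T x = 0" if x: "x \<in> Id2 N \<times> Id2 N" for x
    proof (cases "line (a @ fst x # snd x # b)")
      case False
      then show ?thesis using off[OF ww[OF x]] by simp
    next
      case True
      have "\<not> (l = N \<and> p' = N)" using True \<open>\<not> line w\<close> a(1) pk by (auto simp: line_def)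
      then show ?thesis unfolding T[OF x True] by simp
    qed
    then show ?thesis using False unfolding S by (simp add: sum.neutral)
  qed
qed

text \<open>The braiding that is applied first meets a column of the R-matrix that vanishes at \<open>x = 0\<close> after
  scaling, since the first indices of \<open>w0\<close> alternate between the two middle ones.\<close>

lemma word_coeff_Bw:
  assumes N: "N \<ge> 3" and w0: "w0 \<in> word k" "line w0"
    and adj: "\<And>i. Suc i < k \<Longrightarrow> fst (w0 ! i) \<in> {(N + 1) div 2, opp N ((N + 1) div 2)} \<and>
      fst (w0 ! Suc i) = opp N (fst (w0 ! i))"
    and js: "set js \<subseteq> {1..<k}" "js \<noteq> []" and w: "w \<in> word k"
  shows "if line w then wt N h w0 * inverse (wt N h w) * word_coeff w (brd.Bw js (frag_of (map (theta N h) w0))) \<in> small_values (inverse h)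
    else word_coeff w (brd.Bw js (frag_of (map (theta N h) w0))) = 0"
  using js w
proof (induction js arbitrary: w)
  case (Cons i js)
  let ?z = "frag_of (map (theta N h) w0)"
  have z: "keys ?z \<subseteq> tuples Gm k" using w0(1) by (auto simp: tuples_def)
  have i: "1 \<le> i" "i < k" using Cons.prems(1) by auto
  show ?case
  proof (cases "js = []")
    case True
    have on: "scaled_R N h a b (fst (v ! (i - 1))) (fst (v ! i)) * (wt N h w0 * inverse (wt N h v) * word_coeff v ?z) \<in> small_values (inverse h)"
      if v: "v \<in> word k" and ab: "a \<in> {1..N}" "b \<in> {1..N}" for v a b
    proof (cases "v = w0")
      case True
      have e: "wt N h w0 * inverse (wt N h v) * word_coeff v ?z = 1"
        unfolding True word_coeff_theta[OF w0(1) w0(1)] using wt_nonzero[OF h0] by simp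
      have "Suc (i - 1) = i" using i by simp
      then show ?thesis unfolding e unfolding True
        using adj[of "i - 1"] i scaled_R_small_values[OF h0 ab refl _ N, of "fst (w0 ! (i - 1))"] by auto
    next
      case False
      then show ?thesis by (simp add: word_coeff_theta[OF v w0(1)] small_values_0)
    qed
    show ?thesis unfolding True brd.Bw_simps
      by (rule braid_step[OF N z i _ small_values_0 small_values_add on Cons.prems(3)])
        (use word_coeff_theta[OF _ w0(1)] w0(2) in auto)
  next
    case False
    let ?y = "brd.Bw js ?z"
    have IH: "if line v then wt N h w0 * inverse (wt N h v) * word_coeff v ?y \<in> small_values (inverse h) else word_coeff v ?y = 0"
      if "v \<in> word k" for v using Cons.IH[OF _ False that] Cons.prems(1) by simp
    have y: "keys ?y \<subseteq> tuples Gm k"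
      using brd.braid_word_tc[of js k ?z] Cons.prems(1) z by simp
    have on: "scaled_R N h a b (fst (v ! (i - 1))) (fst (v ! i)) * (wt N h w0 * inverse (wt N h v) * word_coeff v ?y) \<in> small_values (inverse h)"
      if v: "v \<in> word k" "line v" and ab: "a \<in> {1..N}" "b \<in> {1..N}" for v a b
    proof (rule small_values_mult[OF scaled_R_int_poly_values[OF h0 ab]])
      have "v ! (i - 1) \<in> Id2 N" "v ! i \<in> Id2 N" using word_nth[OF v(1)] i by auto
      then show "fst (v ! (i - 1)) \<in> {1..N}" "fst (v ! i) \<in> {1..N}" by (simp_all only: mem_Times_iff)
      show "wt N h w0 * inverse (wt N h v) * word_coeff v ?y \<in> small_values (inverse h)" using IH[OF v(1)] v(2) by simp
    qed
    show ?thesis unfolding brd.Bw_simps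
      by (rule braid_step[OF N y i _ small_values_0 small_values_add on Cons.prems(3)]) (use IH in auto)
  qed
qed simp

theorem forms_nonzero:
  assumes N: "N \<ge> 3" and q: "\<not> algebraic (h\<^sup>2)"
  shows "carrier (Gamma_forms N h s r k) \<noteq> {\<one>\<^bsub>Gamma_forms N h s r k\<^esub>}"
proof -
  let ?m = "(N + 1) div 2"
  define w0 where "w0 = map (\<lambda>t. (if even t then ?m else opp N ?m, N)) [0..<k]"
  let ?z = "frag_of (map (theta N h) w0)" and ?x = "inverse h"
  have m: "?m \<in> {1..N}" using N by auto
  have w0: "w0 \<in> word k" "line w0"
    using m opp_in[OF m] N by (auto simp: w0_def line_def)
  have adj: "fst (w0 ! i) \<in> {?m, opp N ?m} \<and> fst (w0 ! Suc i) = opp N (fst (w0 ! i))" if "Suc i < k" for i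
    using that opp_opp[OF m] by (simp add: w0_def)
  have z: "keys ?z \<subseteq> tuples Gm k" using w0(1) by (auto simp: tuples_def)
  let ?P = "{p. p permutes {1..k}}"
  have P: "finite ?P" "id \<in> ?P" by (simp_all add: finite_permutations permutes_id)
  let ?f = "\<lambda>p. (-1) ^ perm_length k p * word_coeff w0 (brd.Bw (some_reduced_word k p) ?z)"
  have "word_coeff w0 (brd.Az k ?z) = (\<Sum>p\<in>?P. ?f p)"
    unfolding brd.Az_def word_coeff_def fsum_sum fsum_cmul by simp
  also have "\<dots> = ?f id + (\<Sum>p\<in>?P - {id}. ?f p)"
    by (rule sum.remove[OF P])
  also have "?f id = 1"
    by (simp add: perm_length_def some_reduced_word_id word_coeff_theta[OF w0(1) w0(1)])
  finally have e: "word_coeff w0 (brd.Az k ?z) = 1 + (\<Sum>p\<in>?P - {id}. ?f p)" .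
  have "(\<Sum>p\<in>?P - {id}. ?f p) \<in> small_values ?x"
  proof (rule small_values_sum, rule small_values_mult)
    fix p assume p: "p \<in> ?P - {id}"
    show "(- 1) ^ perm_length k p \<in> int_poly_values ?x"
      using int_poly_values_of_bool[of True] int_poly_values_minus[of 1] by (cases "even (perm_length k p)") auto
    have "some_reduced_word k p \<noteq> []" using some_reduced_word(2)[of p k] p by auto
    from word_coeff_Bw[OF N w0 adj some_reduced_word(1) this w0(1)] p w0(2)
    show "word_coeff w0 (brd.Bw (some_reduced_word k p) ?z) \<in> small_values ?x"
      using wt_nonzero[OF h0, of N w0] by simp
  qed
  then have "word_coeff w0 (brd.Az k ?z) \<noteq> 0"
    unfolding e by (rule one_add_small_values_nonzero[OF q refl])
  then have "brd.Az k ?z \<notin> Kg k" using word_coeff_Kg[OF _ w0(1)] by blast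
  from brd.external_power_nontrivial[OF z this] show ?thesis
    by (simp add: Gamma_forms_def canonical_braiding_eq)
qed

end

theorem mainTheorem1:
  fixes N k :: nat and q h s :: complex and r :: "oq \<Rightarrow> oq \<Rightarrow> complex"
  assumes "N \<ge> 3"
    and "\<not> algebraic q"
    and "h\<^sup>2 = q"
    and "universal_r_form N h r"
    and "\<And>a b c d. {a, b, c, d} \<subseteq> {1..N} \<Longrightarrow> r (ucls N h a b) (ucls N h c d) = Rmat N h a c b d"
    and "s \<in> {1, -1}"
    and "k \<ge> 1"
  shows "carrier (Gamma_forms N h s r k) \<noteq> {\<one>\<^bsub>Gamma_forms N h s r k\<^esub>}"
proof -
  have "h \<noteq> 0" using assms(2,3) by auto
  then interpret rform N h s r
    by unfold_locales (use assms(4-6) in auto)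
  show ?thesis using forms_nonzero assms(1-3) by simp
qed

end
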